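(* Let $\Bbbk$ be a field of characteristic $p>2$, let $\mathcal{J}$ be the super Jordan plane over $\Bbbk$, $s=xy+yx$, $\mathcal{J}_s$ the localization of $\mathcal{J}$ at the powers of $s$, and $\mathcal{A}$ the subalgebra of $\mathcal{J}_s$ generated by $(ys^{-1})^2$ and $s^{\pm1}$. Then: (1) The centers of $\mathcal{J}_s$ and $\mathcal{J}$ are given, respectively, by $Z(\mathcal{J}_s)=\Bbbk[s^{\pm p},y^{2p}]$ and $Z(\mathcal{J})=\Bbbk[s^p,y^{2p}]$. (2) $\mathcal{J}_s$ is an Azumaya algebra of rank $(2p)^2$ over its center. (3) $\mathcal{J}_s$ is a prime PI ring whose prime ideals are all regular, and $\operatorname{PI-deg}\mathcal{J}_s=2p$. (4) There is a bijection between the ideals of $\mathcal{J}_s$ and the ideals of $Z(\mathcal{J}_s)$ given by $I\mapsto I\cap Z(\mathcal{J}_s)$, with inverse $\mathfrak{a}\mapsto\mathfrak{a}\mathcal{J}_s$. Moreover, this correspondence preserves primeness. (5) Every simple $\mathcal{J}_s$-module has dimension $2p$. (6) $\mathcal{J}$ is a prime PI algebra, with $\operatorname{PI-deg}\mathcal{J}=2p$. (7) Let $Z:=Z(\mathcal{J})=\Bbbk[s^p,y^{2p}]$ and $K:=\mathrm{Frac}(Z)=\Bbbk(s^p,y^{2p})$. Then $Q(\mathcal{J})\cong\mathcal{J}\otimes_ZK\cong M_2(\mathcal{A})\otimes_ZK$ is a central simple $(2p)^2$-dimensional algebra over the field $K$.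
   Context: The super Jordan plane $\mathcal{J}$ over a field $\Bbbk$ is the unital associative $\Bbbk$-algebra generated by $x,y$ with defining relations $x^2=0$ and $y^2x-xy^2-xyx=0$. Put $s:=xy+yx$. The elements $x^is^jy^k$ ($i\in\{0,1\}$, $j,k\geq 0$) form a $\Bbbk$-basis of $\mathcal{J}$, and $\mathcal{J}$ is Noetherian. The element $s$ is normal ($s\mathcal{J}=\mathcal{J}s$; indeed $sx=xs$, $sy=(y-x)s$) and regular, so the localization $\mathcal{J}_s$ at the powers of $s$ exists and contains $\mathcal{J}$. $Z(R)$ denotes the center of $R$; ideals are two-sided and modules are left modules. $Q(R)$ is the classical quotient ring (localization at all regular elements). The PI degree of a prime PI ring $R$, denoted $\operatorname{PI-deg}R$, is the integer $d$ with $d^2=\dim_{Z(Q(R))}Q(R)$. A prime ideal $\mathfrak{p}$ of a prime PI ring $R$ is regular if $\operatorname{PI-deg}R/\mathfrak{p}=\operatorname{PI-deg}R$. In (7), $M_2(\mathcal A)$ is a $Z$-algebra via the inclusion $Z\subseteq Z(\mathcal{A})$ as scalar matrices (note $s^p,y^{2p}\in\mathcal A$, since $y^{2p}=(ys^{-1})^{2p}s^{2p}$).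
   Formalization: Part (5) is proved only for algebraically closed k, with dimension taken over k; over any other field it fails, since a maximal ideal of the center with a larger residue field gives a simple module of k-dimension greater than 2p. *)

theory Defs
  imports
    "HOL-Algebra.QuotRing"
    "HOL-Algebra.Ideal_Product"
    "HOL-Algebra.Generated_Rings"
    "HOL-Algebra.Embedded_Algebras"
    "HOL-Computational_Algebra.Polynomial"
begin

hide_const (open) Multiset.mult Polynomial.smult

section \<open>Rings, centers, generated subalgebras\<close>

definition ring_center :: "('a, 'm) ring_scheme \<Rightarrow> 'a set" where
  "ring_center R = {z \<in> carrier R. \<forall>r \<in> carrier R. z \<otimes>\<^bsub>R\<^esub> r = r \<otimes>\<^bsub>R\<^esub> z}"

definition opposite_ring :: "('a, 'm) ring_scheme \<Rightarrow> 'a ring" where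
  "opposite_ring R = \<lparr>carrier = carrier R, mult = (\<lambda>a b. b \<otimes>\<^bsub>R\<^esub> a), one = \<one>\<^bsub>R\<^esub>,
     zero = \<zero>\<^bsub>R\<^esub>, add = add R\<rparr>"

definition base_ring :: "'k::comm_ring_1 ring" where
  "base_ring = \<lparr>carrier = UNIV, mult = (*), one = 1, zero = 0, add = (+)\<rparr>"

definition algebraically_closed_field :: "'k::field itself \<Rightarrow> bool" where
  "algebraically_closed_field _ \<longleftrightarrow> (\<forall>f :: 'k poly. degree f > 0 \<longrightarrow> (\<exists>a. poly f a = 0))"

text \<open>A \<open>k\<close>-algebra is a ring \<open>R\<close> together with its structure map \<open>\<eta>\<close> from \<open>k\<close> to the
  center of \<open>R\<close>.\<close>

definition generated_algebra :: "('k \<Rightarrow> 'a) \<Rightarrow> ('a, 'm) ring_scheme \<Rightarrow> 'a set \<Rightarrow> 'a set" where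
  "generated_algebra \<eta> R S = generate_ring R (range \<eta> \<union> S)"

definition linearly_independent_over ::
    "('k::zero \<Rightarrow> 'a) \<Rightarrow> ('a, 'm) ring_scheme \<Rightarrow> 'i set \<Rightarrow> ('i \<Rightarrow> 'a) \<Rightarrow> bool" where
  "linearly_independent_over \<eta> R I m \<longleftrightarrow>
     (\<forall>F c. finite F \<and> F \<subseteq> I \<and> (\<Oplus>\<^bsub>R\<^esub>i\<in>F. \<eta> (c i) \<otimes>\<^bsub>R\<^esub> m i) = \<zero>\<^bsub>R\<^esub> \<longrightarrow> (\<forall>i\<in>F. c i = 0))"

definition matrix_ring :: "nat \<Rightarrow> ('a, 'm) ring_scheme \<Rightarrow> (nat \<times> nat \<Rightarrow> 'a) ring" where
  "matrix_ring n R = (let D = {..<n} \<times> {..<n} in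
     \<lparr>carrier = D \<rightarrow>\<^sub>E carrier R,
      mult = (\<lambda>M N. \<lambda>(i, j)\<in>D. \<Oplus>\<^bsub>R\<^esub>l\<in>{..<n}. M (i, l) \<otimes>\<^bsub>R\<^esub> N (l, j)),
      one = (\<lambda>(i, j)\<in>D. if i = j then \<one>\<^bsub>R\<^esub> else \<zero>\<^bsub>R\<^esub>),
      zero = (\<lambda>_\<in>D. \<zero>\<^bsub>R\<^esub>),
      add = (\<lambda>M N. \<lambda>d\<in>D. M d \<oplus>\<^bsub>R\<^esub> N d)\<rparr>)"

definition scalar_matrix :: "nat \<Rightarrow> ('a, 'm) ring_scheme \<Rightarrow> 'a \<Rightarrow> (nat \<times> nat \<Rightarrow> 'a)" where
  "scalar_matrix n R a =
     (\<lambda>(i, j)\<in>{..<n} \<times> {..<n}. if i = j then a else \<zero>\<^bsub>R\<^esub>)"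


section \<open>Monoid rings, free algebras, tensor products\<close>

definition delta :: "'g \<Rightarrow> 'k::zero \<Rightarrow> 'g \<Rightarrow> 'k" where
  "delta g c = (\<lambda>h. if h = g then c else 0)"

definition monoid_ring :: "('g, 'm) monoid_scheme \<Rightarrow> ('g \<Rightarrow> 'k::comm_ring_1) ring" where
  "monoid_ring G =
     \<lparr>carrier = {f. finite {g. f g \<noteq> 0} \<and> {g. f g \<noteq> 0} \<subseteq> carrier G},
      mult = (\<lambda>f f' g. \<Sum>(u, v)\<in>{(u, v). f u \<noteq> 0 \<and> f' v \<noteq> 0 \<and> u \<otimes>\<^bsub>G\<^esub> v = g}. f u * f' v),
      one = delta \<one>\<^bsub>G\<^esub> 1,
      zero = (\<lambda>_. 0),
      add = (\<lambda>f f' g. f g + f' g)\<rparr>"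

definition free_algebra :: "('x list \<Rightarrow> 'k::comm_ring_1) ring" where
  "free_algebra = monoid_ring \<lparr>carrier = (UNIV :: 'x list set), mult = (@), one = []\<rparr>"

text \<open>The tensor product of two algebras \<open>A\<close>, \<open>B\<close> over a commutative ring \<open>Z\<close> with structure
  maps \<open>\<alpha>\<close>, \<open>\<beta>\<close>. The integral monoid ring of \<open>A \<times> B\<close> is the free abelian group on
  \<open>A \<times> B\<close> with the product \<open>(a, b) (a', b') = (a a', b b')\<close>; the subgroup generated by the
  usual bilinearity relations is a two-sided ideal in it, so that dividing out the ideal they
  generate gives the usual tensor product.\<close>

definition tensor_ideal ::
    "('z, 'q) ring_scheme \<Rightarrow> ('z \<Rightarrow> 'a) \<Rightarrow> ('a, 'm) ring_scheme \<Rightarrow> ('z \<Rightarrow> 'b) \<Rightarrow> ('b, 'n) ring_scheme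
     \<Rightarrow> ('a \<times> 'b \<Rightarrow> int) set" where
  "tensor_ideal Z \<alpha> A \<beta> B = (let F = monoid_ring (A \<times>\<times> B); e = (\<lambda>a b. delta (a, b) (1::int)) in
     genideal F
      ({e (a \<oplus>\<^bsub>A\<^esub> a') b \<ominus>\<^bsub>F\<^esub> (e a b \<oplus>\<^bsub>F\<^esub> e a' b) | a a' b.
           a \<in> carrier A \<and> a' \<in> carrier A \<and> b \<in> carrier B}
       \<union> {e a (b \<oplus>\<^bsub>B\<^esub> b') \<ominus>\<^bsub>F\<^esub> (e a b \<oplus>\<^bsub>F\<^esub> e a b') | a b b'.
           a \<in> carrier A \<and> b \<in> carrier B \<and> b' \<in> carrier B}
       \<union> {e (\<alpha> z \<otimes>\<^bsub>A\<^esub> a) b \<ominus>\<^bsub>F\<^esub> e a (\<beta> z \<otimes>\<^bsub>B\<^esub> b) | z a b.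
           z \<in> carrier Z \<and> a \<in> carrier A \<and> b \<in> carrier B}))"

definition tensor_ring ::
    "('z, 'q) ring_scheme \<Rightarrow> ('z \<Rightarrow> 'a) \<Rightarrow> ('a, 'm) ring_scheme \<Rightarrow> ('z \<Rightarrow> 'b) \<Rightarrow> ('b, 'n) ring_scheme
     \<Rightarrow> ('a \<times> 'b \<Rightarrow> int) set ring" where
  "tensor_ring Z \<alpha> A \<beta> B = monoid_ring (A \<times>\<times> B) Quot tensor_ideal Z \<alpha> A \<beta> B"

definition tensor ::
    "('z, 'q) ring_scheme \<Rightarrow> ('z \<Rightarrow> 'a) \<Rightarrow> ('a, 'm) ring_scheme \<Rightarrow> ('z \<Rightarrow> 'b) \<Rightarrow> ('b, 'n) ring_scheme
     \<Rightarrow> 'a \<Rightarrow> 'b \<Rightarrow> ('a \<times> 'b \<Rightarrow> int) set" where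
  "tensor Z \<alpha> A \<beta> B a b = tensor_ideal Z \<alpha> A \<beta> B +>\<^bsub>monoid_ring (A \<times>\<times> B)\<^esub> delta (a, b) 1"


section \<open>Rings of fractions\<close>

text \<open>The ring of right fractions \<open>a s\<^sup>-\<^sup>1\<close> of \<open>R\<close> with respect to a right denominator set \<open>S\<close>
  (multiplicative, right Ore, right reversible). Two fractions are equal iff they can be expanded
  to the same numerator and the same denominator in \<open>S\<close>; sums use representatives with a common
  denominator; and \<open>(a s\<^sup>-\<^sup>1) (b t\<^sup>-\<^sup>1) = (a c) (t u)\<^sup>-\<^sup>1\<close> whenever \<open>b u = s c\<close>. Sum and product are
  unions over all admissible choices, all of which give the same class. If \<open>S\<close> is also a left
  denominator set, the rings of left and of right fractions agree.\<close>

definition frac_rel :: "('a, 'm) ring_scheme \<Rightarrow> 'a set \<Rightarrow> (('a \<times> 'a) \<times> ('a \<times> 'a)) set" where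
  "frac_rel R S = {((a, s), (b, t)). a \<in> carrier R \<and> s \<in> S \<and> b \<in> carrier R \<and> t \<in> S \<and>
     (\<exists>c \<in> carrier R. \<exists>d \<in> carrier R.
        a \<otimes>\<^bsub>R\<^esub> c = b \<otimes>\<^bsub>R\<^esub> d \<and> s \<otimes>\<^bsub>R\<^esub> c = t \<otimes>\<^bsub>R\<^esub> d \<and> s \<otimes>\<^bsub>R\<^esub> c \<in> S)}"

definition right_frac :: "('a, 'm) ring_scheme \<Rightarrow> 'a set \<Rightarrow> 'a \<Rightarrow> 'a \<Rightarrow> ('a \<times> 'a) set" where
  "right_frac R S a s = frac_rel R S `` {(a, s)}"

definition fraction_ring :: "('a, 'm) ring_scheme \<Rightarrow> 'a set \<Rightarrow> ('a \<times> 'a) set ring" where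
  "fraction_ring R S =
     \<lparr>carrier = (carrier R \<times> S) // frac_rel R S,
      mult = (\<lambda>X Y. \<Union>{right_frac R S (a \<otimes>\<^bsub>R\<^esub> c) (t \<otimes>\<^bsub>R\<^esub> u) | a s b t c u.
                (a, s) \<in> X \<and> (b, t) \<in> Y \<and> c \<in> carrier R \<and> u \<in> S \<and> b \<otimes>\<^bsub>R\<^esub> u = s \<otimes>\<^bsub>R\<^esub> c}),
      one = right_frac R S \<one>\<^bsub>R\<^esub> \<one>\<^bsub>R\<^esub>,
      zero = right_frac R S \<zero>\<^bsub>R\<^esub> \<one>\<^bsub>R\<^esub>,
      add = (\<lambda>X Y. \<Union>{right_frac R S (a \<oplus>\<^bsub>R\<^esub> b) s | a b s. (a, s) \<in> X \<and> (b, s) \<in> Y})\<rparr>"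

definition regular_elements :: "('a, 'm) ring_scheme \<Rightarrow> 'a set" where
  "regular_elements R = {r \<in> carrier R. \<forall>a \<in> carrier R.
     (r \<otimes>\<^bsub>R\<^esub> a = \<zero>\<^bsub>R\<^esub> \<longrightarrow> a = \<zero>\<^bsub>R\<^esub>) \<and> (a \<otimes>\<^bsub>R\<^esub> r = \<zero>\<^bsub>R\<^esub> \<longrightarrow> a = \<zero>\<^bsub>R\<^esub>)}"

definition classical_quotient_ring :: "('a, 'm) ring_scheme \<Rightarrow> ('a \<times> 'a) set ring" where
  "classical_quotient_ring R = fraction_ring R (regular_elements R)"


section \<open>Left modules\<close>

text \<open>The library's \<^locale>\<open>module\<close> requires a commutative base ring.\<close>

locale left_module = R?: ring R + M?: abelian_group M
  for R :: "('a, 'm) ring_scheme" (structure) and M :: "('a, 'b, 'n) module_scheme" (structure) +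
  assumes smult_closed: "\<lbrakk>a \<in> carrier R; x \<in> carrier M\<rbrakk> \<Longrightarrow> a \<odot>\<^bsub>M\<^esub> x \<in> carrier M"
    and smult_l_distr: "\<lbrakk>a \<in> carrier R; b \<in> carrier R; x \<in> carrier M\<rbrakk> \<Longrightarrow>
      (a \<oplus>\<^bsub>R\<^esub> b) \<odot>\<^bsub>M\<^esub> x = a \<odot>\<^bsub>M\<^esub> x \<oplus>\<^bsub>M\<^esub> b \<odot>\<^bsub>M\<^esub> x"
    and smult_r_distr: "\<lbrakk>a \<in> carrier R; x \<in> carrier M; y \<in> carrier M\<rbrakk> \<Longrightarrow>
      a \<odot>\<^bsub>M\<^esub> (x \<oplus>\<^bsub>M\<^esub> y) = a \<odot>\<^bsub>M\<^esub> x \<oplus>\<^bsub>M\<^esub> a \<odot>\<^bsub>M\<^esub> y"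
    and smult_assoc: "\<lbrakk>a \<in> carrier R; b \<in> carrier R; x \<in> carrier M\<rbrakk> \<Longrightarrow>
      (a \<otimes>\<^bsub>R\<^esub> b) \<odot>\<^bsub>M\<^esub> x = a \<odot>\<^bsub>M\<^esub> (b \<odot>\<^bsub>M\<^esub> x)"
    and smult_one: "x \<in> carrier M \<Longrightarrow> \<one>\<^bsub>R\<^esub> \<odot>\<^bsub>M\<^esub> x = x"

definition simple_module :: "('a, 'm) ring_scheme \<Rightarrow> ('a, 'b, 'n) module_scheme \<Rightarrow> bool" where
  "simple_module R M \<longleftrightarrow> left_module R M \<and> carrier M \<noteq> {\<zero>\<^bsub>M\<^esub>} \<and>
     (\<forall>N. submodule N R M \<longrightarrow> N = {\<zero>\<^bsub>M\<^esub>} \<or> N = carrier M)"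

text \<open>The ring fields \<open>mult\<close> and \<open>one\<close> of a module record carry no meaning.\<close>

definition restrict_scalars :: "('r \<Rightarrow> 'a) \<Rightarrow> ('a, 'b, 'n) module_scheme \<Rightarrow> ('r, 'b) module" where
  "restrict_scalars \<eta> M = \<lparr>carrier = carrier M, mult = mult M, one = one M, zero = zero M,
     add = add M, smult = (\<lambda>c x. \<eta> c \<odot>\<^bsub>M\<^esub> x)\<rparr>"

definition self_module :: "('a, 'm) ring_scheme \<Rightarrow> ('a, 'a) module" where
  "self_module A = \<lparr>carrier = carrier A, mult = mult A, one = one A, zero = zero A,
     add = add A, smult = mult A\<rparr>"

text \<open>A module with a basis of \<open>n\<close> elements; over a field this means dimension \<open>n\<close>.\<close>

definition free_of_rank ::
    "('a, 'm) ring_scheme \<Rightarrow> ('a, 'b, 'n) module_scheme \<Rightarrow> nat \<Rightarrow> bool" where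
  "free_of_rank R M n \<longleftrightarrow> (\<exists>b \<in> {..<n} \<rightarrow> carrier M. \<forall>x \<in> carrier M.
     \<exists>!c. c \<in> {..<n} \<rightarrow>\<^sub>E carrier R \<and> x = (\<Oplus>\<^bsub>M\<^esub>i\<in>{..<n}. c i \<odot>\<^bsub>M\<^esub> b i))"

definition linear_maps ::
    "('a, 'm) ring_scheme \<Rightarrow> ('a, 'b, 'n) module_scheme \<Rightarrow> ('a, 'c, 'q) module_scheme
     \<Rightarrow> ('b \<Rightarrow> 'c) set" where
  "linear_maps R M N = {f \<in> carrier M \<rightarrow>\<^sub>E carrier N.
     (\<forall>x \<in> carrier M. \<forall>y \<in> carrier M. f (x \<oplus>\<^bsub>M\<^esub> y) = f x \<oplus>\<^bsub>N\<^esub> f y) \<and>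
     (\<forall>a \<in> carrier R. \<forall>x \<in> carrier M. f (a \<odot>\<^bsub>M\<^esub> x) = a \<odot>\<^bsub>N\<^esub> f x)}"

definition standard_free_module :: "('a, 'm) ring_scheme \<Rightarrow> nat \<Rightarrow> ('a, nat \<Rightarrow> 'a) module" where
  "standard_free_module R n = \<lparr>carrier = {..<n} \<rightarrow>\<^sub>E carrier R, mult = undefined, one = undefined,
     zero = (\<lambda>_\<in>{..<n}. \<zero>\<^bsub>R\<^esub>), add = (\<lambda>f g. \<lambda>i\<in>{..<n}. f i \<oplus>\<^bsub>R\<^esub> g i),
     smult = (\<lambda>a f. \<lambda>i\<in>{..<n}. a \<otimes>\<^bsub>R\<^esub> f i)\<rparr>"

text \<open>Finitely generated projective: a direct summand (a retract) of some \<open>R\<^sup>n\<close>.\<close>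

definition fg_projective :: "('a, 'm) ring_scheme \<Rightarrow> ('a, 'b, 'n) module_scheme \<Rightarrow> bool" where
  "fg_projective R M \<longleftrightarrow> (\<exists>n. \<exists>i \<in> linear_maps R M (standard_free_module R n).
     \<exists>q \<in> linear_maps R (standard_free_module R n) M. \<forall>x \<in> carrier M. q (i x) = x)"

definition endomorphism_ring ::
    "('a, 'm) ring_scheme \<Rightarrow> ('a, 'b, 'n) module_scheme \<Rightarrow> ('b \<Rightarrow> 'b) ring" where
  "endomorphism_ring R M = \<lparr>carrier = linear_maps R M M, mult = compose (carrier M),
     one = (\<lambda>x\<in>carrier M. x), zero = (\<lambda>x\<in>carrier M. \<zero>\<^bsub>M\<^esub>),
     add = (\<lambda>f g. \<lambda>x\<in>carrier M. f x \<oplus>\<^bsub>M\<^esub> g x)\<rparr>"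


section \<open>Azumaya and central simple algebras\<close>

text \<open>\<open>A\<close> is Azumaya over its central subring \<open>Z\<close> if it is a finitely generated projective
  \<open>Z\<close>-module and the canonical map \<open>A \<otimes>\<^sub>Z A\<^sup>o\<^sup>p \<rightarrow> End\<^sub>Z A\<close>, \<open>a \<otimes> b \<mapsto> (c \<mapsto> a c b)\<close>, is
  bijective.\<close>

definition azumaya :: "('a, 'm) ring_scheme \<Rightarrow> 'a set \<Rightarrow> bool" where
  "azumaya A Z \<longleftrightarrow> (let ZR = A\<lparr>carrier := Z\<rparr>; Aop = opposite_ring A in
     ring A \<and> subring Z A \<and> Z \<subseteq> ring_center A \<and>
     fg_projective ZR (self_module A) \<and>
     (\<exists>\<phi> \<in> ring_iso (tensor_ring ZR id A id Aop) (endomorphism_ring ZR (self_module A)).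
        \<forall>a \<in> carrier A. \<forall>b \<in> carrier A.
          \<phi> (tensor ZR id A id Aop a b) = (\<lambda>c\<in>carrier A. a \<otimes>\<^bsub>A\<^esub> c \<otimes>\<^bsub>A\<^esub> b)))"

text \<open>The local condition: for every prime \<open>P\<close> of \<open>Z\<close>, the localization \<open>A\<^sub>P\<close> is free of rank \<open>n\<close>
  over the (isomorphic) image of \<open>Z\<^sub>P\<close> in it.\<close>

definition constant_rank :: "('a, 'm) ring_scheme \<Rightarrow> 'a set \<Rightarrow> nat \<Rightarrow> bool" where
  "constant_rank A Z n \<longleftrightarrow> (\<forall>P. primeideal P (A\<lparr>carrier := Z\<rparr>) \<longrightarrow>
     (let AP = fraction_ring A (Z - P);
          ZP = AP\<lparr>carrier := {right_frac A (Z - P) z s | z s. z \<in> Z \<and> s \<in> Z - P}\<rparr>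
      in free_of_rank ZP (self_module AP) n))"

definition simple_ring :: "('a, 'm) ring_scheme \<Rightarrow> bool" where
  "simple_ring R \<longleftrightarrow> ring R \<and> carrier R \<noteq> {\<zero>\<^bsub>R\<^esub>} \<and>
     (\<forall>I. ideal I R \<longrightarrow> I = {\<zero>\<^bsub>R\<^esub>} \<or> I = carrier R)"

definition central_simple_algebra ::
    "('c, 'n) ring_scheme \<Rightarrow> ('c \<Rightarrow> 'a) \<Rightarrow> ('a, 'm) ring_scheme \<Rightarrow> nat \<Rightarrow> bool" where
  "central_simple_algebra K \<kappa> R n \<longleftrightarrow> field K \<and> \<kappa> \<in> ring_hom K R \<and> simple_ring R \<and>
     ring_center R = \<kappa> ` carrier K \<and> ring.dimension R n (\<kappa> ` carrier K) (carrier R)"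

definition algebra_isomorphic ::
    "('c, 'n) ring_scheme \<Rightarrow> ('c \<Rightarrow> 'a) \<Rightarrow> ('a, 'm) ring_scheme \<Rightarrow> ('c \<Rightarrow> 'b) \<Rightarrow> ('b, 'q) ring_scheme
     \<Rightarrow> bool" where
  "algebra_isomorphic K \<kappa> R \<kappa>' R' \<longleftrightarrow>
     (\<exists>\<phi> \<in> ring_iso R R'. \<forall>c \<in> carrier K. \<phi> (\<kappa> c) = \<kappa>' c)"


section \<open>Prime rings, polynomial identities, PI degree\<close>

text \<open>The library's \<^locale>\<open>primeideal\<close> is reserved for commutative rings.\<close>

definition prime_ideal :: "'a set \<Rightarrow> ('a, 'm) ring_scheme \<Rightarrow> bool" where
  "prime_ideal P R \<longleftrightarrow> ideal P R \<and> P \<noteq> carrier R \<and>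
     (\<forall>I J. ideal I R \<longrightarrow> ideal J R \<longrightarrow> I \<cdot>\<^bsub>R\<^esub> J \<subseteq> P \<longrightarrow> I \<subseteq> P \<or> J \<subseteq> P)"

definition prime_ring :: "('a, 'm) ring_scheme \<Rightarrow> bool" where
  "prime_ring R \<longleftrightarrow> ring R \<and> prime_ideal {\<zero>\<^bsub>R\<^esub>} R"

text \<open>A PI ring satisfies a monic identity: an element of \<open>\<int>\<langle>X\<^sub>0, X\<^sub>1, \<dots>\<rangle>\<close> in which some monomial
  of maximal degree has coefficient \<open>1\<close>.\<close>

definition PI_ring :: "('a, 'm) ring_scheme \<Rightarrow> bool" where
  "PI_ring R \<longleftrightarrow> ring R \<and> (\<exists>f :: nat list \<Rightarrow> int. f \<in> carrier free_algebra \<and>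
     (\<exists>w. f w = 1 \<and> (\<forall>v. f v \<noteq> 0 \<longrightarrow> length v \<le> length w)) \<and>
     (\<forall>r \<in> UNIV \<rightarrow> carrier R.
        (\<Oplus>\<^bsub>R\<^esub>w\<in>{w. f w \<noteq> 0}. [f w] \<cdot>\<^bsub>R\<^esub> foldr (\<lambda>i a. r i \<otimes>\<^bsub>R\<^esub> a) w \<one>\<^bsub>R\<^esub>) = \<zero>\<^bsub>R\<^esub>))"

text \<open>\<open>has_PI_degree R d\<close>: \<open>R\<close> is a prime PI ring and \<open>d\<^sup>2\<close> is the dimension of its classical
  quotient ring over the center of the latter.\<close>

definition has_PI_degree :: "('a, 'm) ring_scheme \<Rightarrow> nat \<Rightarrow> bool" where
  "has_PI_degree R d \<longleftrightarrow> prime_ring R \<and> PI_ring R \<and>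
     (let Q = classical_quotient_ring R in
        ring Q \<and> subfield (ring_center Q) Q \<and>
        ring.dimension Q (d\<^sup>2) (ring_center Q) (carrier Q))"

definition regular_prime :: "'a set \<Rightarrow> ('a, 'm) ring_scheme \<Rightarrow> bool" where
  "regular_prime P R \<longleftrightarrow> prime_ideal P R \<and> (\<exists>d. has_PI_degree R d \<and> has_PI_degree (R Quot P) d)"


section \<open>The super Jordan plane\<close>

datatype sj_gen = GX | GY

definition sj_ideal :: "(sj_gen list \<Rightarrow> 'k::field) set" where
  "sj_ideal = (let F = free_algebra; m = (\<lambda>w. delta w 1) in
     genideal F {m [GX, GX], m [GY, GY, GX] \<ominus>\<^bsub>F\<^esub> m [GX, GY, GY] \<ominus>\<^bsub>F\<^esub> m [GX, GY, GX]})"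

definition super_jordan :: "(sj_gen list \<Rightarrow> 'k::field) set ring" where
  "super_jordan = free_algebra Quot sj_ideal"

definition sj_const :: "'k::field \<Rightarrow> (sj_gen list \<Rightarrow> 'k) set" where
  "sj_const c = sj_ideal +>\<^bsub>free_algebra\<^esub> delta [] c"

definition sj_x :: "(sj_gen list \<Rightarrow> 'k::field) set" where
  "sj_x = sj_ideal +>\<^bsub>free_algebra\<^esub> delta [GX] 1"

definition sj_y :: "(sj_gen list \<Rightarrow> 'k::field) set" where
  "sj_y = sj_ideal +>\<^bsub>free_algebra\<^esub> delta [GY] 1"

definition sj_s :: "(sj_gen list \<Rightarrow> 'k::field) set" where
  "sj_s = sj_x \<otimes>\<^bsub>super_jordan\<^esub> sj_y \<oplus>\<^bsub>super_jordan\<^esub> sj_y \<otimes>\<^bsub>super_jordan\<^esub> sj_x"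

definition sj_s_powers :: "(sj_gen list \<Rightarrow> 'k::field) set set" where
  "sj_s_powers = {sj_s [^]\<^bsub>super_jordan\<^esub> n | n :: nat. True}"

type_synonym 'k sj_loc = "((sj_gen list \<Rightarrow> 'k) set \<times> (sj_gen list \<Rightarrow> 'k) set) set"

definition super_jordan_loc :: "'k::field sj_loc ring" where
  "super_jordan_loc = fraction_ring super_jordan sj_s_powers"

text \<open>The embedding of the super Jordan plane into its localization.\<close>

definition sj_embed :: "(sj_gen list \<Rightarrow> 'k::field) set \<Rightarrow> 'k sj_loc" where
  "sj_embed a = right_frac super_jordan sj_s_powers a \<one>\<^bsub>super_jordan\<^esub>"

text \<open>The subalgebra generated by \<open>(y s\<^sup>-\<^sup>1)\<^sup>2\<close>, \<open>s\<close> and \<open>s\<^sup>-\<^sup>1\<close>.\<close>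

definition sj_A :: "'k::field sj_loc set" where
  "sj_A = (let L = super_jordan_loc; y = sj_embed sj_y; s = sj_embed sj_s in
     generated_algebra (sj_embed \<circ> sj_const) L {(y \<otimes>\<^bsub>L\<^esub> inv\<^bsub>L\<^esub> s) [^]\<^bsub>L\<^esub> (2::nat), s, inv\<^bsub>L\<^esub> s})"

end

theory Submission
  imports Defs "HOL-Combinatorics.Permutations"
begin

hide_const (open) Multiset.mult Polynomial.smult

text \<open>With \<open>t = (y s\<^sup>-\<^sup>1)\<^sup>2\<close> and \<open>v = y s\<^sup>-\<^sup>1 - t x\<close> one has \<open>t s = s t + 1\<close>, while \<open>x\<close>, \<open>v\<close> commute with
  \<open>s\<close>, \<open>t\<close> and generate two by two matrices; so the localization is \<open>M\<^sub>2\<close> of a localized Weyl algebra,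
  free of rank \<open>(2 p)\<^sup>2\<close> over \<open>k[s\<^sup>\<plusminus>\<^sup>p, y\<^sup>2\<^sup>p]\<close>. The coordinates with respect to a suitable basis are maps
  \<open>r \<mapsto> \<Sum> u r v\<close> (matrix units combined with powers of \<open>ad t\<close> and \<open>ad s\<close>). Such a dual basis gives the
  Azumaya property, the correspondence of ideals, primeness and the PI degree, also for quotients and,
  up to a central denominator, for the plane itself. A linear model on the monomials shows that these are
  independent. For simple modules, Nakayama's lemma and elimination make the center act by scalars.

  The product \<open>a **$R b\<close> is the library's \<open>a \<otimes> b\<close> with \<open>R\<close> as a subscript.\<close>

\<comment> \<open>A presentation by generators and relations does not show when an element is zero.
  Computations therefore take place in the span \<open>W\<close> of monomials inside an endomorphism
  ring; the plane and its localization are recognized as copies of subrings of it, and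
  \<open>sj_copy\<close> moves results to them. The dual basis is found in \<open>W\<close>, where
  \<open>s\<close> is invertible. A denominator \<open>d\<close> is built into
  \<open>dual_basis\<close> so that one set of lemmas covers the localization (\<open>d = 1\<close>)
  and the plane (\<open>d\<close> a power of \<open>s^p\<close>). The coordinates have the required
  form because on \<open>s^a t^b\<close> the two inner derivations are partial derivatives:
  \<open>p - 1\<close> of each single out the exponents \<open>p - 1\<close>, as
  \<open>(p - 1)!\<close> is a unit, and a shift of exponents reads off any other coefficient. For
  simple modules the difficulty is that an algebraically closed field of characteristic
  \<open>p\<close> may be countable, so eigenvalues cannot be had by comparing cardinalities. They
  come from an elimination between the two generators \<open>s^p\<close> and \<open>y^(2p)\<close>
  of the center modulo a maximal left ideal.\<close>
syntax "_index" :: "logic \<Rightarrow> index" ("$_" [1000] 1000)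
notation mult (infixl "**\<index>" 70)

section \<open>Centers and regular elements\<close>

lemma ring_centerD:
 assumes "z : ring_center R"
 shows "z : carrier R" "r : carrier R ==> z **$R r = r **$R z"
 using assms by (auto simp: ring_center_def)

lemma ring_centerI:
 assumes "z : carrier R" "!!r. r : carrier R ==> z **$R r = r **$R z"
 shows "z : ring_center R"
 using assms unfolding ring_center_def by blast

lemma (in ring) ring_center_subring: "subring (ring_center R) R"
proof (rule subringI)
 fix h1 h2 assume h: "h1 : ring_center R" "h2 : ring_center R"
 note [simp] = ring_centerD(1)[OF h(1)] ring_centerD(1)[OF h(2)]
 have "h1 ** h2 ** r = r ** (h1 ** h2)" if r: "r : carrier R" for r
 proof -
  have "h1 ** h2 ** r = h1 ** r ** h2"
   using ring_centerD(2)[OF h(2) r] r by (simp add: m_assoc)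
  then show ?thesis using ring_centerD(2)[OF h(1) r] r by (simp add: m_assoc)
 qed
 then show "h1 ** h2 : ring_center R" using ring_centerD(1)[OF h(1)] ring_centerD(1)[OF h(2)]
  by (intro ring_centerI) simp_all
 show "h1 \<oplus> h2 : ring_center R"
  using ring_centerD(2)[OF h(1)] ring_centerD(2)[OF h(2)]
  by (intro ring_centerI) (simp_all add: l_distr r_distr)
next
 fix h assume h: "h : ring_center R"
 show "\<ominus> h : ring_center R"
  using ring_centerD[OF h] by (intro ring_centerI) (simp_all add: l_minus r_minus)
qed (auto simp: ring_center_def)

lemma (in ring) center_closed [simp]:
 "\<zero> : ring_center R" "\<one> : ring_center R"
 "[|a : ring_center R; b : ring_center R|] ==> a ** b : ring_center R"
 "[|a : ring_center R; b : ring_center R|] ==> a \<oplus> b : ring_center R"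
 "a : ring_center R ==> \<ominus> a : ring_center R"
 using ring_center_subring by (auto dest: subringE)

lemma (in ring) inv_in_center:
 assumes "a : ring_center R" "a : Units R"
 shows "inv a : ring_center R"
proof (rule ring_centerI)
 show "inv a : carrier R" using assms by simp
 fix r assume r: "r : carrier R"
 have [simp]: "a : carrier R" using assms(2) by (rule Units_closed)
 have "inv a ** r = inv a ** (r ** a) ** inv a"
  using assms r by (simp add: m_assoc)
 also have "\<dots> = inv a ** (a ** r) ** inv a"
  using ring_centerD(2)[OF assms(1) r] by simp
 also have "\<dots> = r ** inv a"
  using assms r by (simp add: m_assoc[symmetric])
 finally show "inv a ** r = r ** inv a" .
qed

lemma regular_elementsD:
 assumes "r : regular_elements R"
 shows "r : carrier R"
  "[|a : carrier R; r **$R a = \<zero>$R|] ==> a = \<zero>$R"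
  "[|a : carrier R; a **$R r = \<zero>$R|] ==> a = \<zero>$R"
 using assms unfolding regular_elements_def by blast+

lemma regular_elementsI:
 assumes "r : carrier R"
  "!!a. [|a : carrier R; r **$R a = \<zero>$R|] ==> a = \<zero>$R"
  "!!a. [|a : carrier R; a **$R r = \<zero>$R|] ==> a = \<zero>$R"
 shows "r : regular_elements R"
 using assms unfolding regular_elements_def by blast

lemma regular_elements_cancel:
 fixes R (structure)
 assumes "ring R" "r : regular_elements R" "a : carrier R" "b : carrier R"
 shows "r **$R a = r **$R b \<longleftrightarrow> a = b" "a **$R r = b **$R r \<longleftrightarrow> a = b"
proof -
 interpret ring R by fact
 have r: "r : carrier R" using assms(2) by (rule regular_elementsD(1))
 have "a = b" if "r ** a = r ** b"
 proof -
  have "r ** (a \<ominus> b) = \<zero>" using that r assms by (simp add: minus_eq r_distr r_minus r_neg)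
  then have "a \<ominus> b = \<zero>" using assms(2) minus_closed[OF assms(3,4)] unfolding regular_elements_def by blast
  then show ?thesis using assms by (simp add: r_right_minus_eq)
 qed
 moreover have "a = b" if "a ** r = b ** r"
 proof -
  have "(a \<ominus> b) ** r = \<zero>" using that r assms by (simp add: minus_eq l_distr l_minus r_neg)
  then have "a \<ominus> b = \<zero>" using assms(2) minus_closed[OF assms(3,4)] unfolding regular_elements_def by blast
  then show ?thesis using assms by (simp add: r_right_minus_eq)
 qed
 ultimately show "r ** a = r ** b \<longleftrightarrow> a = b" "a ** r = b ** r \<longleftrightarrow> a = b" by blast+
qed

lemma (in ring) regular_elements_mult:
 assumes "a : regular_elements R" "b : regular_elements R"
 shows "a ** b : regular_elements R"
proof (rule regular_elementsI)
 note c = regular_elementsD(1)[OF assms(1)] regular_elementsD(1)[OF assms(2)]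
 show "a ** b : carrier R" using c by simp
 fix r assume r: "r : carrier R"
 show "r = \<zero>" if "a ** b ** r = \<zero>"
  using that c r regular_elementsD(2)[OF assms(1), of "b ** r"] regular_elementsD(2)[OF assms(2) r]
  by (simp only: m_assoc m_closed)
 show "r = \<zero>" if "r ** (a ** b) = \<zero>"
  using that c r regular_elementsD(3)[OF assms(2), of "r ** a"] regular_elementsD(3)[OF assms(1) r]
  by (simp only: m_assoc m_closed)
qed

section \<open>Rings of fractions whose denominators divide central ones\<close>

text \<open>\<open>S_central\<close> asks only that each denominator divide a central one in
  \<open>S\<close>. This covers both localizations in play: at the powers of \<open>s\<close>, where
  \<open>s^n\<close> divides the central \<open>s^(p n)\<close>, and at all regular elements. Every
  fraction then has a central denominator, and the arithmetic is that of the commutative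
  case.\<close>

locale central_frac = ring R for R (structure) +
 fixes S
 assumes S_regular: "S <= regular_elements R"
  and S_one: "\<one> : S"
  and S_mult: "[|s : S; t : S|] ==> s ** t : S"
  and S_central: "s : S ==> \<exists>s'\<in>carrier R. s ** s' : S \<inter> ring_center R"
begin

abbreviation F where "F \<equiv> fraction_ring R S"
abbreviation C where "C \<equiv> ring_center R"
abbreviation fr where "fr \<equiv> right_frac R S"

lemma S_carrier [simp]: "s : S ==> s : carrier R"
 using S_regular by (auto dest: regular_elementsD(1))

lemma C_carrier [simp]: "z : C ==> z : carrier R"
 by (rule ring_centerD(1))

lemma C_comm: "z : C ==> r : carrier R ==> z ** r = r ** z"
 by (rule ring_centerD(2))

lemma S_cancel:
 assumes "s : S" "a : carrier R" "b : carrier R"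
 shows "s ** a = s ** b \<longleftrightarrow> a = b" "a ** s = b ** s \<longleftrightarrow> a = b"
 using regular_elements_cancel[OF ring_axioms] assms S_regular by blast+

text \<open>That \<open>s'\<close> commutes with \<open>s\<close> comes for free:
  \<open>s s'\<close> is central, so \<open>s (s' s) = s (s s')\<close>, and the regular element
  \<open>s\<close> cancels.\<close>

lemma S_centralE:
 assumes "s : S"
 obtains s' where "s' : carrier R" "s ** s' : S" "s ** s' : C" "s' ** s = s ** s'"
proof -
 obtain s' where s': "s' : carrier R" "s ** s' : S" "s ** s' : C"
  using S_central[OF assms] by blast
 have "s ** (s' ** s) = s ** (s ** s')"
  using C_comm[OF s'(3), of s] s' assms by (simp add: m_assoc)
 then show ?thesis using that s' S_cancel assms by simp
qed

text \<open>Since \<open>a s^-1 = (a s') (s s')^-1\<close> with \<open>s s'\<close> central, and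
  likewise for \<open>t\<close>, cross multiplication of central denominators turns the existential
  condition into one equation.\<close>

lemma frac_rel_iff:
 assumes a: "a : carrier R" "b : carrier R" and s: "s : S" "t : S"
  and s': "s' : carrier R" "s ** s' : S" "s ** s' : C" "s' ** s = s ** s'"
  and t': "t' : carrier R" "t ** t' : S" "t ** t' : C" "t' ** t = t ** t'"
 shows "((a, s), (b, t)) : frac_rel R S \<longleftrightarrow> a ** s' ** (t ** t') = b ** t' ** (s ** s')"
proof
 note [simp] = s' t' a s
 assume "((a, s), (b, t)) : frac_rel R S"
 then obtain c d where [simp]: "c : carrier R" "d : carrier R"
  and eq: "a ** c = b ** d" "s ** c = t ** d" and q: "s ** c : S"
  by (auto simp: frac_rel_def)
 define z w where zw: "z = s ** s'" "w = t ** t'"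
 have [simp]: "z : carrier R" "w : carrier R" "z : C" "w : C" unfolding zw by simp_all
 have "a ** s' ** w ** (s ** c) = a ** (s' ** (w ** s)) ** c" by (simp add: m_assoc)
 also have "\<dots> = a ** (s' ** (s ** w)) ** c" by (simp add: C_comm[of w s])
 also have "\<dots> = a ** (s' ** s) ** (w ** c)" by (simp add: m_assoc del: s'(4) s'(2,3))
 also have "\<dots> = a ** (z ** (c ** w))" by (simp add: zw(1)[symmetric] C_comm[of w c] m_assoc)
 also have "\<dots> = (a ** c) ** (z ** w)" using C_comm[of z c] by (simp add: m_assoc[symmetric])
 also have "\<dots> = b ** (d ** (z ** w))" unfolding eq by (simp add: m_assoc)
 also have "d ** (z ** w) = w ** (z ** d)" using C_comm[of z d] C_comm[of w d] C_comm[of z w]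
  by (metis C_comm \<open>d : carrier R\<close> \<open>w : C\<close> \<open>z : C\<close> \<open>z : carrier R\<close> center_closed(3) m_assoc C_carrier)
 also have "b ** (w ** (z ** d)) = b ** (t' ** t) ** (z ** d)" by (simp add: zw(2)[symmetric] m_assoc)
 also have "\<dots> = b ** t' ** (t ** z) ** d" by (simp add: m_assoc del: t'(4) t'(2,3))
 also have "\<dots> = b ** t' ** z ** (t ** d)" by (simp add: C_comm[of z t, symmetric] m_assoc)
 finally have "a ** s' ** w ** (s ** c) = b ** t' ** z ** (s ** c)" using eq by simp
 then show "a ** s' ** (t ** t') = b ** t' ** (s ** s')"
  unfolding zw[symmetric] using S_cancel(2)[OF q] by simp
next
 note [simp] = s' t' a s
 assume eq: "a ** s' ** (t ** t') = b ** t' ** (s ** s')"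
 \<comment> \<open>Both fractions are expanded to the common central denominator
   \<open>(s s') (t t')\<close>.\<close>
 define c d where cd: "c = s' ** (t ** t')" "d = t' ** (s ** s')"
 have [simp]: "c : carrier R" "d : carrier R" by (auto simp: cd)
 have "a ** c = b ** d" using eq by (simp add: cd m_assoc)
 moreover have "s ** c = (s ** s') ** (t ** t')" by (simp add: cd m_assoc)
 moreover have "(s ** s') ** (t ** t') = t ** d" using C_comm[of "s ** s'" "t ** t'"] by (simp add: cd m_assoc)
 moreover have "(s ** s') ** (t ** t') : S" by (simp add: S_mult)
 ultimately have "\<exists>c\<in>carrier R. \<exists>d\<in>carrier R. a ** c = b ** d & s ** c = t ** d & s ** c : S"
  by (intro bexI[of _ c] bexI[of _ d]) simp_all
 then show "((a, s), (b, t)) : frac_rel R S"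
  unfolding frac_rel_def using a s by simp
qed

lemma equiv_frac_rel: "equiv (carrier R \<times> S) (frac_rel R S)"
proof (rule equivI)
 show "frac_rel R S <= (carrier R \<times> S) \<times> (carrier R \<times> S)" by (auto simp: frac_rel_def)
 show "refl_on (carrier R \<times> S) (frac_rel R S)"
  by (rule refl_onI) (auto simp: frac_rel_def intro!: bexI[of _ \<one>])
 show "sym (frac_rel R S)"
  unfolding sym_def frac_rel_def by clarsimp metis
 show "trans (frac_rel R S)"
 proof (rule transI, clarify)
  fix a s b t e u assume 1: "((a, s), (b, t)) : frac_rel R S" and 2: "((b, t), (e, u)) : frac_rel R S"
  then have c: "a : carrier R" "b : carrier R" "e : carrier R" "s : S" "t : S" "u : S"
   by (auto simp: frac_rel_def)
  obtain s' where s': "s' : carrier R" "s ** s' : S" "s ** s' : C" "s' ** s = s ** s'"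
   using S_centralE c by blast
  obtain t' where t': "t' : carrier R" "t ** t' : S" "t ** t' : C" "t' ** t = t ** t'"
   using S_centralE c by blast
  obtain u' where u': "u' : carrier R" "u ** u' : S" "u ** u' : C" "u' ** u = u ** u'"
   using S_centralE c by blast
  define z w r where zw: "z = s ** s'" "w = t ** t'" "r = u ** u'"
  have [simp]: "z : C" "w : C" "r : C" "z : S" "w : S" "r : S" unfolding zw using s' t' u' by simp_all
  note [simp] = c s'(1) t'(1) u'(1)
  have e1: "a ** s' ** w = b ** t' ** z" using 1 frac_rel_iff[OF c(1,2,4,5) s' t'] zw by simp
  have e2: "b ** t' ** r = e ** u' ** w" using 2 frac_rel_iff[OF c(2,3,5,6) t' u'] zw by simp
  have "a ** s' ** r ** w = a ** s' ** w ** r" by (simp add: m_assoc C_comm[of r w])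
  also have "\<dots> = b ** t' ** r ** z" unfolding e1 by (simp add: m_assoc C_comm[of z r])
  also have "\<dots> = e ** u' ** z ** w" unfolding e2 by (simp add: m_assoc C_comm[of w z])
  finally have "a ** s' ** r = e ** u' ** z" using S_cancel(2)[of w] by simp
  then show "((a, s), (e, u)) : frac_rel R S"
   using frac_rel_iff[OF c(1,3,4,6) s' u'] zw by simp
 qed
qed

lemma fr_eq_iff:
 assumes "a : carrier R" "b : carrier R" "s : S" "t : S"
 shows "fr a s = fr b t \<longleftrightarrow> ((a, s), (b, t)) : frac_rel R S"
 unfolding right_frac_def using eq_equiv_class_iff[OF equiv_frac_rel] assms by simp

text \<open>The working form of equality: against a fraction with central denominator it is a single
  cross multiplication, free of the auxiliary \<open>s'\<close>. All arithmetic below is reduced to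
  it by \<open>fr_normalize\<close>.\<close>

lemma frac_rel_central_iff:
 assumes [simp]: "a : carrier R" "b : carrier R" "s : S" "z : S" "z : C"
 shows "((a, s), (b, z)) : frac_rel R S \<longleftrightarrow> a ** z = b ** s"
proof -
 obtain s' where s': "s' : carrier R" "s ** s' : S" "s ** s' : C" "s' ** s = s ** s'"
  using S_centralE assms by blast
 define w where w: "w = s ** s'"
 have [simp]: "s' : carrier R" "w : S" "w : C" using s' w by simp_all
 have "((a, s), (b, z)) : frac_rel R S \<longleftrightarrow> a ** s' ** z = b ** w"
  using frac_rel_iff[OF assms(1-4) s', of \<one>] w by simp
 also have "\<dots> \<longleftrightarrow> a ** s' ** z ** s = b ** w ** s" using S_cancel(2)[of s] by simp
 also have "a ** s' ** z ** s = a ** (s' ** s) ** z" by (simp add: m_assoc C_comm[of z s] del: s'(4))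
 also have "\<dots> = a ** z ** w" by (simp add: s'(4) w[symmetric] m_assoc C_comm[of w z])
 also have "b ** w ** s = b ** s ** w" by (simp add: m_assoc C_comm[of w s])
 also have "a ** z ** w = b ** s ** w \<longleftrightarrow> a ** z = b ** s" using S_cancel(2)[of w] by simp
 finally show ?thesis .
qed

lemma fr_eq_central_iff:
 assumes "a : carrier R" "b : carrier R" "s : S" "z : S" "z : C"
 shows "fr a s = fr b z \<longleftrightarrow> a ** z = b ** s"
 using fr_eq_iff frac_rel_central_iff assms by simp

lemma mem_fr_central_iff:
 assumes "b : carrier R" "z : S" "z : C"
 shows "(a, s) : fr b z \<longleftrightarrow> a : carrier R & s : S & a ** z = b ** s"
proof -
 have "(a, s) : fr b z \<longleftrightarrow> ((a, s), (b, z)) : frac_rel R S"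
  unfolding right_frac_def using equiv_frac_rel by (auto elim: equivE dest: symD)
 moreover have "((a, s), (b, z)) : frac_rel R S ==> a : carrier R & s : S"
  by (auto simp: frac_rel_def)
 ultimately show ?thesis using frac_rel_central_iff[of a b s z] assms by blast
qed

lemma fr_closed [simp]: "a : carrier R ==> s : S ==> fr a s : carrier F"
 by (auto simp: fraction_ring_def right_frac_def intro!: quotientI)

lemma fr_normalize:
 assumes "a : carrier R" "s : S"
 obtains b z where "b : carrier R" "z : S" "z : C" "fr a s = fr b z"
proof -
 obtain s' where s': "s' : carrier R" "s ** s' : S" "s ** s' : C" "s' ** s = s ** s'"
  using S_centralE assms by blast
 have "a ** (s ** s') = a ** s' ** s" using s' assms by (simp add: m_assoc)
 then have "fr a s = fr (a ** s') (s ** s')" using fr_eq_central_iff s' assms by simp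
 then show ?thesis using that s' assms by (metis m_closed)
qed

lemma frac_cases:
 assumes "X : carrier F"
 obtains a z where "a : carrier R" "z : S" "z : C" "X = fr a z"
proof -
 obtain a s where "a : carrier R" "s : S" "X = fr a s"
  using assms by (auto simp: fraction_ring_def right_frac_def elim!: quotientE)
 then show ?thesis using fr_normalize that by metis
qed

text \<open>The product is a union over all admissible choices. Each of them yields the class on the
  right, and at least one choice exists, so the union collapses to this class; sums are treated in
  the same way.\<close>

lemma fr_mult:
 assumes [simp]: "a : carrier R" "b : carrier R" "z : S" "z : C" "w : S" "w : C"
 shows "fr a z **$F fr b w = fr (a ** b) (z ** w)"
proof -
 let ?M = "{fr (a' ** c) (t ** u) | a' s b' t c u. (a', s) : fr a z & (b', t) : fr b w &
   c : carrier R & u : S & b' ** u = s ** c}"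
 have zw [simp]: "z ** w : S" "z ** w : C" by (simp_all add: S_mult)
 have "fr (a' ** c) (t ** u) = fr (a ** b) (z ** w)"
  if "(a', s) : fr a z" "(b', t) : fr b w" and [simp]: "c : carrier R" "u : S" and bu: "b' ** u = s ** c" for a' s b' t c u
 proof -
  have [simp]: "a' : carrier R" "s : S" "b' : carrier R" "t : S"
   and e: "a' ** z = a ** s" "b' ** w = b ** t"
   using that by (auto simp: mem_fr_central_iff)
  have "a' ** c ** (z ** w) = a' ** z ** c ** w"
   using C_comm[of z c] by (simp add: m_assoc[symmetric]) (simp add: m_assoc)
  also have "\<dots> = a ** (b' ** u) ** w" by (simp add: e bu m_assoc)
  also have "\<dots> = a ** (b' ** w) ** u" by (simp add: m_assoc C_comm[of w u])
  also have "\<dots> = a ** b ** (t ** u)" by (simp add: e m_assoc)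
  finally show ?thesis by (subst fr_eq_central_iff) (simp_all add: S_mult)
 qed
 moreover have "fr (a ** b) (z ** w) : ?M"
 proof -
  \<comment> \<open>Existence of a choice: \<open>c = b\<close> and \<open>u = z\<close> are
    admissible because \<open>z\<close> commutes with \<open>b\<close>.\<close>
  have m: "(a, z) : fr a z" "(b, w) : fr b w" "b ** z = z ** b" using C_comm[of z b]
   by (simp_all add: mem_fr_central_iff)
  moreover have "z ** w = w ** z" using C_comm by simp
  ultimately have "fr (a ** b) (z ** w) = fr (a ** b) (w ** z) & (a, z) : fr a z & (b, w) : fr b w &
    b : carrier R & z : S & b ** z = z ** b" by simp
  then show ?thesis by blast
 qed
 ultimately have "?M = {fr (a ** b) (z ** w)}" by blast
 then show ?thesis unfolding fraction_ring_def by simp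
qed

lemma fr_add:
 assumes [simp]: "a : carrier R" "b : carrier R" "z : S" "z : C" "w : S" "w : C"
 shows "fr a z \<oplus>$F fr b w = fr (a ** w \<oplus> b ** z) (z ** w)"
proof -
 let ?M = "{fr (a' \<oplus> b') s | a' b' s. (a', s) : fr a z & (b', s) : fr b w}"
 have zw [simp]: "z ** w : S" "z ** w : C" by (simp_all add: S_mult)
 have "fr (a' \<oplus> b') s = fr (a ** w \<oplus> b ** z) (z ** w)"
  if "(a', s) : fr a z" "(b', s) : fr b w" for a' s b'
 proof -
  have [simp]: "a' : carrier R" "s : S" "b' : carrier R"
   and e: "a' ** z = a ** s" "b' ** w = b ** s"
   using that by (auto simp: mem_fr_central_iff)
  have "(a' \<oplus> b') ** (z ** w) = a' ** z ** w \<oplus> b' ** w ** z"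
   by (simp add: l_distr m_assoc C_comm[of w z])
  also have "\<dots> = a ** (s ** w) \<oplus> b ** (s ** z)" by (simp add: e m_assoc)
  also have "\<dots> = a ** w ** s \<oplus> b ** z ** s" by (simp add: m_assoc C_comm[of z s] C_comm[of w s])
  also have "\<dots> = (a ** w \<oplus> b ** z) ** s" by (simp add: l_distr)
  finally show ?thesis by (subst fr_eq_central_iff) simp_all
 qed
 moreover have "fr (a ** w \<oplus> b ** z) (z ** w) : ?M"
 proof -
  have "(a ** w, z ** w) : fr a z" "(b ** z, z ** w) : fr b w"
   by (simp_all add: mem_fr_central_iff m_assoc C_comm[of z w] S_mult)
  then show ?thesis by blast
 qed
 ultimately have "?M = {fr (a ** w \<oplus> b ** z) (z ** w)}" by blast
 then show ?thesis unfolding fraction_ring_def by simp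
qed

lemma F_one: "\<one>$F = fr \<one> \<one>" and F_zero: "\<zero>$F = fr \<zero> \<one>"
 by (simp_all add: fraction_ring_def)

lemma ring_F: "ring F"
proof (rule ringI)
 note [simp] = S_mult S_one fr_mult fr_add F_one F_zero fr_eq_central_iff
 show "abelian_group F"
 proof (rule abelian_groupI)
  fix X Y assume "X : carrier F" "Y : carrier F"
  then obtain a z b w where [simp]: "a : carrier R" "z : S" "z : C" "X = fr a z"
   "b : carrier R" "w : S" "w : C" "Y = fr b w" by (elim frac_cases) metis
  show "X \<oplus>$F Y : carrier F" by simp
  show "X \<oplus>$F Y = Y \<oplus>$F X" by (simp add: a_comm C_comm[of z w])
 next
  fix X Y U assume "X : carrier F" "Y : carrier F" "U : carrier F"
  then obtain a z b w c u where [simp]: "a : carrier R" "z : S" "z : C" "X = fr a z"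
   "b : carrier R" "w : S" "w : C" "Y = fr b w" "c : carrier R" "u : S" "u : C" "U = fr c u"
   by (elim frac_cases) metis
  have "a ** (w ** u) \<oplus> (b ** (z ** u) \<oplus> c ** (z ** w)) = a ** (w ** u) \<oplus> (b ** (u ** z) \<oplus> c ** (w ** z))"
   by (simp add: C_comm[of u z] C_comm[of w z])
  then have "(a ** w \<oplus> b ** z) ** u \<oplus> c ** (z ** w) = a ** (w ** u) \<oplus> (b ** u \<oplus> c ** w) ** z"
   by (simp add: l_distr m_assoc a_assoc)
  then show "X \<oplus>$F Y \<oplus>$F U = X \<oplus>$F (Y \<oplus>$F U)"
   by (simp add: m_assoc)
 next
  show "\<zero>$F : carrier F" by simp
 next
  fix X assume "X : carrier F"
  then obtain a z where [simp]: "a : carrier R" "z : S" "z : C" "X = fr a z" by (elim frac_cases) metis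
  show "\<zero>$F \<oplus>$F X = X" by simp
  show "\<exists>Y\<in>carrier F. Y \<oplus>$F X = \<zero>$F"
  proof (rule bexI)
   show "fr (\<ominus> a) z \<oplus>$F X = \<zero>$F" by (simp add: l_minus l_neg)
  qed simp
 qed
 show "Group.monoid F"
 proof (rule monoidI)
  fix X Y assume "X : carrier F" "Y : carrier F"
  then obtain a z b w where [simp]: "a : carrier R" "z : S" "z : C" "X = fr a z"
   "b : carrier R" "w : S" "w : C" "Y = fr b w" by (elim frac_cases) metis
  show "X **$F Y : carrier F" by simp
 next
  fix X Y U assume "X : carrier F" "Y : carrier F" "U : carrier F"
  then obtain a z b w c u where [simp]: "a : carrier R" "z : S" "z : C" "X = fr a z"
   "b : carrier R" "w : S" "w : C" "Y = fr b w" "c : carrier R" "u : S" "u : C" "U = fr c u"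
   by (elim frac_cases) metis
  show "X **$F Y **$F U = X **$F (Y **$F U)"
   by (simp add: m_assoc)
 next
  show "\<one>$F : carrier F" by simp
 next
  fix X assume "X : carrier F"
  then obtain a z where [simp]: "a : carrier R" "z : S" "z : C" "X = fr a z" by (elim frac_cases) metis
  show "\<one>$F **$F X = X" "X **$F \<one>$F = X" by simp_all
 qed
 fix X Y U assume "X : carrier F" "Y : carrier F" "U : carrier F"
 then obtain a z b w c u where [simp]: "a : carrier R" "z : S" "z : C" "X = fr a z"
  "b : carrier R" "w : S" "w : C" "Y = fr b w" "c : carrier R" "u : S" "u : C" "U = fr c u"
  by (elim frac_cases) metis
 have 1: "x ** y ** (v ** x') = x ** v ** (y ** x')" if "v : C" "x : carrier R" "y : carrier R" "x' : carrier R" for x y v x'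
  using that C_comm[of v y] by (simp add: m_assoc[symmetric]) (simp add: m_assoc)
 have comm: "w ** z = z ** w" "u ** z = z ** u" "u ** w = w ** u" by (simp_all add: C_comm)
 have lcomm: "w ** (z ** x) = z ** (w ** x)" "u ** (z ** x) = z ** (u ** x)" "u ** (w ** x) = w ** (u ** x)"
  if "x : carrier R" for x using that by (simp_all add: m_assoc[symmetric] comm)
 have lcomm2: "z ** (c ** x) = c ** (z ** x)" "w ** (c ** x) = c ** (w ** x)" "u ** (c ** x) = c ** (u ** x)"
   "u ** (b ** x) = b ** (u ** x)" "w ** (b ** x) = b ** (w ** x)"  "z ** (b ** x) = b ** (z ** x)"
   "w ** (a ** x) = a ** (w ** x)"  "z ** (a ** x) = a ** (z ** x)"
  if "x : carrier R" for x
  using that C_comm[of z a] C_comm[of z b] C_comm[of z c] C_comm[of w a] C_comm[of w b] C_comm[of w c]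
   C_comm[of u b] C_comm[of u c] by (simp_all add: m_assoc[symmetric])
 show "(X \<oplus>$F Y) **$F U = X **$F U \<oplus>$F Y **$F U"
  by (simp add: l_distr r_distr m_assoc comm lcomm lcomm2)
 show "U **$F (X \<oplus>$F Y) = U **$F X \<oplus>$F U **$F Y"
  by (simp add: l_distr r_distr m_assoc comm lcomm lcomm2)
qed

definition emb where "emb a = fr a \<one>"

lemma emb_hom: "emb : ring_hom R F"
 by (rule ring_hom_memI) (simp_all add: emb_def S_one fr_mult fr_add F_one)

lemma emb_closed [simp]: "a : carrier R ==> emb a : carrier F"
 by (simp add: emb_def S_one)

lemma emb_eq_iff: "a : carrier R ==> b : carrier R ==> emb a = emb b \<longleftrightarrow> a = b"
 by (simp add: emb_def S_one fr_eq_central_iff)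

lemma emb_inj: "inj_on emb (carrier R)"
 by (auto intro!: inj_onI simp: emb_eq_iff)

lemma fr_emb:
 assumes "a : carrier R" "s : S"
 shows "fr a s **$F emb s = emb a"
proof -
 obtain b z where bz [simp]: "b : carrier R" "z : S" "z : C" "fr a s = fr b z" using fr_normalize assms by metis
 then have "a ** z = b ** s" using fr_eq_central_iff assms by metis
 then show ?thesis using assms by (simp add: emb_def S_one fr_mult fr_eq_central_iff)
qed

lemma emb_Units:
 assumes "s : S"
 shows "emb s : Units F"
proof -
 interpret F: ring F by (rule ring_F)
 have "fr \<one> s **$F emb s = \<one>$F" using fr_emb[of \<one> s] assms by (simp add: emb_def F_one)
 moreover obtain s' where s': "s' : carrier R" "s ** s' : S" "s ** s' : C" "s' ** s = s ** s'"
  using S_centralE assms by blast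
 have "emb s **$F fr s' (s ** s') = \<one>$F"
  using s' assms by (simp add: emb_def S_one fr_mult fr_eq_central_iff F_one S_mult)
 ultimately show ?thesis
  using F.inv_unique[of "fr \<one> s" "emb s" "fr s' (s ** s')"] assms s' unfolding Units_def
  by (auto simp: emb_def S_one intro!: bexI[of _ "fr \<one> s"])
qed

lemma fr_eq_emb_inv:
 assumes "a : carrier R" "s : S"
 shows "fr a s = emb a **$F inv$F emb s"
proof -
 interpret F: ring F by (rule ring_F)
 show ?thesis using fr_emb[OF assms] emb_Units[OF assms(2)] assms
  by (metis F.m_assoc F.Units_inv_closed F.Units_r_inv F.r_one F.Units_closed fr_closed)
qed

lemma emb_center:
 assumes "z : C" shows "emb z : ring_center F"
proof (rule ring_centerI)
 show "emb z : carrier F" using assms by simp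
 fix X assume "X : carrier F"
 then obtain a w where [simp]: "a : carrier R" "w : S" "w : C" "X = fr a w" by (elim frac_cases) metis
 show "emb z **$F X = X **$F emb z"
  using assms by (simp add: emb_def S_one fr_mult C_comm[of z a])
qed

text \<open>A central fraction \<open>a w^-1\<close> with \<open>w\<close> central commutes with
  every \<open>emb r\<close>; cancelling \<open>w\<close> shows that \<open>a\<close> is central as
  well.\<close>

lemma center_F: "ring_center F = {fr z w | z w. z : C & w : S & w : C}"
proof (intro equalityI subsetI; clarify)
 interpret F: ring F by (rule ring_F)
 fix X assume X: "X : ring_center F"
 then have "X : carrier F" by (rule ring_centerD(1))
 then obtain a w where [simp]: "a : carrier R" "w : S" "w : C" and Xf: "X = fr a w" by (elim frac_cases) metis
 have "a ** r = r ** a" if [simp]: "r : carrier R" for r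
 proof -
  have "X **$F emb r = emb r **$F X" using ring_centerD(2)[OF X] by simp
  then have "a ** r ** w = r ** a ** w" by (simp add: Xf emb_def S_one fr_mult fr_eq_central_iff)
  then show ?thesis using S_cancel(2)[of w] by simp
 qed
 then have "a : C" by (intro ring_centerI) simp_all
 then show "\<exists>z w. X = fr z w & z : C & w : S & w : C"
  using Xf by (intro exI[of _ a] exI[of _ w]) simp
next
 interpret F: ring F by (rule ring_F)
 fix z w assume zw: "z : C" "w : S" "w : C"
 then have "inv$F emb w : ring_center F"
  by (intro F.inv_in_center emb_center emb_Units) auto
 then show "fr z w : ring_center F" using zw
  by (simp add: fr_eq_emb_inv emb_center)
qed

end

text \<open>The universal property, for injective homomorphisms.\<close>

locale central_frac_hom = central_frac R S + T: ring T for R (structure) and S and T (structure) +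
 fixes f
 assumes f_hom: "f : ring_hom R T" and f_inj: "inj_on f (carrier R)" and f_units: "s : S ==> f s : Units T"
begin

text \<open>The value is read off an arbitrary representative of the class; \<open>lift_fr\<close>
  shows that the choice does not matter.\<close>

definition lift where
 "lift X = (SOME v. \<exists>a s. (a, s) : X & v = f a **$T inv$T f s)"

lemma f_closed [simp]: "a : carrier R ==> f a : carrier T"
 using f_hom by (rule ring_hom_closed)

lemma f_comm:
 assumes "z : C" "a : carrier R" shows "f z **$T f a = f a **$T f z"
 using ring_hom_mult[OF f_hom] assms C_comm by (metis C_carrier)

lemma lift_fr:
 assumes "a : carrier R" "s : S"
 shows "lift (fr a s) = f a **$T inv$T f s"
proof -
 obtain b z where bz [simp]: "b : carrier R" "z : S" "z : C" "fr a s = fr b z" using fr_normalize assms by metis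
 have key: "f a' **$T inv$T f s' = f b **$T inv$T f z" if "(a', s') : fr b z" for a' s'
 proof -
  have [simp]: "a' : carrier R" "s' : S" and "a' **$R z = b **$R s'" using that by (auto simp: mem_fr_central_iff)
  then have e: "f a' **$T f z = f b **$T f s'" using ring_hom_mult[OF f_hom] by (metis C_carrier bz(1,3) S_carrier)
  have [simp]: "f z : Units T" "f s' : Units T" by (simp_all add: f_units)
  have "f a' **$T inv$T f s' **$T f z = f a' **$T (inv$T f s' **$T (f z **$T f s') **$T inv$T f s')"
   by (simp add: T.m_assoc)
  also have "\<dots> = f a' **$T f z **$T inv$T f s'"
   unfolding f_comm[OF bz(3) S_carrier[OF \<open>s' : S\<close>]]
   by (simp add: T.m_assoc[symmetric] del: )
  also have "\<dots> = f b"  unfolding e by (simp add: T.m_assoc)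
  finally show ?thesis by (metis T.m_assoc T.Units_r_inv T.r_one T.m_closed T.Units_inv_closed T.Units_closed f_closed \<open>a' : carrier R\<close> \<open>f s' : Units T\<close> \<open>f z : Units T\<close>)
 qed
 have "(a, s) : fr b z" using fr_eq_central_iff mem_fr_central_iff assms bz by metis
 have "\<exists>a' s'. (a', s') : fr b z & lift (fr b z) = f a' **$T inv$T f s'"
  unfolding lift_def by (rule someI_ex) (use \<open>(a, s) : fr b z\<close> in blast)
 then show ?thesis using key \<open>(a, s) : fr b z\<close> bz(4) by metis
qed

lemma lift_emb: "a : carrier R ==> lift (emb a) = f a"
 using lift_fr[of a "\<one>$R"] ring_hom_one[OF f_hom] by (simp add: emb_def S_one)

lemma lift_hom: "lift : ring_hom F T"
proof (rule ring_hom_memI)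
 have fm: "f (a **$R b) = f a **$T f b" "f (a \<oplus>$R b) = f a \<oplus>$T f b" if "a : carrier R" "b : carrier R" for a b
  using ring_hom_mult[OF f_hom] ring_hom_add[OF f_hom] that by auto
 show "lift X : carrier T" if "X : carrier F" for X
  using that by (elim frac_cases) (simp add: lift_fr f_units)
 fix X Y assume "X : carrier F" "Y : carrier F"
 then obtain a z b w where [simp]: "a : carrier R" "z : S" "z : C" and X: "X = fr a z" and
   [simp]: "b : carrier R" "w : S" "w : C" and Y: "Y = fr b w" by (elim frac_cases) metis
 have [simp]: "f z : Units T" "f w : Units T" by (simp_all add: f_units)
 have iz: "inv$T f z **$T f c = f c **$T inv$T f z" if [simp]: "c : carrier R" for c
 proof -
  have "inv$T f z **$T f c = inv$T f z **$T (f c **$T f z) **$T inv$T f z" by (simp add: T.m_assoc)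
  also have "\<dots> = f c **$T inv$T f z" unfolding f_comm[OF \<open>z : C\<close> \<open>c : carrier R\<close>, symmetric] by (simp add: T.m_assoc[symmetric])
  finally show ?thesis .
 qed
 have izw: "inv$T f (z **$R w) = inv$T f z **$T inv$T f w"
 proof -
  have c: "f z **$T f w = f w **$T f z" using f_comm[of z w] by simp
  have "(f w **$T f z) **$T (inv$T f z **$T inv$T f w) = f w **$T (f z **$T inv$T f z) **$T inv$T f w"
   by (simp add: T.m_assoc del: T.Units_r_inv)
  moreover have "(inv$T f z **$T inv$T f w) **$T (f w **$T f z) = inv$T f z **$T (inv$T f w **$T f w) **$T f z"
   by (simp add: T.m_assoc del: T.Units_l_inv)
  ultimately show ?thesis using T.inv_char[of "f w **$T f z" "inv$T f z **$T inv$T f w"]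
   by (simp add: fm c)
 qed
 show "lift (X **$F Y) = lift X **$T lift Y"
 proof -
  have "lift X **$T lift Y = f a **$T (inv$T f z **$T f b) **$T inv$T f w"
   by (simp add: X Y lift_fr T.m_assoc)
  also have "\<dots> = f a **$T f b **$T (inv$T f z **$T inv$T f w)" by (simp add: iz T.m_assoc)
  finally show ?thesis using izw by (simp add: X Y fr_mult lift_fr S_mult fm)
 qed
 show "lift (X \<oplus>$F Y) = lift X \<oplus>$T lift Y"
 proof -
  have "f w **$T (inv$T f z **$T inv$T f w) = inv$T f z"
   using iz[of w] by (simp add: T.m_assoc[symmetric]) (metis iz T.Units_closed T.Units_inv_closed T.Units_r_inv T.m_assoc T.r_one \<open>f w : Units T\<close> \<open>f z : Units T\<close> \<open>w : C\<close> C_carrier)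
  moreover have "f z **$T (inv$T f z **$T inv$T f w) = inv$T f w"
   by (simp add: T.m_assoc[symmetric])
  ultimately have "lift X \<oplus>$T lift Y = (f a **$T f w \<oplus>$T f b **$T f z) **$T (inv$T f z **$T inv$T f w)"
   by (simp add: X Y lift_fr T.l_distr T.m_assoc)
  then show ?thesis using izw by (simp add: X Y fr_add lift_fr S_mult fm)
 qed
next
 show "lift \<one>$F = \<one>$T" using lift_emb[of "\<one>$R"] ring_hom_one[OF f_hom] by (simp add: F_one emb_def)
qed

text \<open>Multiplication by the common denominator \<open>z w\<close> takes two fractions into the
  image of the ring, where injectivity of \<open>f\<close> applies.\<close>

lemma lift_inj: "inj_on lift (carrier F)"
proof (rule inj_onI)
 fix X Y assume "X : carrier F" "Y : carrier F" and eq: "lift X = lift Y"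
 then obtain a z b w where [simp]: "a : carrier R" "z : S" "z : C" and X: "X = fr a z" and
   [simp]: "b : carrier R" "w : S" "w : C" and Y: "Y = fr b w" by (elim frac_cases) metis
 interpret F: ring F by (rule ring_F)
 have "lift (X **$F emb (z **$R w)) = lift (Y **$F emb (z **$R w))"
  using ring_hom_mult[OF lift_hom] \<open>X : carrier F\<close> \<open>Y : carrier F\<close> eq by simp
 moreover have "X **$F emb (z **$R w) = emb (a **$R w)"
  by (simp add: X emb_def S_one S_mult fr_mult fr_eq_central_iff m_assoc C_comm[of z w])
 moreover have "Y **$F emb (z **$R w) = emb (b **$R z)"
  by (simp add: Y emb_def S_one fr_mult fr_eq_central_iff m_assoc)
 ultimately have "f (a **$R w) = f (b **$R z)" by (simp add: lift_emb)
 then have "a **$R w = b **$R z" using f_inj by (auto dest: inj_onD)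
 then show "X = Y" by (simp add: X Y fr_eq_central_iff)
qed

end

section \<open>Monoid rings and their universal property\<close>

lemma monoid_ring_simps:
 "carrier (monoid_ring G) = {f. finite {g. f g ~= 0} & {g. f g ~= 0} <= carrier G}"
 "\<one>\<^bsub>monoid_ring G\<^esub> = delta \<one>$G 1"
 "\<zero>\<^bsub>monoid_ring G\<^esub> = (%_. 0)"
 "f \<oplus>\<^bsub>monoid_ring G\<^esub> f' = (%g. f g + f' g)"
 by (simp_all add: monoid_ring_def)

text \<open>The supports are enlarged to arbitrary finite sets \<open>A\<close> and
  \<open>B\<close>, so that several products can be written over one common index set and compared
  term by term.\<close>

lemma monoid_ring_mult:
 assumes "finite A" "finite B" "{g. f g ~= 0} <= A" "{g. f' g ~= 0} <= B"
 shows "(f **\<^bsub>monoid_ring G\<^esub> f') g = (\<Sum>u\<in>A. \<Sum>v\<in>B. if u **$G v = g then f u * f' v else 0)"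
proof -
 have "(f **\<^bsub>monoid_ring G\<^esub> f') g
   = (\<Sum>(u, v)\<in>{(u, v). f u ~= 0 & f' v ~= 0 & u **$G v = g}. f u * f' v)"
  by (simp add: monoid_ring_def)
 also have "\<dots> = (\<Sum>(u, v)\<in>A \<times> B. if u **$G v = g then f u * f' v else 0)"
  using assms by (intro sum.mono_neutral_cong_left) (auto split: if_splits)
 also have "\<dots> = (\<Sum>u\<in>A. \<Sum>v\<in>B. if u **$G v = g then f u * f' v else 0)"
  by (simp add: sum.cartesian_product)
 finally show ?thesis .
qed

lemma delta_simps [simp]: "delta g a g = a" "h ~= g ==> delta g a h = 0" "delta g 0 = (%_. 0)"
 by (auto simp: delta_def)

lemma (in monoid) monoid_ring_mult_support:
 assumes "f : carrier (monoid_ring G)" "f' : carrier (monoid_ring G)"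
 shows "{g. (f **\<^bsub>monoid_ring G\<^esub> f') g ~= 0} <= (%(u, v). u ** v) ` ({g. f g ~= 0} \<times> {g. f' g ~= 0})"
proof
 fix g assume g: "g : {g. (f **\<^bsub>monoid_ring G\<^esub> f') g ~= 0}"
 show "g : (%(u, v). u ** v) ` ({g. f g ~= 0} \<times> {g. f' g ~= 0})"
 proof (rule ccontr)
  assume n: "g \<notin> (%(u, v). u ** v) ` ({g. f g ~= 0} \<times> {g. f' g ~= 0})"
  have "(f **\<^bsub>monoid_ring G\<^esub> f') g = 0"
   using n assms by (subst monoid_ring_mult[OF _ _ order_refl order_refl])
    (auto simp: monoid_ring_simps intro!: sum.neutral)
  then show False using g by simp
 qed
qed

lemma (in monoid) monoid_ring_mult_closed:
 assumes "f : carrier (monoid_ring G)" "f' : carrier (monoid_ring G)"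
 shows "f **\<^bsub>monoid_ring G\<^esub> f' : carrier (monoid_ring G)"
proof -
 have "(%(u, v). u ** v) ` ({g. f g ~= 0} \<times> {g. f' g ~= 0}) <= carrier G"
  using assms by (auto simp: monoid_ring_simps)
 moreover have "finite ((%(u, v). u ** v) ` ({g. f g ~= 0} \<times> {g. f' g ~= 0}))"
  using assms by (auto simp: monoid_ring_simps)
 ultimately show ?thesis
  using monoid_ring_mult_support[OF assms] unfolding monoid_ring_simps by (auto intro: finite_subset)
qed

text \<open>Both bracketings equal the triple sum of \<open>f1 u * f2 v * f3 w\<close> over
  \<open>u v w = g\<close>. The intermediate product \<open>h\<close> ranges over the finite set
  \<open>A12\<close> or \<open>A23\<close> of products of support elements, is brought to the
  innermost sum, and is determined there.\<close>

lemma (in monoid) monoid_ring_assoc: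
 fixes f1 :: "'a => 'k::comm_ring_1"
 assumes "f1 : carrier (monoid_ring G)" "f2 : carrier (monoid_ring G)" "f3 : carrier (monoid_ring G)"
 shows "f1 **\<^bsub>monoid_ring G\<^esub> f2 **\<^bsub>monoid_ring G\<^esub> f3 = f1 **\<^bsub>monoid_ring G\<^esub> (f2 **\<^bsub>monoid_ring G\<^esub> f3)"
proof
 fix g
 define A1 A2 A3 where A: "A1 = {g. f1 g ~= 0}" "A2 = {g. f2 g ~= 0}" "A3 = {g. f3 g ~= 0}"
 have fin [simp]: "finite A1" "finite A2" "finite A3" and c: "A1 <= carrier G" "A2 <= carrier G" "A3 <= carrier G"
  using assms by (auto simp: A monoid_ring_simps)
 define A12 A23 where B: "A12 = (%(u, v). u ** v) ` (A1 \<times> A2)" "A23 = (%(u, v). u ** v) ` (A2 \<times> A3)"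
 have finB [simp]: "finite A12" "finite A23" by (auto simp: B)
 note s12 = monoid_ring_mult_support[OF assms(1,2), folded A B]
 note s23 = monoid_ring_mult_support[OF assms(2,3), folded A B]
 have e12: "(f1 **\<^bsub>monoid_ring G\<^esub> f2) h = (\<Sum>u\<in>A1. \<Sum>v\<in>A2. if u ** v = h then f1 u * f2 v else 0)" for h
  by (rule monoid_ring_mult) (simp_all add: A[symmetric])
 have e23: "(f2 **\<^bsub>monoid_ring G\<^esub> f3) h = (\<Sum>u\<in>A2. \<Sum>v\<in>A3. if u ** v = h then f2 u * f3 v else 0)" for h
  by (rule monoid_ring_mult) (simp_all add: A[symmetric])
 have "(f1 **\<^bsub>monoid_ring G\<^esub> f2 **\<^bsub>monoid_ring G\<^esub> f3) g
   = (\<Sum>h\<in>A12. \<Sum>w\<in>A3. if h ** w = g then (\<Sum>u\<in>A1. \<Sum>v\<in>A2. if u ** v = h then f1 u * f2 v else 0) * f3 w else 0)"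
  using monoid_ring_mult[of A12 A3 "f1 **\<^bsub>monoid_ring G\<^esub> f2" f3 G g, OF _ _ s12] unfolding e12
  by (simp add: A(3)[symmetric])
 also have "\<dots> = (\<Sum>h\<in>A12. \<Sum>w\<in>A3. \<Sum>u\<in>A1. \<Sum>v\<in>A2. if u ** v = h then (if h ** w = g then f1 u * f2 v * f3 w else 0) else 0)"
  by (intro sum.cong refl) (auto simp: sum_distrib_right intro!: sum.cong sum.neutral)
 also have "\<dots> = (\<Sum>w\<in>A3. \<Sum>h\<in>A12. \<Sum>u\<in>A1. \<Sum>v\<in>A2. (if u ** v = h then (if h ** w = g then f1 u * f2 v * f3 w else 0) else 0))"
  by (rule sum.swap)
 also have "\<dots> = (\<Sum>w\<in>A3. \<Sum>u\<in>A1. \<Sum>h\<in>A12. \<Sum>v\<in>A2. (if u ** v = h then (if h ** w = g then f1 u * f2 v * f3 w else 0) else 0))"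
  by (rule sum.cong[OF refl], rule sum.swap)
 also have "\<dots> = (\<Sum>w\<in>A3. \<Sum>u\<in>A1. \<Sum>v\<in>A2. \<Sum>h\<in>A12. (if u ** v = h then (if h ** w = g then f1 u * f2 v * f3 w else 0) else 0))"
  by (rule sum.cong[OF refl], rule sum.cong[OF refl], rule sum.swap)
 also have "\<dots> = (\<Sum>w\<in>A3. \<Sum>u\<in>A1. \<Sum>v\<in>A2. if u ** v ** w = g then f1 u * f2 v * f3 w else 0)"
  by (intro sum.cong refl) (auto simp: B)
 also have "\<dots> = (\<Sum>u\<in>A1. \<Sum>w\<in>A3. \<Sum>v\<in>A2. (if u ** v ** w = g then f1 u * f2 v * f3 w else 0))"
  by (rule sum.swap)
 also have "\<dots> = (\<Sum>u\<in>A1. \<Sum>v\<in>A2. \<Sum>w\<in>A3. (if u ** v ** w = g then f1 u * f2 v * f3 w else 0))"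
  by (rule sum.cong[OF refl], rule sum.swap)
 also have "\<dots> = (\<Sum>u\<in>A1. \<Sum>v\<in>A2. \<Sum>w\<in>A3. if u ** (v ** w) = g then f1 u * f2 v * f3 w else 0)"
 proof (intro sum.cong refl)
  fix u v w assume "u : A1" "v : A2" "w : A3"
  then have "u ** v ** w = u ** (v ** w)" using c by (auto intro!: m_assoc)
  then show "(if u ** v ** w = g then f1 u * f2 v * f3 w else 0) = (if u ** (v ** w) = g then f1 u * f2 v * f3 w else 0)" by simp
 qed
 also have "\<dots> = (\<Sum>u\<in>A1. \<Sum>v\<in>A2. \<Sum>w\<in>A3. \<Sum>h\<in>A23. if v ** w = h then (if u ** h = g then f1 u * f2 v * f3 w else 0) else 0)"
  by (intro sum.cong refl) (auto simp: B)
 also have "\<dots> = (\<Sum>u\<in>A1. \<Sum>v\<in>A2. \<Sum>h\<in>A23. \<Sum>w\<in>A3. (if v ** w = h then (if u ** h = g then f1 u * f2 v * f3 w else 0) else 0))"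
  by (rule sum.cong[OF refl], rule sum.cong[OF refl], rule sum.swap)
 also have "\<dots> = (\<Sum>u\<in>A1. \<Sum>h\<in>A23. \<Sum>v\<in>A2. \<Sum>w\<in>A3. (if v ** w = h then (if u ** h = g then f1 u * f2 v * f3 w else 0) else 0))"
  by (rule sum.cong[OF refl], rule sum.swap)
 also have "\<dots> = (\<Sum>u\<in>A1. \<Sum>h\<in>A23. if u ** h = g then f1 u * (\<Sum>v\<in>A2. \<Sum>w\<in>A3. if v ** w = h then f2 v * f3 w else 0) else 0)"
  by (intro sum.cong refl) (auto simp: sum_distrib_left mult.assoc intro!: sum.cong sum.neutral)
 also have "\<dots> = (f1 **\<^bsub>monoid_ring G\<^esub> (f2 **\<^bsub>monoid_ring G\<^esub> f3)) g"
  using monoid_ring_mult[of A1 A23 f1 "f2 **\<^bsub>monoid_ring G\<^esub> f3" G g, OF _ _ _ s23] unfolding e23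
  by (simp add: A(1)[symmetric])
 finally show "(f1 **\<^bsub>monoid_ring G\<^esub> f2 **\<^bsub>monoid_ring G\<^esub> f3) g = (f1 **\<^bsub>monoid_ring G\<^esub> (f2 **\<^bsub>monoid_ring G\<^esub> f3)) g" .
qed

lemma (in monoid) delta_closed [simp]: "g : carrier G ==> delta g a : carrier (monoid_ring G)"
 by (auto simp: monoid_ring_simps delta_def)

lemma delta_mult:
 "delta g a **\<^bsub>monoid_ring G\<^esub> delta h b = delta (g **$G h) (a * b)"
 by (rule ext, subst monoid_ring_mult[of "{g}" "{h}"]) (auto simp: delta_def)

lemma delta_add:
 "delta g a \<oplus>\<^bsub>monoid_ring G\<^esub> delta g b = delta g (a + b)"
 by (auto simp: monoid_ring_simps delta_def)

lemma (in monoid) ring_monoid_ring: "ring (monoid_ring G :: ('a => 'k::comm_ring_1) ring)"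
proof (rule ringI)
 let ?R = "monoid_ring G :: ('a => 'k) ring"
 have closed: "f \<oplus>\<^bsub>?R\<^esub> f' : carrier ?R" if "f : carrier ?R" "f' : carrier ?R" for f f'
 proof -
  have "{g. f g + f' g ~= 0} <= {g. f g ~= 0} \<union> {g. f' g ~= 0}" by auto
  then show ?thesis using that by (auto simp: monoid_ring_simps intro: finite_subset)
 qed
 show "abelian_group ?R"
 proof (rule abelian_groupI)
  fix f f' assume "f : carrier ?R" "f' : carrier ?R"
  then show "f \<oplus>\<^bsub>?R\<^esub> f' : carrier ?R" by (rule closed)
 next
  fix f assume "f : carrier ?R"
  then show "\<exists>f'\<in>carrier ?R. f' \<oplus>\<^bsub>?R\<^esub> f = \<zero>\<^bsub>?R\<^esub>"
   by (intro bexI[of _ "%g. - f g"]) (auto simp: monoid_ring_simps)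
 qed (auto simp: monoid_ring_simps add_ac)
 show "Group.monoid ?R"
 proof (rule monoidI)
  fix f assume f: "f : carrier ?R"
  then have fin: "finite {g. f g ~= 0}" and c: "{g. f g ~= 0} <= carrier G" by (auto simp: monoid_ring_simps)
  have "(\<one>\<^bsub>?R\<^esub> **\<^bsub>?R\<^esub> f) g = f g" for g
  proof -
   have "(\<one>\<^bsub>?R\<^esub> **\<^bsub>?R\<^esub> f) g = (\<Sum>v\<in>{g. f g ~= 0}. if \<one> ** v = g then f v else 0)"
    by (subst monoid_ring_mult[of "{\<one>}" "{g. f g ~= 0}"]) (auto simp: fin monoid_ring_simps delta_def intro!: sum.cong)
   also have "\<dots> = (\<Sum>v\<in>{g. f g ~= 0}. if v = g then f v else 0)"
    using c by (intro sum.cong) auto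
   finally show ?thesis using fin by (auto simp: sum.delta)
  qed
  then show "\<one>\<^bsub>?R\<^esub> **\<^bsub>?R\<^esub> f = f" by blast
  have "(f **\<^bsub>?R\<^esub> \<one>\<^bsub>?R\<^esub>) g = f g" for g
  proof -
   have "(f **\<^bsub>?R\<^esub> \<one>\<^bsub>?R\<^esub>) g = (\<Sum>v\<in>{g. f g ~= 0}. if v ** \<one> = g then f v else 0)"
    by (subst monoid_ring_mult[of "{g. f g ~= 0}" "{\<one>}"]) (auto simp: fin monoid_ring_simps delta_def intro!: sum.cong)
   also have "\<dots> = (\<Sum>v\<in>{g. f g ~= 0}. if v = g then f v else 0)"
    using c by (intro sum.cong) auto
   finally show ?thesis using fin by (auto simp: sum.delta)
  qed
  then show "f **\<^bsub>?R\<^esub> \<one>\<^bsub>?R\<^esub> = f" by blast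
 qed (simp_all add: monoid_ring_mult_closed monoid_ring_assoc, simp add: monoid_ring_simps(2))
 fix f1 f2 f3 assume f: "f1 : carrier ?R" "f2 : carrier ?R" "f3 : carrier ?R"
 define A B where AB: "A = {g. f1 g ~= 0} \<union> {g. f2 g ~= 0}" "B = {g. f3 g ~= 0}"
 have fin: "finite A" "finite B" using f by (auto simp: monoid_ring_simps AB)
 show "(f1 \<oplus>\<^bsub>?R\<^esub> f2) **\<^bsub>?R\<^esub> f3 = f1 **\<^bsub>?R\<^esub> f3 \<oplus>\<^bsub>?R\<^esub> f2 **\<^bsub>?R\<^esub> f3"
 proof
  fix g
  have "((f1 \<oplus>\<^bsub>?R\<^esub> f2) **\<^bsub>?R\<^esub> f3) g = (\<Sum>u\<in>A. \<Sum>v\<in>B. if u ** v = g then (f1 u + f2 u) * f3 v else 0)"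
   unfolding monoid_ring_simps(4) by (subst monoid_ring_mult[of A B]) (auto simp: fin, auto simp: AB)
  also have "\<dots> = (\<Sum>u\<in>A. \<Sum>v\<in>B. if u ** v = g then f1 u * f3 v else 0) + (\<Sum>u\<in>A. \<Sum>v\<in>B. if u ** v = g then f2 u * f3 v else 0)"
   unfolding sum.distrib[symmetric] by (intro sum.cong refl) (auto simp: algebra_simps)
  also have "(\<Sum>u\<in>A. \<Sum>v\<in>B. if u ** v = g then f1 u * f3 v else 0) = (f1 **\<^bsub>?R\<^esub> f3) g"
   by (subst monoid_ring_mult[of A B]) (auto simp: fin, auto simp: AB)
  also have "(\<Sum>u\<in>A. \<Sum>v\<in>B. if u ** v = g then f2 u * f3 v else 0) = (f2 **\<^bsub>?R\<^esub> f3) g"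
   by (subst monoid_ring_mult[of A B]) (auto simp: fin, auto simp: AB)
  finally show "((f1 \<oplus>\<^bsub>?R\<^esub> f2) **\<^bsub>?R\<^esub> f3) g = (f1 **\<^bsub>?R\<^esub> f3 \<oplus>\<^bsub>?R\<^esub> f2 **\<^bsub>?R\<^esub> f3) g" by (simp add: monoid_ring_simps(4))
 qed
 show "f3 **\<^bsub>?R\<^esub> (f1 \<oplus>\<^bsub>?R\<^esub> f2) = f3 **\<^bsub>?R\<^esub> f1 \<oplus>\<^bsub>?R\<^esub> f3 **\<^bsub>?R\<^esub> f2"
 proof
  fix g
  have "(f3 **\<^bsub>?R\<^esub> (f1 \<oplus>\<^bsub>?R\<^esub> f2)) g = (\<Sum>v\<in>B. \<Sum>u\<in>A. if v ** u = g then f3 v * (f1 u + f2 u) else 0)"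
   unfolding monoid_ring_simps(4) by (subst monoid_ring_mult[of B A]) (auto simp: fin, auto simp: AB)
  also have "\<dots> = (\<Sum>v\<in>B. \<Sum>u\<in>A. if v ** u = g then f3 v * f1 u else 0) + (\<Sum>v\<in>B. \<Sum>u\<in>A. if v ** u = g then f3 v * f2 u else 0)"
   unfolding sum.distrib[symmetric] by (intro sum.cong refl) (auto simp: algebra_simps)
  also have "(\<Sum>v\<in>B. \<Sum>u\<in>A. if v ** u = g then f3 v * f1 u else 0) = (f3 **\<^bsub>?R\<^esub> f1) g"
   by (subst monoid_ring_mult[of B A]) (auto simp: fin, auto simp: AB)
  also have "(\<Sum>v\<in>B. \<Sum>u\<in>A. if v ** u = g then f3 v * f2 u else 0) = (f3 **\<^bsub>?R\<^esub> f2) g"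
   by (subst monoid_ring_mult[of B A]) (auto simp: fin, auto simp: AB)
  finally show "(f3 **\<^bsub>?R\<^esub> (f1 \<oplus>\<^bsub>?R\<^esub> f2)) g = (f3 **\<^bsub>?R\<^esub> f1 \<oplus>\<^bsub>?R\<^esub> f3 **\<^bsub>?R\<^esub> f2) g" by (simp add: monoid_ring_simps(4))
 qed
qed

text \<open>One point of the support is removed at a time. The step puts no condition on how
  \<open>g\<close> relates to the support of \<open>f\<close>, which is convenient for the additive
  statements proved with it.\<close>

lemma (in monoid) monoid_ring_induct [consumes 1, case_names zero add]:
 fixes f :: "'a => 'k::comm_ring_1"
 assumes "f : carrier (monoid_ring G)"
  and "P \<zero>\<^bsub>monoid_ring G\<^esub>"
  and step: "!!f g a. [|f : carrier (monoid_ring G); P f; g : carrier G|] ==> P (f \<oplus>\<^bsub>monoid_ring G\<^esub> delta g a)"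
 shows "P f"
proof -
 have "\<forall>f. f : carrier (monoid_ring G) & card {g. f g ~= 0} = n --> P f" for n
 proof (induction n)
  case 0
  then show ?case using assms(2) by (auto simp: monoid_ring_simps)
 next
  case (Suc n)
  show ?case
  proof (intro allI impI, elim conjE)
   fix f :: "'a => 'k" assume f: "f : carrier (monoid_ring G)" and c: "card {g. f g ~= 0} = Suc n"
   then obtain g where g: "f g ~= 0" by (metis (mono_tags, lifting) Collect_empty_eq card.empty nat.distinct(1))
   define f' where "f' = f(g := 0)"
   have s: "{h. f' h ~= 0} = {g. f g ~= 0} - {g}" by (auto simp: f'_def)
   have "f' : carrier (monoid_ring G)" using f unfolding monoid_ring_simps mem_Collect_eq s by auto
   moreover have "card {h. f' h ~= 0} = n" unfolding s using c g f by (simp add: monoid_ring_simps)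
   ultimately have "P f'" using Suc by blast
   moreover have "f = f' \<oplus>\<^bsub>monoid_ring G\<^esub> delta g (f g)" by (auto simp: f'_def monoid_ring_simps delta_def)
   moreover have "g : carrier G" using g f by (auto simp: monoid_ring_simps)
   ultimately show "P f" using step[of f' g "f g"] \<open>f' : carrier (monoid_ring G)\<close> by simp
  qed
 qed
 then show ?thesis using assms(1) by blast
qed

text \<open>The data of the universal property: a coefficient map and a multiplicative map with
  commuting images. It serves the tensor product, where an integer \<open>n\<close> goes to
  \<open>n\<close> times the identity, and the free algebra over \<open>k\<close>, where a word goes
  to its value.\<close>

locale monoid_ring_target = G: monoid G + T: ring T
 for G :: "('g, 'm) monoid_scheme" (structure) and T :: "('t, 'n) ring_scheme" (structure) +
 fixes c :: "'k::comm_ring_1 => 't" and h :: "'g => 't"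
 assumes c_closed [simp]: "c a : carrier T"
  and c_add: "c (a + b) = c a \<oplus>$T c b" and c_mult: "c (a * b) = c a **$T c b" and c_one: "c 1 = \<one>$T"
  and h_closed [simp]: "g : carrier G ==> h g : carrier T"
  and h_one: "h \<one>$G = \<one>$T"
  and h_mult: "[|g : carrier G; g' : carrier G|] ==> h (g **$G g') = h g **$T h g'"
  and c_comm: "g : carrier G ==> c a **$T h g = h g **$T c a"
begin

abbreviation MR :: "('g => 'k) ring" where "MR \<equiv> monoid_ring G"

definition mlift :: "('g => 'k) => 't" where
 "mlift f = (\<Oplus>$T g\<in>{g. f g ~= 0}. c (f g) **$T h g)"

lemma c_zero [simp]: "c 0 = \<zero>$T"
proof -
 have "c 0 \<oplus>$T c 0 = c 0" using c_add[of 0 0] by simp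
 then show ?thesis by (metis T.add.r_cancel_one' c_closed)
qed

lemma mlift_eq:
 assumes "finite A" "A <= carrier G" "{g. f g ~= 0} <= A"
 shows "mlift f = (\<Oplus>$T g\<in>A. c (f g) **$T h g)"
 unfolding mlift_def using assms
 by (intro T.add.finprod_mono_neutral_cong_left) (auto simp: subset_iff)

lemma mlift_closed: "f : carrier MR ==> mlift f : carrier T"
 unfolding mlift_def by (rule T.finsum_closed) (auto simp: monoid_ring_simps)

lemma mlift_zero: "mlift \<zero>$MR = \<zero>$T"
 by (simp add: mlift_def monoid_ring_simps)

lemma mlift_delta: "g : carrier G ==> mlift (delta g a) = c a **$T h g"
 by (subst mlift_eq[of "{g}"]) (auto simp: delta_def)

lemma mlift_add:
 assumes "f : carrier MR" "f' : carrier MR"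
 shows "mlift (f \<oplus>$MR f') = mlift f \<oplus>$T mlift f'"
proof -
 define A where "A = {g. f g ~= 0} \<union> {g. f' g ~= 0}"
 have A: "finite A" "A <= carrier G" using assms by (auto simp: monoid_ring_simps A_def)
 have "mlift (f \<oplus>$MR f') = (\<Oplus>$T g\<in>A. c (f g) **$T h g \<oplus>$T c (f' g) **$T h g)"
 proof -
  have "mlift (f \<oplus>$MR f') = (\<Oplus>$T g\<in>A. c (f g + f' g) **$T h g)"
   using A by (subst mlift_eq[of A]) (auto simp: A_def monoid_ring_simps)
  also have "\<dots> = (\<Oplus>$T g\<in>A. c (f g) **$T h g \<oplus>$T c (f' g) **$T h g)"
   using A(2) by (intro T.finsum_cong') (auto simp: c_add T.l_distr subset_iff)
  finally show ?thesis .
 qed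
 also have "\<dots> = mlift f \<oplus>$T mlift f'"
  using A by (subst (1 2) mlift_eq[of A]) (auto simp: A_def subset_iff intro!: T.finsum_addf)
 finally show ?thesis .
qed

lemma mlift_mult:
 assumes "f : carrier MR" "f' : carrier MR"
 shows "mlift (f **$MR f') = mlift f **$T mlift f'"
proof -
 interpret MR: ring MR by (rule G.ring_monoid_ring)
 have *: "mlift (f **$MR delta g a) = mlift f **$T mlift (delta g a)" if g: "g : carrier G" for g a
  using assms(1)
 proof (induction f rule: G.monoid_ring_induct)
  case zero
  then show ?case using g by (simp add: mlift_zero mlift_delta)
 next
  case (add f g' b)
  have "mlift (delta g' b **$MR delta g a) = c (b * a) **$T h (g' **$G g)"
   using add g by (simp add: delta_mult mlift_delta)
  also have "\<dots> = c b **$T (c a **$T h g') **$T h g"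
   using add g by (simp add: c_mult h_mult T.m_assoc)
  also have "\<dots> = mlift (delta g' b) **$T mlift (delta g a)"
   using add g by (simp add: c_comm[of g' a] mlift_delta T.m_assoc)
  finally show ?case using add g
   by (simp add: MR.l_distr mlift_add T.l_distr mlift_closed)
 qed
 show ?thesis
  using assms(2)
 proof (induction f' rule: G.monoid_ring_induct)
  case zero
  then show ?case using assms by (simp add: mlift_zero mlift_closed)
 next
  case (add f' g' b)
  then show ?case using * assms by (simp add: MR.r_distr mlift_add T.r_distr mlift_closed)
 qed
qed

lemma mlift_hom: "mlift : ring_hom MR T"
 by (rule ring_hom_memI)
  (simp_all add: mlift_closed mlift_mult mlift_add monoid_ring_simps(2) mlift_delta c_one h_one)

end

section \<open>Quotient rings and tensor products\<close>

lemma (in ideal) quotient_cases: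
 assumes "X : carrier (R Quot I)"
 obtains x where "x : carrier R" "X = I +> x"
 using assms by (auto simp: FactRing_simps)

lemma (in ideal) quotient_lift:
 assumes "ring T" and f: "f : ring_hom R T" and ker: "!!x. x : I ==> f x = \<zero>$T"
 obtains phi where "phi : ring_hom (R Quot I) T" "!!x. x : carrier R ==> phi (I +> x) = f x"
proof -
 interpret T: ring T by fact
 define phi where "phi X = f (SOME x. x : X)" for X
 have *: "phi (I +> x) = f x" if x: "x : carrier R" for x
 proof -
  have "x : I +> x" using x by (rule a_rcos_self)
  then have "(SOME y. y : I +> x) : I +> x" by (rule someI)
  then obtain i where i: "i : I" "(SOME y. y : I +> x) = i \<oplus> x" by (auto simp: a_r_coset_def r_coset_def)
  then show ?thesis unfolding phi_def i(2)
   using ring_hom_add[OF f Icarr[OF i(1)] x] ker[OF i(1)] ring_hom_closed[OF f x] by simp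
 qed
 have "phi : ring_hom (R Quot I) T"
 proof (rule ring_hom_memI)
  show "phi X : carrier T" if "X : carrier (R Quot I)" for X
   using that * ring_hom_closed[OF f] by (auto simp: FactRing_simps)
  fix X Y assume "X : carrier (R Quot I)" "Y : carrier (R Quot I)"
  then obtain x y where xy: "x : carrier R" "y : carrier R" "X = I +> x" "Y = I +> y" by (auto simp: FactRing_simps)
  then show "phi (X **\<^bsub>R Quot I\<^esub> Y) = phi X **$T phi Y" "phi (X \<oplus>\<^bsub>R Quot I\<^esub> Y) = phi X \<oplus>$T phi Y"
   using ring_hom_mult[OF f] ring_hom_add[OF f] by (simp_all add: FactRing_def rcoset_mult_add a_rcos_sum *)
 next
  show "phi \<one>\<^bsub>R Quot I\<^esub> = \<one>$T" using ring_hom_one[OF f] by (simp add: FactRing_def *)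
 qed
 then show ?thesis using * that by blast
qed

locale tensor_data = A: ring A + B: ring B
 for Z :: "('z, 'q) ring_scheme" and \<alpha> :: "'z => 'a" and A :: "('a, 'm) ring_scheme"
  and \<beta> :: "'z => 'b" and B :: "('b, 'n) ring_scheme" +
 assumes \<alpha>_closed: "z : carrier Z ==> \<alpha> z : carrier A" and \<beta>_closed: "z : carrier Z ==> \<beta> z : carrier B"
begin

abbreviation MR :: "('a \<times> 'b => int) ring" where "MR \<equiv> monoid_ring (A \<times>\<times> B)"
abbreviation TI where "TI \<equiv> tensor_ideal Z \<alpha> A \<beta> B"
abbreviation TR where "TR \<equiv> tensor_ring Z \<alpha> A \<beta> B"
abbreviation ten where "ten \<equiv> tensor Z \<alpha> A \<beta> B"

text \<open>The generators of \<open>tensor_ideal\<close> under a name of their own, so that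
  membership and vanishing can be checked one relation at a time.\<close>

definition rels where "rels = (let e = (%a b. delta (a, b) (1::int)) in
   ({e (a \<oplus>$A a') b \<ominus>$MR (e a b \<oplus>$MR e a' b) | a a' b.
      a : carrier A & a' : carrier A & b : carrier B}
    \<union> {e a (b \<oplus>$B b') \<ominus>$MR (e a b \<oplus>$MR e a b') | a b b'.
      a : carrier A & b : carrier B & b' : carrier B}
    \<union> {e (\<alpha> z **$A a) b \<ominus>$MR e a (\<beta> z **$B b) | z a b.
      z : carrier Z & a : carrier A & b : carrier B}))"

lemma TI_eq: "TI = genideal MR rels"
 by (simp add: tensor_ideal_def rels_def Let_def)

lemma monoid_AB: "Group.monoid (A \<times>\<times> B)"
 by (rule DirProd_monoid) (rule A.is_monoid B.is_monoid)+

sublocale AB: Group.monoid "A \<times>\<times> B" by (rule monoid_AB)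

sublocale MR: ring MR by (rule AB.ring_monoid_ring)

lemma AB_simps [simp]: "carrier (A \<times>\<times> B) = carrier A \<times> carrier B"
 "(a, b) **\<^bsub>A \<times>\<times> B\<^esub> (a', b') = (a **$A a', b **$B b')" "\<one>\<^bsub>A \<times>\<times> B\<^esub> = (\<one>$A, \<one>$B)"
 by (auto simp: DirProd_def)

lemma e_closed [simp]: "a : carrier A ==> b : carrier B ==> delta (a, b) n : carrier MR"
 by (rule AB.delta_closed) simp

lemma rels_carrier: "rels <= carrier MR"
 by (auto simp: rels_def Let_def \<alpha>_closed \<beta>_closed)

sublocale TI: ideal TI MR
 unfolding TI_eq by (rule MR.genideal_ideal[OF rels_carrier])

sublocale TR: ring TR
 unfolding tensor_ring_def by (rule TI.quotient_is_ring)

lemma rels_eq: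
 assumes "x \<ominus>$MR y : rels" "x : carrier MR" "y : carrier MR"
 shows "TI +>$MR x = TI +>$MR y"
proof -
 have "x \<ominus>$MR y : TI" unfolding TI_eq using MR.genideal_self[OF rels_carrier] assms(1) by blast
 then show ?thesis using MR.quotient_eq_iff_same_a_r_cos[OF TI.is_ideal assms(2,3)] by blast
qed

lemma coset_add: "x : carrier MR ==> y : carrier MR ==> TI +>$MR (x \<oplus>$MR y) = (TI +>$MR x) \<oplus>$TR (TI +>$MR y)"
 using ring_hom_add[OF TI.rcos_ring_hom] by (simp add: tensor_ring_def)

lemma ten_closed [simp]: "a : carrier A ==> b : carrier B ==> ten a b : carrier TR"
 using ring_hom_closed[OF TI.rcos_ring_hom] by (simp add: tensor_def tensor_ring_def)

lemma ten_add_left: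
 assumes "a : carrier A" "a' : carrier A" "b : carrier B"
 shows "ten (a \<oplus>$A a') b = ten a b \<oplus>$TR ten a' b"
proof -
 have "TI +>$MR delta (a \<oplus>$A a', b) 1 = TI +>$MR (delta (a, b) 1 \<oplus>$MR delta (a', b) 1)"
  using assms by (intro rels_eq MR.a_closed e_closed) (auto simp: rels_def Let_def)
 then show ?thesis using assms by (simp add: tensor_def coset_add)
qed

lemma ten_add_right:
 assumes "a : carrier A" "b : carrier B" "b' : carrier B"
 shows "ten a (b \<oplus>$B b') = ten a b \<oplus>$TR ten a b'"
proof -
 have "TI +>$MR delta (a, b \<oplus>$B b') 1 = TI +>$MR (delta (a, b) 1 \<oplus>$MR delta (a, b') 1)"
  using assms by (intro rels_eq MR.a_closed e_closed) (auto simp: rels_def Let_def)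
 then show ?thesis using assms by (simp add: tensor_def coset_add)
qed

lemma ten_balanced:
 assumes "z : carrier Z" "a : carrier A" "b : carrier B"
 shows "ten (\<alpha> z **$A a) b = ten a (\<beta> z **$B b)"
 unfolding tensor_def using assms \<alpha>_closed \<beta>_closed
 by (intro rels_eq e_closed) (auto simp: rels_def Let_def)

lemma ten_mult:
 assumes "a : carrier A" "a' : carrier A" "b : carrier B" "b' : carrier B"
 shows "ten a b **$TR ten a' b' = ten (a **$A a') (b **$B b')"
 using ring_hom_mult[OF TI.rcos_ring_hom, of "delta (a, b) 1" "delta (a', b') 1"] assms
 by (simp add: tensor_def tensor_ring_def delta_mult)

lemma ten_one: "\<one>$TR = ten \<one>$A \<one>$B"
 by (simp add: tensor_def tensor_ring_def FactRing_def monoid_ring_simps)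

lemma ten_zero_left: "b : carrier B ==> ten \<zero>$A b = \<zero>$TR"
 using ten_add_left[of "\<zero>$A" "\<zero>$A" b] by (simp add: TR.add.l_cancel_one)

lemma ten_minus_left:
 assumes "a : carrier A" "b : carrier B"
 shows "ten (\<ominus>$A a) b = \<ominus>$TR ten a b"
 using ten_add_left[of "\<ominus>$A a" a b] assms ten_zero_left[of b]
 by (intro TR.add.inv_equality[symmetric]) (auto simp: A.l_neg)

text \<open>Pure tensors and sums suffice because an integer multiple of a basis element of the free
  group is again a sum of pure tensors: a negative sign moves into the left factor.\<close>

lemma tensor_induct [consumes 1, case_names tensor add minus]:
 assumes "X : carrier TR"
  and t: "!!a b. [|a : carrier A; b : carrier B|] ==> P (ten a b)"
  and add: "!!X Y. [|X : carrier TR; Y : carrier TR; P X; P Y|] ==> P (X \<oplus>$TR Y)"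
 shows "P X"
proof -
 have z: "P \<zero>$TR" using t[of "\<zero>$A" "\<zero>$B"] ten_zero_left by simp
 have cd: "TI +>$MR delta (a, b) n : carrier TR" if "a : carrier A" "b : carrier B" for a b n
  using ring_hom_closed[OF TI.rcos_ring_hom] that by (simp add: tensor_ring_def)
 have nn: "P (TI +>$MR delta (a, b) (int n))" if ab: "a : carrier A" "b : carrier B" for a b n
 proof (induction n)
  case 0
  have "TI +>$MR \<zero>$MR = \<zero>$TR" using ring_hom_zero[OF TI.rcos_ring_hom MR.ring_axioms TI.quotient_is_ring] by (simp add: tensor_ring_def)
  then show ?case using z by (simp add: monoid_ring_simps)
 next
  case (Suc n)
  have "delta (a, b) (int (Suc n)) = delta (a, b) (int n) \<oplus>$MR delta (a, b) 1" by (simp add: delta_add add.commute)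
  then have "TI +>$MR delta (a, b) (int (Suc n)) = (TI +>$MR delta (a, b) (int n)) \<oplus>$TR ten a b"
   using ab by (simp add: coset_add tensor_def)
  then show ?case using add[OF _ _ Suc t[OF ab]] ab cd by simp
 qed
 have neg: "TI +>$MR delta (a, b) (- int n) = TI +>$MR delta (\<ominus>$A a, b) (int n)" if ab: "a : carrier A" "b : carrier B" for a b n
 proof (induction n)
  case (Suc n)
  have e: "delta (a, b) (- int (Suc n)) = delta (a, b) (- int n) \<oplus>$MR delta (a, b) (- 1)"
   "delta (\<ominus>$A a, b) (int (Suc n)) = delta (\<ominus>$A a, b) (int n) \<oplus>$MR delta (\<ominus>$A a, b) 1"
   by (simp_all add: delta_add add.commute)
  have "delta (a, b) 1 \<oplus>$MR delta (a, b) (-1) = \<zero>$MR" by (simp add: delta_add monoid_ring_simps(3))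
  then have "ten a b \<oplus>$TR (TI +>$MR delta (a, b) (-1)) = \<zero>$TR"
   using ab coset_add[of "delta (a, b) 1" "delta (a, b) (-1)"] ring_hom_zero[OF TI.rcos_ring_hom MR.ring_axioms TI.quotient_is_ring]
   by (simp add: tensor_def tensor_ring_def)
  then have "TI +>$MR delta (a, b) (-1) = ten (\<ominus>$A a) b"
   using ab cd by (metis ten_minus_left TR.minus_equality ten_closed TR.a_comm)
  then show ?case unfolding e using ab Suc by (simp add: coset_add tensor_def)
 qed simp
 have single: "P (TI +>$MR delta (a, b) n)" if ab: "a : carrier A" "b : carrier B" for a b n
  by (cases n rule: int_cases2) (use nn neg ab in auto)
 obtain f where f: "f : carrier MR" "X = TI +>$MR f" using assms(1) TI.quotient_cases unfolding tensor_ring_def by blast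
 have "P (TI +>$MR f)" using f(1)
 proof (induction f rule: AB.monoid_ring_induct)
  case zero
  then show ?case using z ring_hom_zero[OF TI.rcos_ring_hom MR.ring_axioms TI.quotient_is_ring] by (simp add: tensor_ring_def)
 next
  case (add f g n)
  obtain a b where g: "g = (a, b)" by (cases g)
  have ab: "a : carrier A" "b : carrier B" using add g by auto
  have "TI +>$MR f : carrier TR"
   using ring_hom_closed[OF TI.rcos_ring_hom] add by (simp add: tensor_ring_def)
  then have "P ((TI +>$MR f) \<oplus>$TR (TI +>$MR delta g n))"
   using assms(3) add ab cd[OF ab] single[OF ab] g by blast
  then show ?case using add ab by (simp add: coset_add g)
 qed
 then show ?thesis by (simp add: f)
qed

end

locale tensor_target = tensor_data Z \<alpha> A \<beta> B + T: ring T
 for Z :: "('z, 'q) ring_scheme" and \<alpha> :: "'z => 'a" and A :: "('a, 'm) ring_scheme"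
  and \<beta> :: "'z => 'b" and B :: "('b, 'n) ring_scheme" and T :: "('t, 'p) ring_scheme" +
 fixes f g
 assumes f_hom: "f : ring_hom A T" and g_hom: "g : ring_hom B T"
  and fg_comm: "[|a : carrier A; b : carrier B|] ==> f a **$T g b = g b **$T f a"
  and fg_balanced: "z : carrier Z ==> f (\<alpha> z) = g (\<beta> z)"
begin

lemma f_closed [simp]: "a : carrier A ==> f a : carrier T" and g_closed [simp]: "b : carrier B ==> g b : carrier T"
 using ring_hom_closed f_hom g_hom by metis+

text \<open>The integral monoid ring maps to \<open>T\<close> by
  \<open>(a, b) |-> f a * g b\<close>, which is multiplicative because the two images commute. Every
  defining relation goes to zero, hence so does the ideal generated by them.\<close>

lemma tensor_lift:
 obtains phi where "phi : ring_hom TR T" "!!a b. [|a : carrier A; b : carrier B|] ==> phi (ten a b) = f a **$T g b"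
proof -
 interpret M: monoid_ring_target "A \<times>\<times> B" T "%n::int. add_pow T (n) \<one>$T" "%(a, b). f a **$T g b"
 proof
  show "add_pow T (a) \<one>$T : carrier T" for a :: int by simp
  show "add_pow T (a + b) \<one>$T = add_pow T (a) \<one>$T \<oplus>$T add_pow T (b) \<one>$T" for a b :: int
   by (simp add: T.add.int_pow_mult)
  show "add_pow T (a * b) \<one>$T = (add_pow T (a) \<one>$T) **$T (add_pow T (b) \<one>$T)" for a b :: int
   by (simp add: T.add_pow_ldistr_int T.add.int_pow_pow mult.commute)
  show "add_pow T (1::int) \<one>$T = \<one>$T" by (rule T.add.int_pow_1) simp
  show "(case x of (a, b) => f a **$T g b) : carrier T" if "x : carrier (A \<times>\<times> B)" for x using that by auto
  show "(case \<one>\<^bsub>A \<times>\<times> B\<^esub> of (a, b) => f a **$T g b) = \<one>$T"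
   using ring_hom_one[OF f_hom] ring_hom_one[OF g_hom] by simp
  show "(case x **\<^bsub>A \<times>\<times> B\<^esub> y of (a, b) => f a **$T g b) = (case x of (a, b) => f a **$T g b) **$T (case y of (a, b) => f a **$T g b)"
   if xy: "x : carrier (A \<times>\<times> B)" "y : carrier (A \<times>\<times> B)" for x y
  proof -
   obtain a b a' b' where [simp]: "x = (a, b)" "y = (a', b')" "a : carrier A" "b : carrier B" "a' : carrier A" "b' : carrier B"
    using xy by (cases x, cases y) auto
   have "f a **$T f a' **$T (g b **$T g b') = f a **$T (f a' **$T g b) **$T g b'" by (simp add: T.m_assoc)
   also have "\<dots> = f a **$T g b **$T (f a' **$T g b')" by (simp add: fg_comm[of a' b] T.m_assoc)
   finally show ?thesis using ring_hom_mult[OF f_hom] ring_hom_mult[OF g_hom] by simp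
  qed
  show "(add_pow T (a) \<one>$T) **$T (case x of (a, b) => f a **$T g b) = (case x of (a, b) => f a **$T g b) **$T (add_pow T (a) \<one>$T)"
   if "x : carrier (A \<times>\<times> B)" for x and a :: int
   using that by (cases x) (simp add: T.add_pow_ldistr_int T.add_pow_rdistr_int)
 qed
 have ml: "M.mlift (delta (a, b) 1) = f a **$T g b" if "a : carrier A" "b : carrier B" for a b
  using that M.mlift_delta[of "(a, b)" 1] by (simp add: M.c_one)
 interpret H: ring_hom_ring MR T M.mlift
  by (rule ring_hom_ringI2[OF MR.ring_axioms T.ring_axioms M.mlift_hom])
 have "rels <= a_kernel MR T M.mlift"
 proof
  fix x assume x: "x : rels"
  then have xc: "x : carrier MR" using rels_carrier by blast
  have sub: "M.mlift (u \<ominus>$MR v) = \<zero>$T" if "u : carrier MR" "v : carrier MR" "M.mlift u = M.mlift v" for u v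
   using that by (simp add: MR.minus_eq M.mlift_add H.hom_a_inv T.r_neg)
  have "M.mlift x = \<zero>$T"
   using x unfolding rels_def Let_def
  proof (elim UnE CollectE exE conjE)
   fix a a' b assume h: "x = delta (a \<oplus>$A a', b) 1 \<ominus>$MR (delta (a, b) 1 \<oplus>$MR delta (a', b) 1)"
    "a : carrier A" "a' : carrier A" "b : carrier B"
   show ?thesis unfolding h(1) using h(2-)
    by (intro sub) (simp_all add: ml M.mlift_add ring_hom_add[OF f_hom] T.l_distr)
  next
   fix a b' b assume h: "x = delta (a, b \<oplus>$B b') 1 \<ominus>$MR (delta (a, b) 1 \<oplus>$MR delta (a, b') 1)"
    "a : carrier A" "b : carrier B" "b' : carrier B"
   show ?thesis unfolding h(1) using h(2-)
    by (intro sub) (simp_all add: ml M.mlift_add ring_hom_add[OF g_hom] T.r_distr)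
  next
   fix z a b assume h: "x = delta (\<alpha> z **$A a, b) 1 \<ominus>$MR delta (a, \<beta> z **$B b) 1"
    "z : carrier Z" "a : carrier A" "b : carrier B"
   show ?thesis unfolding h(1) using h(2-) \<alpha>_closed[OF h(2)] \<beta>_closed[OF h(2)]
    by (intro sub) (simp_all add: ml M.mlift_add ring_hom_mult[OF f_hom] ring_hom_mult[OF g_hom]
      fg_balanced T.m_assoc[symmetric], simp add: fg_comm[symmetric])
  qed
  then show "x : a_kernel MR T M.mlift" using xc unfolding a_kernel_def' by blast
 qed
 then have "TI <= a_kernel MR T M.mlift"
  unfolding TI_eq by (rule MR.genideal_minimal[OF H.kernel_is_ideal])
 then have "M.mlift x = \<zero>$T" if "x : TI" for x using that unfolding a_kernel_def' by blast
 then obtain phi where "phi : ring_hom TR T" "!!x. x : carrier MR ==> phi (TI +>$MR x) = M.mlift x"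
  using TI.quotient_lift[OF T.ring_axioms M.mlift_hom] unfolding tensor_ring_def by metis
 then show ?thesis using that[of phi] ml by (simp add: tensor_def)
qed

end

section \<open>Finite sums and linear combinations\<close>

lemma finsum_ring_hom:
 assumes "ring R" "ring S" "h : ring_hom R S" "finite A" "f : A \<rightarrow> carrier R"
 shows "h (\<Oplus>$R i\<in>A. f i) = (\<Oplus>$S i\<in>A. h (f i))"
proof -
 interpret R: ring R by fact
 interpret S: ring S by fact
 note h = assms(3)
 show ?thesis using assms(4,5)
 proof (induction A)
  case empty
  then show ?case using ring_hom_zero[OF h R.ring_axioms S.ring_axioms] by simp
 next
  case (insert a A)
  then show ?case using ring_hom_add[OF h] ring_hom_closed[OF h] by (simp add: Pi_iff)
 qed
qed

lemma (in ring) finsum_delta: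
 assumes "finite A" "j : A" "a : carrier R"
 shows "(\<Oplus>i\<in>A. if i = j then a else \<zero>) = a"
proof -
 have "(\<Oplus>i\<in>A. if i = j then a else \<zero>) = (\<Oplus>i\<in>A. if j = i then a else \<zero>)"
  using assms by (intro finsum_cong') auto
 then show ?thesis using finsum_singleton[OF assms(2,1), of "%_. a"] assms by simp
qed

lemma (in ring) finsum_in_ideal:
 assumes "ideal I R" "finite A" "!!i. i : A ==> f i : I"
 shows "(\<Oplus>i\<in>A. f i) : I"
proof -
 interpret I: ideal I R by fact
 show ?thesis using assms(2,3)
 proof (induction A)
  case (insert a A)
  then have "(\<Oplus>i\<in>insert a A. f i) = f a \<oplus> (\<Oplus>i\<in>A. f i)"
   by (intro finsum_insert) (auto simp: I.a_Hcarr)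
  then show ?case using insert by (simp add: I.a_closed)
 qed (simp add: I.zero_closed)
qed

text \<open>Links dimension theory, which is phrased with lists, to indexed sums. The minimum
  appears because \<open>combine\<close> stops at the end of the shorter list.\<close>

lemma (in ring) combine_eq_finsum:
 assumes "set Ks <= carrier R" "set Us <= carrier R"
 shows "combine Ks Us = (\<Oplus>i\<in>{..<min (length Ks) (length Us)}. (Ks ! i) ** (Us ! i))"
 using assms
proof (induction Ks Us rule: combine.induct)
 case (1 k Ks w Us)
 let ?m = "min (length Ks) (length Us)"
 let ?f = "%i. ((k # Ks) ! i) ** ((w # Us) ! i)"
 have c: "k ** w : carrier R" "Ks ! i ** Us ! i : carrier R" if "i < ?m" for i
  using 1(2,3) that nth_mem by (auto simp: subset_iff)
 have c0: "k ** w : carrier R" using 1(2,3) by auto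
 have "(\<Oplus>i\<in>{..<Suc ?m}. ?f i) = (\<Oplus>i\<in>insert 0 (Suc ` {..<?m}). ?f i)"
  by (simp add: lessThan_Suc_eq_insert_0)
 also have "\<dots> = ?f 0 \<oplus> (\<Oplus>i\<in>Suc ` {..<?m}. ?f i)"
  using c c0 by (intro finsum_insert) auto
 also have "(\<Oplus>i\<in>Suc ` {..<?m}. ?f i) = (\<Oplus>i\<in>{..<?m}. ?f (Suc i))"
  using c by (intro finsum_reindex) auto
 finally show ?case using 1 by simp
qed auto

section \<open>Dual bases over the center\<close>

text \<open>The action on \<open>R\<close> of the element \<open>\<Sum> u k \<otimes> v k\<close> of
  the tensor product of \<open>R\<close> with its opposite ring. Such maps are linear over the
  center and preserve every two-sided ideal.\<close>

definition elem_op :: "('a, 'm) ring_scheme => nat => (nat => 'a) => (nat => 'a) => 'a => 'a" where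
 "elem_op R m u v r = (\<Oplus>$R k\<in>{..<m}. u k **$R r **$R v k)"

text \<open>The maps \<open>z i\<close> are the coordinates with respect to the family \<open>b\<close> over the center, up to the
 common denominator \<open>d\<close>. That they have the form \<open>r \<mapsto> \<Sum>\<^sub>k u\<^sub>k r v\<^sub>k\<close> is what makes the ring
 Azumaya when \<open>d = 1\<close>, and an order in a central simple algebra in general.\<close>

locale dual_basis = ring R for R (structure) +
 fixes n :: nat and N :: "nat => nat" and b :: "nat => 'a" and u v :: "nat => nat => 'a" and d :: 'a
 assumes b_closed [simp]: "i < n ==> b i : carrier R"
  and u_closed [simp]: "i < n ==> k < N i ==> u i k : carrier R"
  and v_closed [simp]: "i < n ==> k < N i ==> v i k : carrier R"
  and d_center: "d : ring_center R"
  and z_center: "i < n ==> r : carrier R ==> elem_op R (N i) (u i) (v i) r : ring_center R"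
  and expand: "r : carrier R ==> d ** r = (\<Oplus>i\<in>{..<n}. elem_op R (N i) (u i) (v i) r ** b i)"
  and dual: "i < n ==> j < n ==> elem_op R (N i) (u i) (v i) (b j) = (if i = j then d else \<zero>)"
begin

abbreviation C where "C \<equiv> ring_center R"
abbreviation z where "z i \<equiv> elem_op R (N i) (u i) (v i)"

lemma C_carrier [simp]: "c : C ==> c : carrier R"
 by (rule ring_centerD(1))

lemma C_comm: "c : C ==> r : carrier R ==> c ** r = r ** c"
 by (rule ring_centerD(2))

lemma d_closed [simp]: "d : carrier R" by (rule C_carrier[OF d_center])

lemma z_closed [simp]: "i < n ==> r : carrier R ==> z i r : carrier R"
 by (rule C_carrier[OF z_center])

lemma z_add:
 assumes "i < n" "r : carrier R" "r' : carrier R"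
 shows "z i (r \<oplus> r') = z i r \<oplus> z i r'"
proof -
 have "z i (r \<oplus> r') = (\<Oplus>k\<in>{..<N i}. u i k ** r ** v i k \<oplus> u i k ** r' ** v i k)"
  unfolding elem_op_def using assms by (intro finsum_cong' refl) (simp_all add: r_distr l_distr)
 also have "\<dots> = z i r \<oplus> z i r'"
  unfolding elem_op_def using assms by (intro finsum_addf) auto
 finally show ?thesis .
qed

lemma z_mult_center:
 assumes "i < n" "c : C" "r : carrier R"
 shows "z i (c ** r) = c ** z i r"
proof -
 have "c ** z i r = (\<Oplus>k\<in>{..<N i}. c ** (u i k ** r ** v i k))"
  unfolding elem_op_def using assms by (intro finsum_rdistr) auto
 also have "\<dots> = z i (c ** r)"
  unfolding elem_op_def
 proof (intro finsum_cong' refl)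
  fix k assume "k : {..<N i}"
  then have k: "k < N i" by simp
  show "c ** (u i k ** r ** v i k) = u i k ** (c ** r) ** v i k"
   using C_comm[OF assms(2) u_closed[OF assms(1) k]] k assms by (simp add: m_assoc[symmetric])
 qed (use assms in auto)
 finally show ?thesis by simp
qed

lemma z_finsum:
 assumes "i < n" "finite A" "f : A \<rightarrow> carrier R"
 shows "z i (\<Oplus>j\<in>A. f j) = (\<Oplus>j\<in>A. z i (f j))"
 using assms(2,3)
proof (induction A)
 case empty
 have "z i \<zero> = \<zero>" using z_mult_center[OF assms(1), of \<zero> \<zero>] assms(1) by simp
 then show ?case by simp
next
 case (insert a A)
 then show ?case using assms(1) by (simp add: z_add Pi_iff)
qed

lemma z_combination:
 assumes "i < n" "!!j. j < n ==> c j : C"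
 shows "z i (\<Oplus>j\<in>{..<n}. c j ** b j) = c i ** d"
proof -
 have "z i (\<Oplus>j\<in>{..<n}. c j ** b j) = (\<Oplus>j\<in>{..<n}. z i (c j ** b j))"
  using assms by (intro z_finsum) auto
 also have "\<dots> = (\<Oplus>j\<in>{..<n}. if j = i then c i ** d else \<zero>)"
  using assms by (intro finsum_cong') (auto simp: z_mult_center dual)
 also have "\<dots> = c i ** d" using assms by (intro finsum_delta) auto
 finally show ?thesis .
qed

lemma z_nonzero:
 assumes r: "r : carrier R" and dr: "d ** r ~= \<zero>"
 obtains i where "i < n" "z i r ~= \<zero>"
proof (rule ccontr)
 assume "\<not> thesis"
 then have 0: "z i r = \<zero>" if "i < n" for i using that \<open>!!i. [|i < n; z i r ~= \<zero>|] ==> thesis\<close> by blast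
 have "d ** r = (\<Oplus>i\<in>{..<n}. \<zero>)"
  unfolding expand[OF r] by (intro finsum_cong' refl) (auto simp: 0)
 then show False using dr by simp
qed

text \<open>The gain from the form \<open>u r v\<close>: the coordinates of an element of a
  two-sided ideal stay in the ideal, and they are central. This is how ideals come to be controlled
  by the center.\<close>

lemma z_ideal:
 assumes "ideal I R" "r : I" "i < n"
 shows "z i r : I"
proof -
 interpret I: ideal I R by fact
 show ?thesis unfolding elem_op_def using assms by (intro finsum_in_ideal) (auto simp: I.I_l_closed I.I_r_closed)
qed

lemma basis_independent:
 assumes "!!j. j < n ==> c j : C" "(\<Oplus>j\<in>{..<n}. c j ** b j) = \<zero>" "i < n"
 shows "c i ** d = \<zero>"
 using z_combination[of i c] z_mult_center[of i \<zero> \<zero>] assms by simp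

text \<open>The family extends to every ring of fractions with central denominators.\<close>

lemma dual_basis_fraction_ring:
 assumes "central_frac R S"
 shows "dual_basis (fraction_ring R S) n N (%i. central_frac.emb R S (b i))
  (%i k. central_frac.emb R S (u i k)) (%i k. central_frac.emb R S (v i k)) (central_frac.emb R S d)"
proof -
 interpret F: central_frac R S by fact
 interpret FR: ring F.F by (rule F.ring_F)
 let ?e = F.emb
 have hom: "?e (x ** y) = ?e x **$F.F ?e y" if "x : carrier R" "y : carrier R" for x y
  using ring_hom_mult[OF F.emb_hom] that by auto
 \<comment> \<open>A central denominator slides through each term \<open>u a v\<close>, so the
   coordinates of \<open>a w^-1\<close> are those of \<open>a\<close> divided by
   \<open>w\<close>.\<close>
 have zF: "elem_op F.F (N i) (%k. ?e (u i k)) (%k. ?e (v i k)) (F.fr a w) = ?e (z i a) **$F.F inv$F.F ?e w"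
  if i: "i < n" and a: "a : carrier R" and w: "w : S" "w : F.C" for i a w
 proof -
  have unit: "?e w : Units F.F" using w by (simp add: F.emb_Units)
  have wc: "inv$F.F ?e w : ring_center F.F"
   by (intro FR.inv_in_center F.emb_center F.emb_Units w)
  have "?e (z i a) = (\<Oplus>$F.F k\<in>{..<N i}. ?e (u i k ** a ** v i k))"
   unfolding elem_op_def using i a
   by (intro finsum_ring_hom[OF ring_axioms F.ring_F F.emb_hom]) auto
  then have "?e (z i a) **$F.F inv$F.F ?e w
    = (\<Oplus>$F.F k\<in>{..<N i}. ?e (u i k ** a ** v i k) **$F.F inv$F.F ?e w)"
   using i a unit by (simp add: FR.finsum_ldistr Pi_iff)
  also have "\<dots> = elem_op F.F (N i) (%k. ?e (u i k)) (%k. ?e (v i k)) (F.fr a w)"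
   unfolding elem_op_def
  proof (intro FR.finsum_cong' refl)
   fix k assume "k : {..<N i}"
   then have k: "u i k : carrier R" "v i k : carrier R" using i by auto
   have "?e (u i k ** a ** v i k) **$F.F inv$F.F ?e w
     = ?e (u i k) **$F.F ?e a **$F.F (?e (v i k) **$F.F inv$F.F ?e w)"
    using k a unit by (simp add: hom FR.m_assoc)
   also have "?e (v i k) **$F.F inv$F.F ?e w = inv$F.F ?e w **$F.F ?e (v i k)"
    using ring_centerD(2)[OF wc, of "?e (v i k)"] k by simp
   finally show "?e (u i k ** a ** v i k) **$F.F inv$F.F ?e w = ?e (u i k) **$F.F F.fr a w **$F.F ?e (v i k)"
    using k a unit w by (simp add: F.fr_eq_emb_inv FR.m_assoc)
  qed (use i a unit in \<open>auto simp: F.fr_eq_emb_inv w\<close>)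
  finally show ?thesis by simp
 qed
 show ?thesis
 proof
  show "?e d : ring_center F.F" by (rule F.emb_center[OF d_center])
  fix i j assume ij: "i < n" "j < n"
  have one: "\<one> : S" "\<one> : F.C" by (simp_all add: F.S_one)
  have "inv$F.F ?e \<one> = \<one>$F.F" using ring_hom_one[OF F.emb_hom] by simp
  then have "elem_op F.F (N i) (%k. ?e (u i k)) (%k. ?e (v i k)) (?e (b j)) = ?e (z i (b j))"
   using zF[OF ij(1) b_closed[OF ij(2)] one] ij by (simp add: F.emb_def[symmetric])
  then show "elem_op F.F (N i) (%k. ?e (u i k)) (%k. ?e (v i k)) (?e (b j)) = (if i = j then ?e d else \<zero>$F.F)"
   using ij ring_hom_zero[OF F.emb_hom ring_axioms F.ring_F] by (simp add: dual)
 next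
  fix i X assume i: "i < n" and "X : carrier F.F"
  then obtain a w where aw: "a : carrier R" "w : S" "w : F.C" "X = F.fr a w" by (elim F.frac_cases) metis
  show "elem_op F.F (N i) (%k. ?e (u i k)) (%k. ?e (v i k)) X : ring_center F.F"
   unfolding aw(4) zF[OF i aw(1-3)]
   by (intro FR.center_closed F.emb_center z_center i FR.inv_in_center F.emb_Units aw)
 next
  fix X assume "X : carrier F.F"
  then obtain a w where aw: "a : carrier R" "w : S" "w : F.C" "X = F.fr a w" by (elim F.frac_cases) metis
  have unit: "?e w : Units F.F" using aw by (simp add: F.emb_Units)
  have wc: "inv$F.F ?e w : ring_center F.F"
   by (intro FR.inv_in_center F.emb_center F.emb_Units aw)
  have "?e d **$F.F X = ?e (d ** a) **$F.F inv$F.F ?e w"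
   using aw unit by (simp add: F.fr_eq_emb_inv hom FR.m_assoc)
  also have "?e (d ** a) = (\<Oplus>$F.F i\<in>{..<n}. ?e (z i a ** b i))"
   unfolding expand[OF aw(1)] using aw
   by (intro finsum_ring_hom[OF ring_axioms F.ring_F F.emb_hom]) auto
  also have "\<dots> **$F.F inv$F.F ?e w = (\<Oplus>$F.F i\<in>{..<n}. ?e (z i a ** b i) **$F.F inv$F.F ?e w)"
   using aw unit by (intro FR.finsum_ldistr) auto
  also have "\<dots> = (\<Oplus>$F.F i\<in>{..<n}. elem_op F.F (N i) (%k. ?e (u i k)) (%k. ?e (v i k)) X **$F.F ?e (b i))"
  proof (intro FR.finsum_cong' refl)
   fix i assume "i : {..<n}"
   then have i: "i < n" by simp
   show "?e (z i a ** b i) **$F.F inv$F.F ?e w = elem_op F.F (N i) (%k. ?e (u i k)) (%k. ?e (v i k)) X **$F.F ?e (b i)"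
    unfolding aw(4) zF[OF i aw(1-3)] using i aw unit ring_centerD(2)[OF wc, of "?e (b i)"]
    by (simp add: hom FR.m_assoc)
  qed (use aw unit zF in auto)
  finally show "?e d **$F.F X = (\<Oplus>$F.F i\<in>{..<n}. elem_op F.F (N i) (%k. ?e (u i k)) (%k. ?e (v i k)) X **$F.F ?e (b i))" .
 qed auto
qed

text \<open>The left factor \<open>r\<close> lets one argument serve twice: \<open>r = 1\<close>
  gives the independence behind the dimension, and a regular \<open>r\<close> gives that of the
  family \<open>r b_i\<close>.\<close>

lemma combine_basis_zero:
 assumes K: "subfield C R" and d0: "d ~= \<zero>" and Ks: "set Ks <= C"
  and r: "r : carrier R" and r_cancel: "!!a. a : carrier R ==> r ** a = \<zero> ==> a = \<zero>"
  and comb: "combine Ks (map (%i. r ** b i) [0..<n]) = \<zero>"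
 shows "set (take n Ks) <= {\<zero>}"
proof -
 let ?m = "min (length Ks) n"
 have KsC: "Ks ! i : C" if "i < length Ks" for i using Ks that by (meson nth_mem subset_iff)
 \<comment> \<open>Coefficients past the end of \<open>Ks\<close> are set to zero, so that the sum
   can run over all of \<open>{..<n}\<close>.\<close>
 define c where "c i = (if i < length Ks then Ks ! i else \<zero>)" for i
 have cC: "c i : C" for i using KsC by (simp add: c_def)
 have "set Ks <= carrier R" "set (map (%i. r ** b i) [0..<n]) <= carrier R" using Ks C_carrier r by auto
 from combine_eq_finsum[OF this] comb
 have "\<zero> = (\<Oplus>i\<in>{..<?m}. (Ks ! i) ** (map (%i. r ** b i) [0..<n] ! i))" by simp
 also have "\<dots> = (\<Oplus>i\<in>{..<?m}. (Ks ! i) ** (r ** b i))"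
  using KsC r by (intro finsum_cong' refl) auto
 also have "\<dots> = (\<Oplus>i\<in>{..<n}. c i ** (r ** b i))"
  using cC r KsC by (intro add.finprod_mono_neutral_cong_left) (auto simp: c_def)
 also have "\<dots> = (\<Oplus>i\<in>{..<n}. r ** (c i ** b i))"
  using cC r C_comm[OF cC r] by (intro finsum_cong') (auto simp: m_assoc[symmetric])
 also have "\<dots> = r ** (\<Oplus>i\<in>{..<n}. c i ** b i)"
  using cC r by (intro finsum_rdistr[symmetric]) auto
 finally have "(\<Oplus>i\<in>{..<n}. c i ** b i) = \<zero>" using cC r_cancel by (simp add: Pi_iff)
 then have cd: "c i ** d = \<zero>" if "i < n" for i using basis_independent[of c i] cC that by simp
 have "c i = \<zero>" if "i < n" for i
  using cd[OF that] subfieldE(5)[OF K cC[of i] d_center] d0 by blast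
 then show ?thesis by (force simp: set_conv_nth c_def)
qed

lemma dimension_carrier:
 assumes K: "subfield C R" and d0: "d ~= \<zero>"
 shows "dimension n C (carrier R)"
proof -
 let ?Us = "map (%i. \<one> ** b i) [0..<n]"
 have Us: "set ?Us <= carrier R" by auto
 have "independent C ?Us"
 proof (rule trivial_combine_imp_independent[OF K Us])
  fix Ks assume "set Ks <= C" "combine Ks ?Us = \<zero>"
  then show "set (take (length ?Us) Ks) <= {\<zero>}"
   using combine_basis_zero[OF K d0, of Ks \<one>] by simp
 qed
 moreover have "Span C ?Us = carrier R"
 proof
  show "Span C ?Us <= carrier R" using Span_in_carrier[OF _ Us, of C] C_carrier by blast
  show "carrier R <= Span C ?Us"
  proof
   fix r assume r: "r : carrier R"
   have "d : Units (R\<lparr>carrier := C\<rparr>)" using subfield.subfield_Units[OF K] d0 d_center by blast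
   then obtain e where e: "e : C" "e ** d = \<one>" unfolding Units_def by auto
   have "r = e ** (d ** r)" using e r by (simp add: m_assoc[symmetric])
   also have "\<dots> = (\<Oplus>i\<in>{..<n}. (e ** z i r) ** b i)"
    unfolding expand[OF r] using e r by (subst finsum_rdistr) (auto simp: m_assoc intro!: finsum_cong')
   also have "\<dots> = combine (map (%i. e ** z i r) [0..<n]) ?Us"
    using e r by (subst combine_eq_finsum) (auto intro!: finsum_cong')
   finally show "r : Span C ?Us"
    unfolding Span_eq_combine_set[OF K Us] using e z_center r by fastforce
  qed
 qed
 ultimately show ?thesis using dimensionI[OF K, of ?Us "carrier R"] by simp
qed

text \<open>A nonzero ideal contains a nonzero coordinate of one of its elements, and this is a unit
  because the center is a field.\<close>

lemma simple_ring_if_subfield: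
 assumes K: "subfield C R" and d0: "d ~= \<zero>"
 shows "simple_ring R"
 unfolding simple_ring_def
proof (intro conjI allI impI)
 have U: "Units (R\<lparr>carrier := C\<rparr>) = C - {\<zero>}" by (rule subfield.subfield_Units[OF K])
 then have du: "d : Units (R\<lparr>carrier := C\<rparr>)" using d0 d_center by blast
 show "ring R" by (rule ring_axioms)
 show "carrier R ~= {\<zero>}" using d0 d_closed by blast
 fix I assume I: "ideal I R"
 then interpret I: ideal I R .
 show "I = {\<zero>} \<or> I = carrier R"
 proof (rule disjCI)
  assume "I ~= carrier R"
  show "I = {\<zero>}"
  proof (rule ccontr)
   assume "I ~= {\<zero>}"
   then obtain r where r: "r : I" "r ~= \<zero>" using I.zero_closed by blast
   have rc: "r : carrier R" using r by (simp add: I.a_Hcarr)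
   have "d ** r ~= \<zero>"
   proof
    assume "d ** r = \<zero>"
    obtain e where e: "e : C" "e ** d = \<one>" using du unfolding Units_def by auto
    have "r = e ** (d ** r)" using e rc by (simp add: m_assoc[symmetric])
    then show False using \<open>d ** r = \<zero>\<close> e r by simp
   qed
   then obtain i where i: "i < n" "z i r ~= \<zero>" using z_nonzero rc by blast
   then have "z i r : C - {\<zero>}" using z_center rc by simp
   then have "z i r : Units (R\<lparr>carrier := C\<rparr>)" by (simp add: U)
   then obtain e where e: "e : C" "e ** z i r = \<one>" unfolding Units_def by auto
   then have "\<one> : I" using I.I_l_closed[OF z_ideal[OF I r(1) i(1)], of e] by simp
   then show False using \<open>I ~= carrier R\<close> I.one_imp_carrier by blast
  qed
 qed
qed

end

text \<open>Absence of torsion over the center makes the center a domain. Inverting its nonzero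
  elements gives a field over which the images of the \<open>b i\<close> form a basis.\<close>

locale dual_basis_domain = dual_basis +
 assumes center_cancel: "[|c : ring_center R; r : carrier R; c ** r = \<zero>; c ~= \<zero>|] ==> r = \<zero>"
  and d_nonzero: "d ~= \<zero>"
begin

lemma one_nonzero: "\<one> ~= \<zero>"
 using d_nonzero by (metis d_closed l_one l_null)

abbreviation C0 where "C0 \<equiv> C - {\<zero>}"

lemma C0_regular: "C0 <= regular_elements R"
proof
 fix c assume c: "c : C0"
 show "c : regular_elements R"
 proof (rule regular_elementsI)
  show "c : carrier R" using c by simp
  fix a assume a: "a : carrier R"
  show "a = \<zero>" if "c ** a = \<zero>" using center_cancel[of c a] c a that by simp
  show "a = \<zero>" if "a ** c = \<zero>" using center_cancel[of c a] C_comm[of c a] c a that by simp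
 qed
qed

lemma ideal_center_nonzero:
 assumes I: "ideal I R" "I ~= {\<zero>}"
 obtains c where "c : I" "c : C0"
proof -
 interpret I: ideal I R by fact
 obtain r where r: "r : I" "r ~= \<zero>" using assms I.zero_closed by blast
 have rc: "r : carrier R" using r by (simp add: I.a_Hcarr)
 have "d ** r ~= \<zero>" using center_cancel[OF d_center rc] d_nonzero r by blast
 then obtain i where i: "i < n" "z i r ~= \<zero>" using z_nonzero rc by blast
 then show ?thesis using that z_ideal[OF I(1) r(1) i(1)] z_center[OF i(1) rc] by blast
qed

text \<open>Two nonzero ideals contain nonzero central elements \<open>c\<close> and
  \<open>c'\<close>, and \<open>c c'\<close> is nonzero because central elements cancel.\<close>

lemma prime_ring: "prime_ring R"
 unfolding prime_ring_def prime_ideal_def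
proof (intro conjI allI impI)
 show "ring R" by (rule ring_axioms)
 show "ideal {\<zero>} R" by (rule zeroideal)
 show "{\<zero>} ~= carrier R" using one_nonzero one_closed by blast
 fix I J assume I: "ideal I R" and J: "ideal J R" and IJ: "I \<cdot> J <= {\<zero>}"
 interpret I: ideal I R by fact
 interpret J: ideal J R by fact
 show "I <= {\<zero>} \<or> J <= {\<zero>}"
 proof (rule ccontr)
  assume "\<not> ?thesis"
  then have "I ~= {\<zero>}" "J ~= {\<zero>}" by auto
  then obtain c c' where c: "c : I" "c : C0" "c' : J" "c' : C0"
   using ideal_center_nonzero I J by metis
  then have "c ** c' = \<zero>" using IJ ideal_prod.prod[of c I c' J R] by blast
  then show False using center_cancel[of c c'] c by simp
 qed
qed

lemma central_frac_C0: "central_frac R C0"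
proof
 show "C0 <= regular_elements R" by (rule C0_regular)
 show "\<one> : C0" using one_nonzero by simp
 show "s ** t : C0" if "s : C0" "t : C0" for s t
  using center_cancel[of s t] that by auto
 show "\<exists>s'\<in>carrier R. s ** s' : C0 \<inter> C" if "s : C0" for s
  using that by (intro bexI[of _ \<one>]) auto
qed

text \<open>A nonzero central fraction is \<open>a w^-1\<close> with \<open>a\<close> central and
  nonzero. Then \<open>a\<close> belongs to \<open>S\<close> and \<open>w a^-1\<close> is an
  inverse.\<close>

lemma subfield_center_fraction_ring:
 assumes "central_frac R S" "C0 <= S"
 shows "subfield (ring_center (fraction_ring R S)) (fraction_ring R S)"
proof -
 interpret F: central_frac R S by fact
 interpret FR: ring F.F by (rule F.ring_F)
 let ?K = "ring_center F.F"
 have zS: "\<zero> \<notin> S"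
 proof
  assume "\<zero> : S"
  then show False using F.S_cancel(1)[of \<zero> \<one> \<zero>] one_nonzero by simp
 qed
 show ?thesis
 proof (rule FR.subfieldI)
  show "subcring ?K F.F"
   using FR.ring_center_subring by (rule FR.subcringI) (auto dest: ring_centerD)
  show "Units (F.F\<lparr>carrier := ?K\<rparr>) = ?K - {\<zero>$F.F}"
  proof (intro equalityI subsetI)
   fix X assume "X : Units (F.F\<lparr>carrier := ?K\<rparr>)"
   then have X: "X : ?K" and "\<exists>Y\<in>?K. Y **$F.F X = \<one>$F.F" unfolding Units_def by auto
   then obtain Y where Y: "Y : ?K" "Y **$F.F X = \<one>$F.F" by blast
   have "X ~= \<zero>$F.F"
   proof
    assume "X = \<zero>$F.F"
    then have "\<one>$F.F = \<zero>$F.F" using Y FR.r_null[OF ring_centerD(1)[OF Y(1)]] by simp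
    then show False using one_nonzero by (simp add: F.F_one F.F_zero F.fr_eq_central_iff F.S_one)
   qed
   then show "X : ?K - {\<zero>$F.F}" using X by blast
  next
   fix X assume X: "X : ?K - {\<zero>$F.F}"
   then obtain a w where aw: "X = F.fr a w" "a : C" "w : S" "w : C" unfolding F.center_F by blast
   have "a ~= \<zero>" using X aw by (auto simp: F.F_zero F.fr_eq_central_iff F.S_one)
   then have aS: "a : S" using aw assms(2) by blast
   have Y: "F.fr w a : ?K" using aS aw unfolding F.center_F by blast
   have "F.fr w a **$F.F X = \<one>$F.F" "X **$F.F F.fr w a = \<one>$F.F"
    using aw aS C_comm[of a w] by (simp_all add: F.fr_mult F.F_one F.fr_eq_central_iff F.S_one F.S_mult)
   then show "X : Units (F.F\<lparr>carrier := ?K\<rparr>)" using X Y unfolding Units_def by auto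
  qed
 qed
qed

lemma fraction_ring_dimension:
 assumes S: "central_frac R S" "C0 <= S"
 defines "F \<equiv> fraction_ring R S"
 shows "ring F" "subfield (ring_center F) F" "ring.dimension F n (ring_center F) (carrier F)" "simple_ring F"
proof -
 interpret F: central_frac R S by fact
 interpret D: dual_basis F.F n N "%i. F.emb (b i)" "%i k. F.emb (u i k)" "%i k. F.emb (v i k)" "F.emb d"
  by (rule dual_basis_fraction_ring[OF S(1)])
 note K = subfield_center_fraction_ring[OF S]
 have "F.emb d ~= \<zero>$F.F" using F.emb_eq_iff[of d \<zero>] d_nonzero by (simp add: F.F_zero F.emb_def)
 then show "ring F" "subfield (ring_center F) F" "ring.dimension F n (ring_center F) (carrier F)" "simple_ring F"
  unfolding F_def using F.ring_F K D.dimension_carrier D.simple_ring_if_subfield by blast+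
qed

text \<open>Over the field of central fractions, multiplication by a regular \<open>r\<close> is
  injective on a space of dimension \<open>n\<close>: the \<open>n\<close> elements
  \<open>r b_i\<close> are independent and therefore span. Hence \<open>1 = r X\<close> for some
  fraction \<open>X = a w^-1\<close>, that is, \<open>r a = w\<close> is central and
  nonzero.\<close>

lemma regular_divides_central:
 assumes r: "r : regular_elements R"
 obtains r' where "r' : carrier R" "r ** r' : C0"
proof -
 interpret F: central_frac R C0 by (rule central_frac_C0)
 interpret D: dual_basis F.F n N "%i. F.emb (b i)" "%i k. F.emb (u i k)" "%i k. F.emb (v i k)" "F.emb d"
  by (rule dual_basis_fraction_ring[OF central_frac_C0])
 note K = subfield_center_fraction_ring[OF central_frac_C0 order_refl]
 have d0: "F.emb d ~= \<zero>$F.F" using F.emb_eq_iff[of d \<zero>] d_nonzero by (simp add: F.F_zero F.emb_def)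
 have rc: "r : carrier R" using r by (rule regular_elementsD(1))
 have cancel: "X = \<zero>$F.F" if "X : carrier F.F" and 0: "F.emb r **$F.F X = \<zero>$F.F" for X
 proof -
  obtain a w where aw: "a : carrier R" "w : C0" "w : F.C" "X = F.fr a w"
   using \<open>X : carrier F.F\<close> by (elim F.frac_cases) metis
  have "F.fr (r ** a) w = F.fr \<zero> \<one>"
   using 0 F.fr_mult[OF rc aw(1) F.S_one center_closed(2) aw(2,3)] aw
   by (simp only: F.emb_def F.F_zero l_one C_carrier)
  then have "r ** a = \<zero>"
   using F.fr_eq_central_iff[OF m_closed[OF rc aw(1)] zero_closed aw(2) F.S_one center_closed(2)] aw rc by simp
  then have "a = \<zero>" using regular_elementsD(2)[OF r] aw by blast
  then show ?thesis
   using F.fr_eq_central_iff[OF zero_closed zero_closed aw(2) F.S_one center_closed(2)] aw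
   by (simp add: F.F_zero)
 qed
 let ?Us = "map (%i. F.emb r **$F.F F.emb (b i)) [0..<n]"
 have Us: "set ?Us <= carrier F.F" using rc by auto
 have "D.independent D.C ?Us"
 proof (rule D.trivial_combine_imp_independent[OF K Us])
  fix Ks assume Ks: "set Ks <= D.C" "D.combine Ks ?Us = \<zero>$F.F"
  have "set (take n Ks) <= {\<zero>$F.F}"
   by (rule D.combine_basis_zero[OF K d0 Ks(1) F.emb_closed[OF rc] cancel Ks(2)])
  then show "set (take (length ?Us) Ks) <= {\<zero>$F.F}" by simp
 qed
 then have "D.Span D.C ?Us = carrier F.F"
  using D.independent_length_eq_dimension[OF K D.dimension_carrier[OF K d0], of ?Us] Us by simp
 then have "\<one>$F.F : D.Span D.C ?Us" by simp
 then obtain Ks where Ks: "set Ks <= D.C" "\<one>$F.F = D.combine Ks ?Us"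
  using D.Span_eq_combine_set[OF K Us] by auto
 let ?m = "min (length Ks) n"
 have KsC: "Ks ! i : D.C" if "i < length Ks" for i using Ks that by (meson nth_mem subset_iff)
 have "\<one>$F.F = (\<Oplus>$F.F i\<in>{..<?m}. (Ks ! i) **$F.F (F.emb r **$F.F F.emb (b i)))"
 proof -
  have "set Ks <= carrier F.F" using Ks D.C_carrier by blast
  from D.combine_eq_finsum[OF this Us] Ks(2)
  have "\<one>$F.F = (\<Oplus>$F.F i\<in>{..<?m}. (Ks ! i) **$F.F (?Us ! i))" by simp
  also have "\<dots> = (\<Oplus>$F.F i\<in>{..<?m}. (Ks ! i) **$F.F (F.emb r **$F.F F.emb (b i)))"
   using KsC rc by (intro D.finsum_cong' refl) auto
  finally show ?thesis .
 qed
 also have "\<dots> = (\<Oplus>$F.F i\<in>{..<?m}. F.emb r **$F.F ((Ks ! i) **$F.F F.emb (b i)))"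
 proof (intro D.finsum_cong' refl)
  fix i assume "i : {..<?m}"
  then have i: "i < n" "Ks ! i : D.C" using KsC by auto
  show "(Ks ! i) **$F.F (F.emb r **$F.F F.emb (b i)) = F.emb r **$F.F ((Ks ! i) **$F.F F.emb (b i))"
   using D.C_comm[OF i(2), of "F.emb r"] i rc D.C_carrier[OF i(2)] by (simp add: D.m_assoc[symmetric])
 qed (use KsC rc in auto)
 also have "\<dots> = F.emb r **$F.F (\<Oplus>$F.F i\<in>{..<?m}. (Ks ! i) **$F.F F.emb (b i))"
  using KsC rc by (intro D.finsum_rdistr[symmetric]) auto
 finally obtain X where X: "X : carrier F.F" "\<one>$F.F = F.emb r **$F.F X"
  using KsC by (metis (no_types, lifting) D.finsum_closed D.m_closed D.C_carrier F.emb_closed Pi_I b_closed lessThan_iff min_less_iff_conj)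
 obtain a w where aw: "a : carrier R" "w : C0" "w : F.C" "X = F.fr a w"
  using X(1) by (elim F.frac_cases) metis
 have "F.fr \<one> \<one> = F.fr (r ** a) w"
  using X(2) F.fr_mult[OF rc aw(1) F.S_one center_closed(2) aw(2,3)] aw
  by (simp only: F.emb_def F.F_one l_one C_carrier)
 then have "r ** a = w"
  using F.fr_eq_central_iff[OF one_closed m_closed[OF rc aw(1)] F.S_one aw(2,3)] aw rc by simp
 then show ?thesis using that[of a] aw by simp
qed

text \<open>Brings the classical quotient ring under \<open>central_frac\<close>, so that it has
  central denominators and inherits the dual basis.\<close>

lemma central_frac_regular: "central_frac R (regular_elements R)"
proof
 show "\<one> : regular_elements R" by (rule regular_elementsI) auto
 show "s ** t : regular_elements R" if "s : regular_elements R" "t : regular_elements R" for s t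
  using that by (rule regular_elements_mult)
 show "\<exists>s'\<in>carrier R. s ** s' : regular_elements R \<inter> C" if "s : regular_elements R" for s
  using regular_divides_central[OF that] C0_regular by blast
qed simp

lemma has_PI_degree:
 assumes "PI_ring R" "n = m\<^sup>2"
 shows "has_PI_degree R m"
 unfolding has_PI_degree_def Let_def classical_quotient_ring_def
 using fraction_ring_dimension[OF central_frac_regular C0_regular] prime_ring assms by simp

end

section \<open>The center as a ring, the opposite ring, the regular module\<close>

lemma (in ring) idealI_mult:
 assumes "I <= carrier R" "\<zero> : I" "!!a b. a : I ==> b : I ==> a \<oplus> b : I"
  and "!!a r. a : I ==> r : carrier R ==> r ** a : I" "!!a r. a : I ==> r : carrier R ==> a ** r : I"
 shows "ideal I R"
proof (rule idealI[OF ring_axioms])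
 have "\<ominus> a : I" if "a : I" for a
  using assms(4)[OF that, of "\<ominus> \<one>"] assms(1) that by (simp add: l_minus subset_iff)
 then show "subgroup I (add_monoid R)"
  using assms by (intro subgroup.intro) (auto simp: a_inv_def)
qed (use assms in auto)

lemma (in ring) cring_center: "cring (R\<lparr>carrier := ring_center R\<rparr>)"
proof -
 have "ring (R\<lparr>carrier := ring_center R\<rparr>)" by (rule subring_is_ring[OF ring_center_subring])
 moreover have "comm_monoid (R\<lparr>carrier := ring_center R\<rparr>)"
  by (rule comm_monoidI) (auto simp: m_assoc ring_centerD(1) intro: ring_centerD(2))
 ultimately show ?thesis by (rule cring.intro)
qed

lemma opposite_ring_simps [simp]:
 "carrier (opposite_ring R) = carrier R" "a **\<^bsub>opposite_ring R\<^esub> b = b **$R a"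
 "\<one>\<^bsub>opposite_ring R\<^esub> = \<one>$R" "\<zero>\<^bsub>opposite_ring R\<^esub> = \<zero>$R" "a \<oplus>\<^bsub>opposite_ring R\<^esub> b = a \<oplus>$R b"
 by (simp_all add: opposite_ring_def)

lemma (in ring) ring_opposite_ring: "ring (opposite_ring R)"
proof (rule ringI)
 show "abelian_group (opposite_ring R)"
  by (rule abelian_groupI) (auto simp: a_ac intro: bexI[of _ "\<ominus> _"] l_neg)
 show "Group.monoid (opposite_ring R)"
  by (rule monoidI) (auto simp: m_assoc)
qed (auto simp: l_distr r_distr)

lemma self_module_simps [simp]:
 "carrier (self_module A) = carrier A" "x \<odot>\<^bsub>self_module A\<^esub> y = x **$A y"
 "x \<oplus>\<^bsub>self_module A\<^esub> y = x \<oplus>$A y" "\<zero>\<^bsub>self_module A\<^esub> = \<zero>$A"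
 by (simp_all add: self_module_def)

lemma finsum_self_module: "finsum (self_module A) = finsum A"
 by (auto simp: finsum_def finprod_def self_module_def fun_eq_iff)

context dual_basis
begin

abbreviation ZR where "ZR \<equiv> R\<lparr>carrier := C\<rparr>"

lemma free_of_rank_self:
 assumes d1: "d = \<one>"
 shows "free_of_rank ZR (self_module R) n"
 unfolding free_of_rank_def finsum_self_module self_module_simps
proof (intro bexI[of _ b] ballI)
 show "b : {..<n} \<rightarrow> carrier R" by auto
 fix x assume x: "x : carrier R"
 show "\<exists>!c. c : {..<n} \<rightarrow>\<^sub>E carrier ZR & x = (\<Oplus>i\<in>{..<n}. c i ** b i)"
 proof (rule ex1I)
  show "(\<lambda>i\<in>{..<n}. z i x) : {..<n} \<rightarrow>\<^sub>E carrier ZR & x = (\<Oplus>i\<in>{..<n}. (\<lambda>i\<in>{..<n}. z i x) i ** b i)"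
  proof
   have "x = (\<Oplus>i\<in>{..<n}. z i x ** b i)" using expand[OF x] x d1 by simp
   also have "\<dots> = (\<Oplus>i\<in>{..<n}. (\<lambda>i\<in>{..<n}. z i x) i ** b i)"
    using x by (intro finsum_cong' refl) auto
   finally show "x = (\<Oplus>i\<in>{..<n}. (\<lambda>i\<in>{..<n}. z i x) i ** b i)" .
  qed (use z_center x in auto)
  fix c assume c: "c : {..<n} \<rightarrow>\<^sub>E carrier ZR & x = (\<Oplus>i\<in>{..<n}. c i ** b i)"
  then have cC: "c i : C" if "i < n" for i using that by auto
  show "c = (\<lambda>i\<in>{..<n}. z i x)"
  proof (rule PiE_ext)
   show "c : {..<n} \<rightarrow>\<^sub>E C" using c by simp
   show "(\<lambda>i\<in>{..<n}. z i x) : {..<n} \<rightarrow>\<^sub>E C" using z_center x by auto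
   fix i assume "i : {..<n}"
   then have i: "i < n" by simp
   have "z i x = c i ** d" using z_combination[OF i cC] c by simp
   then show "c i = (\<lambda>i\<in>{..<n}. z i x) i" using i cC by (simp add: d1)
  qed
 qed
qed

end

section \<open>Dual bases without denominator: ideals, primes and quotients\<close>

text \<open>The index \<open>i0\<close> makes the map \<open>z i0\<close> a projection of
  \<open>R\<close> onto its center that is linear over the center. It recovers an ideal of the
  center from its extension, and it lifts central elements of a quotient to the center of
  \<open>R\<close>.\<close>

locale azumaya_basis = dual_basis R n N b u v "\<one>$R" for R (structure) and n N b u v +
 fixes i0
 assumes i0: "i0 < n" and z_i0_one: "elem_op R (N i0) (u i0) (v i0) \<one> = \<one>"
begin

lemma expand1: "r : carrier R ==> (\<Oplus>i\<in>{..<n}. z i r ** b i) = r"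
 using expand[of r] by simp

sublocale ZR: cring ZR by (rule cring_center)

lemma contraction_ideal:
 assumes "ideal I R" shows "ideal (I \<inter> C) ZR"
proof -
 interpret I: ideal I R by fact
 show ?thesis
  by (rule ZR.idealI_mult) (auto simp: I.I_l_closed I.I_r_closed)
qed

text \<open>In the expansion of \<open>r\<close> in \<open>I\<close> along the \<open>b i\<close>,
  all coefficients \<open>z i r\<close> are central and lie in \<open>I\<close>.\<close>

lemma ideal_eq_extension:
 assumes "ideal I R" shows "(I \<inter> C) \<cdot> carrier R = I"
proof
 interpret I: ideal I R by fact
 show "(I \<inter> C) \<cdot> carrier R <= I"
 proof
  fix x assume "x : (I \<inter> C) \<cdot> carrier R"
  then show "x : I" by (induction rule: ideal_prod.induct) (auto simp: I.I_r_closed)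
 qed
 show "I <= (I \<inter> C) \<cdot> carrier R"
 proof
  fix r assume r: "r : I"
  then have rc: "r : carrier R" by (simp add: I.a_Hcarr)
  have "\<zero> ** \<zero> : (I \<inter> C) \<cdot> carrier R" by (rule ideal_prod.prod) (auto simp: I.zero_closed)
  then have 0: "\<zero> : (I \<inter> C) \<cdot> carrier R" by simp
  have "(\<Oplus>i\<in>A. z i r ** b i) : (I \<inter> C) \<cdot> carrier R" if "finite A" "A <= {..<n}" for A
   using that
  proof (induction A)
   case (insert a A)
   have "z a r ** b a : (I \<inter> C) \<cdot> carrier R"
    using insert z_ideal[OF assms r] z_center[OF _ rc] by (intro ideal_prod.prod) auto
   moreover have "(\<Oplus>i\<in>insert a A. z i r ** b i) = z a r ** b a \<oplus> (\<Oplus>i\<in>A. z i r ** b i)"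
    using insert rc by (intro finsum_insert) auto
   ultimately show ?case using insert by (auto intro: ideal_prod.sum)
  qed (simp add: 0)
  then show "r : (I \<inter> C) \<cdot> carrier R" using expand1[OF rc] by (metis finite_lessThan order_refl)
 qed
qed

lemma extension_ideal:
 assumes "ideal a ZR" shows "ideal (a \<cdot> carrier R) R"
proof -
 interpret a: ideal a ZR by fact
 have aC: "a <= C" using a.a_subset by simp
 show ?thesis
 proof (rule idealI_mult)
  show sub: "a \<cdot> carrier R <= carrier R"
  proof
   fix x assume "x : a \<cdot> carrier R"
   then show "x : carrier R" by (induction rule: ideal_prod.induct) (use aC in auto)
  qed
  have "\<zero> ** \<zero> : a \<cdot> carrier R" using a.zero_closed by (intro ideal_prod.prod) auto
  then show "\<zero> : a \<cdot> carrier R" by simp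
  show "x \<oplus> y : a \<cdot> carrier R" if "x : a \<cdot> carrier R" "y : a \<cdot> carrier R" for x y
   using that by (rule ideal_prod.sum)
  fix x r assume x: "x : a \<cdot> carrier R" and r: "r : carrier R"
  show "r ** x : a \<cdot> carrier R" using x
  proof (induction rule: ideal_prod.induct)
   case (prod i j)
   have i: "i : C" using prod aC by blast
   have "r ** (i ** j) = i ** (r ** j)" using C_comm[OF i r] i prod r by (simp add: m_assoc[symmetric])
   then show ?case using prod r by (auto intro: ideal_prod.prod)
  next
   case (sum s1 s2)
   then show ?case using sub r by (auto simp: r_distr subset_iff intro!: ideal_prod.sum)
  qed
  show "x ** r : a \<cdot> carrier R" using x
  proof (induction rule: ideal_prod.induct)
   case (prod i j)
   have i: "i : C" using prod aC by blast
   have "i ** j ** r = i ** (j ** r)" using i prod r by (simp add: m_assoc)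
   then show ?case using prod r by (auto intro: ideal_prod.prod)
  next
   case (sum s1 s2)
   then show ?case using sub r by (auto simp: l_distr subset_iff intro!: ideal_prod.sum)
  qed
 qed
qed

text \<open>The projection \<open>z i0\<close> sends a product \<open>i j\<close> with
  \<open>i\<close> in \<open>a\<close> to \<open>i (z i0 j)\<close>, which lies in \<open>a\<close>,
  and it fixes central elements.\<close>

lemma contraction_extension:
 assumes "ideal a ZR" shows "(a \<cdot> carrier R) \<inter> C = a"
proof
 interpret a: ideal a ZR by fact
 have aC: "a <= C" using a.a_subset by simp
 show "a <= (a \<cdot> carrier R) \<inter> C"
 proof
  fix x assume x: "x : a"
  then have "x ** \<one> : a \<cdot> carrier R" by (intro ideal_prod.prod) auto
  then show "x : (a \<cdot> carrier R) \<inter> C" using x aC by auto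
 qed
 show "(a \<cdot> carrier R) \<inter> C <= a"
 proof
  fix x assume x: "x : (a \<cdot> carrier R) \<inter> C"
  have "y : carrier R & z i0 y : a" if "y : a \<cdot> carrier R" for y using that
  proof (induction rule: ideal_prod.induct)
   case (prod i j)
   have i: "i : C" using prod aC by blast
   have "i **$ZR z i0 j : a" using prod z_center[OF i0, of j] by (intro a.I_r_closed) auto
   then show ?case using z_mult_center[OF i0 i] i prod by simp
  next
   case (sum s1 s2)
   then show ?case using a.a_closed[of "z i0 s1" "z i0 s2"] i0 by (simp add: z_add)
  qed
  then have "z i0 x : a" using x by blast
  moreover have "z i0 x = x" using z_mult_center[of i0 x \<one>] x i0 z_i0_one by simp
  ultimately show "x : a" by simp
 qed
qed

lemma ideals_bij: "bij_betw (%I. I \<inter> C) {I. ideal I R} {a. ideal a ZR}"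
 by (rule bij_betwI[where g = "%a. a \<cdot> carrier R"])
  (auto simp: contraction_ideal extension_ideal ideal_eq_extension contraction_extension)

text \<open>For central \<open>a\<close> and \<open>c\<close> the ideals \<open>R a\<close> and
  \<open>R c\<close> have their product in \<open>I\<close> as soon as \<open>a c\<close> is in
  \<open>I\<close>. Conversely an ideal is the extension of its central part, so an ideal not
  contained in \<open>I\<close> has a central element outside \<open>I\<close>.\<close>

lemma prime_ideal_iff:
 assumes I: "ideal I R"
 shows "prime_ideal I R \<longleftrightarrow> primeideal (I \<inter> C) ZR"
proof
 interpret I: ideal I R by fact
 assume P: "prime_ideal I R"
 show "primeideal (I \<inter> C) ZR"
 proof (rule primeidealI[OF contraction_ideal[OF I] ZR.is_cring])
  show "carrier ZR ~= I \<inter> C"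
  proof
   assume "carrier ZR = I \<inter> C"
   then have "C = I \<inter> C" by simp
   then have "\<one> : I" using center_closed(2) by blast
   then show False using I.one_imp_carrier P unfolding prime_ideal_def by blast
  qed
  fix a c assume ac: "a : carrier ZR" "c : carrier ZR" "a **$ZR c : I \<inter> C"
  have idl: "ideal (carrier R #> e) R" if e: "e : C" for e
  proof (rule idealI_mult)
   note [simp] = r_coset_def
   show "carrier R #> e <= carrier R" using e by auto
   show "\<zero> : carrier R #> e" using e by (auto intro!: bexI[of _ \<zero>])
   fix x y assume "x : carrier R #> e" "y : carrier R #> e"
   then obtain s t where st: "s : carrier R" "t : carrier R" "x = s ** e" "y = t ** e" by auto
   have "x \<oplus> y = (s \<oplus> t) ** e" using st e by (simp add: l_distr)
   then show "x \<oplus> y : carrier R #> e" using a_closed[OF st(1,2)] unfolding r_coset_def by blast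
  next
   fix x r assume x: "x : carrier R #> e" and r: "r : carrier R"
   then obtain s where s: "s : carrier R" "x = s ** e" by (auto simp: r_coset_def)
   have "r ** x = (r ** s) ** e" using s e r by (simp add: m_assoc)
   then show "r ** x : carrier R #> e" using m_closed[OF r s(1)] unfolding r_coset_def by blast
   have "x ** r = (s ** r) ** e" using s e r C_comm[OF e r] by (simp add: m_assoc)
   then show "x ** r : carrier R #> e" using m_closed[OF s(1) r] unfolding r_coset_def by blast
  qed
  have "(carrier R #> a) \<cdot> (carrier R #> c) <= I"
  proof
   fix x assume "x : (carrier R #> a) \<cdot> (carrier R #> c)"
   then show "x : I"
   proof (induction rule: ideal_prod.induct)
    case (prod i j)
    then obtain s t where st: "s : carrier R" "t : carrier R" "i = s ** a" "j = t ** c" by (auto simp: r_coset_def)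
    have [simp]: "a : C" "c : C" using ac by auto
    have "i ** j = s ** (t ** a) ** c" using st C_comm[of a t] by (simp add: m_assoc[symmetric]) (simp add: m_assoc)
    also have "\<dots> = (s ** t) ** (a ** c)" using st by (simp add: m_assoc)
    finally show ?case using ac st by (simp add: I.I_l_closed)
   qed (simp add: I.a_closed)
  qed
  then have "carrier R #> a <= I \<or> carrier R #> c <= I"
   using P idl ac unfolding prime_ideal_def by simp
  moreover have "e : carrier R #> e" if "e : C" for e using that by (auto simp: r_coset_def intro!: bexI[of _ \<one>])
  ultimately show "a : I \<inter> C \<or> c : I \<inter> C" using ac by auto
 qed
next
 interpret I: ideal I R by fact
 assume P: "primeideal (I \<inter> C) ZR"
 interpret P: primeideal "I \<inter> C" ZR by fact
 show "prime_ideal I R"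
  unfolding prime_ideal_def
 proof (intro conjI allI impI)
  show "ideal I R" by fact
  show "I ~= carrier R" using P.I_notcarr C_carrier by auto
  fix I1 I2 assume I12: "ideal I1 R" "ideal I2 R" "I1 \<cdot> I2 <= I"
  have sub: "A <= I" if A: "ideal A R" "A \<inter> C <= I" for A
  proof -
   have "(A \<inter> C) \<cdot> carrier R <= (I \<inter> C) \<cdot> carrier R"
   proof
    fix x assume "x : (A \<inter> C) \<cdot> carrier R"
    then show "x : (I \<inter> C) \<cdot> carrier R"
     by (induction rule: ideal_prod.induct) (use A in \<open>auto intro: ideal_prod.intros\<close>)
   qed
   then show ?thesis using ideal_eq_extension A I by simp
  qed
  show "I1 <= I \<or> I2 <= I"
  proof (rule ccontr)
   assume "\<not> ?thesis"
   then obtain a c where ac: "a : I1 \<inter> C" "a \<notin> I" "c : I2 \<inter> C" "c \<notin> I" using sub I12 by blast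
   have "a ** c : I1 \<cdot> I2" using ac by (intro ideal_prod.prod) auto
   then have "a **$ZR c : I \<inter> C" using I12 ac by auto
   then show False using P.I_prime[of a c] ac by auto
  qed
 qed
qed

text \<open>The formulas of a dual basis reduce modulo \<open>P\<close>. What remains is
  torsion-freeness over the center of the quotient: its elements lift to central elements
  \<open>c'\<close> of \<open>R\<close>, and if \<open>c' x\<close> lies in \<open>P\<close>,
  primeness of \<open>P \<inter> C\<close> puts every coordinate of \<open>x\<close> into
  \<open>P\<close>.\<close>

lemma dual_basis_quotient:
 assumes P: "prime_ideal P R"
 shows "dual_basis_domain (R Quot P) n N (%i. P +> b i) (%i k. P +> u i k) (%i k. P +> v i k) (P +> \<one>)"
proof -
 have idP: "ideal P R" using P by (simp add: prime_ideal_def)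
 interpret P: ideal P R by fact
 interpret Q: ring "R Quot P" by (rule P.quotient_is_ring)
 let ?h = "%r. P +> r"
 note hom = P.rcos_ring_hom
 have hc [simp]: "?h r : carrier (R Quot P)" if "r : carrier R" for r by (rule ring_hom_closed[OF hom that])
 have hm: "?h (r ** s) = ?h r **\<^bsub>R Quot P\<^esub> ?h s" if "r : carrier R" "s : carrier R" for r s
  using ring_hom_mult[OF hom that] .
 have h1: "?h \<one> = \<one>\<^bsub>R Quot P\<^esub>" using ring_hom_one[OF hom] .
 have h0: "?h \<zero> = \<zero>\<^bsub>R Quot P\<^esub>" using ring_hom_zero[OF hom ring_axioms Q.ring_axioms] .
 have zero_iff: "?h r = \<zero>\<^bsub>R Quot P\<^esub> \<longleftrightarrow> r : P" if "r : carrier R" for r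
  using quotient_eq_iff_same_a_r_cos[OF idP that zero_closed] that unfolding h0[symmetric] by (simp add: minus_eq)
 have hz: "elem_op (R Quot P) (N i) (%k. ?h (u i k)) (%k. ?h (v i k)) (?h r) = ?h (z i r)" if "i < n" "r : carrier R" for i r
 proof -
  have "?h (z i r) = (\<Oplus>\<^bsub>R Quot P\<^esub>k\<in>{..<N i}. ?h (u i k ** r ** v i k))"
   unfolding elem_op_def using that
   by (intro finsum_ring_hom[OF ring_axioms Q.ring_axioms hom]) auto
  also have "\<dots> = elem_op (R Quot P) (N i) (%k. ?h (u i k)) (%k. ?h (v i k)) (?h r)"
   unfolding elem_op_def using that by (intro Q.finsum_cong' refl) (auto simp: hm)
  finally show ?thesis by simp
 qed
 have hC: "?h c : ring_center (R Quot P)" if c: "c : C" for c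
 proof (rule ring_centerI)
  show "?h c : carrier (R Quot P)" using c by simp
  fix X assume "X : carrier (R Quot P)"
  then obtain x where x: "x : carrier R" "X = ?h x" by (rule P.quotient_cases)
  show "?h c **\<^bsub>R Quot P\<^esub> X = X **\<^bsub>R Quot P\<^esub> ?h c"
   using x c C_comm[OF c x(1)] hm[of c x] hm[of x c] by simp
 qed
 \<comment> \<open>For central \<open>X\<close> one has \<open>u X v = X u v\<close> term by term,
   so \<open>z i0\<close> takes a lift of \<open>X\<close> to another lift of \<open>X\<close>, and
   this one is central in \<open>R\<close>.\<close>
 have center: "\<exists>c\<in>C. X = ?h c" if X: "X : ring_center (R Quot P)" for X
 proof -
  obtain x where x: "x : carrier R" "X = ?h x" using ring_centerD(1)[OF X] by (rule P.quotient_cases)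
  have "?h (z i0 x) = (\<Oplus>\<^bsub>R Quot P\<^esub>k\<in>{..<N i0}. X **\<^bsub>R Quot P\<^esub> (?h (u i0 k) **\<^bsub>R Quot P\<^esub> ?h (v i0 k)))"
   unfolding hz[OF i0 x(1), symmetric] unfolding elem_op_def x(2)[symmetric]
  proof (intro Q.finsum_cong' refl)
   fix k assume "k : {..<N i0}"
   then have k: "u i0 k : carrier R" "v i0 k : carrier R" using i0 by auto
   show "?h (u i0 k) **\<^bsub>R Quot P\<^esub> X **\<^bsub>R Quot P\<^esub> ?h (v i0 k) = X **\<^bsub>R Quot P\<^esub> (?h (u i0 k) **\<^bsub>R Quot P\<^esub> ?h (v i0 k))"
    using k x ring_centerD(2)[OF X, of "?h (u i0 k)"] by (simp add: Q.m_assoc[symmetric])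
  qed (use x i0 in auto)
  also have "\<dots> = X **\<^bsub>R Quot P\<^esub> (\<Oplus>\<^bsub>R Quot P\<^esub>k\<in>{..<N i0}. ?h (u i0 k) **\<^bsub>R Quot P\<^esub> ?h (v i0 k))"
   using x i0 by (intro Q.finsum_rdistr[symmetric]) auto
  also have "(\<Oplus>\<^bsub>R Quot P\<^esub>k\<in>{..<N i0}. ?h (u i0 k) **\<^bsub>R Quot P\<^esub> ?h (v i0 k)) = ?h (z i0 \<one>)"
   unfolding hz[OF i0 one_closed, symmetric] unfolding elem_op_def h1 using i0 by (intro Q.finsum_cong' refl) auto
  finally have "?h (z i0 x) = X" using x by (simp add: z_i0_one h1)
  then show ?thesis using z_center[OF i0 x(1)] by blast
 qed
 have prime: "primeideal (P \<inter> C) ZR" using prime_ideal_iff[OF idP] P by simp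
 interpret PC: primeideal "P \<inter> C" ZR by (rule prime)
 show ?thesis
 proof (unfold_locales, goal_cases)
  case (5 i X)
  then show ?case using hz hC z_center by (elim P.quotient_cases) auto
 next
  case (6 X)
  then obtain x where x: "x : carrier R" "X = ?h x" by (rule P.quotient_cases)
  have "?h x = ?h (\<Oplus>i\<in>{..<n}. z i x ** b i)" by (simp add: expand1[OF x(1)])
  also have "\<dots> = (\<Oplus>\<^bsub>R Quot P\<^esub>i\<in>{..<n}. ?h (z i x ** b i))"
   using x by (intro finsum_ring_hom[OF ring_axioms Q.ring_axioms hom]) auto
  also have "\<dots> = (\<Oplus>\<^bsub>R Quot P\<^esub>i\<in>{..<n}. elem_op (R Quot P) (N i) (%k. ?h (u i k)) (%k. ?h (v i k)) X **\<^bsub>R Quot P\<^esub> ?h (b i))"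
   unfolding x(2) using x by (intro Q.finsum_cong' refl) (auto simp: hz hm)
  finally show ?case using x by (simp add: h1)
 next
  case (7 i j)
  then show ?case using dual[of i j] by (simp add: hz h0)
 next
  case (8 c X)
  then obtain c' x where cx: "c' : C" "c = ?h c'" "x : carrier R" "X = ?h x" using center P.quotient_cases by metis
  have "c' ** x : P" using 8 cx hm[of c' x] zero_iff[of "c' ** x"] by simp
  moreover have nP: "c' \<notin> P" using 8 cx zero_iff[of c'] by simp
  ultimately have "z i x : P" if i: "i < n" for i
  proof -
   have "z i (c' ** x) : P" using z_ideal[OF idP \<open>c' ** x : P\<close> i] .
   then have "c' **$ZR z i x : P \<inter> C" using z_mult_center[OF i cx(1,3)] z_center[OF i cx(3)] cx by simp
   then show ?thesis using PC.I_prime[of c' "z i x"] nP cx z_center[OF i cx(3)] by auto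
  qed
  then have "(\<Oplus>i\<in>{..<n}. z i x ** b i) : P" by (intro finsum_in_ideal[OF idP]) (auto simp: P.I_r_closed)
  then show ?case using expand1[OF cx(3)] zero_iff cx by simp
 next
  case 9
  have "\<one> \<notin> P" using P P.one_imp_carrier by (auto simp: prime_ideal_def)
  then show ?case using zero_iff by simp
 qed (use hC in \<open>auto\<close>)
qed

text \<open>The localization at a prime of the center inherits the dual basis, hence is free over
  its own center; by \<open>center_F\<close> this center is exactly the localized center that the
  definition refers to.\<close>

lemma constant_rank:
 assumes "dual_basis_domain R n N b u v \<one>"
 shows "constant_rank R C n"
 unfolding constant_rank_def Let_def
proof (intro allI impI)
 interpret D: dual_basis_domain R n N b u v "\<one>" by fact
 fix P assume "primeideal P ZR"
 then interpret P: primeideal P ZR .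
 have S: "central_frac R (C - P)"
 proof
  show "C - P <= regular_elements R" using D.C0_regular P.zero_closed by auto
  show "\<one> : C - P" using P.one_imp_carrier P.I_notcarr by auto
  show "s ** t : C - P" if "s : C - P" "t : C - P" for s t
   using P.I_prime[of s t] that by auto
  show "\<exists>s'\<in>carrier R. s ** s' : (C - P) \<inter> C" if "s : C - P" for s
   using that by (intro bexI[of _ \<one>]) auto
 qed
 interpret F: central_frac R "C - P" by (rule S)
 interpret B: dual_basis F.F n N "%i. F.emb (b i)" "%i k. F.emb (u i k)" "%i k. F.emb (v i k)" "F.emb \<one>"
  by (rule dual_basis_fraction_ring[OF S])
 have "{F.fr a s | a s. a : C & s : C - P} = B.C" unfolding F.center_F by blast
 then show "free_of_rank (F.F\<lparr>carrier := {F.fr a s | a s. a : C & s : C - P}\<rparr>) (self_module F.F) n"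
  using B.free_of_rank_self ring_hom_one[OF F.emb_hom] by simp
qed

end

section \<open>Endomorphisms over the center and the Azumaya isomorphism\<close>

context ring
begin

abbreviation (input) EndR where "EndR \<equiv> endomorphism_ring (R\<lparr>carrier := ring_center R\<rparr>) (self_module R)"

lemma EndR_carrier:
 "f : carrier EndR \<longleftrightarrow> f : carrier R \<rightarrow>\<^sub>E carrier R &
  (\<forall>x\<in>carrier R. \<forall>y\<in>carrier R. f (x \<oplus> y) = f x \<oplus> f y) &
  (\<forall>c\<in>ring_center R. \<forall>x\<in>carrier R. f (c ** x) = c ** f x)"
 by (simp add: endomorphism_ring_def linear_maps_def)

lemma EndR_simps:
 "f **$EndR g = (\<lambda>x\<in>carrier R. f (g x))" "\<one>$EndR = (\<lambda>x\<in>carrier R. x)"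
 "\<zero>$EndR = (\<lambda>x\<in>carrier R. \<zero>)" "f \<oplus>$EndR g = (\<lambda>x\<in>carrier R. f x \<oplus> g x)"
 by (simp_all add: endomorphism_ring_def compose_def)

lemma EndR_D:
 assumes "f : carrier EndR"
 shows "x : carrier R ==> f x : carrier R"
  "[|x : carrier R; y : carrier R|] ==> f (x \<oplus> y) = f x \<oplus> f y"
  "[|c : ring_center R; x : carrier R|] ==> f (c ** x) = c ** f x"
  "f : extensional (carrier R)"
 using assms unfolding EndR_carrier by (auto simp: PiE_def)

lemma EndR_I:
 assumes "!!x. x : carrier R ==> f x : carrier R"
  "!!x y. [|x : carrier R; y : carrier R|] ==> f (x \<oplus> y) = f x \<oplus> f y"
  "!!c x. [|c : ring_center R; x : carrier R|] ==> f (c ** x) = c ** f x"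
 shows "(\<lambda>x\<in>carrier R. f x) : carrier EndR"
 unfolding EndR_carrier using assms ring_centerD(1)[of _ R] by auto

lemma EndR_eqI:
 assumes "f : carrier EndR" "g : carrier EndR" "!!x. x : carrier R ==> f x = g x"
 shows "f = g"
 using extensionalityI[OF EndR_D(4)[OF assms(1)] EndR_D(4)[OF assms(2)]] assms(3) by blast

lemma EndR_closed:
 assumes "f : carrier EndR" "g : carrier EndR"
 shows "f **$EndR g : carrier EndR" "f \<oplus>$EndR g : carrier EndR"
proof -
 note f = EndR_D[OF assms(1)] and g = EndR_D[OF assms(2)]
 show "f **$EndR g : carrier EndR"
  unfolding EndR_simps by (rule EndR_I) (simp_all add: f g)
 show "f \<oplus>$EndR g : carrier EndR"
  unfolding EndR_simps
  by (rule EndR_I) (auto simp: f g r_distr ring_centerD(1) a_ac)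
qed

lemma EndR_zero_one: "\<zero>$EndR : carrier EndR" "\<one>$EndR : carrier EndR"
 unfolding EndR_simps by (rule EndR_I; simp add: ring_centerD(1))+

lemma ring_EndR: "ring EndR"
proof (rule ringI)
 note [simp] = EndR_closed EndR_zero_one
 show "abelian_group EndR"
 proof (rule abelian_groupI)
  fix f g h assume fgh: "f : carrier EndR" "g : carrier EndR" "h : carrier EndR"
  show "f \<oplus>$EndR g \<oplus>$EndR h = f \<oplus>$EndR (g \<oplus>$EndR h)"
   using fgh by (intro EndR_eqI EndR_closed) (simp_all add: EndR_simps(4) EndR_D(1) a_assoc)
 next
  fix f g assume fg: "f : carrier EndR" "g : carrier EndR"
  show "f \<oplus>$EndR g = g \<oplus>$EndR f"
   using fg by (intro EndR_eqI EndR_closed) (simp_all add: EndR_simps(4) EndR_D(1) a_comm)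
 next
  fix f assume f: "f : carrier EndR"
  show "\<zero>$EndR \<oplus>$EndR f = f"
   using f by (intro EndR_eqI EndR_closed EndR_zero_one) (simp_all add: EndR_simps(3,4) EndR_D(1))
  have m: "(\<lambda>x\<in>carrier R. \<ominus> f x) : carrier EndR"
   by (rule EndR_I) (simp_all add: EndR_D[OF f] minus_add r_minus ring_centerD(1) a_comm)
  show "\<exists>g\<in>carrier EndR. g \<oplus>$EndR f = \<zero>$EndR"
   using f m by (intro bexI[OF _ m] EndR_eqI EndR_closed EndR_zero_one) (simp_all add: EndR_simps(3,4) EndR_D(1) l_neg)
 qed simp_all
 show "Group.monoid EndR"
 proof (rule monoidI)
  fix f g h assume fgh: "f : carrier EndR" "g : carrier EndR" "h : carrier EndR"
  show "f **$EndR g **$EndR h = f **$EndR (g **$EndR h)"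
   using fgh by (intro EndR_eqI EndR_closed) (simp_all add: EndR_simps(1) EndR_D(1))
 next
  fix f assume f: "f : carrier EndR"
  show "\<one>$EndR **$EndR f = f" "f **$EndR \<one>$EndR = f"
   using f by (intro EndR_eqI EndR_closed EndR_zero_one; simp add: EndR_simps(1,2) EndR_D(1))+
 qed simp_all
 fix f g h assume fgh: "f : carrier EndR" "g : carrier EndR" "h : carrier EndR"
 show "(f \<oplus>$EndR g) **$EndR h = f **$EndR h \<oplus>$EndR g **$EndR h"
  using fgh by (intro EndR_eqI EndR_closed) (simp_all add: EndR_simps(1,4) EndR_D(1))
 show "h **$EndR (f \<oplus>$EndR g) = h **$EndR f \<oplus>$EndR h **$EndR g"
  using fgh by (intro EndR_eqI EndR_closed) (simp_all add: EndR_simps(1,4) EndR_D(1,2))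
qed

lemma EndR_finsum_eval:
 assumes "finite A" "!!i. i : A ==> f i : carrier EndR" "x : carrier R"
 shows "(\<Oplus>$EndR i\<in>A. f i) x = (\<Oplus>i\<in>A. f i x)"
proof -
 interpret E: ring EndR by (rule ring_EndR)
 show ?thesis using assms(1,2)
 proof (induction A)
  case empty
  then show ?case using assms by (simp add: EndR_simps)
 next
  case (insert a A)
  then have "(\<Oplus>$EndR i\<in>insert a A. f i) = f a \<oplus>$EndR (\<Oplus>$EndR i\<in>A. f i)"
   by (intro E.finsum_insert) auto
  moreover have "(\<Oplus>i\<in>insert a A. f i x) = f a x \<oplus> (\<Oplus>i\<in>A. f i x)"
   using insert assms(3) EndR_D(1) by (intro finsum_insert) auto
  ultimately show ?case using insert assms(3) by (simp add: EndR_simps)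
 qed
qed

end

lemma (in tensor_data) ten_finsum_left:
 assumes "finite I" "f : I \<rightarrow> carrier A" "b : carrier B"
 shows "ten (\<Oplus>$A i\<in>I. f i) b = (\<Oplus>$TR i\<in>I. ten (f i) b)"
 using assms by (induction I) (auto simp: ten_zero_left ten_add_left Pi_iff)

context azumaya_basis
begin

text \<open>The retraction is given by the dual basis: coordinates in one direction, combinations of
  the \<open>b i\<close> in the other.\<close>

lemma fg_projective_self: "fg_projective ZR (self_module R)"
 unfolding fg_projective_def
proof (intro exI[of _ n] bexI ballI)
 let ?i = "\<lambda>r\<in>carrier R. \<lambda>i\<in>{..<n}. z i r"
 let ?q = "\<lambda>c\<in>carrier (standard_free_module ZR n). \<Oplus>i\<in>{..<n}. c i ** b i"
 show "?i : linear_maps ZR (self_module R) (standard_free_module ZR n)"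
  unfolding linear_maps_def standard_free_module_def
  by (auto simp: z_center z_add z_mult_center fun_eq_iff restrict_def split: if_splits)
 have mem: "c i : C" if "c : carrier (standard_free_module ZR n)" "i < n" for c i
  using that PiE_mem[of c "{..<n}" "%_. C" i] by (simp add: standard_free_module_def)
 have terms: "(%i. c i ** b i) : {..<n} \<rightarrow> carrier R" if "c : carrier (standard_free_module ZR n)" for c
  using C_carrier[OF mem[OF that]] by (intro Pi_I) simp
 note sum_closed = finsum_closed[OF terms]
 show "?q : linear_maps ZR (standard_free_module ZR n) (self_module R)"
  unfolding linear_maps_def
 proof (intro CollectI conjI ballI)
  show "?q : carrier (standard_free_module ZR n) \<rightarrow>\<^sub>E carrier (self_module R)"
   unfolding self_module_simps by (rule restrict_PiE_iff[THEN iffD2]) (blast intro: sum_closed)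
  fix c c' assume cc: "c : carrier (standard_free_module ZR n)" "c' : carrier (standard_free_module ZR n)"
  note cC = mem[OF cc(1)] mem[OF cc(2)]
  have s: "c \<oplus>\<^bsub>standard_free_module ZR n\<^esub> c' = (\<lambda>i\<in>{..<n}. c i \<oplus> c' i)" by (simp add: standard_free_module_def)
  have sc: "(\<lambda>i\<in>{..<n}. c i \<oplus> c' i) : carrier (standard_free_module ZR n)"
   using cC by (simp add: standard_free_module_def)
  have "?q (c \<oplus>\<^bsub>standard_free_module ZR n\<^esub> c') = (\<Oplus>i\<in>{..<n}. (\<lambda>i\<in>{..<n}. c i \<oplus> c' i) i ** b i)"
   unfolding s using sc by simp
  also have "\<dots> = (\<Oplus>i\<in>{..<n}. c i ** b i \<oplus> c' i ** b i)"
  proof (intro finsum_cong' refl)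
   fix i assume i: "i : {..<n}"
   then have "c i : C" "c' i : C" using cC by simp_all
   then show "(\<lambda>i\<in>{..<n}. c i \<oplus> c' i) i ** b i = c i ** b i \<oplus> c' i ** b i" using i by (simp add: l_distr)
  qed (use terms[OF cc(1)] terms[OF cc(2)] in \<open>simp add: Pi_iff\<close>)
  also have "\<dots> = (\<Oplus>i\<in>{..<n}. c i ** b i) \<oplus> (\<Oplus>i\<in>{..<n}. c' i ** b i)"
   using terms[OF cc(1)] terms[OF cc(2)] by (rule finsum_addf)
  finally show "?q (c \<oplus>\<^bsub>standard_free_module ZR n\<^esub> c') = ?q c \<oplus>\<^bsub>self_module R\<^esub> ?q c'" using cc by simp
 next
  fix a c assume a: "a : carrier ZR" and cc: "c : carrier (standard_free_module ZR n)"
  note cC = mem[OF cc]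
  have aC: "a : C" using a by simp
  have s: "a \<odot>\<^bsub>standard_free_module ZR n\<^esub> c = (\<lambda>i\<in>{..<n}. a ** c i)" by (simp add: standard_free_module_def)
  have sc: "(\<lambda>i\<in>{..<n}. a ** c i) : carrier (standard_free_module ZR n)"
   using cC aC by (simp add: standard_free_module_def)
  have "?q (a \<odot>\<^bsub>standard_free_module ZR n\<^esub> c) = (\<Oplus>i\<in>{..<n}. (\<lambda>i\<in>{..<n}. a ** c i) i ** b i)"
   unfolding s using sc by simp
  also have "\<dots> = (\<Oplus>i\<in>{..<n}. a ** (c i ** b i))"
  proof (intro finsum_cong' refl)
   fix i assume i: "i : {..<n}"
   then have "c i : C" using cC by simp
   then show "(\<lambda>i\<in>{..<n}. a ** c i) i ** b i = a ** (c i ** b i)" using i aC by (simp add: m_assoc)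
  qed (use terms[OF cc] aC in \<open>simp add: Pi_iff\<close>)
  also have "\<dots> = a ** (\<Oplus>i\<in>{..<n}. c i ** b i)"
   using terms[OF cc] aC by (intro finsum_rdistr[symmetric]) simp_all
  finally show "?q (a \<odot>\<^bsub>standard_free_module ZR n\<^esub> c) = a \<odot>\<^bsub>self_module R\<^esub> ?q c" using cc by simp
 qed
 fix x assume "x : carrier (self_module R)"
 then have x: "x : carrier R" by simp
 have ic: "(\<lambda>i\<in>{..<n}. z i x) : carrier (standard_free_module ZR n)"
  using x z_center by (simp add: standard_free_module_def)
 have "?q (?i x) = (\<Oplus>i\<in>{..<n}. (\<lambda>i\<in>{..<n}. z i x) i ** b i)" using ic x by simp
 also have "\<dots> = (\<Oplus>i\<in>{..<n}. z i x ** b i)" using x by (intro finsum_cong' refl) auto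
 finally show "?q (?i x) = x" using expand1[OF x] by simp
qed

text \<open>Because the coordinate maps are themselves of the form
  \<open>r |-> \<Sum> u r v\<close>, the inverse of the canonical map can be written down:
  surjectivity composes an endomorphism with the expansion along the \<open>b i\<close>, and
  injectivity reads the right factors of a tensor off its action.\<close>

lemma azumaya: "azumaya R C"
proof -
 interpret E: ring EndR by (rule ring_EndR)
 let ?Op = "opposite_ring R"
 interpret Op: ring ?Op by (rule ring_opposite_ring)
 let ?f = "%a. \<lambda>c\<in>carrier R. a ** c" and ?g = "%a. \<lambda>c\<in>carrier R. c ** a"
 have fE: "?f a : carrier EndR" if a: "a : carrier R" for a
 proof (rule EndR_I)
  fix c x assume c: "c : C" and x: "x : carrier R"
  show "a ** (c ** x) = c ** (a ** x)" using C_comm[OF c a] a c x by (simp add: m_assoc[symmetric])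
 qed (use a in \<open>simp_all add: r_distr\<close>)
 have gE: "?g a : carrier EndR" if a: "a : carrier R" for a
  by (rule EndR_I) (use a in \<open>simp_all add: l_distr m_assoc\<close>)
 interpret T: tensor_target ZR id R id ?Op EndR ?f ?g
 proof unfold_locales
  show "?f : ring_hom R EndR"
  proof (rule ring_hom_memI)
   fix x y assume xy: "x : carrier R" "y : carrier R"
   show "?f (x ** y) = ?f x **$EndR ?f y" "?f (x \<oplus> y) = ?f x \<oplus>$EndR ?f y"
    using xy by (auto simp: EndR_simps m_assoc l_distr restrict_def fun_eq_iff)
  qed (use fE in \<open>auto simp: EndR_simps restrict_def fun_eq_iff\<close>)
  show "?g : ring_hom ?Op EndR"
  proof (rule ring_hom_memI)
   fix x y assume xy: "x : carrier ?Op" "y : carrier ?Op"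
   show "?g (x **\<^bsub>?Op\<^esub> y) = ?g x **$EndR ?g y" "?g (x \<oplus>\<^bsub>?Op\<^esub> y) = ?g x \<oplus>$EndR ?g y"
    using xy by (auto simp: EndR_simps m_assoc r_distr restrict_def fun_eq_iff)
  qed (use gE in \<open>auto simp: EndR_simps restrict_def fun_eq_iff\<close>)
  show "?f x **$EndR ?g y = ?g y **$EndR ?f x" if "x : carrier R" "y : carrier ?Op" for x y
   using that by (auto simp: EndR_simps m_assoc restrict_def fun_eq_iff)
  show "?f (id c) = ?g (id c)" if "c : carrier ZR" for c
   using that C_comm by (auto simp: restrict_def fun_eq_iff)
 qed auto
 obtain phi where phi: "phi : ring_hom T.TR EndR"
  and phi_ten: "!!a c. [|a : carrier R; c : carrier ?Op|] ==> phi (T.ten a c) = ?f a **$EndR ?g c"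
  using T.tensor_lift by metis
 have ten_apply: "phi (T.ten a c) x = a ** x ** c" if "a : carrier R" "c : carrier R" "x : carrier R" for a c x
  using that by (simp add: phi_ten EndR_simps m_assoc)
 have surj: "\<exists>X\<in>carrier T.TR. phi X = h" if h: "h : carrier EndR" for h
 proof -
  \<comment> \<open>An endomorphism satisfies \<open>h x = \<Sum> h (b i) (z i x)\<close>; replacing
    \<open>z i\<close> by its operators \<open>u r v\<close> gives this tensor.\<close>
  let ?X = "\<Oplus>$T.TR i\<in>{..<n}. \<Oplus>$T.TR k\<in>{..<N i}. T.ten (h (b i) ** u i k) (v i k)"
  have c1: "T.ten (h (b i) ** u i k) (v i k) : carrier T.TR" if "i < n" "k < N i" for i k
   using that EndR_D(1)[OF h] by simp
  have c2: "(\<Oplus>$T.TR k\<in>{..<N i}. T.ten (h (b i) ** u i k) (v i k)) : carrier T.TR" if "i < n" for i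
   using c1 that by (intro T.TR.finsum_closed) auto
  have X: "?X : carrier T.TR" using c2 by (intro T.TR.finsum_closed) auto
  have inner: "phi (\<Oplus>$T.TR k\<in>{..<N i}. T.ten (h (b i) ** u i k) (v i k)) x = h (b i) ** z i x"
   if i: "i < n" and x: "x : carrier R" for i x
  proof -
   have hb: "h (b i) : carrier R" using EndR_D(1)[OF h] i by simp
   have "phi (\<Oplus>$T.TR k\<in>{..<N i}. T.ten (h (b i) ** u i k) (v i k))
     = (\<Oplus>$EndR k\<in>{..<N i}. phi (T.ten (h (b i) ** u i k) (v i k)))"
    using c1 i by (intro finsum_ring_hom[OF T.TR.ring_axioms ring_EndR phi]) auto
   then have "phi (\<Oplus>$T.TR k\<in>{..<N i}. T.ten (h (b i) ** u i k) (v i k)) x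
     = (\<Oplus>$EndR k\<in>{..<N i}. phi (T.ten (h (b i) ** u i k) (v i k))) x" by simp
   also have "\<dots> = (\<Oplus>k\<in>{..<N i}. phi (T.ten (h (b i) ** u i k) (v i k)) x)"
    using c1 i x ring_hom_closed[OF phi] by (intro EndR_finsum_eval) auto
   also have "\<dots> = (\<Oplus>k\<in>{..<N i}. h (b i) ** (u i k ** x ** v i k))"
    using i x hb by (intro finsum_cong' refl) (auto simp: ten_apply m_assoc)
   also have "\<dots> = h (b i) ** z i x"
    unfolding elem_op_def using i x hb by (intro finsum_rdistr[symmetric]) auto
   finally show ?thesis .
  qed
  have "phi ?X x = h x" if x: "x : carrier R" for x
  proof -
   have "phi ?X = (\<Oplus>$EndR i\<in>{..<n}. phi (\<Oplus>$T.TR k\<in>{..<N i}. T.ten (h (b i) ** u i k) (v i k)))"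
    using c2 by (intro finsum_ring_hom[OF T.TR.ring_axioms ring_EndR phi]) auto
   then have "phi ?X x = (\<Oplus>$EndR i\<in>{..<n}. phi (\<Oplus>$T.TR k\<in>{..<N i}. T.ten (h (b i) ** u i k) (v i k))) x" by simp
   also have "\<dots> = (\<Oplus>i\<in>{..<n}. phi (\<Oplus>$T.TR k\<in>{..<N i}. T.ten (h (b i) ** u i k) (v i k)) x)"
    using c2 x ring_hom_closed[OF phi] by (intro EndR_finsum_eval) auto
   also have "\<dots> = (\<Oplus>i\<in>{..<n}. h (z i x ** b i))"
   proof (intro finsum_cong' refl)
    fix i assume "i : {..<n}"
    then have i: "i < n" by simp
    show "phi (\<Oplus>$T.TR k\<in>{..<N i}. T.ten (h (b i) ** u i k) (v i k)) x = h (z i x ** b i)"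
     using inner[OF i x] EndR_D(3)[OF h z_center[OF i x], of "b i"] C_comm[OF z_center[OF i x], of "h (b i)"]
      EndR_D(1)[OF h, of "b i"] i by simp
   qed (use x EndR_D(1)[OF h] in auto)
   also have "\<dots> = h (\<Oplus>i\<in>{..<n}. z i x ** b i)"
   proof -
    have "h (\<Oplus>i\<in>A. z i x ** b i) = (\<Oplus>i\<in>A. h (z i x ** b i))" if "finite A" "A <= {..<n}" for A
     using that
    proof (induction A)
     case empty
     then show ?case using EndR_D(3)[OF h, of \<zero> \<zero>] EndR_D(1)[OF h, of \<zero>] by simp
    next
     case (insert a A)
     have fc: "(%i. z i x ** b i) : A \<rightarrow> carrier R" using insert x by auto
     have "h (\<Oplus>i\<in>insert a A. z i x ** b i) = h (z a x ** b a \<oplus> (\<Oplus>i\<in>A. z i x ** b i))"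
      using insert x fc by (subst finsum_insert) auto
     also have "\<dots> = h (z a x ** b a) \<oplus> (\<Oplus>i\<in>A. h (z i x ** b i))"
      using insert x fc EndR_D(2)[OF h] by simp
     also have "\<dots> = (\<Oplus>i\<in>insert a A. h (z i x ** b i))"
      using insert x EndR_D(1)[OF h] by (intro finsum_insert[symmetric]) auto
     finally show ?case .
    qed
    then show ?thesis by simp
   qed
   finally show ?thesis using expand1[OF x] by simp
  qed
  then have "phi ?X = h" using ring_hom_closed[OF phi X] h by (intro EndR_eqI) auto
  then show ?thesis using X by blast
 qed
 \<comment> \<open>The left factor is expanded along the \<open>b i\<close>, and its central
   coefficients move across the tensor sign.\<close>
 have form: "\<exists>c. (\<forall>i<n. c i : carrier R) & X = (\<Oplus>$T.TR i\<in>{..<n}. T.ten (b i) (c i))"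
  if "X : carrier T.TR" for X
  using that
 proof (induction X rule: T.tensor_induct)
  case (tensor a c)
  then have c: "a : carrier R" "c : carrier R" by auto
  have "T.ten a c = T.ten (\<Oplus>i\<in>{..<n}. z i a ** b i) c" by (simp add: expand1[OF c(1)])
  also have "\<dots> = (\<Oplus>$T.TR i\<in>{..<n}. T.ten (z i a ** b i) c)"
   using c by (intro T.ten_finsum_left) auto
  also have "\<dots> = (\<Oplus>$T.TR i\<in>{..<n}. T.ten (b i) (z i a **\<^bsub>?Op\<^esub> c))"
  proof (intro T.TR.finsum_cong' refl)
   fix i assume i: "i : {..<n}"
   show "T.ten (z i a ** b i) c = T.ten (b i) (z i a **\<^bsub>?Op\<^esub> c)"
    using T.ten_balanced[of "z i a" "b i" c] z_center[of i a] i c by simp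
  qed (use c in auto)
  finally have "T.ten a c = (\<Oplus>$T.TR i\<in>{..<n}. T.ten (b i) (z i a **\<^bsub>?Op\<^esub> c))" .
  moreover have "\<forall>i<n. z i a **\<^bsub>?Op\<^esub> c : carrier R" using c by simp
  ultimately show ?case by (intro exI[of _ "%i. z i a **\<^bsub>?Op\<^esub> c"] conjI)
 next
  case (add X Y)
  then obtain c c' where cc: "\<forall>i<n. c i : carrier R" "X = (\<Oplus>$T.TR i\<in>{..<n}. T.ten (b i) (c i))"
   "\<forall>i<n. c' i : carrier R" "Y = (\<Oplus>$T.TR i\<in>{..<n}. T.ten (b i) (c' i))" by blast
  have "X \<oplus>$T.TR Y = (\<Oplus>$T.TR i\<in>{..<n}. T.ten (b i) (c i) \<oplus>$T.TR T.ten (b i) (c' i))"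
   unfolding cc(2,4) using cc(1,3) by (intro T.TR.finsum_addf[symmetric]) auto
  also have "\<dots> = (\<Oplus>$T.TR i\<in>{..<n}. T.ten (b i) (c i \<oplus> c' i))"
  proof (intro T.TR.finsum_cong' refl)
   fix i assume i: "i : {..<n}"
   show "T.ten (b i) (c i) \<oplus>$T.TR T.ten (b i) (c' i) = T.ten (b i) (c i \<oplus> c' i)"
    using T.ten_add_right[of "b i" "c i" "c' i"] cc(1,3) i by simp
  qed (use cc(1,3) in auto)
  finally have "X \<oplus>$T.TR Y = (\<Oplus>$T.TR i\<in>{..<n}. T.ten (b i) (c i \<oplus> c' i))" .
  moreover have "\<forall>i<n. c i \<oplus> c' i : carrier R" using cc(1,3) by simp
  ultimately show ?case by (intro exI[of _ "%i. c i \<oplus> c' i"] conjI)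
 qed
 have ker: "X = \<zero>$T.TR" if X: "X : carrier T.TR" "phi X = \<zero>$EndR" for X
 proof -
  obtain c where c: "!!i. i < n ==> c i : carrier R" and Xc: "X = (\<Oplus>$T.TR i\<in>{..<n}. T.ten (b i) (c i))"
   using form[OF X(1)] by blast
  have sum0: "(\<Oplus>i\<in>{..<n}. b i ** x ** c i) = \<zero>" if x: "x : carrier R" for x
  proof -
   have "phi X = (\<Oplus>$EndR i\<in>{..<n}. phi (T.ten (b i) (c i)))"
    unfolding Xc using c by (intro finsum_ring_hom[OF T.TR.ring_axioms ring_EndR phi]) auto
   then have "phi X x = (\<Oplus>i\<in>{..<n}. phi (T.ten (b i) (c i)) x)"
    using c x ring_hom_closed[OF phi] by (simp only:) (intro EndR_finsum_eval, auto)
   also have "\<dots> = (\<Oplus>i\<in>{..<n}. b i ** x ** c i)"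
    using c x by (intro finsum_cong' refl) (auto simp: ten_apply)
   finally show ?thesis using X(2) x by (simp add: EndR_simps)
  qed
  have "c j = \<zero>" if j: "j < n" for j
  proof -
   \<comment> \<open>The identity \<open>sum0\<close> is taken at \<open>x = v j k\<close>,
     multiplied by \<open>u j k\<close> on the left and summed over \<open>k\<close>; the sum
     assembles to \<open>z j (b i) c i\<close>, so duality leaves \<open>c j\<close>.\<close>
   have "\<zero> = (\<Oplus>k\<in>{..<N j}. u j k ** (\<Oplus>i\<in>{..<n}. b i ** v j k ** c i))"
    using sum0 j by (subst finsum_cong'[of _ _ "%_. \<zero>"]) auto
   also have "\<dots> = (\<Oplus>k\<in>{..<N j}. \<Oplus>i\<in>{..<n}. u j k ** b i ** v j k ** c i)"
   proof (intro finsum_cong' refl)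
    fix k assume "k : {..<N j}"
    then have k: "u j k : carrier R" "v j k : carrier R" using j by auto
    have "u j k ** (\<Oplus>i\<in>{..<n}. b i ** v j k ** c i) = (\<Oplus>i\<in>{..<n}. u j k ** (b i ** v j k ** c i))"
     using k c by (intro finsum_rdistr) auto
    also have "\<dots> = (\<Oplus>i\<in>{..<n}. u j k ** b i ** v j k ** c i)"
     using k c by (intro finsum_cong' refl) (auto simp: m_assoc)
    finally show "u j k ** (\<Oplus>i\<in>{..<n}. b i ** v j k ** c i) = (\<Oplus>i\<in>{..<n}. u j k ** b i ** v j k ** c i)" .
   qed (use j c in \<open>auto intro!: finsum_closed\<close>)
   also have "\<dots> = (\<Oplus>i\<in>{..<n}. z j (b i) ** c i)"
   proof -
    have "(\<Oplus>k\<in>A. \<Oplus>i\<in>{..<n}. u j k ** b i ** v j k ** c i) = (\<Oplus>i\<in>{..<n}. (\<Oplus>k\<in>A. u j k ** b i ** v j k) ** c i)"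
     if "finite A" "A <= {..<N j}" for A
     using that
    proof (induction A)
     case empty
     then show ?case using c by (subst finsum_cong'[of _ _ "%_. \<zero>"]) auto
    next
     case (insert a A)
     have cl: "u j a : carrier R" "v j a : carrier R" using insert j by auto
     have cA: "(\<Oplus>k\<in>A. u j k ** b i ** v j k) : carrier R" if "i < n" for i using insert j that by (intro finsum_closed) auto
     have "(\<Oplus>k\<in>insert a A. \<Oplus>i\<in>{..<n}. u j k ** b i ** v j k ** c i)
       = (\<Oplus>i\<in>{..<n}. u j a ** b i ** v j a ** c i) \<oplus> (\<Oplus>k\<in>A. \<Oplus>i\<in>{..<n}. u j k ** b i ** v j k ** c i)"
      using insert j c by (intro finsum_insert) (auto intro!: finsum_closed)
     also have "\<dots> = (\<Oplus>i\<in>{..<n}. u j a ** b i ** v j a ** c i \<oplus> (\<Oplus>k\<in>A. u j k ** b i ** v j k) ** c i)"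
      using insert j c cl cA by (subst finsum_addf) auto
     also have "\<dots> = (\<Oplus>i\<in>{..<n}. (\<Oplus>k\<in>insert a A. u j k ** b i ** v j k) ** c i)"
     proof (intro finsum_cong' refl)
      fix i assume "i : {..<n}"
      then have i: "i < n" by simp
      have "(\<Oplus>k\<in>insert a A. u j k ** b i ** v j k) = u j a ** b i ** v j a \<oplus> (\<Oplus>k\<in>A. u j k ** b i ** v j k)"
       using insert j i by (intro finsum_insert) auto
      then show "u j a ** b i ** v j a ** c i \<oplus> (\<Oplus>k\<in>A. u j k ** b i ** v j k) ** c i = (\<Oplus>k\<in>insert a A. u j k ** b i ** v j k) ** c i"
       using i c cl cA by (simp add: l_distr)
     qed (use insert j c in \<open>auto intro!: m_closed finsum_closed\<close>)
     finally show ?case .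
    qed
    then show ?thesis unfolding elem_op_def by simp
   qed
   also have "\<dots> = (\<Oplus>i\<in>{..<n}. if i = j then c j else \<zero>)"
    using c j by (intro finsum_cong' refl) (auto simp: dual)
   also have "\<dots> = c j" using j c by (intro finsum_delta) auto
   finally show ?thesis by simp
  qed
  then have "X = (\<Oplus>$T.TR i\<in>{..<n}. \<zero>$T.TR)"
   unfolding Xc
  proof (intro T.TR.finsum_cong' refl)
   fix i assume i: "i : {..<n}" and c0: "!!j. j < n ==> c j = \<zero>"
   have "T.ten (b i) \<zero> = T.ten (\<zero> ** b i) \<one>"
    using T.ten_balanced[of \<zero> "b i" \<one>] i by simp
   then show "T.ten (b i) (c i) = \<zero>$T.TR" using c0 i T.ten_zero_left[of \<one>] by simp
  qed auto
  then show ?thesis by simp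
 qed
 interpret H: ring_hom_ring T.TR EndR phi by (rule ring_hom_ringI2[OF T.TR.ring_axioms ring_EndR phi])
 have "inj_on phi (carrier T.TR)"
 proof (rule inj_onI)
  fix X Y assume XY: "X : carrier T.TR" "Y : carrier T.TR" "phi X = phi Y"
  have "phi (X \<ominus>$T.TR Y) = \<zero>$EndR" using XY by (simp add: T.TR.minus_eq E.r_neg)
  then have "X \<ominus>$T.TR Y = \<zero>$T.TR" using ker XY by simp
  then show "X = Y" using XY by simp
 qed
 then have "bij_betw phi (carrier T.TR) (carrier EndR)"
  using surj ring_hom_closed[OF phi] unfolding bij_betw_def by blast
 then have iso: "phi : ring_iso T.TR EndR" using phi by (simp add: ring_iso_def)
 have "phi (T.ten a c) = (\<lambda>x\<in>carrier R. a ** x ** c)" if "a : carrier R" "c : carrier R" for a c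
  using that by (simp add: phi_ten EndR_simps m_assoc cong: restrict_cong)
 then show ?thesis
  unfolding azumaya_def Let_def using iso ring_axioms ring_center_subring fg_projective_self by blast
qed

end

subsection \<open>Transfer of polynomial identities\<close>

lemma ring_hom_add_pow_int:
 assumes "ring R" "ring S" "h : ring_hom R S" "x : carrier R"
 shows "h (add_pow R (n::int) x) = add_pow S n (h x)"
proof -
 interpret R: ring R by fact
 interpret S: ring S by fact
 interpret H: ring_hom_ring R S h by (rule ring_hom_ringI2) (fact R.ring_axioms S.ring_axioms assms)+
 have nat: "h (add_pow R (m::nat) x) = add_pow S m (h x)" for m
  by (induction m) (use assms(4) in simp_all)
 show ?thesis
  using nat assms(4) by (cases "n \<ge> 0") (simp_all add: add_pow_int_ge add_pow_int_lt)
qed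

lemma ring_hom_foldr_mult:
 assumes "ring R" "ring S" "h : ring_hom R S" "r : UNIV \<rightarrow> carrier R"
 shows "foldr (%i a. r i **$R a) w \<one>$R : carrier R"
  "h (foldr (%i a. r i **$R a) w \<one>$R) = foldr (%i a. h (r i) **$S a) w \<one>$S"
proof -
 interpret R: ring R by fact
 interpret S: ring S by fact
 have "foldr (%i a. r i **$R a) w \<one>$R : carrier R &
  h (foldr (%i a. r i **$R a) w \<one>$R) = foldr (%i a. h (r i) **$S a) w \<one>$S"
 proof (induction w)
  case Nil
  then show ?case using ring_hom_one[OF assms(3)] by simp
 next
  case (Cons a w)
  have "r a : carrier R" using assms(4) by auto
  then show ?case using Cons ring_hom_mult[OF assms(3)] by simp
 qed
 then show "foldr (%i a. r i **$R a) w \<one>$R : carrier R"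
  "h (foldr (%i a. r i **$R a) w \<one>$R) = foldr (%i a. h (r i) **$S a) w \<one>$S" by simp_all
qed

text \<open>The common core of both transfers: along an injective homomorphism an identity is pulled
  back, along a surjective one it is pushed forward.\<close>

lemma ring_hom_evaluation:
 assumes RS: "ring R" "ring S" "h : ring_hom R S" "r : UNIV \<rightarrow> carrier R"
  and f: "(f :: nat list => int) : carrier free_algebra"
 shows "h (\<Oplus>$R w\<in>{w. f w ~= 0}. add_pow R (f w) (foldr (%i a. r i **$R a) w \<one>$R))
  = (\<Oplus>$S w\<in>{w. f w ~= 0}. add_pow S (f w) (foldr (%i a. h (r i) **$S a) w \<one>$S))"
  "(\<Oplus>$R w\<in>{w. f w ~= 0}. add_pow R (f w) (foldr (%i a. r i **$R a) w \<one>$R)) : carrier R"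
proof -
 interpret R: ring R by fact
 interpret S: ring S by fact
 have fin: "finite {w. f w ~= 0}" using f by (simp add: free_algebra_def monoid_ring_def)
 have c: "add_pow R (f w) (foldr (%i a. r i **$R a) w \<one>$R) : carrier R" for w
  using ring_hom_foldr_mult(1)[OF RS] by simp
 have cS: "foldr (%i a. h (r i) **$S a) w \<one>$S : carrier S" for w
  using ring_hom_foldr_mult[OF RS] ring_hom_closed[OF RS(3)] by metis
 show "(\<Oplus>$R w\<in>{w. f w ~= 0}. add_pow R (f w) (foldr (%i a. r i **$R a) w \<one>$R)) : carrier R"
  using c by (intro R.finsum_closed) auto
 have "h (\<Oplus>$R w\<in>{w. f w ~= 0}. add_pow R (f w) (foldr (%i a. r i **$R a) w \<one>$R))
   = (\<Oplus>$S w\<in>{w. f w ~= 0}. h (add_pow R (f w) (foldr (%i a. r i **$R a) w \<one>$R)))"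
  using c fin by (intro finsum_ring_hom[OF RS(1-3)]) auto
 also have "\<dots> = (\<Oplus>$S w\<in>{w. f w ~= 0}. add_pow S (f w) (foldr (%i a. h (r i) **$S a) w \<one>$S))"
  using ring_hom_add_pow_int[OF RS(1-3) ring_hom_foldr_mult(1)[OF RS]] ring_hom_foldr_mult(2)[OF RS] cS
  by (intro S.finsum_cong' refl) auto
 finally show "h (\<Oplus>$R w\<in>{w. f w ~= 0}. add_pow R (f w) (foldr (%i a. r i **$R a) w \<one>$R))
  = (\<Oplus>$S w\<in>{w. f w ~= 0}. add_pow S (f w) (foldr (%i a. h (r i) **$S a) w \<one>$S))" .
qed

lemma PI_ring_inj:
 assumes "ring R" and h: "h : ring_hom R S" "inj_on h (carrier R)" and PI: "PI_ring S"
 shows "PI_ring R"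
proof -
 have S: "ring S" using PI by (simp add: PI_ring_def)
 obtain f :: "nat list => int" where f: "f : carrier free_algebra"
  and w: "\<exists>w. f w = 1 & (\<forall>v. f v ~= 0 --> length v \<le> length w)"
  and id: "\<forall>r\<in>UNIV \<rightarrow> carrier S. (\<Oplus>$S w\<in>{w. f w ~= 0}. add_pow S (f w) (foldr (%i a. r i **$S a) w \<one>$S)) = \<zero>$S"
  using PI unfolding PI_ring_def by blast
 have "(\<Oplus>$R w\<in>{w. f w ~= 0}. add_pow R (f w) (foldr (%i a. r i **$R a) w \<one>$R)) = \<zero>$R" (is "?x = _")
  if r: "r : UNIV \<rightarrow> carrier R" for r
 proof -
  have "(%i. h (r i)) : UNIV \<rightarrow> carrier S" using r ring_hom_closed[OF h(1)] by auto
  from bspec[OF id this] have "h ?x = \<zero>$S"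
   using ring_hom_evaluation(1)[OF assms(1) S h(1) r f] by simp
  then have "h ?x = h \<zero>$R" using ring_hom_zero[OF h(1) assms(1) S] by simp
  then show ?thesis
   using inj_onD[OF h(2)] ring_hom_evaluation(2)[OF assms(1) S h(1) r f] ring.ring_simprules(2)[OF assms(1)] by blast
 qed
 then show ?thesis unfolding PI_ring_def using f w assms(1) by blast
qed

lemma PI_ring_surj:
 assumes "ring S" and h: "h : ring_hom R S" "h ` carrier R = carrier S" and PI: "PI_ring R"
 shows "PI_ring S"
proof -
 have R: "ring R" using PI by (simp add: PI_ring_def)
 obtain f :: "nat list => int" where f: "f : carrier free_algebra"
  and w: "\<exists>w. f w = 1 & (\<forall>v. f v ~= 0 --> length v \<le> length w)"
  and id: "\<forall>r\<in>UNIV \<rightarrow> carrier R. (\<Oplus>$R w\<in>{w. f w ~= 0}. add_pow R (f w) (foldr (%i a. r i **$R a) w \<one>$R)) = \<zero>$R"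
  using PI unfolding PI_ring_def by blast
 have "(\<Oplus>$S w\<in>{w. f w ~= 0}. add_pow S (f w) (foldr (%i a. r i **$S a) w \<one>$S)) = \<zero>$S"
  if r: "r : UNIV \<rightarrow> carrier S" for r
 proof -
  have "\<forall>i. \<exists>x\<in>carrier R. h x = r i"
  proof
   fix i
   have "r i : h ` carrier R" using r h(2) by auto
   then show "\<exists>x\<in>carrier R. h x = r i" by auto
  qed
  then obtain r' where r': "!!i. r' i : carrier R" "!!i. h (r' i) = r i" by metis
  then have rr: "r' : UNIV \<rightarrow> carrier R" by auto
  show ?thesis
   using ring_hom_evaluation(1)[OF R assms(1) h(1) rr f] bspec[OF id rr] ring_hom_zero[OF h(1) R assms(1)]
   by (simp add: r'(2))
 qed
 then show ?thesis unfolding PI_ring_def using f w assms(1) by blast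
qed

subsection \<open>Tensor products with a ring of fractions\<close>

text \<open>Since all of \<open>B\<close> consists of fractions, denominators can be collected and
  every tensor becomes a single \<open>ten a (inv (\<beta> w))\<close>. If such a tensor maps to
  zero, multiplying by the image of \<open>\<beta> w\<close> gives \<open>f a = 0\<close>, hence
  \<open>a = 0\<close>.\<close>

lemma (in tensor_target) tensor_localization:
 assumes Z_mult: "!!w w'. [|w : carrier Z; w' : carrier Z|] ==> w **$Z w' : carrier Z"
  and \<beta>_mult: "!!w w'. [|w : carrier Z; w' : carrier Z|] ==> \<beta> (w **$Z w') = \<beta> w **$B \<beta> w'"
  and B_comm: "!!b b'. [|b : carrier B; b' : carrier B|] ==> b **$B b' = b' **$B b"
  and B_frac: "!!b. b : carrier B ==> \<exists>z\<in>carrier Z. \<exists>w\<in>carrier Z. \<beta> w : Units B & b = \<beta> z **$B inv$B \<beta> w"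
  and f_inj: "inj_on f (carrier A)"
  and surj: "!!t. t : carrier T ==> \<exists>a\<in>carrier A. \<exists>w\<in>carrier Z. \<beta> w : Units B & t = f a **$T g (inv$B \<beta> w)"
 obtains phi where "phi : ring_iso TR T" "!!a b. [|a : carrier A; b : carrier B|] ==> phi (ten a b) = f a **$T g b"
proof -
 obtain phi where phi: "phi : ring_hom TR T" and phi_ten: "!!a b. [|a : carrier A; b : carrier B|] ==> phi (ten a b) = f a **$T g b"
  using tensor_lift by metis
 have expand: "ten a (inv$B \<beta> w) = ten (\<alpha> w' **$A a) (inv$B \<beta> w' **$B inv$B \<beta> w)"
  if "a : carrier A" "w : carrier Z" "w' : carrier Z" "\<beta> w : Units B" "\<beta> w' : Units B" for a w w'
 proof -
  have "\<beta> w' **$B (inv$B \<beta> w' **$B inv$B \<beta> w) = inv$B \<beta> w"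
   using that \<beta>_closed by (simp add: B.m_assoc[symmetric])
  then show ?thesis using ten_balanced[of w' a "inv$B \<beta> w' **$B inv$B \<beta> w"] that by simp
 qed
 have inv_mult: "inv$B \<beta> w' **$B inv$B \<beta> w = inv$B \<beta> (w **$Z w') & \<beta> (w **$Z w') : Units B"
  if "w : carrier Z" "w' : carrier Z" "\<beta> w : Units B" "\<beta> w' : Units B" for w w'
 proof -
  have c: "\<beta> w : carrier B" "\<beta> w' : carrier B" using that \<beta>_closed by auto
  have "(\<beta> w **$B \<beta> w') **$B (inv$B \<beta> w' **$B inv$B \<beta> w) = \<beta> w **$B (\<beta> w' **$B inv$B \<beta> w') **$B inv$B \<beta> w"
   using that c by (simp add: B.m_assoc del: B.Units_r_inv)
  then have 1: "(\<beta> w **$B \<beta> w') **$B (inv$B \<beta> w' **$B inv$B \<beta> w) = \<one>$B" using that c by simp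
  then have 2: "(inv$B \<beta> w' **$B inv$B \<beta> w) **$B (\<beta> w **$B \<beta> w') = \<one>$B"
   using B_comm[of "\<beta> w **$B \<beta> w'" "inv$B \<beta> w' **$B inv$B \<beta> w"] that c by simp
  show ?thesis
   using B.inv_char[OF _ _ 1 2] that c by (simp add: \<beta>_mult)
 qed
 have form: "\<exists>a\<in>carrier A. \<exists>w\<in>carrier Z. \<beta> w : Units B & X = ten a (inv$B \<beta> w)" if "X : carrier TR" for X
  using that
 proof (induction X rule: tensor_induct)
  case (tensor a b)
  then obtain z w where zw: "z : carrier Z" "w : carrier Z" "\<beta> w : Units B" "b = \<beta> z **$B inv$B \<beta> w"
   using B_frac by blast
  then have "ten a b = ten (\<alpha> z **$A a) (inv$B \<beta> w)" using ten_balanced[of z a "inv$B \<beta> w"] tensor by simp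
  moreover have "\<alpha> z **$A a : carrier A" using \<alpha>_closed zw tensor by simp
  ultimately show ?case using zw by blast
 next
  case (add X Y)
  then obtain a w a' w' where aw: "a : carrier A" "w : carrier Z" "\<beta> w : Units B" "X = ten a (inv$B \<beta> w)"
   "a' : carrier A" "w' : carrier Z" "\<beta> w' : Units B" "Y = ten a' (inv$B \<beta> w')" by blast
  let ?i = "inv$B \<beta> w' **$B inv$B \<beta> w"
  have "X = ten (\<alpha> w' **$A a) ?i" using expand aw by blast
  moreover have "Y = ten (\<alpha> w **$A a') ?i"
   using expand[of a' w' w] B_comm[of "inv$B \<beta> w'" "inv$B \<beta> w"] aw by simp
  ultimately have "X \<oplus>$TR Y = ten (\<alpha> w' **$A a \<oplus>$A \<alpha> w **$A a') ?i"
   using aw \<alpha>_closed by (simp add: ten_add_left)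
  moreover have "\<alpha> w' **$A a \<oplus>$A \<alpha> w **$A a' : carrier A" using aw \<alpha>_closed by simp
  ultimately show ?case using inv_mult[of w w'] aw Z_mult[of w w'] by metis
 qed
 interpret H: ring_hom_ring TR T phi by (rule ring_hom_ringI2[OF TR.ring_axioms T.ring_axioms phi])
 have f0: "f \<zero>$A = \<zero>$T" using ring_hom_zero[OF f_hom A.ring_axioms T.ring_axioms] .
 have ker: "X = \<zero>$TR" if X: "X : carrier TR" "phi X = \<zero>$T" for X
 proof -
  obtain a w where aw: "a : carrier A" "w : carrier Z" "\<beta> w : Units B" "X = ten a (inv$B \<beta> w)"
   using form X by blast
  have "f a = f a **$T (g (inv$B \<beta> w) **$T g (\<beta> w))"
   using aw ring_hom_mult[OF g_hom, of "inv$B \<beta> w" "\<beta> w", symmetric] ring_hom_one[OF g_hom] \<beta>_closed by simp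
  also have "\<dots> = phi X **$T g (\<beta> w)" using aw \<beta>_closed by (simp add: phi_ten T.m_assoc)
  also have "\<dots> = \<zero>$T" using X aw \<beta>_closed by simp
  finally have "a = \<zero>$A" using inj_onD[OF f_inj, of a "\<zero>$A"] f0 aw by simp
  then show ?thesis using aw ten_zero_left by simp
 qed
 have "inj_on phi (carrier TR)"
 proof (rule inj_onI)
  fix X Y assume XY: "X : carrier TR" "Y : carrier TR" "phi X = phi Y"
  have "phi (X \<ominus>$TR Y) = \<zero>$T" using XY by (simp add: TR.minus_eq T.r_neg)
  then have "X \<ominus>$TR Y = \<zero>$TR" using ker XY by simp
  then show "X = Y" using XY by simp
 qed
 moreover have "\<exists>X\<in>carrier TR. phi X = t" if t: "t : carrier T" for t
 proof -
  obtain a w where aw: "a : carrier A" "w : carrier Z" "\<beta> w : Units B" "t = f a **$T g (inv$B \<beta> w)"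
   using surj[OF t] by blast
  then have "phi (ten a (inv$B \<beta> w)) = t" by (simp add: phi_ten)
  then show ?thesis using aw by (intro bexI[of _ "ten a (inv$B \<beta> w)"]) auto
 qed
 ultimately have "bij_betw phi (carrier TR) (carrier T)"
  using ring_hom_closed[OF phi] unfolding bij_betw_def by blast
 then show ?thesis using that phi phi_ten by (simp add: ring_iso_def)
qed

subsection \<open>The field of fractions of the center\<close>

context dual_basis_domain
begin

sublocale ZC: cring ZR by (rule cring_center)

lemma ring_center_ZR: "ring_center ZR = C"
proof (intro equalityI subsetI)
 fix c assume "c : ring_center ZR"
 from ring_centerD(1)[OF this] show "c : C" by simp
next
 fix c assume c: "c : C"
 show "c : ring_center ZR" using c by (intro ring_centerI ZC.m_comm) simp_all
qed

lemma central_frac_center: "central_frac ZR C0"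
proof
 show "C0 <= regular_elements ZR"
 proof
  fix c assume c: "c : C0"
  show "c : regular_elements ZR"
  proof (rule regular_elementsI)
   show "c : carrier ZR" using c by simp
   fix a assume a: "a : carrier ZR"
   show "a = \<zero>$ZR" if "c **$ZR a = \<zero>$ZR" using center_cancel[of c a] c a that by simp
   show "a = \<zero>$ZR" if "a **$ZR c = \<zero>$ZR" using center_cancel[of c a] C_comm[of c a] c a that by simp
  qed
 qed
 show "\<one>$ZR : C0" using one_nonzero by simp
 show "s **$ZR t : C0" if "s : C0" "t : C0" for s t
  using center_cancel[of s t] that by auto
 show "\<exists>s'\<in>carrier ZR. s **$ZR s' : C0 \<inter> ring_center ZR" if "s : C0" for s
  unfolding ring_center_ZR using that by (intro bexI[of _ \<one>]) auto
qed

sublocale KF: central_frac ZR C0 by (rule central_frac_center)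
sublocale QF: central_frac R "regular_elements R" by (rule central_frac_regular)

abbreviation K where "K \<equiv> KF.F"
abbreviation Q where "Q \<equiv> QF.F"

text \<open>Reads a fraction of central elements as a fraction over the whole ring. By
  \<open>KQ_fr\<close> every member of the class contributes the same fraction, so the union is one
  class.\<close>

definition KQ where "KQ X = (\<Union>(z, w)\<in>X. QF.fr z w)"

lemma K_cases:
 assumes "X : carrier K"
 obtains a w where "a : C" "w : C0" "X = KF.fr a w"
 using assms by (elim KF.frac_cases) (auto simp: ring_center_ZR)

lemma KQ_fr:
 assumes "a : C" "w : C0"
 shows "KQ (KF.fr a w) = QF.fr a w"
proof -
 have w: "w : regular_elements R" "w : C" using assms C0_regular by auto
 have "QF.fr a' w' = QF.fr a w" if "(a', w') : KF.fr a w" for a' w'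
 proof -
  have "a' : C" "w' : C0" "a' ** w = a ** w'"
   using that assms KF.mem_fr_central_iff[of a w a' w'] by (auto simp: ring_center_ZR)
  moreover have "w' : regular_elements R" using \<open>w' : C0\<close> C0_regular by blast
  ultimately show ?thesis using QF.fr_eq_central_iff[of a' a w' w] w assms by simp
 qed
 moreover have "(a, w) : KF.fr a w"
  using assms by (subst KF.mem_fr_central_iff) (auto simp: ring_center_ZR)
 ultimately show ?thesis unfolding KQ_def by blast
qed

lemma KQ_hom: "KQ : ring_hom K Q"
proof (rule ring_hom_memI)
 have reg: "w : regular_elements R" if "w : C0" for w using that C0_regular by blast
 show "KQ X : carrier Q" if X: "X : carrier K" for X
  using X by (rule K_cases) (simp add: KQ_fr reg)
 fix X Y assume "X : carrier K" "Y : carrier K"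
 then obtain a w a' w' where aw: "a : C" "w : C0" "X = KF.fr a w" "a' : C" "w' : C0" "Y = KF.fr a' w'"
  by (elim K_cases) metis
 have ww: "w ** w' : C0" using KF.S_mult[of w w'] aw by simp
 have "X **$K Y = KF.fr (a ** a') (w ** w')"
  using KF.fr_mult[of a a' w w'] aw by (simp add: ring_center_ZR)
 then show "KQ (X **$K Y) = KQ X **$Q KQ Y"
  using aw ww reg by (simp add: KQ_fr QF.fr_mult)
 have "X \<oplus>$K Y = KF.fr (a ** w' \<oplus> a' ** w) (w ** w')"
  using KF.fr_add[of a a' w w'] aw by (simp add: ring_center_ZR)
 then show "KQ (X \<oplus>$K Y) = KQ X \<oplus>$Q KQ Y"
  using aw ww reg by (simp add: KQ_fr QF.fr_add)
next
 have "KQ (KF.fr \<one> \<one>) = QF.fr \<one> \<one>" using one_nonzero by (intro KQ_fr) auto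
 then show "KQ \<one>$K = \<one>$Q" by (simp add: KF.F_one QF.F_one)
qed

text \<open>A central fraction has a central numerator and a central regular denominator; the latter
  is nonzero, so the same pair defines an element of \<open>K\<close>.\<close>

lemma KQ_image: "KQ ` carrier K = ring_center Q"
proof (intro equalityI subsetI)
 fix X assume "X : KQ ` carrier K"
 then obtain Y where Y: "Y : carrier K" "X = KQ Y" by blast
 from Y(1) obtain a w where "a : C" "w : C0" "Y = KF.fr a w" by (rule K_cases)
 then have "a : C" "w : C0" "X = QF.fr a w" using KQ_fr Y by simp_all
 then show "X : ring_center Q" unfolding QF.center_F using C0_regular by blast
next
 fix X assume "X : ring_center Q"
 then obtain a w where aw: "a : C" "w : regular_elements R" "w : C" "X = QF.fr a w" unfolding QF.center_F by blast
 have "w ~= \<zero>" using aw(2) regular_elementsD(2)[OF aw(2), of \<one>] one_nonzero by auto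
 then have "w : C0" using aw by simp
 then have "X = KQ (KF.fr a w)" "KF.fr a w : carrier K" using aw KQ_fr by simp_all
 then show "X : KQ ` carrier K" by blast
qed

lemma field_K: "field K"
proof -
 interpret KR: ring K by (rule KF.ring_F)
 interpret KC: cring K
 proof
  fix X Y assume "X : carrier K" "Y : carrier K"
  then obtain a w a' w' where aw: "a : C" "w : C0" "X = KF.fr a w" "a' : C" "w' : C0" "Y = KF.fr a' w'"
   by (elim K_cases) metis
  then show "X **$K Y = Y **$K X"
   using KF.fr_mult[of a a' w w'] KF.fr_mult[of a' a w' w] C_comm[of a a'] C_comm[of w w'] by (simp add: ring_center_ZR)
 qed
 have ne: "\<one>$K ~= \<zero>$K"
  using one_nonzero KF.fr_eq_central_iff[of \<one> \<zero> \<one> \<one>] by (simp add: KF.F_one KF.F_zero ring_center_ZR)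
 show ?thesis
 proof (rule KC.cring_fieldI2[OF ne[symmetric]])
  fix X assume X: "X : carrier K" "X ~= \<zero>$K"
  then obtain a w where aw: "a : C" "w : C0" "X = KF.fr a w" by (elim K_cases)
  have "a ~= \<zero>"
   using X(2) aw one_nonzero KF.fr_eq_central_iff[of a \<zero> w \<one>] by (auto simp: KF.F_zero ring_center_ZR)
  then have a0: "a : C0" using aw by simp
  have "KF.fr a w **$K KF.fr w a = KF.fr (a ** w) (w ** a)"
   using KF.fr_mult[of a w w a] aw a0 by (simp add: ring_center_ZR)
  also have "\<dots> = KF.fr \<one> \<one>"
   using KF.fr_eq_central_iff[of "a ** w" \<one> "w ** a" \<one>] KF.S_mult[of w a] aw a0 one_nonzero C_comm[of a w]
   by (simp add: ring_center_ZR)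
  finally have "X **$K KF.fr w a = \<one>$K" by (simp add: aw KF.F_one)
  then show "\<exists>Y\<in>carrier K. X **$K Y = \<one>$K" using aw a0 by (intro bexI[of _ "KF.fr w a"]) auto
 qed
qed

lemma central_simple_algebra: "central_simple_algebra K KQ Q n"
 unfolding central_simple_algebra_def KQ_image
 using field_K KQ_hom fraction_ring_dimension[OF central_frac_regular C0_regular] by blast

end


section \<open>Subrings of a type class ring as ring records\<close>

text \<open>A bridge between two styles: identities are computed in a type class ring, while ideals,
  quotients and dimension are formulated for records with a carrier.\<close>

definition ring_on :: "'a::ring_1 set => 'a ring" where
 "ring_on W = \<lparr>carrier = W, mult = (*), one = 1, zero = 0, add = (+)\<rparr>"

lemma ring_on_simps [simp]:
 "carrier (ring_on W) = W" "x **\<^bsub>ring_on W\<^esub> y = x * y" "\<one>\<^bsub>ring_on W\<^esub> = 1"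
 "\<zero>\<^bsub>ring_on W\<^esub> = 0" "x \<oplus>\<^bsub>ring_on W\<^esub> y = x + y"
 by (simp_all add: ring_on_def)

definition subring_set :: "'a::ring_1 set => bool" where
 "subring_set W \<longleftrightarrow> 1 : W & (\<forall>x\<in>W. \<forall>y\<in>W. x - y : W & x * y : W)"

lemma subring_setD:
 assumes "subring_set W"
 shows "1 : W" "0 : W" "x : W ==> y : W ==> x - y : W" "x : W ==> y : W ==> x * y : W"
  "x : W ==> - x : W" "x : W ==> y : W ==> x + y : W" "x : W ==> x ^ k : W"
proof -
 show 1: "1 : W" and d: "!!x y. x : W ==> y : W ==> x - y : W" and m: "!!x y. x : W ==> y : W ==> x * y : W"
  using assms by (auto simp: subring_set_def)
 show 0: "0 : W" using d[OF 1 1] by simp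
 show n: "!!x. x : W ==> - x : W" using d[OF 0] by simp
 show "x : W ==> y : W ==> x + y : W" using d[OF _ n, of x y] by simp
 show "x : W ==> x ^ k : W" by (induction k) (auto simp: 1 m)
qed

lemma subring_set_UNIV [simp]: "subring_set UNIV"
 by (simp add: subring_set_def)

lemma ring_ring_on:
 assumes "subring_set W" shows "ring (ring_on W)"
proof (rule ringI)
 note [simp] = subring_setD[OF assms]
 show "abelian_group (ring_on W)"
  by (rule abelian_groupI) (auto simp: add_ac intro: bexI[of _ "- _"])
 show "Group.monoid (ring_on W)"
  by (rule monoidI) (auto simp: mult.assoc)
qed (auto simp: algebra_simps)

lemma finsum_ring_on:
 assumes "subring_set W" "finite A" "!!i. i : A ==> f i : W"
 shows "(\<Oplus>\<^bsub>ring_on W\<^esub>i\<in>A. f i) = (\<Sum>i\<in>A. f i)"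
proof -
 interpret ring "ring_on W" by (rule ring_ring_on[OF assms(1)])
 show ?thesis using assms(2,3)
  by (induction A) (simp_all add: Pi_iff)
qed

lemma add_pow_ring_on:
 assumes "subring_set W" "x : W"
 shows "add_pow (ring_on W) (n::int) x = of_int n * x"
proof -
 interpret ring "ring_on W" by (rule ring_ring_on[OF assms(1)])
 have nat: "add_pow (ring_on W) (m::nat) x = of_nat m * x" for m
  by (induction m) (simp_all add: distrib_right add.commute)
 have neg: "\<ominus>\<^bsub>ring_on W\<^esub> y = - y" if "y : W" for y
  using that subring_setD(5)[OF assms(1)] by (intro minus_equality) auto
 have "of_nat m * x : W" for m using assms
  by (induction m) (auto simp: subring_setD distrib_right)
 then show ?thesis
  by (cases "n \<ge> 0") (simp_all add: add_pow_int_ge add_pow_int_lt nat neg del: of_nat_nat, simp_all)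
qed

subsection \<open>The standard identity\<close>

text \<open>The value at \<open>r\<close> of the standard polynomial of degree \<open>m\<close>,
  familiar from the theorem of Amitsur and Levitzki.\<close>

definition standard_sum :: "nat => (nat => 'a::ring_1) => 'a" where
 "standard_sum m r = (\<Sum>\<pi> | \<pi> permutes {..<m}. of_int (sign \<pi>) * prod_list (map (r \<circ> \<pi>) [0..<m]))"

text \<open>Composition with the transposition of \<open>i\<close> and \<open>j\<close> reverses
  every sign and keeps every product, so the sum equals its own negative.\<close>

lemma standard_sum_alternating:
 fixes r :: "nat => 'a::ring_1"
 assumes ij: "i < m" "j < m" "i ~= j" "r i = r j" and two: "!!x::'a. x + x = 0 ==> x = 0"
 shows "standard_sum m r = 0"
proof -
 define \<tau> where "\<tau> = transpose i j"
 have \<tau>: "\<tau> permutes {..<m}" using ij by (simp add: \<tau>_def permutes_swap_id)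
 have r\<tau>: "r \<circ> \<tau> = r" using ij by (auto simp: \<tau>_def fun_eq_iff transpose_def)
 have sg: "sign (\<tau> \<circ> \<pi>) = - sign \<pi>" if "\<pi> permutes {..<m}" for \<pi>
  using that \<tau> ij sign_compose[of \<tau> \<pi>] permutation_permutes by (auto simp: \<tau>_def sign_swap_id permutation_swap_id)
 have "standard_sum m r = (\<Sum>\<pi> | \<pi> permutes {..<m}. of_int (sign (\<tau> \<circ> \<pi>)) * prod_list (map (r \<circ> (\<tau> \<circ> \<pi>)) [0..<m]))"
  unfolding standard_sum_def by (rule setum_permutations_compose_left[OF \<tau>])
 also have "\<dots> = (\<Sum>\<pi> | \<pi> permutes {..<m}. - (of_int (sign \<pi>) * prod_list (map (r \<circ> \<pi>) [0..<m])))"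
  using sg r\<tau> by (intro sum.cong refl) (simp add: comp_assoc[symmetric])
 also have "\<dots> = - standard_sum m r" by (simp add: standard_sum_def sum_negf)
 finally show ?thesis using two by (metis add.right_inverse)
qed

lemma prod_list_commute:
 fixes c :: "'a::ring_1"
 assumes "!!x. x : set xs ==> c * x = x * c"
 shows "c * prod_list xs = prod_list xs * c"
 using assms
proof (induction xs)
 case (Cons x xs)
 have "c * (x * prod_list xs) = x * (c * prod_list xs)" using Cons.prems[of x] by (simp add: mult.assoc[symmetric])
 then show ?case using Cons by (simp add: mult.assoc)
qed simp

text \<open>The argument at \<open>k\<close> occurs once in each product, which thus has the form
  \<open>A x B\<close> with \<open>A\<close> and \<open>B\<close> built from the other arguments.
  The coefficients commute with these and can be pulled to the front.\<close>

lemma standard_sum_linear: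
 fixes r :: "nat => 'a::ring_1"
 assumes k: "k < m" and fin: "finite J"
  and comm: "!!i j. [|i < m; i ~= k; j : J|] ==> c j * r i = r i * c j"
 shows "standard_sum m (r(k := \<Sum>j\<in>J. c j * b j)) = (\<Sum>j\<in>J. c j * standard_sum m (r(k := b j)))"
proof -
 have "\<exists>A B. (\<forall>x. prod_list (map (r(k := x) \<circ> \<pi>) [0..<m]) = A * x * B) & (\<forall>j\<in>J. c j * A = A * c j)"
  if \<pi>: "\<pi> permutes {..<m}" for \<pi>
 proof -
  have "k : set (map \<pi> [0..<m])" using permutes_image[OF \<pi>] k by (metis atLeast_upt lessThan_iff list.set_map)
  then obtain ys zs where s: "map \<pi> [0..<m] = ys @ k # zs" by (meson split_list)
  have d: "distinct (map \<pi> [0..<m])" using permutes_inj_on[OF \<pi>] by (simp add: distinct_map)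
  have kn: "k \<notin> set ys" "k \<notin> set zs" using d unfolding s by auto
  have lt: "i < m" if "i : set ys" for i
  proof -
   have "i : set (map \<pi> [0..<m])" unfolding s using that by simp
   then obtain i' where "i' < m" "i = \<pi> i'" by auto
   then show ?thesis using permutes_in_image[OF \<pi>, of i'] by simp
  qed
  have "prod_list (map (r(k := x) \<circ> \<pi>) [0..<m]) = prod_list (map r ys) * x * prod_list (map r zs)" for x
  proof -
   have "map (r(k := x) \<circ> \<pi>) [0..<m] = map (r(k := x)) (map \<pi> [0..<m])" by simp
   also have "\<dots> = map (r(k := x)) (ys @ k # zs)" by (simp only: s)
   also have "\<dots> = map r ys @ x # map r zs" using kn by simp
   finally show ?thesis by (simp add: mult.assoc)
  qed
  moreover have "c j * prod_list (map r ys) = prod_list (map r ys) * c j" if "j : J" for j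
   using comm lt kn that by (intro prod_list_commute) auto
  ultimately show ?thesis by blast
 qed
 then obtain A B where AB: "!!\<pi> x. \<pi> permutes {..<m} ==> prod_list (map (r(k := x) \<circ> \<pi>) [0..<m]) = A \<pi> * x * B \<pi>"
  and comA: "!!\<pi> j. \<pi> permutes {..<m} ==> j : J ==> c j * A \<pi> = A \<pi> * c j" by metis
 have "standard_sum m (r(k := \<Sum>j\<in>J. c j * b j)) = (\<Sum>\<pi> | \<pi> permutes {..<m}. \<Sum>j\<in>J. c j * (of_int (sign \<pi>) * (A \<pi> * b j * B \<pi>)))"
  unfolding standard_sum_def
 proof (intro sum.cong refl)
  fix \<pi> assume "\<pi> : {\<pi>. \<pi> permutes {..<m}}"
  then have \<pi>: "\<pi> permutes {..<m}" by simp
  have "of_int (sign \<pi>) * prod_list (map (r(k := \<Sum>j\<in>J. c j * b j) \<circ> \<pi>) [0..<m])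
    = (\<Sum>j\<in>J. of_int (sign \<pi>) * (A \<pi> * (c j * b j) * B \<pi>))"
   unfolding AB[OF \<pi>] by (simp add: sum_distrib_left sum_distrib_right)
  also have "\<dots> = (\<Sum>j\<in>J. c j * (of_int (sign \<pi>) * (A \<pi> * b j * B \<pi>)))"
  proof (intro sum.cong refl)
   fix j assume j: "j : J"
   have "A \<pi> * (c j * b j) = c j * (A \<pi> * b j)" using comA[OF \<pi> j] by (simp add: mult.assoc[symmetric])
   moreover have "of_int (sign \<pi>) * (c j * x) = c j * (of_int (sign \<pi>) * x)" for x :: 'a
    by (metis mult.assoc mult_of_int_commute)
   ultimately show "of_int (sign \<pi>) * (A \<pi> * (c j * b j) * B \<pi>) = c j * (of_int (sign \<pi>) * (A \<pi> * b j * B \<pi>))"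
    by (simp add: mult.assoc)
  qed
  finally show "of_int (sign \<pi>) * prod_list (map (r(k := \<Sum>j\<in>J. c j * b j) \<circ> \<pi>) [0..<m])
    = (\<Sum>j\<in>J. c j * (of_int (sign \<pi>) * (A \<pi> * b j * B \<pi>)))" .
 qed
 also have "\<dots> = (\<Sum>j\<in>J. \<Sum>\<pi> | \<pi> permutes {..<m}. c j * (of_int (sign \<pi>) * (A \<pi> * b j * B \<pi>)))"
  by (rule sum.swap)
 also have "\<dots> = (\<Sum>j\<in>J. c j * standard_sum m (r(k := b j)))"
  unfolding standard_sum_def sum_distrib_left by (intro sum.cong refl) (simp add: AB)
 finally show ?thesis .
qed

text \<open>A multilinear alternating expression in \<open>n + 1\<close> arguments vanishes on
  anything spanned by \<open>n\<close> elements over commuting scalars: expanding one argument after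
  another leaves only members of \<open>b\<close>, and two of them coincide by the pigeonhole
  principle.\<close>

lemma standard_identity:
 fixes W :: "'a::ring_1 set" and b :: "nat => 'a"
 assumes b: "!!j. j < n ==> b j : W"
  and span: "!!w. w : W ==> \<exists>c. (\<forall>j<n. \<forall>w'\<in>W. c j * w' = w' * c j) & w = (\<Sum>j<n. c j * b j)"
  and two: "!!x::'a. x + x = 0 ==> x = 0" and r: "!!i. i < Suc n ==> r i : W"
 shows "standard_sum (Suc n) r = 0"
proof -
 have "standard_sum (Suc n) r = 0"
  \<comment> \<open>Induction on the number \<open>k\<close> of leading arguments still to be
    expanded; those from \<open>k\<close> on already belong to the spanning family.\<close>
  if "k \<le> Suc n" "\<forall>i<Suc n. r i : W" "\<forall>i<Suc n. k \<le> i --> r i : b ` {..<n}" for k r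
  using that
 proof (induction k arbitrary: r)
  case 0
  have "\<not> inj_on r {..<Suc n}"
  proof
   assume "inj_on r {..<Suc n}"
   then have "card (r ` {..<Suc n}) = Suc n" by (simp add: card_image)
   moreover have "card (r ` {..<Suc n}) \<le> card (b ` {..<n})" using 0 by (intro card_mono) auto
   moreover have "card (b ` {..<n}) \<le> n" using card_image_le[of "{..<n}" b] by simp
   ultimately show False by simp
  qed
  then obtain i j where "i < Suc n" "j < Suc n" "i ~= j" "r i = r j" unfolding inj_on_def by auto
  then show ?case using standard_sum_alternating two by blast
 next
  case (Suc k)
  have k: "k < Suc n" using Suc by simp
  obtain c where c: "!!j w'. j < n ==> w' : W ==> c j * w' = w' * c j" "r k = (\<Sum>j<n. c j * b j)"
   using span[of "r k"] Suc(3) k by blast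
  have "standard_sum (Suc n) (r(k := b j)) = 0" if "j < n" for j
   using Suc.prems that b by (intro Suc.IH) auto
  moreover have "standard_sum (Suc n) (r(k := \<Sum>j\<in>{..<n}. c j * b j)) = (\<Sum>j\<in>{..<n}. c j * standard_sum (Suc n) (r(k := b j)))"
   using c(1) Suc.prems by (intro standard_sum_linear k) auto
  moreover have "r(k := \<Sum>j\<in>{..<n}. c j * b j) = r" using c(2) by auto
  ultimately show ?case by simp
 qed
 from this[of "Suc n" r] show ?thesis using r by simp
qed

text \<open>The same polynomial as an element of the free ring, that is, as a coefficient function
  on words; a word that lists no permutation gets the coefficient zero.\<close>

definition standard_polynomial :: "nat => nat list => int" where
 "standard_polynomial m w =
  (if w : (\<lambda>\<pi>. map \<pi> [0..<m]) ` {\<pi>. \<pi> permutes {..<m}}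
   then sign (inv_into {\<pi>. \<pi> permutes {..<m}} (\<lambda>\<pi>. map \<pi> [0..<m]) w) else 0)"

lemma inj_on_permutation_word: "inj_on (\<lambda>\<pi>. map \<pi> [0..<m]) {\<pi>. \<pi> permutes {..<m}}"
proof (rule inj_onI)
 fix \<pi> \<rho> assume p: "\<pi> : {\<pi>. \<pi> permutes {..<m}}" "\<rho> : {\<pi>. \<pi> permutes {..<m}}" and e: "map \<pi> [0..<m] = map \<rho> [0..<m]"
 show "\<pi> = \<rho>"
 proof
  fix i
  show "\<pi> i = \<rho> i"
   using e p by (cases "i < m") (auto simp: permutes_def)
 qed
qed

lemma standard_polynomial_word:
 "\<pi> permutes {..<m} ==> standard_polynomial m (map \<pi> [0..<m]) = sign \<pi>"
 unfolding standard_polynomial_def using inv_into_f_f[OF inj_on_permutation_word, of \<pi> m]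
 by (auto simp del: map_eq_conv)

lemma standard_polynomial_support:
 "{w. standard_polynomial m w ~= 0} = (\<lambda>\<pi>. map \<pi> [0..<m]) ` {\<pi>. \<pi> permutes {..<m}}"
 using standard_polynomial_word by (auto simp: standard_polynomial_def sign_def)

lemma PI_ring_on:
 fixes W :: "'a::ring_1 set" and b :: "nat => 'a"
 assumes W: "subring_set W" and b: "!!j. j < n ==> b j : W"
  and span: "!!w. w : W ==> \<exists>c. (\<forall>j<n. \<forall>w'\<in>W. c j * w' = w' * c j) & w = (\<Sum>j<n. c j * b j)"
  and two: "!!x::'a. x + x = 0 ==> x = 0"
 shows "PI_ring (ring_on W)"
 unfolding PI_ring_def
proof (intro conjI exI[of _ "standard_polynomial (Suc n)"] ballI)
 let ?f = "standard_polynomial (Suc n)" and ?P = "{\<pi>. \<pi> permutes {..<Suc n}}"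
 have fin: "finite ?P" by (simp add: finite_permutations)
 show "ring (ring_on W)" by (rule ring_ring_on[OF W])
 show "?f : carrier free_algebra"
  using fin by (simp add: free_algebra_def monoid_ring_def standard_polynomial_support)
 show "\<exists>w. ?f w = 1 & (\<forall>v. ?f v ~= 0 --> length v \<le> length w)"
 proof (intro exI conjI allI impI)
  show "?f [0..<Suc n] = 1"
   using standard_polynomial_word[OF permutes_id, of "Suc n"] by (simp add: sign_id del: upt_Suc)
  fix v assume "?f v ~= 0"
  then have "v : (\<lambda>\<pi>. map \<pi> [0..<Suc n]) ` ?P" using standard_polynomial_support by blast
  then show "length v \<le> length [0..<Suc n]" by auto
 qed
 fix r :: "nat => 'a" assume r: "r : UNIV \<rightarrow> carrier (ring_on W)"
 then have rW: "r i : W" for i by auto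
 have fold: "foldr (%i a. r i **\<^bsub>ring_on W\<^esub> a) w \<one>\<^bsub>ring_on W\<^esub> = prod_list (map r w)" for w
  by (induction w) simp_all
 have pW: "prod_list (map r w) : W" for w
  by (induction w) (simp_all add: subring_setD[OF W] rW)
 have iW: "of_int i * x : W" if x: "x : W" for i x
 proof -
  interpret ring "ring_on W" by (rule ring_ring_on[OF W])
  have "add_pow (ring_on W) i x : carrier (ring_on W)" using x by (intro add.int_pow_closed) simp
  then show ?thesis using add_pow_ring_on[OF W x] by simp
 qed
 have "(\<Oplus>\<^bsub>ring_on W\<^esub>w\<in>{w. ?f w ~= 0}. add_pow (ring_on W) (?f w) (foldr (%i a. r i **\<^bsub>ring_on W\<^esub> a) w \<one>\<^bsub>ring_on W\<^esub>))
   = (\<Sum>w\<in>{w. ?f w ~= 0}. of_int (?f w) * prod_list (map r w))"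
  unfolding fold add_pow_ring_on[OF W pW]
  by (intro finsum_ring_on[OF W] iW pW) (simp add: standard_polynomial_support fin)
 also have "\<dots> = standard_sum (Suc n) r"
  unfolding standard_polynomial_support standard_sum_def
  by (subst sum.reindex[OF inj_on_permutation_word]) (simp add: standard_polynomial_word del: upt_Suc)
 also have "\<dots> = 0" using r by (intro standard_identity[OF b span two]) auto
 finally show "(\<Oplus>\<^bsub>ring_on W\<^esub>w\<in>{w. ?f w ~= 0}. add_pow (ring_on W) (?f w) (foldr (%i a. r i **\<^bsub>ring_on W\<^esub> a) w \<one>\<^bsub>ring_on W\<^esub>)) = \<zero>\<^bsub>ring_on W\<^esub>"
  by simp
qed

section \<open>Relations in the localized plane\<close>

text \<open>Turns a relation \<open>a b = c\<close> into a rewrite rule that also applies inside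
  products nested to the right.\<close>

lemma assoc_rule: "a * b = c ==> a * (b * d) = c * d" for a b c d :: "'a::semigroup_mult"
 by (simp add: mult.assoc[symmetric])

text \<open>The relations are explored in any algebra in which \<open>s\<close> has an inverse
  \<open>si\<close>; the span \<open>W\<close> of the monomials, defined below, plays the part of
  the localized plane.\<close>

locale sj_alg =
 fixes eta :: "'k::field => 'a::ring_1" and x y s si :: 'a
 assumes eta_add: "eta (a + b) = eta a + eta b" and eta_mult: "eta (a * b) = eta a * eta b" and eta_one [simp]: "eta 1 = 1"
  and eta_comm: "eta a * r = r * eta a"
  and xx [simp]: "x * x = 0" and s_def: "s = x * y + y * x"
  and yyx: "y * y * x = x * y * y + x * y * x"
  and ssi [simp]: "s * si = 1" "si * s = 1"
begin

lemma eta_zero [simp]: "eta 0 = 0"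
 using eta_add[of 0 0] by simp

lemma eta_of_nat: "eta (of_nat n) = of_nat n"
 by (induction n) (simp_all add: eta_add)

sublocale vs: vector_space "%c a. eta c * a"
 by unfold_locales (simp_all add: eta_add eta_mult distrib_left distrib_right mult.assoc)

lemma eta_scale_right: "a * (eta c * b) = eta c * (a * b)"
 by (metis eta_comm mult.assoc)

lemma span_left_mult:
 assumes "!!b. b : B ==> a * b : vs.span C" "w : vs.span B"
 shows "a * w : vs.span C"
 using assms(2)
proof (induction w rule: vs.span_induct_alt)
 case base
 then show ?case by (simp add: vs.span_zero)
next
 case (step c b w)
 then show ?case using assms(1)[of b]
  by (simp add: distrib_left eta_scale_right vs.span_add vs.span_scale)
qed

lemma span_right_mult:
 assumes "!!b. b : B ==> b * a : vs.span C" "w : vs.span B"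
 shows "w * a : vs.span C"
 using assms(2)
proof (induction w rule: vs.span_induct_alt)
 case base
 then show ?case by (simp add: vs.span_zero)
next
 case (step c b w)
 then show ?case using assms(1)[of b]
  by (simp add: distrib_right mult.assoc vs.span_add vs.span_scale)
qed

lemma span_of_int: "w : vs.span B ==> of_int n * w : vs.span B"
proof -
 assume w: "w : vs.span B"
 have nat: "of_nat m * w : vs.span B" for m
  using vs.span_scale[OF w, of "of_nat m"] by (simp add: eta_of_nat)
 show ?thesis
 proof (cases "n \<ge> 0")
  case True
  then show ?thesis using nat[of "nat n"] by simp
 next
  case False
  then have "of_int n * w = - (of_nat (nat (- n)) * w)" by simp
  then show ?thesis using vs.span_neg[OF nat[of "nat (- n)"]] by simp
 qed
qed

lemma xxa [simp]: "x * (x * a) = 0" by (simp add: mult.assoc[symmetric])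
lemma ssia [simp]: "s * (si * a) = a" "si * (s * a) = a" by (simp_all add: mult.assoc[symmetric])

lemma sx: "s * x = x * s"
 by (simp add: s_def distrib_left distrib_right mult.assoc)

lemma ys: "y * s = s * y + x * s"
 by (simp add: s_def distrib_left distrib_right mult.assoc[symmetric] yyx)

lemma six: "si * x = x * si"
proof -
 have "si * x = si * (x * s) * si" by (simp add: mult.assoc)
 also have "\<dots> = x * si" by (simp add: sx[symmetric] mult.assoc[symmetric])
 finally show ?thesis .
qed

lemma ysi: "y * si = si * y - x * si"
proof -
 have "si * y = si * (y * s) * si" by (simp add: mult.assoc)
 also have "\<dots> = y * si + x * si"
  by (simp add: ys distrib_left distrib_right) (simp add: sx[symmetric] mult.assoc[symmetric])
 finally show ?thesis by simp
qed

definition w where "w = y * si"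
definition t where "t = w * w"
text \<open>A corrected \<open>w\<close>. From \<open>x w + w x = 1\<close>, \<open>x x = 0\<close>
  and \<open>t = w w\<close> commuting with \<open>x\<close> and \<open>w\<close> one gets
  \<open>(w - t x) (w - t x) = t - t (x w + w x) = 0\<close>, while the relation with
  \<open>x\<close> is kept. So \<open>x\<close> and \<open>v\<close> behave like the two
  off-diagonal matrix units.\<close>

definition v where "v = w - t * x"

lemma ws: "w * s = y" by (simp add: w_def mult.assoc)

lemma xw: "x * w + w * x = 1"
proof -
 have "x * w + w * x = (x * y + y * x) * si" by (simp add: w_def distrib_right mult.assoc six)
 then show ?thesis by (simp add: s_def[symmetric])
qed

lemma wx: "w * x = 1 - x * w" using xw by (simp add: eq_diff_eq add.commute)

lemmas wxa = assoc_rule[OF wx]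

lemma tx: "t * x = x * t"
 by (simp add: t_def mult.assoc wx wxa left_diff_distrib right_diff_distrib)

lemma sw: "s * w = w * s - x"
proof -
 have "s * w = (s * y) * si" by (simp add: w_def mult.assoc)
 also have "s * y = y * s - x * s" using ys by simp
 finally show ?thesis by (simp add: left_diff_distrib mult.assoc ws)
qed

lemmas swa = assoc_rule[OF sw] and sxa = assoc_rule[OF sx]

lemma st: "s * t = t * s - 1"
 by (simp add: t_def mult.assoc wx wxa sw swa left_diff_distrib right_diff_distrib)

lemma tw: "t * w = w * t" by (simp add: t_def mult.assoc)

lemma vx: "v * x = 1 - x * v"
 by (simp add: v_def t_def mult.assoc wx wxa left_diff_distrib right_diff_distrib)

lemma vv [simp]: "v * v = 0"
 by (simp add: v_def t_def mult.assoc wx wxa left_diff_distrib right_diff_distrib)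

lemma tv: "t * v = v * t"
 by (simp add: v_def t_def mult.assoc wx wxa left_diff_distrib right_diff_distrib)

lemma sv: "s * v = v * s"
 by (simp add: v_def t_def mult.assoc wx wxa sw swa sx sxa left_diff_distrib right_diff_distrib)

lemma siv: "si * v = v * si"
proof -
 have "si * v = si * (v * s) * si" by (simp add: mult.assoc)
 also have "\<dots> = v * si" by (simp add: sv[symmetric] mult.assoc[symmetric])
 finally show ?thesis .
qed

lemma w_eq: "w = v + t * x" by (simp add: v_def)

lemma ts: "t * s = s * t + 1" using st by simp

lemma tsi: "t * si = si * t - si * si"
proof -
 have "si * t = si * (t * s) * si" by (simp add: mult.assoc)
 also have "\<dots> = t * si + si * si" by (simp add: ts distrib_left distrib_right mult.assoc)
 finally show ?thesis by simp
qed

lemma vva [simp]: "v * (v * a) = 0" by (simp add: mult.assoc[symmetric])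
lemmas vxa = assoc_rule[OF vx]

subsection \<open>Matrix units\<close>

text \<open>The truth values index rows and columns. As \<open>x\<close> and \<open>v\<close> have
  square zero and \<open>x v + v x = 1\<close>, the products \<open>x v\<close> and
  \<open>v x\<close> are complementary idempotents.\<close>

definition E :: "bool => bool => 'a" where
 "E i j = (if i then (if j then v * x else v) else (if j then x else x * v))"

lemma E_mult: "E i j * E k l = (if j = k then E i l else 0)"
 by (cases i; cases j; cases k; cases l)
  (simp_all add: E_def mult.assoc vx vxa left_diff_distrib right_diff_distrib)

lemma E_one: "E False False + E True True = 1"
 by (simp add: E_def vx)

lemma E_comm:
 assumes "a * x = x * a" "a * v = v * a"
 shows "a * E i j = E i j * a"
 unfolding E_def using assms by (auto simp: mult.assoc) (simp_all add: mult.assoc[symmetric], simp_all add: mult.assoc)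

subsection \<open>Integer powers of \<open>s\<close>\<close>

definition spow :: "int => 'a" where
 "spow j = (if j \<ge> 0 then s ^ nat j else si ^ nat (- j))"

lemma spow_0 [simp]: "spow 0 = 1" and spow_of_nat: "spow (int n) = s ^ n" and spow_1 [simp]: "spow 1 = s"
 by (simp_all add: spow_def)

lemma ssi_comm: "s * si = si * s" by simp

lemma s_si_pow: "s * si ^ n = si ^ n * s"
 by (simp add: power_commuting_commutes)

lemma spow_Suc: "spow (j + 1) = s * spow j" "spow (j + 1) = spow j * s"
proof -
 consider "j \<ge> 0" | "j < 0" by linarith
 then have "spow (j + 1) = s * spow j & s * spow j = spow j * s"
 proof cases
  case 1
  then have "nat (j + 1) = Suc (nat j)" by simp
  then show ?thesis using 1 by (simp add: spow_def power_commutes)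
 next
  case 2
  define n where "n = nat (- j - 1)"
  have j: "j = - int n - 1" using 2 by (simp add: n_def)
  have e: "nat (- j) = Suc n" using j by simp
  have "spow (j + 1) = si ^ n" using j by (cases n) (simp_all add: spow_def nat_add_distrib)
  moreover have "s * spow j = si ^ n" using 2 e by (simp add: spow_def)
  moreover have "spow j * s = si ^ n" using 2 e by (simp add: spow_def) (simp add: power_commutes[symmetric] mult.assoc)
  ultimately show ?thesis by simp
 qed
 then show "spow (j + 1) = s * spow j" "spow (j + 1) = spow j * s" by simp_all
qed

lemma spow_pred: "spow (j - 1) = si * spow j" "spow (j - 1) = spow j * si"
proof -
 have "si * spow j = si * (s * spow (j - 1))" "spow j * si = spow (j - 1) * s * si"
  using spow_Suc[of "j - 1"] by simp_all
 then show "spow (j - 1) = si * spow j" "spow (j - 1) = spow j * si" by (simp_all add: mult.assoc)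
qed

lemma spow_add: "spow (i + j) = spow i * spow j"
proof (induction i rule: int_induct[where k = 0])
 case (step1 i)
 have "i + 1 + j = (i + j) + 1" by simp
 then have "spow (i + 1 + j) = s * spow (i + j)" by (simp only: spow_Suc(1))
 then show ?case using step1 by (simp add: spow_Suc(1) mult.assoc)
next
 case (step2 i)
 have "i - 1 + j = (i + j) - 1" by simp
 then have "spow (i - 1 + j) = si * spow (i + j)" by (simp only: spow_pred(1))
 then show ?case using step2 by (simp add: spow_pred(1) mult.assoc)
qed simp

lemma spow_comm: "spow i * spow j = spow j * spow i"
 by (simp add: spow_add[symmetric] add.commute)

lemma spow_commute:
 assumes "s * a = a * s"
 shows "spow j * a = a * spow j"
proof (induction j rule: int_induct[where k = 0])
 case (step1 i)
 have "spow (i + 1) * a = s * (a * spow i)" using step1 by (simp add: spow_Suc(1) mult.assoc)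
 then show ?case using assms by (simp add: spow_Suc(1) mult.assoc[symmetric])
next
 case (step2 i)
 have "si * a = si * (a * s) * si" by (simp add: mult.assoc)
 then have si: "si * a = a * si" by (simp add: assms[symmetric] mult.assoc[symmetric])
 have "spow (i - 1) * a = si * (a * spow i)" using step2 by (simp add: spow_pred(1) mult.assoc)
 then show ?case by (simp add: spow_pred(1) mult.assoc[symmetric] si)
qed simp

lemmas spow_x = spow_commute[OF sx] and spow_v = spow_commute[OF sv]

text \<open>By \<open>y s = s y + x s\<close>, and since \<open>x\<close> commutes with
  \<open>s\<close>, each factor \<open>s\<close> passed by \<open>y\<close> contributes one copy of
  \<open>x s^j\<close>. In characteristic \<open>p\<close> the correction disappears when
  \<open>p\<close> divides \<open>j\<close>.\<close>

lemma y_spow: "y * spow j = spow j * y + of_int j * (x * spow j)"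
proof (induction j rule: int_induct[where k = 0])
 case (step1 i)
 have "y * spow (i + 1) = (spow i * y + of_int i * (x * spow i)) * s"
  using step1 by (simp add: spow_Suc(2) mult.assoc[symmetric])
 also have "\<dots> = spow i * (y * s) + of_int i * (x * (spow i * s))" by (simp add: distrib_right mult.assoc)
 also have "\<dots> = spow (i + 1) * y + of_int (i + 1) * (x * spow (i + 1))"
  using assoc_rule[OF spow_x[of i], of s]
  by (simp add: ys distrib_left distrib_right spow_Suc(2) mult.assoc)
 finally show ?case .
next
 case (step2 i)
 have "y * spow (i - 1) = (spow i * y + of_int i * (x * spow i)) * si"
  using step2 by (simp add: spow_pred(2) mult.assoc[symmetric])
 also have "\<dots> = spow i * (y * si) + of_int i * (x * (spow i * si))" by (simp add: distrib_right mult.assoc)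
 also have "\<dots> = spow (i - 1) * y + of_int (i - 1) * (x * spow (i - 1))"
  using assoc_rule[OF spow_x[of i], of si]
  by (simp add: ysi right_diff_distrib left_diff_distrib spow_pred(2) mult.assoc)
 finally show ?case .
qed simp

text \<open>Commutation with \<open>t\<close> acts on integer powers of \<open>s\<close> as the
  derivative with respect to \<open>s\<close>.\<close>

lemma t_spow: "t * spow j = spow j * t + of_int j * spow (j - 1)"
proof (induction j rule: int_induct[where k = 0])
 case (step1 i)
 have "t * spow (i + 1) = (spow i * t + of_int i * spow (i - 1)) * s"
  using step1 by (simp add: spow_Suc(2) mult.assoc[symmetric])
 also have "\<dots> = spow i * (t * s) + of_int i * spow i"
  using spow_Suc(2)[of "i - 1"] by (simp add: distrib_right mult.assoc)
 also have "\<dots> = spow (i + 1) * t + of_int (i + 1) * spow (i + 1 - 1)"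
  by (simp add: ts distrib_left distrib_right spow_Suc(2) mult.assoc)
 finally show ?case .
next
 case (step2 i)
 have "t * spow (i - 1) = (spow i * t + of_int i * spow (i - 1)) * si"
  using step2 by (simp add: spow_pred(2) mult.assoc[symmetric])
 also have "\<dots> = spow i * (t * si) + of_int i * spow (i - 1 - 1)"
  using spow_pred(2)[of "i - 1"] by (simp add: distrib_right mult.assoc)
 also have "spow i * (t * si) = spow (i - 1) * t - spow (i - 1 - 1)"
  using spow_pred(2)[of "i - 1"] spow_pred(2)[of i] by (simp add: tsi right_diff_distrib mult.assoc[symmetric])
 also have "spow (i - 1) * t - spow (i - 1 - 1) + of_int i * spow (i - 1 - 1) = spow (i - 1) * t + of_int (i - 1) * spow (i - 1 - 1)"
  by (simp add: left_diff_distrib)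
 finally show ?case .
qed simp

lemma tn_s: "t ^ n * s = s * t ^ n + of_nat n * t ^ (n - 1)"
proof (induction n)
 case (Suc n)
 have "t ^ Suc n * s = t * (s * t ^ n + of_nat n * t ^ (n - 1))" using Suc by (simp add: mult.assoc)
 also have "\<dots> = (t * s) * t ^ n + of_nat n * (t * t ^ (n - 1))"
  by (metis (no_types, lifting) distrib_left mult.assoc mult_of_nat_commute)
 also have "of_nat n * (t * t ^ (n - 1)) = of_nat n * t ^ n" by (cases n) simp_all
 finally show ?case by (simp add: ts distrib_right mult.assoc add.assoc)
qed simp

lemma t_sn: "t * s ^ n = s ^ n * t + of_nat n * s ^ (n - 1)"
 using t_spow[of "int n"] by (cases n) (simp_all add: spow_of_nat[symmetric] del: power_Suc)

lemma tn_x: "t ^ n * x = x * t ^ n" and tn_v: "t ^ n * v = v * t ^ n"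
 by (rule power_commuting_commutes[OF tx] power_commuting_commutes[OF tv])+

subsection \<open>The two bases\<close>

text \<open>Two spanning families of one space are used: \<open>mon\<close> follows the presentation
  and is the one shown to be independent, \<open>mon'\<close> follows the decomposition into matrix
  units and the localized Weyl algebra and gives the structure over the center.\<close>

definition mon :: "bool \<times> int \<times> nat => 'a" where
 "mon = (%(i, j, k). (if i then x else 1) * spow j * y ^ k)"

definition W where "W = vs.span (range mon)"

definition mon' :: "(bool \<times> bool) \<times> int \<times> nat => 'a" where
 "mon' = (%((i, j), a, b). E i j * spow a * t ^ b)"

text \<open>These formulas close the span under left multiplication, and they prescribe the
  operators \<open>end_x\<close>, \<open>end_y\<close>, \<open>end_s\<close> and
  \<open>end_si\<close> of the model.\<close>

lemma mon_left:
 "x * mon (i, j, k) = (if i then 0 else mon (True, j, k))"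
 "s * mon (i, j, k) = mon (i, j + 1, k)"
 "si * mon (i, j, k) = mon (i, j - 1, k)"
 "y * mon (False, j, k) = mon (False, j, Suc k) + of_int j * mon (True, j, k)"
 "y * mon (True, j, k) = mon (False, j + 1, k) - mon (True, j, Suc k)"
proof -
 show "x * mon (i, j, k) = (if i then 0 else mon (True, j, k))" by (simp add: mon_def mult.assoc)
 show "s * mon (i, j, k) = mon (i, j + 1, k)"
  by (simp add: mon_def spow_Suc mult.assoc[symmetric] sx)
 show "si * mon (i, j, k) = mon (i, j - 1, k)"
  by (simp add: mon_def spow_pred(1) mult.assoc[symmetric] six)
 show "y * mon (False, j, k) = mon (False, j, Suc k) + of_int j * mon (True, j, k)"
  by (simp add: mon_def mult.assoc[symmetric] y_spow distrib_right)
 have yx: "y * x = s - x * y" by (simp add: s_def)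
 have "y * mon (True, j, k) = (s - x * y) * (spow j * y ^ k)" by (simp add: mon_def mult.assoc[symmetric] yx)
 also have "\<dots> = spow (j + 1) * y ^ k - x * ((y * spow j) * y ^ k)"
  by (simp add: left_diff_distrib spow_Suc(1) mult.assoc)
 also have "x * ((y * spow j) * y ^ k) = x * (spow j * (y * y ^ k)) + of_int j * (x * (x * (spow j * y ^ k)))"
  by (simp add: y_spow distrib_left distrib_right mult.assoc)
   (metis mult.assoc mult_of_int_commute xxa)
 finally show "y * mon (True, j, k) = mon (False, j + 1, k) - mon (True, j, Suc k)"
  by (simp add: mon_def mult.assoc)
qed

lemma mon_W: "mon q : W" by (simp add: W_def vs.span_base)

lemma W_left:
 assumes "u : W" shows "x * u : W" "y * u : W" "s * u : W" "si * u : W"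
proof -
 have 0: "0 : W" by (simp add: W_def vs.span_zero)
 have m: "x * mon q : W & y * mon q : W & s * mon q : W & si * mon q : W" for q
 proof -
  obtain i j k where q: "q = (i, j, k)" by (cases q)
  have "of_int j * mon (True, j, k) : W" using mon_W span_of_int unfolding W_def by blast
  then have "y * mon q : W" unfolding q
   using mon_left(4,5)[of j k] mon_W vs.span_add vs.span_diff unfolding W_def by (cases i) auto
  then show ?thesis unfolding q using mon_left(1-3)[of i j k] mon_W 0 by simp
 qed
 show "x * u : W" "y * u : W" "s * u : W" "si * u : W"
  using assms m span_left_mult[of "range mon" _ "range mon" u] unfolding W_def by blast+
qed

lemma W_closed: "0 : W" "1 : W" "u : W ==> u' : W ==> u + u' : W" "u : W ==> u' : W ==> u - u' : W"
 "u : W ==> eta c * u : W"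
 using mon_W[of "(False, 0, 0)"] unfolding W_def
 by (simp_all add: vs.span_zero vs.span_add vs.span_diff vs.span_scale mon_def)

lemma W_left':
 assumes "u : W" shows "w * u : W" "t * u : W" "v * u : W" "spow j * u : W" "t ^ b * u : W" "y ^ b * u : W" "E i i' * u : W"
proof -
 have w: "w * u : W" if "u : W" for u using W_left that by (simp add: w_def mult.assoc)
 have t: "t * u : W" if "u : W" for u using w that by (simp add: t_def mult.assoc)
 have v: "v * u : W" if "u : W" for u using w t W_left W_closed that by (simp add: v_def left_diff_distrib mult.assoc)
 show "w * u : W" "t * u : W" "v * u : W" using w t v assms by simp_all
 have "s ^ n * u : W" "si ^ n * u : W" for n
  using assms W_left by (induction n) (simp_all add: mult.assoc)
 then show "spow j * u : W" by (simp add: spow_def)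
 show "t ^ b * u : W" "y ^ b * u : W" using assms t W_left by (induction b) (simp_all add: mult.assoc)
 show "E i i' * u : W" using assms v W_left by (simp add: E_def mult.assoc)
qed

lemma subring_W: "subring_set W"
proof -
 have "u * u' : W" if u: "u : W" and u': "u' : W" for u u'
 proof -
  have "mon q * u' : W" for q
   using u' W_left W_left' by (cases q) (auto simp: mon_def mult.assoc)
  then show ?thesis using span_right_mult[of "range mon" u' "range mon" u] u unfolding W_def by blast
 qed
 then show ?thesis using W_closed by (simp add: subring_set_def)
qed

lemma W_gens: "x : W" "y : W" "s : W" "si : W" "t : W" "v : W" "spow j : W" "eta c : W" "E i i' : W"
 using W_left[OF W_closed(2)] W_left'[OF W_closed(2)] W_closed(5)[OF W_closed(2)] by simp_all

lemma mon'_W: "mon' q : W"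
 using W_left'[OF W_closed(2)] W_left' by (cases q) (auto simp: mon'_def mult.assoc)

text \<open>The span of \<open>mon'\<close> contains \<open>1\<close>, the sum of the two diagonal
  matrix units, and is closed under left multiplication by \<open>x\<close>, \<open>v\<close>,
  \<open>t\<close>, \<open>s\<close> and \<open>si\<close>, hence by \<open>y = (v + t x) s\<close>.
  So it contains every \<open>mon\<close>; the other inclusion holds because \<open>W\<close> is
  closed under the factors of \<open>mon'\<close>.\<close>

lemma W_eq: "W = vs.span (range mon')"
proof
 let ?V = "vs.span (range mon')"
 show "?V <= W"
 proof
  fix u assume "u : ?V"
  then show "u : W"
   by (induction u rule: vs.span_induct_alt) (auto intro: W_closed mon'_W)
 qed
 have 0: "0 : ?V" by (rule vs.span_zero)
 have b: "mon' q : ?V" for q by (rule vs.span_base) simp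
 have m: "x * mon' q : ?V & v * mon' q : ?V & t * mon' q : ?V & s * mon' q : ?V & si * mon' q : ?V" for q
 proof -
  obtain i j a c where q: "q = ((i, j), a, c)" by (metis surj_pair)
  have "x * mon' q = (if i then mon' ((False, j), a, c) else 0)"
   using E_mult[of False True i j] by (simp add: q mon'_def mult.assoc[symmetric] E_def[of False True])
  moreover have "v * mon' q = (if i then 0 else mon' ((True, j), a, c))"
   using E_mult[of True False i j] by (simp add: q mon'_def mult.assoc[symmetric] E_def[of True False])
  moreover have "t * mon' q = mon' ((i, j), a, Suc c) + of_int a * mon' ((i, j), a - 1, c)"
  proof -
   have "t * mon' q = E i j * (t * spow a) * t ^ c"
    using E_comm[OF tx tv, of i j] by (simp add: q mon'_def mult.assoc[symmetric])
   also have "\<dots> = E i j * (spow a * (t * t ^ c)) + E i j * (of_int a * (spow (a - 1) * t ^ c))"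
    by (simp add: t_spow distrib_left distrib_right mult.assoc)
   also have "E i j * (of_int a * (spow (a - 1) * t ^ c)) = of_int a * (E i j * (spow (a - 1) * t ^ c))"
    by (metis mult.assoc mult_of_int_commute)
   finally show ?thesis by (simp add: mon'_def mult.assoc)
  qed
  moreover have "s * mon' q = mon' ((i, j), a + 1, c)"
  proof -
   have "s * mon' q = E i j * (s * spow a) * t ^ c"
    using E_comm[OF sx sv, of i j] by (simp add: q mon'_def mult.assoc[symmetric])
   then show ?thesis by (simp add: mon'_def spow_Suc(1))
  qed
  moreover have "si * mon' q = mon' ((i, j), a - 1, c)"
  proof -
   have "si * mon' q = E i j * (si * spow a) * t ^ c"
    using E_comm[OF six siv, of i j] by (simp add: q mon'_def mult.assoc[symmetric])
   then show ?thesis by (simp add: mon'_def spow_pred(1))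
  qed
  ultimately show ?thesis using b 0 vs.span_add[OF b span_of_int[OF b]] by auto
 qed
 have cl: "x * u : ?V" "v * u : ?V" "t * u : ?V" "s * u : ?V" "si * u : ?V" if "u : ?V" for u
  using that m span_left_mult[of "range mon'" _ "range mon'" u] by blast+
 have y: "y * u : ?V" if "u : ?V" for u
 proof -
  have "y * u = (v + t * x) * s * u" by (simp only: ws w_eq[symmetric])
  then have "y * u = v * (s * u) + t * (x * (s * u))" by (simp add: distrib_right mult.assoc)
  then show ?thesis by (rule ssubst) (intro vs.span_add cl that)
 qed
 have "1 = mon' ((False, False), 0, 0) + mon' ((True, True), 0, 0)" by (simp add: mon'_def E_one)
 then have 1: "1 : ?V" by (rule ssubst) (rule vs.span_add[OF b b])
 have sp: "spow j * u : ?V" if u: "u : ?V" for u j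
 proof -
  have "s ^ n * u : ?V" "si ^ n * u : ?V" for n
   by (induction n) (simp_all add: mult.assoc cl u)
  then show ?thesis by (simp add: spow_def)
 qed
 have yp: "y ^ n : ?V" for n
  by (induction n) (simp_all add: 1 y)
 have "mon q : ?V" for q
 proof -
  obtain i j k where q: "q = (i, j, k)" by (cases q)
  show ?thesis unfolding q mon_def using cl(1)[OF sp[OF yp, of j k]] sp[OF yp, of j k]
   by (simp add: mult.assoc)
 qed
 then show "W <= ?V" unfolding W_def by (intro vs.span_minimal) (auto simp: vs.subspace_span)
qed

subsection \<open>Powers of \<open>y\<close>\<close>

text \<open>In matrix form the square of \<open>y\<close> is diagonal. Its entries
  \<open>t s s\<close> and \<open>s t s\<close> are conjugate under \<open>s\<close>, which later
  makes their \<open>p\<close>-th powers agree.\<close>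

lemma y_square: "y * y = E False False * (t * s * s) + E True True * (s * t * s)"
proof -
 have "y * y = (w * s) * (w * s)" by (simp only: ws)
 then have "y * y = w * (s * w) * s" by (simp only: mult.assoc)
 also have "\<dots> = t * s * s - w * x * s" by (simp add: sw t_def right_diff_distrib left_diff_distrib mult.assoc)
 also have "w * x = E True True" by (subst w_eq) (simp add: distrib_right mult.assoc E_def)
 also have "t * s * s - E True True * s = (E False False + E True True) * (t * s * s) - E True True * s"
  by (simp only: E_one mult_1_left)
 also have "\<dots> = E False False * (t * s * s) + E True True * ((t * s - 1) * s)"
  by (simp add: distrib_right left_diff_distrib right_diff_distrib mult.assoc)
 finally show ?thesis by (simp add: st)
qed

lemma sts_power: "(s * t * s) ^ n = s ^ n * t ^ n * s ^ n"
proof (induction n)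
 case (Suc n)
 \<comment> \<open>One factor \<open>t\<close> is moved to the left across \<open>s^(n+1)\<close>
   and one factor \<open>s\<close> out to the front; the corrections are
   \<open>(n + 1) t^n s^n\<close> with opposite signs and cancel.\<close>
 have a: "t ^ n * s ^ Suc n * t = s * t ^ Suc n * s ^ n"
 proof -
  have c: "t ^ n * (of_nat m * z) = of_nat m * (t ^ n * z)" for m and z :: 'a
   by (metis mult.assoc mult_of_nat_commute)
  have "t ^ n * s ^ Suc n * t = t ^ n * (t * s ^ Suc n - of_nat (Suc n) * s ^ n)"
   using t_sn[of "Suc n"] by (simp add: mult.assoc del: power_Suc of_nat_Suc)
  also have "\<dots> = t ^ Suc n * s * s ^ n - of_nat (Suc n) * (t ^ n * s ^ n)"
   by (simp add: right_diff_distrib c mult.assoc power_commutes del: of_nat_Suc) (simp add: mult.assoc[symmetric] power_commutes)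
  also have "\<dots> = s * t ^ Suc n * s ^ n"
   using tn_s[of "Suc n"] by (simp add: distrib_right mult.assoc del: power_Suc of_nat_Suc)
  finally show ?thesis .
 qed
 have "(s * t * s) ^ Suc n = s ^ n * t ^ n * s ^ n * (s * t * s)" using Suc by (simp only: power_Suc2)
 also have "\<dots> = s ^ n * (t ^ n * s ^ Suc n * t) * s" by (simp add: mult.assoc power_commutes) (simp add: mult.assoc[symmetric] power_commutes)
 also have "\<dots> = s ^ Suc n * t ^ Suc n * s ^ Suc n" unfolding a by (simp add: mult.assoc power_commutes) (simp add: mult.assoc[symmetric] power_commutes)
 finally show ?case .
qed simp

lemma y_even_power: "y ^ (2 * n) = E False False * (t * s * s) ^ n + E True True * (s * t * s) ^ n"
proof (induction n)
 case 0
 then show ?case by (simp add: E_one)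
next
 case (Suc n)
 have cx: "(t * s * s) * x = x * (t * s * s)" "(s * t * s) * x = x * (s * t * s)"
  by (metis mult.assoc sx tx)+
 have cv: "(t * s * s) * v = v * (t * s * s)" "(s * t * s) * v = v * (s * t * s)"
  by (metis mult.assoc sv tv)+
 define A B where AB: "A = t * s * s" "B = s * t * s"
 have ea: "A * (E i j * z) = E i j * (A * z)" "B * (E i j * z) = E i j * (B * z)" for i j z
  using assoc_rule[OF E_comm[OF cx(1) cv(1)], of i j z] assoc_rule[OF E_comm[OF cx(2) cv(2)], of i j z]
  by (simp_all add: AB mult.assoc)
 have ee: "E i j * (E k l * z) = (if j = k then E i l * z else 0)" for i j k l z
  using E_mult[of i j k l] by (simp add: mult.assoc[symmetric])
 have "y ^ (2 * Suc n) = (y * y) * y ^ (2 * n)" by (simp add: mult.assoc)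
 also have "\<dots> = (E False False * A + E True True * B) * (E False False * A ^ n + E True True * B ^ n)"
  by (simp add: y_square Suc AB)
 also have "\<dots> = E False False * A ^ Suc n + E True True * B ^ Suc n"
  by (simp add: distrib_left distrib_right mult.assoc ea ee)
 finally show ?case by (simp add: AB)
qed

end

lemma commute_mult: "z * a = a * z ==> z * b = b * z ==> z * (a * b) = a * b * z" for a b z :: "'a::semigroup_mult"
 by (metis mult.assoc)

lemma commute_add: "z * a = a * z ==> z * b = b * z ==> z * (a + b) = (a + b) * z" for a b z :: "'a::semiring"
 by (simp add: distrib_left distrib_right)

section \<open>Characteristic \<open>p\<close> and the central subring\<close>

text \<open>Independence of the monomials is assumed here; \<open>sj_model_p\<close> establishes it
  for the operators on functions.\<close>

locale sj_alg_p = sj_alg eta x y s si for eta :: "'k::field => 'a::ring_1" and x y s si +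
 fixes p :: nat
 assumes indep: "[|finite F; (\<Sum>q\<in>F. eta (c q) * mon q) = 0; q : F|] ==> c q = 0"
  and char: "CHAR('k) = p" and p2: "p > 2"
begin

lemma prime_p: "prime p"
 using prime_CHAR_semidom[where 'a = 'k] char p2 by simp

lemma of_nat_p_dvd: "p dvd n ==> of_nat n = (0::'a)"
 using eta_of_nat[of n] of_nat_eq_0_iff_char_dvd[where 'a = 'k, of n] char by simp

lemma of_int_p: "of_int (int p * i) = (0::'a)"
 using of_nat_p_dvd[of p] by simp

lemma two_cancel:
 assumes "a + a = (0::'a)" shows "a = 0"
proof -
 have "\<not> p dvd 2" using p2 by (auto dest: dvd_imp_le)
 then have "(of_nat 2 :: 'k) ~= 0" using of_nat_eq_0_iff_char_dvd[where 'a = 'k, of 2] char by simp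
 then have "a = eta (inverse (of_nat 2)) * (eta (of_nat 2) * a)"
  by (simp add: mult.assoc[symmetric] eta_mult[symmetric])
 also have "eta (of_nat 2) * a = a + a" unfolding eta_of_nat by (simp add: mult_2)
 finally show ?thesis using assms by simp
qed

lemma commute_W:
 assumes "z * x = x * z" "z * y = y * z" "z * s = s * z" and u: "u : W"
 shows "z * u = u * z"
 using u unfolding W_def
proof (induction u rule: vs.span_induct_alt)
 case (step c m u)
 then obtain q where m: "m = mon q" by blast
 obtain i j k where q: "q = (i, j, k)" by (cases q)
 have "z * spow j = spow j * z" using spow_commute[of z j] assms(3) by simp
 moreover have "z * y ^ k = y ^ k * z" using power_commuting_commutes[of y z k] assms(2) by simp
 ultimately have "z * (spow j * y ^ k) = (spow j * y ^ k) * z" by (metis mult.assoc)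
 then have "z * m = m * z" using assms(1) unfolding m q mon_def by (auto simp: mult.assoc) (metis mult.assoc)
 then show ?case using step by (simp add: distrib_left distrib_right eta_scale_right mult.assoc)
qed simp

lemma spow_p_central: "u : W ==> spow (int p * i) * u = u * spow (int p * i)"
proof (rule commute_W)
 show "spow (int p * i) * x = x * spow (int p * i)" by (rule spow_x)
 show "spow (int p * i) * y = y * spow (int p * i)"
  unfolding y_spow of_int_p by simp
 show "spow (int p * i) * s = s * spow (int p * i)"
  by (rule trans[OF spow_Suc(2)[symmetric] spow_Suc(1)])
qed

lemma t_p_central: "u : W ==> t ^ (p * j) * u = u * t ^ (p * j)"
proof (rule commute_W)
 let ?z = "t ^ (p * j)"
 show x: "?z * x = x * ?z" by (rule tn_x)
 show s: "?z * s = s * ?z" using tn_s[of "p * j"] of_nat_p_dvd[of "p * j"] by simp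
 have v: "?z * v = v * ?z" by (rule tn_v)
 have t: "?z * t = t * ?z" by (simp add: power_commutes)
 have y: "y = (v + t * x) * s" by (simp only: ws w_eq[symmetric])
 have "?z * ((v + t * x) * s) = ((v + t * x) * s) * ?z"
  by (intro commute_mult commute_add x s v t)
 then show "?z * y = y * ?z" by (simp only: y[symmetric])
qed

text \<open>The diagonal entries of \<open>y^(2p)\<close> are the \<open>p\<close>-th powers of
  \<open>t s s\<close> and \<open>s t s\<close>. The second is \<open>s^p t^p s^p\<close>, which
  commutes with \<open>s\<close>, so conjugation by \<open>s\<close> changes nothing and the two
  entries agree.\<close>

lemma y_power_2p: "y ^ (2 * p) = t ^ p * spow (int (2 * p))"
proof -
 have st: "s ^ p * t ^ p * s ^ p = t ^ p * spow (int (2 * p))"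
 proof -
  have "t ^ p * s ^ p = s ^ p * t ^ p"
   using t_p_central[OF subring_setD(7)[OF subring_W W_gens(3)], of 1 p] by simp
  then have "s ^ p * t ^ p * s ^ p = t ^ p * (s ^ p * s ^ p)" by (simp only: mult.assoc[symmetric])
  also have "s ^ p * s ^ p = spow (int (2 * p))"
   by (simp add: spow_of_nat mult_2 power_add del: of_nat_mult of_nat_add)
  finally show ?thesis .
 qed
 have "t * s * s = si * (s * t * s) * s" by (simp add: mult.assoc)
 moreover have "(si * a * s) ^ n = si * a ^ n * s" for a n
  by (induction n) (simp_all add: mult.assoc)
 ultimately have "(t * s * s) ^ p = si * (s * t * s) ^ p * s" by simp
 also have "\<dots> = si * s ^ p * t ^ p * s ^ p * s" by (simp only: sts_power mult.assoc[symmetric])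
 also have "\<dots> = si * s * (s ^ p * t ^ p * s ^ p)"
 proof -
  have "s * t ^ p = t ^ p * s" using t_p_central[OF W_gens(3), of 1] by simp
  then have "s * (s ^ p * t ^ p * s ^ p) = (s ^ p * t ^ p * s ^ p) * s"
   by (intro commute_mult power_commutes[symmetric])
  then have "si * (s * (s ^ p * t ^ p * s ^ p)) = si * ((s ^ p * t ^ p * s ^ p) * s)" by (rule arg_cong)
  from this[symmetric] show ?thesis by (simp only: mult.assoc)
 qed
 finally have "(t * s * s) ^ p = s ^ p * t ^ p * s ^ p" by simp
 then have "y ^ (2 * p) = (E False False + E True True) * (s ^ p * t ^ p * s ^ p)"
  unfolding y_even_power by (simp add: sts_power distrib_right)
 then show ?thesis by (simp add: E_one st)
qed

definition zmon :: "int \<times> nat => 'a" where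
 "zmon = (%(i, j). spow (int p * i) * y ^ (2 * p * j))"

text \<open>The expected center, the algebra of polynomials in \<open>y^(2p)\<close> and Laurent
  polynomials in \<open>s^p\<close>; \<open>center_W\<close> shows that nothing else in
  \<open>W\<close> is central.\<close>

definition Z0 where "Z0 = vs.span (range zmon)"

lemma zmon_mon: "zmon (i, j) = mon (False, int p * i, 2 * p * j)"
 by (simp add: zmon_def mon_def)

lemma y_power_2pj: "y ^ (2 * p * j) = t ^ (p * j) * spow (int p * (2 * int j))"
proof (induction j)
 case (Suc j)
 have "y ^ (2 * p * Suc j) = y ^ (2 * p) * y ^ (2 * p * j)" by (simp add: power_add)
 also have "\<dots> = t ^ p * (spow (int (2 * p)) * t ^ (p * j)) * spow (int p * (2 * int j))"
  unfolding y_power_2p Suc by (simp add: mult.assoc)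
 also have "spow (int (2 * p)) * t ^ (p * j) = t ^ (p * j) * spow (int (2 * p))"
  using t_p_central[OF W_gens(7), of j] by simp
 also have "t ^ p * (t ^ (p * j) * spow (int (2 * p))) * spow (int p * (2 * int j))
   = t ^ (p * Suc j) * (spow (int (2 * p)) * spow (int p * (2 * int j)))"
  by (simp add: power_add mult.assoc)
 also have "spow (int (2 * p)) * spow (int p * (2 * int j)) = spow (int p * (2 * int (Suc j)))"
  by (simp add: spow_add[symmetric] algebra_simps)
 finally show ?case .
qed simp

text \<open>Translates between the central elements natural for the Weyl algebra, \<open>s^p\<close>
  and \<open>t^p\<close>, and those of the plane, \<open>s^p\<close> and \<open>y^(2p)\<close>. They
  differ by powers of the unit \<open>s^p\<close>.\<close>

lemma zmon_t: "spow (int p * i) * t ^ (p * j) = zmon (i - 2 * int j, j)"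
proof -
 have "zmon (i - 2 * int j, j) = spow (int p * (i - 2 * int j)) * (t ^ (p * j) * spow (int p * (2 * int j)))"
  by (simp only: zmon_def prod.case y_power_2pj)
 also have "t ^ (p * j) * spow (int p * (2 * int j)) = spow (int p * (2 * int j)) * t ^ (p * j)"
  by (rule t_p_central[OF W_gens(7)])
 also have "spow (int p * (i - 2 * int j)) * (spow (int p * (2 * int j)) * t ^ (p * j)) = spow (int p * (i - 2 * int j)) * spow (int p * (2 * int j)) * t ^ (p * j)"
  by (simp only: mult.assoc)
 also have "\<dots> = spow (int p * (i - 2 * int j) + int p * (2 * int j)) * t ^ (p * j)"
  by (simp only: spow_add)
 also have "int p * (i - 2 * int j) + int p * (2 * int j) = int p * i" by (simp add: algebra_simps)
 finally show ?thesis by simp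
qed

lemma zmon_central: "u : W ==> zmon q * u = u * zmon q"
proof -
 assume u: "u : W"
 obtain i j where q: "q = (i, j)" by (cases q)
 have "zmon q = spow (int p * i) * t ^ (p * j) * spow (int p * (2 * int j))"
  unfolding q zmon_def prod.case y_power_2pj by (simp only: mult.assoc)
 moreover have "u * (spow (int p * i) * t ^ (p * j) * spow (int p * (2 * int j))) = spow (int p * i) * t ^ (p * j) * spow (int p * (2 * int j)) * u"
  by (intro commute_mult spow_p_central[OF u, symmetric] t_p_central[OF u, symmetric])
 ultimately show ?thesis by simp
qed

lemma Z0_central:
 assumes "z : Z0" "u : W" shows "z * u = u * z"
 using assms(1) unfolding Z0_def
proof (induction z rule: vs.span_induct_alt)
 case (step c m z)
 then show ?case using zmon_central[OF assms(2)] by (auto simp: distrib_left distrib_right eta_scale_right mult.assoc)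
qed simp

lemma Z0_W: "z : Z0 ==> z : W"
proof -
 have "range zmon <= range mon" by (auto simp: zmon_mon)
 then show "z : Z0 ==> z : W" unfolding Z0_def W_def using vs.span_mono by blast
qed

lemma zmon_mult: "zmon (i, j) * zmon (i', j') = zmon (i + i', j + j')"
proof -
 have "zmon (i, j) * zmon (i', j') = spow (int p * i) * (y ^ (2 * p * j) * spow (int p * i')) * y ^ (2 * p * j')"
  by (simp add: zmon_def mult.assoc)
 also have "y ^ (2 * p * j) * spow (int p * i') = spow (int p * i') * y ^ (2 * p * j)"
  using spow_p_central[of "y ^ (2 * p * j)" i'] subring_setD(7)[OF subring_W W_gens(2)] by simp
 also have "spow (int p * i) * (spow (int p * i') * y ^ (2 * p * j)) * y ^ (2 * p * j')
   = (spow (int p * i) * spow (int p * i')) * (y ^ (2 * p * j) * y ^ (2 * p * j'))" by (simp add: mult.assoc)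
 finally show ?thesis by (simp add: zmon_def spow_add[symmetric] power_add[symmetric] algebra_simps)
qed

lemma Z0_closed: "0 : Z0" "1 : Z0" "z : Z0 ==> z' : Z0 ==> z + z' : Z0" "z : Z0 ==> z' : Z0 ==> z * z' : Z0"
 "z : Z0 ==> eta c * z : Z0" "zmon q : Z0"
proof -
 show m: "zmon q : Z0" for q unfolding Z0_def by (rule vs.span_base) simp
 show "1 : Z0" using m[of "(0, 0)"] by (simp add: zmon_def)
 show "0 : Z0" "z : Z0 ==> z' : Z0 ==> z + z' : Z0" "z : Z0 ==> eta c * z : Z0"
  unfolding Z0_def by (simp_all add: vs.span_zero vs.span_add vs.span_scale)
 assume z: "z : Z0" "z' : Z0"
 have "zmon q * z' : Z0" for q
  using span_left_mult[of "range zmon" "zmon q" "range zmon" z'] z(2) m zmon_mult unfolding Z0_def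
  by (cases q) force
 then show "z * z' : Z0" using span_right_mult[of "range zmon" z' "range zmon" z] z(1) unfolding Z0_def by blast
qed

lemma span_exhibit:
 assumes "r : vs.span (f ` A)"
 obtains F c where "finite F" "F <= A" "r = (\<Sum>q\<in>F. eta (c q) * f q)" "!!q. q : F ==> c q ~= 0"
proof -
 have "\<exists>F c. finite F & F <= A & r = (\<Sum>q\<in>F. eta (c q) * f q)"
  using assms
 proof (induction r rule: vs.span_induct_alt)
  case base
  show ?case by (intro exI[of _ "{}"]) simp
 next
  case (step a m r)
  then obtain F c q where F: "finite F" "F <= A" "r = (\<Sum>q\<in>F. eta (c q) * f q)" "q : A" "m = f q" by blast
  let ?c = "%q'. (if q' = q then a else 0) + (if q' : F then c q' else 0)"
  have "(\<Sum>q'\<in>insert q F. eta (?c q') * f q') = (\<Sum>q'\<in>insert q F. if q' = q then eta a * f q' else 0) + (\<Sum>q'\<in>insert q F. if q' : F then eta (c q') * f q' else 0)"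
   unfolding sum.distrib[symmetric] by (intro sum.cong refl) (auto simp: eta_add distrib_right)
  also have "(\<Sum>q'\<in>insert q F. if q' = q then eta a * f q' else 0) = eta a * f q" using F by (simp add: sum.delta)
  also have "(\<Sum>q'\<in>insert q F. if q' : F then eta (c q') * f q' else 0) = r"
   unfolding F(3) using F(1) by (intro sum.mono_neutral_cong_right) auto
  finally show ?case using F by (intro exI[of _ "insert q F"] exI[of _ ?c]) auto
 qed
 then obtain F c where F: "finite F" "F <= A" "r = (\<Sum>q\<in>F. eta (c q) * f q)" by blast
 have "r = (\<Sum>q\<in>{q\<in>F. c q ~= 0}. eta (c q) * f q)"
  unfolding F(3) using F(1) by (intro sum.mono_neutral_right) auto
 note sum = this
 have fin: "finite {q\<in>F. c q ~= 0}" and sub: "{q\<in>F. c q ~= 0} <= A" using F(1,2) by auto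
 show ?thesis by (rule that[OF fin sub sum]) simp
qed

lemma zmon_indep:
 assumes "finite F" "(\<Sum>q\<in>F. eta (c q) * zmon q) = 0" "q : F"
 shows "c q = 0"
proof -
 let ?g = "%(i, j). (False, int p * i, 2 * p * j)" and ?h = "%(m, i, j). (i div int p, j div (2 * p))"
 have inv: "?h (?g q) = q" for q using p2 by (cases q) auto
 have inj: "inj_on ?g F" by (rule inj_on_inverseI[where g = ?h]) (rule inv)
 have "(\<Sum>q\<in>?g ` F. eta ((c \<circ> ?h) q) * mon q) = (\<Sum>q\<in>F. eta (c (?h (?g q))) * mon (?g q))"
  by (subst sum.reindex[OF inj]) simp
 also have "\<dots> = (\<Sum>q\<in>F. eta (c q) * zmon q)" unfolding inv by (intro sum.cong refl) (auto simp: zmon_mon)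
 finally have "(c \<circ> ?h) (?g q) = 0" using assms by (intro indep[of "?g ` F" "c \<circ> ?h" "?g q"]) auto
 then show ?thesis using inv[of q] by simp
qed

text \<open>In the lexicographic order on exponents, the product of the two leading monomials is
  produced by no other pair, so its coefficient in the product is the product of the leading
  coefficients.\<close>

lemma Z0_domain:
 assumes z: "z : Z0" "z' : Z0" "z ~= 0" "z' ~= 0"
 shows "z * z' ~= 0"
proof
 assume 0: "z * z' = 0"
 obtain F c where F: "finite F" "z = (\<Sum>q\<in>F. eta (c q) * zmon q)" "!!q. q : F ==> c q ~= 0"
  using z(1) unfolding Z0_def by (elim span_exhibit) blast
 obtain F' c' where F': "finite F'" "z' = (\<Sum>q\<in>F'. eta (c' q) * zmon q)" "!!q. q : F' ==> c' q ~= 0"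
  using z(2) unfolding Z0_def by (elim span_exhibit) blast
 have top: "\<exists>q\<in>G. \<forall>r\<in>G. fst r < fst q \<or> fst r = fst q & snd r \<le> snd q" if G: "finite G" "G ~= {}" for G :: "(int \<times> nat) set"
 proof -
  define a where "a = Max (fst ` G)"
  have a: "a : fst ` G" "!!r. r : G ==> fst r \<le> a" using G by (simp_all add: a_def)
  define H where "H = {r\<in>G. fst r = a}"
  have H: "finite H" "H ~= {}" using G a by (auto simp: H_def)
  define b where "b = Max (snd ` H)"
  have "b : snd ` H" using H by (simp add: b_def)
  then obtain q where q: "q : H" "snd q = b" by blast
  have "snd r \<le> b" if "r : H" for r using H that by (simp add: b_def)
  then show ?thesis using q a by (intro bexI[of _ q]) (fastforce simp: H_def)+
 qed
 have ne: "F ~= {}" "F' ~= {}" using z F(2) F'(2) by auto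
 obtain q where q: "q : F" "!!r. r : F ==> fst r < fst q \<or> fst r = fst q & snd r \<le> snd q"
  using top[OF F(1) ne(1)] by blast
 obtain q' where q': "q' : F'" "!!r. r : F' ==> fst r < fst q' \<or> fst r = fst q' & snd r \<le> snd q'"
  using top[OF F'(1) ne(2)] by blast
 let ?add = "\<lambda>(r :: int \<times> nat, r' :: int \<times> nat). (fst r + fst r', snd r + snd r')"
 let ?P = "F \<times> F'"
 have "z * z' = (\<Sum>r\<in>F. \<Sum>r'\<in>F'. (eta (c r) * zmon r) * (eta (c' r') * zmon r'))"
  unfolding F(2) F'(2) by (rule sum_product)
 also have "\<dots> = (\<Sum>(r, r')\<in>?P. (eta (c r) * zmon r) * (eta (c' r') * zmon r'))"
  by (rule sum.cartesian_product)
 also have "\<dots> = (\<Sum>pr\<in>?P. eta (c (fst pr) * c' (snd pr)) * zmon (?add pr))"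
 proof (intro sum.cong refl)
  fix pr assume "pr : ?P"
  obtain i j i' j' where pr: "pr = ((i, j), (i', j'))" by (metis surj_pair)
  have "(eta (c (i, j)) * zmon (i, j)) * (eta (c' (i', j')) * zmon (i', j')) = eta (c (i, j)) * (eta (c' (i', j')) * (zmon (i, j) * zmon (i', j')))"
   using eta_scale_right[of "zmon (i, j)" "c' (i', j')" "zmon (i', j')"] by (simp only: mult.assoc)
  then show "(case pr of (r, r') => (eta (c r) * zmon r) * (eta (c' r') * zmon r')) = eta (c (fst pr) * c' (snd pr)) * zmon (?add pr)"
   unfolding pr prod.case fst_conv snd_conv zmon_mult eta_mult by (simp only: mult.assoc)
 qed
 also have "\<dots> = (\<Sum>g\<in>?add ` ?P. \<Sum>pr\<in>{pr : ?P. ?add pr = g}. eta (c (fst pr) * c' (snd pr)) * zmon (?add pr))"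
  using F(1) F'(1) by (intro sum.image_gen) simp
 also have "\<dots> = (\<Sum>g\<in>?add ` ?P. eta (\<Sum>pr\<in>{pr : ?P. ?add pr = g}. c (fst pr) * c' (snd pr)) * zmon g)"
 proof (intro sum.cong refl)
  fix g
  have eta_sum: "eta (sum f A) = (\<Sum>i\<in>A. eta (f i))" if "finite A" for f :: "(int \<times> nat) \<times> (int \<times> nat) => 'k" and A
   using that by (induction A) (simp_all add: eta_add)
  show "(\<Sum>pr\<in>{pr : ?P. ?add pr = g}. eta (c (fst pr) * c' (snd pr)) * zmon (?add pr))
    = eta (\<Sum>pr\<in>{pr : ?P. ?add pr = g}. c (fst pr) * c' (snd pr)) * zmon g"
   using F(1) F'(1) by (subst eta_sum) (auto simp: sum_distrib_right intro!: sum.cong)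
 qed
 finally have "(\<Sum>g\<in>?add ` ?P. eta (\<Sum>pr\<in>{pr : ?P. ?add pr = g}. c (fst pr) * c' (snd pr)) * zmon g) = 0" using 0 by simp
 moreover have "?add (q, q') : ?add ` ?P" using q q' by blast
 ultimately have "(\<Sum>pr\<in>{pr : ?P. ?add pr = ?add (q, q')}. c (fst pr) * c' (snd pr)) = 0"
  using F(1) F'(1) by (intro zmon_indep[of "?add ` ?P" "%g. \<Sum>pr\<in>{pr : ?P. ?add pr = g}. c (fst pr) * c' (snd pr)"]) auto
 moreover have "{pr : ?P. ?add pr = ?add (q, q')} = {(q, q')}"
 proof
  show "{pr : ?P. ?add pr = ?add (q, q')} <= {(q, q')}"
  proof
   fix pr assume "pr : {pr : ?P. ?add pr = ?add (q, q')}"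
   then obtain r r' where pr: "pr = (r, r')" "r : F" "r' : F'" "fst r + fst r' = fst q + fst q'" "snd r + snd r' = snd q + snd q'" by auto
   have "fst r = fst q & fst r' = fst q'" using q(2)[OF pr(2)] q'(2)[OF pr(3)] pr(4) by linarith
   moreover have "snd r = snd q & snd r' = snd q'" using q(2)[OF pr(2)] q'(2)[OF pr(3)] pr(5) calculation by linarith
   ultimately show "pr : {(q, q')}" by (simp add: pr(1) prod_eq_iff)
  qed
 qed (use q q' in auto)
 ultimately have "c q * c' q' = 0" by simp
 then show False using F(3)[OF q(1)] F'(3)[OF q'(1)] by simp
qed

subsection \<open>Coordinates over the center\<close>

text \<open>The maps of the form of \<open>elem_op\<close> with all factors in \<open>W\<close>. The
  list of factors is hidden by a quantifier, so that closure under sums, composition and powers can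
  be used without recording it.\<close>

definition elop :: "('a => 'a) => bool" where
 "elop f \<longleftrightarrow> (\<exists>ps. set ps <= W \<times> W & (\<forall>r. f r = (\<Sum>(a, b)\<leftarrow>ps. a * r * b)))"

lemma elop_basic: "a : W ==> b : W ==> elop (%r. a * r * b)"
 unfolding elop_def by (intro exI[of _ "[(a, b)]"]) simp

lemma elop_add:
 assumes "elop f" "elop g" shows "elop (%r. f r + g r)"
proof -
 obtain ps qs where "set ps <= W \<times> W" "\<forall>r. f r = (\<Sum>(a, b)\<leftarrow>ps. a * r * b)"
  "set qs <= W \<times> W" "\<forall>r. g r = (\<Sum>(a, b)\<leftarrow>qs. a * r * b)" using assms unfolding elop_def by blast
 then show ?thesis unfolding elop_def by (intro exI[of _ "ps @ qs"]) simp
qed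

lemma elop_zero: "elop (%r. 0)"
 unfolding elop_def by (intro exI[of _ "[]"]) simp

lemma elop_bimult:
 assumes "elop f" "a : W" "b : W" shows "elop (%r. a * f r * b)"
proof -
 obtain ps where ps: "set ps <= W \<times> W" "\<forall>r. f r = (\<Sum>(a, b)\<leftarrow>ps. a * r * b)" using assms unfolding elop_def by blast
 have "a * (\<Sum>(c, d)\<leftarrow>ps. c * r * d) * b = (\<Sum>(c, d)\<leftarrow>map (%(c, d). (a * c, d * b)) ps. c * r * d)" for r
  by (induction ps) (auto simp: distrib_left distrib_right mult.assoc)
 moreover have "set (map (%(c, d). (a * c, d * b)) ps) <= W \<times> W"
  using ps(1) assms subring_setD(4)[OF subring_W] by auto
 ultimately show ?thesis unfolding elop_def using ps(2) by (intro exI[of _ "map (%(c, d). (a * c, d * b)) ps"]) simp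
qed

lemma elop_comp:
 assumes "elop f" "elop g" shows "elop (%r. f (g r))"
proof -
 obtain ps where ps: "set ps <= W \<times> W" "\<forall>r. f r = (\<Sum>(a, b)\<leftarrow>ps. a * r * b)" using assms unfolding elop_def by blast
 have "elop (%r. \<Sum>(a, b)\<leftarrow>ps. a * g r * b)"
  using ps(1) by (induction ps) (auto intro!: elop_zero elop_add elop_bimult assms(2))
 then show ?thesis using ps(2) by simp
qed

lemma elop_power: "elop f ==> elop (%r. (f ^^ n) r)"
proof (induction n)
 case 0
 show ?case using elop_basic[OF W_closed(2) W_closed(2)] by simp
next
 case (Suc n)
 then show ?case using elop_comp[of f "f ^^ n"] by simp
qed

lemma elop_linear:
 assumes "elop f"
 shows "f (r + r') = f r + f r'" "f 0 = 0" "r : W ==> f r : W"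
  "(!!u. u : W ==> z * u = u * z) ==> f (z * r) = z * f r"
proof -
 obtain ps where ps: "set ps <= W \<times> W" "f = (%r. \<Sum>(a, b)\<leftarrow>ps. a * r * b)" using assms unfolding elop_def by blast
 show "f (r + r') = f r + f r'" unfolding ps(2) by (induction ps) (auto simp: distrib_left distrib_right)
 show "f 0 = 0" unfolding ps(2) by (induction ps) auto
 show "f r : W" if "r : W"
  unfolding ps(2) using ps(1) that by (induction ps) (auto intro!: W_closed subring_setD(4)[OF subring_W])
 show "f (z * r) = z * f r" if z: "!!u. u : W ==> z * u = u * z"
  unfolding ps(2) using ps(1)
 proof (induction ps)
  case (Cons q ps)
  obtain a b where q: "q = (a, b)" by (cases q)
  have "a * (z * r) * b = z * (a * r * b)" using z[of a] Cons(2) q by (simp add: mult.assoc[symmetric])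
  then show ?case using Cons q by (simp add: distrib_left)
 qed simp
qed

lemma elop_sum:
 assumes "elop f" shows "f (\<Sum>i\<in>A. g i) = (\<Sum>i\<in>A. f (g i))"
 by (induction A rule: infinite_finite_induct) (simp_all add: elop_linear[OF assms])

text \<open>On \<open>s^a t^b\<close> the inner derivations \<open>adt\<close> and
  \<open>ads\<close> are the partial derivatives with respect to \<open>s\<close> and to
  \<open>t\<close>.\<close>

definition adt where "adt r = t * r - r * t"
definition ads where "ads r = r * s - s * r"

lemma elop_ad: "elop adt" "elop ads"
proof -
 have m: "- a : W" if "a : W" for a using subring_setD(5)[OF subring_W that] .
 have "adt = (%r. t * r * 1 + (- 1) * r * t)" "ads = (%r. 1 * r * s + (- s) * r * 1)"
  by (auto simp: adt_def ads_def fun_eq_iff)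
 moreover have "elop (%r. t * r * 1 + (- 1) * r * t)" "elop (%r. 1 * r * s + (- s) * r * 1)"
  by (intro elop_add elop_basic W_gens W_closed m)+
 ultimately show "elop adt" "elop ads" by (simp_all only:)
qed

lemma of_nat_left: "a * (of_nat n * b) = of_nat n * (a * b)" for a b :: 'a
 by (metis mult.assoc mult_of_nat_commute)

lemma adt_monomial: "(adt ^^ m) (s ^ a * t ^ b) = of_nat (\<Prod>i<m. a - i) * (s ^ (a - m) * t ^ b)"
proof (induction m)
 case (Suc m)
 have ad: "adt (of_nat n * r) = of_nat n * adt r" for n r
  by (simp add: adt_def right_diff_distrib of_nat_left mult.assoc)
 have "adt (s ^ c * t ^ b) = of_nat c * (s ^ (c - 1) * t ^ b)" for c
 proof -
  have "t * (s ^ c * t ^ b) = (s ^ c * t + of_nat c * s ^ (c - 1)) * t ^ b"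
   by (simp only: t_sn[symmetric] mult.assoc)
  then show ?thesis by (simp add: adt_def distrib_right mult.assoc power_commutes)
 qed
 then have "(adt ^^ Suc m) (s ^ a * t ^ b) = of_nat (\<Prod>i<m. a - i) * (of_nat (a - m) * (s ^ (a - m - 1) * t ^ b))"
  using Suc by (simp add: ad)
 then show ?case by (simp add: mult.assoc)
qed simp

lemma ads_monomial: "(ads ^^ m) (s ^ a * t ^ b) = of_nat (\<Prod>i<m. b - i) * (s ^ a * t ^ (b - m))"
proof (induction m)
 case (Suc m)
 have ad: "ads (of_nat n * r) = of_nat n * ads r" for n r
  by (simp add: ads_def right_diff_distrib of_nat_left mult.assoc)
 have "ads (s ^ a * t ^ c) = of_nat c * (s ^ a * t ^ (c - 1))" for c
 proof -
  have "(s ^ a * t ^ c) * s = s ^ a * (s * t ^ c + of_nat c * t ^ (c - 1))"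
   by (simp only: tn_s[symmetric] mult.assoc)
  also have "\<dots> = s ^ a * s * t ^ c + of_nat c * (s ^ a * t ^ (c - 1))"
   by (simp only: distrib_left of_nat_left mult.assoc)
  also have "s ^ a * s * t ^ c = s * (s ^ a * t ^ c)" by (simp only: power_commutes mult.assoc)
  finally show ?thesis by (simp add: ads_def)
 qed
 then have "(ads ^^ Suc m) (s ^ a * t ^ b) = of_nat (\<Prod>i<m. b - i) * (of_nat (b - m) * (s ^ a * t ^ (b - m - 1)))"
  using Suc by (simp add: ad)
 then show ?case by (simp add: mult.assoc)
qed simp

text \<open>Normalizes the factor \<open>(p - 1)!\<close> that \<open>p - 1\<close> derivatives of a
  power with exponent \<open>p - 1\<close> leave behind. This factorial is not divisible by
  \<open>p\<close>.\<close>

definition \<kappa> :: 'k where "\<kappa> = inverse (of_nat (fact (p - 1)))"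

lemma fact_nonzero: "(of_nat (fact (p - 1)) :: 'k) ~= 0"
 using of_nat_eq_0_iff_char_dvd[where 'a = 'k, of "fact (p - 1)"] char prime_p p2
 by (simp add: prime_dvd_fact_iff)

text \<open>For \<open>a < p - 1\<close> truncated subtraction produces the factor
  \<open>a - a = 0\<close>. For \<open>p \<le> a \<le> 2 p - 2\<close> the index
  \<open>i = a - p\<close> lies in the range and contributes the factor \<open>p\<close>. The bound
  on \<open>a\<close> is what keeps this index below \<open>p - 1\<close>.\<close>

lemma falling_mod_p:
 assumes "a \<le> 2 * p - 2"
 shows "of_nat (\<Prod>i<p - 1. a - i) = (if a = p - 1 then of_nat (fact (p - 1)) else (0 :: 'a))"
proof -
 consider "a < p - 1" | "a = p - 1" | "a \<ge> p" by linarith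
 then show ?thesis
 proof cases
  case 1
  then have 0: "(\<Prod>i<p - 1. a - i) = 0" by (intro prod_zero) auto
  from 1 have "a ~= p - 1" by simp
  then show ?thesis by (simp only: 0 of_nat_0 if_False)
 next
  case 2
  have "(\<Prod>i<n. n - i) = fact n" for n :: nat
   unfolding fact_prod_rev by (simp add: atLeast0LessThan)
  then have 0: "(\<Prod>i<p - 1. p - 1 - i) = fact (p - 1)" .
  show ?thesis unfolding 2 0 by (simp only: simp_thms if_True)
 next
  case 3
  have "a - (a - p) dvd (\<Prod>i<p - 1. a - i)" using 3 assms p2 by (intro dvd_prodI) auto
  then have "p dvd (\<Prod>i<p - 1. a - i)" using 3 by simp
  then have 0: "of_nat (\<Prod>i<p - 1. a - i) = (0 :: 'a)" by (rule of_nat_p_dvd)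
  from 3 p2 have "a ~= p - 1" by simp
  then show ?thesis by (simp only: 0 if_False)
 qed
qed

text \<open>Extracts the coefficient of \<open>s^(p-1) t^(p-1)\<close> from combinations of
  \<open>s^a t^b\<close> with exponents up to \<open>2 p - 2\<close>. Exponents in that range arise
  when exponents below \<open>p\<close> are shifted by at most \<open>p - 1\<close>.\<close>

definition top where "top r = eta (\<kappa> * \<kappa>) * (adt ^^ (p - 1)) ((ads ^^ (p - 1)) r)"

lemma elop_top: "elop top"
proof -
 have "elop (%r. eta (\<kappa> * \<kappa>) * (adt ^^ (p - 1)) ((ads ^^ (p - 1)) r) * 1)"
  by (intro elop_bimult elop_comp[of "adt ^^ (p - 1)" "ads ^^ (p - 1)"] elop_power elop_ad W_gens W_closed)
 then show ?thesis by (simp add: top_def[abs_def])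
qed

lemma top_monomial:
 assumes "a \<le> 2 * p - 2" "b \<le> 2 * p - 2"
 shows "top (s ^ a * t ^ b) = (if a = p - 1 & b = p - 1 then 1 else 0)"
proof -
 have lin: "(adt ^^ m) (of_nat n * r) = of_nat n * (adt ^^ m) r" for m n r
  using elop_linear(4)[OF elop_power[OF elop_ad(1)], of "of_nat n"] by (simp add: mult_of_nat_commute)
 have "top (s ^ a * t ^ b) = eta (\<kappa> * \<kappa>) * (of_nat (\<Prod>i<p - 1. b - i) * (of_nat (\<Prod>i<p - 1. a - i) * (s ^ (a - (p - 1)) * t ^ (b - (p - 1)))))"
  unfolding top_def ads_monomial lin adt_monomial ..
 also have "\<dots> = (if a = p - 1 & b = p - 1 then eta (\<kappa> * \<kappa>) * (of_nat (fact (p - 1)) * of_nat (fact (p - 1))) else 0)"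
  unfolding falling_mod_p[OF assms(1)] falling_mod_p[OF assms(2)] by simp
 also have "eta (\<kappa> * \<kappa>) * (of_nat (fact (p - 1)) * of_nat (fact (p - 1))) = eta ((\<kappa> * \<kappa>) * (of_nat (fact (p - 1)) * of_nat (fact (p - 1))))"
  by (simp only: eta_mult eta_of_nat)
 also have "(\<kappa> * \<kappa>) * (of_nat (fact (p - 1)) * of_nat (fact (p - 1))) = 1"
 proof -
  have 1: "\<kappa> * of_nat (fact (p - 1)) = 1" using fact_nonzero unfolding \<kappa>_def by (rule left_inverse)
  have "(\<kappa> * \<kappa>) * (of_nat (fact (p - 1)) * of_nat (fact (p - 1))) = (\<kappa> * of_nat (fact (p - 1))) * (\<kappa> * of_nat (fact (p - 1)))"
   by (simp only: ac_simps)
  then show ?thesis by (simp only: 1 mult_1_left)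
 qed
 finally show ?thesis by simp
qed

definition bas :: "(bool \<times> bool) \<times> nat \<times> nat => 'a" where
 "bas = (%((i, j), a, b). E i j * (s ^ a * t ^ b))"

text \<open>The coordinate at \<open>bas ((i, j), a, b)\<close>. Summing
  \<open>E k i * r * E j k\<close> over both values of \<open>k\<close> isolates the matrix entry at
  \<open>(i, j)\<close> as a scalar matrix; the outer powers then move \<open>s^a t^b\<close> to the
  exponents \<open>p - 1\<close>, where \<open>top\<close> reads off its coefficient.\<close>

definition zop :: "(bool \<times> bool) \<times> nat \<times> nat => 'a => 'a" where
 "zop = (%((i, j), a, b) r. top (s ^ (p - 1 - a) * (E False i * r * E j False + E True i * r * E j True) * t ^ (p - 1 - b)))"

definition Ix :: "((bool \<times> bool) \<times> nat \<times> nat) set" where "Ix = UNIV \<times> {..<p} \<times> {..<p}"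

lemma card_Ix: "card Ix = (2 * p)\<^sup>2" "finite Ix"
 by (simp_all add: Ix_def card_cartesian_product power2_eq_square UNIV_Times_UNIV[symmetric] del: UNIV_Times_UNIV)

lemma bas_W: "bas q : W"
 using W_left'(7) subring_setD(4,7)[OF subring_W] W_gens by (cases q) (auto simp: bas_def)

lemma elop_zop: "elop (zop q)"
proof -
 obtain i j a b where q: "q = ((i, j), a, b)" by (metis surj_pair)
 have "elop (%r. top (s ^ (p - 1 - a) * (E False i * r * E j False + E True i * r * E j True) * t ^ (p - 1 - b)))"
  by (intro elop_comp[OF elop_top] elop_bimult elop_add elop_basic W_gens subring_setD(7)[OF subring_W])
 then show ?thesis by (simp add: q zop_def)
qed

lemma zop_bas:
 assumes "q : Ix" "q' : Ix"
 shows "zop q (bas q') = (if q = q' then 1 else 0)"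
proof -
 obtain i j a b where q: "q = ((i, j), a, b)" by (metis surj_pair)
 obtain i' j' c d where q': "q' = ((i', j'), c, d)" by (metis surj_pair)
 have lt: "a < p" "b < p" "c < p" "d < p" using assms by (auto simp: Ix_def q q')
 let ?z = "s ^ c * t ^ d"
 have sE: "s ^ c * E k l = E k l * s ^ c" and tE: "t ^ d * E k l = E k l * t ^ d" for k l
  using power_commuting_commutes[OF E_comm[OF sx sv]] power_commuting_commutes[OF E_comm[OF tx tv]] by simp_all
 then have zE: "?z * E k l = E k l * ?z" for k l by (metis mult.assoc)
 have "E k i * bas q' * E j k = (if i = i' & j = j' then E k k * ?z else 0)" for k
 proof -
  have "E k i * bas q' * E j k = (E k i * E i' j') * (?z * E j k)" by (simp add: bas_def q' mult.assoc)
  also have "\<dots> = (E k i * E i' j') * (E j k * ?z)" by (simp only: zE)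
  also have "\<dots> = (E k i * E i' j') * E j k * ?z" by (simp only: mult.assoc)
  also have "\<dots> = (if i = i' & j = j' then E k k * ?z else 0)" by (simp add: E_mult)
  finally show ?thesis .
 qed
 then have inner: "E False i * bas q' * E j False + E True i * bas q' * E j True = (if i = i' & j = j' then ?z else 0)"
  using E_one by (simp add: distrib_right[symmetric])
 have "s ^ (p - 1 - a) * ?z * t ^ (p - 1 - b) = s ^ (p - 1 - a + c) * t ^ (d + (p - 1 - b))"
  by (simp add: power_add mult.assoc)
 moreover have "top (s ^ (p - 1 - a + c) * t ^ (d + (p - 1 - b))) = (if a = c & b = d then 1 else 0)"
  using lt by (subst top_monomial) auto
 ultimately have "top (s ^ (p - 1 - a) * ?z * t ^ (p - 1 - b)) = (if a = c & b = d then 1 else 0)" by simp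
 then show ?thesis using elop_linear(2)[OF elop_top] inner by (simp add: q zop_def) (simp add: q')
qed

lemma W_Z0_combination:
 assumes "u : W"
 shows "\<exists>c. (\<forall>q. c q : Z0) & u = (\<Sum>q\<in>Ix. c q * bas q)"
 using assms unfolding W_eq
proof (induction u rule: vs.span_induct_alt)
 case base
 show ?case using Z0_closed(1) by (intro exI[of _ "%_. 0"]) simp
next
 case (step e m u)
 then obtain i j a b where m: "m = mon' ((i, j), a, b)" by (metis imageE surj_pair)
 obtain c where c: "!!q. c q : Z0" "u = (\<Sum>q\<in>Ix. c q * bas q)" using step by blast
 \<comment> \<open>Division of the exponents by \<open>p\<close>: the remainders select the basis
   element, the quotients form the central factor \<open>z\<close>. For the negative powers of
   \<open>s\<close> the integer remainder is nonnegative, so \<open>nat\<close> loses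
   nothing.\<close>
 define q0 where "q0 = ((i, j), nat (a mod int p), b mod p)"
 define z where "z = spow (int p * (a div int p)) * t ^ (p * (b div p))"
 have z: "z : Z0" unfolding z_def zmon_t by (rule Z0_closed)
 have q0: "q0 : Ix" using p2 by (auto simp: q0_def Ix_def nat_less_iff)
 have "m = z * bas q0"
 proof -
  let ?S = "spow (int p * (a div int p))" and ?T = "t ^ (p * (b div p))"
  have "spow a = ?S * s ^ nat (a mod int p)"
   using p2 by (simp add: spow_of_nat[symmetric] spow_add[symmetric])
  moreover have "t ^ b = ?T * t ^ (b mod p)" by (simp add: power_add[symmetric])
  ultimately have "m = E i j * (?S * s ^ nat (a mod int p)) * (?T * t ^ (b mod p))" by (simp add: m mon'_def)
  also have "\<dots> = (E i j * ?S) * (s ^ nat (a mod int p) * ?T) * t ^ (b mod p)" by (simp add: mult.assoc)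
  also have "s ^ nat (a mod int p) * ?T = ?T * s ^ nat (a mod int p)"
   using t_p_central[OF subring_setD(7)[OF subring_W W_gens(3)]] by simp
  also have "E i j * ?S = ?S * E i j" using spow_p_central[OF W_gens(9)] by simp
  also have "?S * E i j * (?T * s ^ nat (a mod int p)) * t ^ (b mod p) = ?S * (E i j * ?T) * (s ^ nat (a mod int p) * t ^ (b mod p))"
   by (simp add: mult.assoc)
  also have "E i j * ?T = ?T * E i j" using t_p_central[OF W_gens(9)] by simp
  finally show ?thesis by (simp add: z_def q0_def bas_def mult.assoc)
 qed
 then have "eta e * m + u = (\<Sum>q\<in>Ix. (c q + (if q = q0 then eta e * z else 0)) * bas q)"
  unfolding c(2) distrib_right sum.distrib using q0 card_Ix(2)
  by (simp add: if_distrib[of "%z. z * _"] sum.delta mult.assoc add.commute cong: if_cong)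
 moreover have "c q + (if q = q0 then eta e * z else 0) : Z0" for q
  using c z Z0_closed by simp
 ultimately show ?case by (intro exI[of _ "%q. c q + (if q = q0 then eta e * z else 0)"]) blast
qed

lemma zop_combination:
 assumes "!!q. c q : Z0" "q : Ix"
 shows "zop q (\<Sum>r\<in>Ix. c r * bas r) = c q"
proof -
 have "zop q (\<Sum>r\<in>Ix. c r * bas r) = (\<Sum>r\<in>Ix. c r * zop q (bas r))"
  unfolding elop_sum[OF elop_zop] using Z0_central[OF assms(1)]
  by (intro sum.cong refl elop_linear(4)[OF elop_zop]) auto
 also have "\<dots> = (\<Sum>r\<in>Ix. if r = q then c r else 0)"
  using assms(2) by (intro sum.cong refl) (auto simp: zop_bas)
 finally show ?thesis using assms(2) card_Ix by simp
qed

lemma zop_expand: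
 assumes "u : W" shows "u = (\<Sum>q\<in>Ix. zop q u * bas q)" "q : Ix ==> zop q u : Z0"
proof -
 obtain c where c: "!!q. c q : Z0" "u = (\<Sum>q\<in>Ix. c q * bas q)" using W_Z0_combination[OF assms] by blast
 have z: "zop q u = c q" if "q : Ix" for q using zop_combination[OF c(1) that] c(2) by simp
 show "u = (\<Sum>q\<in>Ix. zop q u * bas q)" by (subst c(2)) (simp add: z)
 show "q : Ix ==> zop q u : Z0" using z c by simp
qed

text \<open>The identity is the sum of two basis elements, one for each diagonal matrix unit. The
  coordinate at the first of them is the projection onto the center that
  \<open>azumaya_basis\<close> asks for.\<close>

lemma zop_one: "zop ((False, False), 0, 0) 1 = 1" "((False, False), 0, 0) : Ix"
proof -
 show m: "((False, False), 0, 0) : Ix" using p2 by (simp add: Ix_def)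
 have m': "((True, True), 0, 0) : Ix" using p2 by (simp add: Ix_def)
 have "1 = bas ((False, False), 0, 0) + bas ((True, True), 0, 0)" by (simp add: bas_def E_one)
 then have "zop ((False, False), 0, 0) 1 = zop ((False, False), 0, 0) (bas ((False, False), 0, 0) + bas ((True, True), 0, 0))" by simp
 also have "\<dots> = 1" unfolding elop_linear(1)[OF elop_zop] zop_bas[OF m m] zop_bas[OF m m'] by simp
 finally show "zop ((False, False), 0, 0) 1 = 1" .
qed

text \<open>A central \<open>z\<close> passes through all terms \<open>u r v\<close>, so
  \<open>z\<close> equals the coordinate of \<open>z * 1\<close> at the distinguished index, and
  coordinates lie in \<open>Z0\<close>.\<close>

lemma center_W:
 assumes "z : W" "!!u. u : W ==> z * u = u * z" shows "z : Z0"
proof -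
 have "zop ((False, False), 0, 0) (z * 1) = z * zop ((False, False), 0, 0) 1"
  using assms(2) by (intro elop_linear(4)[OF elop_zop]) auto
 then show ?thesis using zop_expand(2)[OF assms(1) zop_one(2)] zop_one(1) by simp
qed

text \<open>The coordinates of \<open>z u\<close> are \<open>z\<close> times those of
  \<open>u\<close>, and all of this happens in the domain \<open>Z0\<close>.\<close>

lemma Z0_torsion_free:
 assumes "z : Z0" "u : W" "z * u = 0" "z ~= 0" shows "u = 0"
proof -
 have "zop q u = 0" if q: "q : Ix" for q
 proof (rule ccontr)
  assume "zop q u ~= 0"
  then have "z * zop q u ~= 0" using Z0_domain assms zop_expand(2)[OF assms(2) q] by blast
  moreover have "zop q (z * u) = z * zop q u" using Z0_central[OF assms(1)] by (intro elop_linear(4)[OF elop_zop])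
  ultimately show False using assms(3) elop_linear(2)[OF elop_zop] by simp
 qed
 then show ?thesis by (subst zop_expand(1)[OF assms(2)]) simp
qed

text \<open>Puts the coordinates into the format of \<open>dual_basis\<close>: the index set is
  numbered, and the factor lists behind \<open>elop\<close> are split into the families
  \<open>u\<close> and \<open>v\<close>.\<close>

lemma dual_data:
 obtains b :: "nat => 'a" and N :: "nat => nat" and u v :: "nat => nat => 'a" and i0 :: nat where
  "!!i. i < (2 * p)\<^sup>2 ==> b i : W"
  "!!i k. i < (2 * p)\<^sup>2 ==> k < N i ==> u i k : W & v i k : W"
  "!!i r. i < (2 * p)\<^sup>2 ==> r : W ==> (\<Sum>k<N i. u i k * r * v i k) : Z0"
  "!!r. r : W ==> r = (\<Sum>i<(2 * p)\<^sup>2. (\<Sum>k<N i. u i k * r * v i k) * b i)"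
  "!!i j. i < (2 * p)\<^sup>2 ==> j < (2 * p)\<^sup>2 ==> (\<Sum>k<N i. u i k * b j * v i k) = (if i = j then 1 else 0)"
  "i0 < (2 * p)\<^sup>2" "(\<Sum>k<N i0. u i0 k * 1 * v i0 k) = 1"
proof -
 let ?n = "(2 * p)\<^sup>2"
 obtain e where e: "bij_betw e {..<?n} Ix"
  using ex_bij_betw_nat_finite[OF card_Ix(2)] card_Ix(1) by (auto simp: atLeast0LessThan)
 have eI: "e i : Ix" if "i < ?n" for i using e that by (auto simp: bij_betw_def)
 have "\<forall>q. \<exists>ps. set ps <= W \<times> W & (\<forall>r. zop q r = (\<Sum>(a, b)\<leftarrow>ps. a * r * b))"
  using elop_zop unfolding elop_def by blast
 then obtain ps where ps: "!!q. set (ps q) <= W \<times> W" "!!q r. zop q r = (\<Sum>(a, b)\<leftarrow>ps q. a * r * b)" by metis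
 define N where "N i = length (ps (e i))" for i
 define u where "u i k = fst (ps (e i) ! k)" for i k
 define v where "v i k = snd (ps (e i) ! k)" for i k
 have z: "(\<Sum>k<N i. u i k * r * v i k) = zop (e i) r" for i r
  unfolding ps(2) by (simp add: sum_list_sum_nth N_def u_def v_def case_prod_beta atLeast0LessThan)
 have uv: "u i k : W & v i k : W" if "k < N i" for i k
  using ps(1)[of "e i"] nth_mem[of k "ps (e i)"] that unfolding N_def u_def v_def by (metis mem_Times_iff subset_iff)
 have "((False, False), 0, 0) : e ` {..<?n}" unfolding bij_betw_imp_surj_on[OF e] by (rule zop_one(2))
 then obtain i0 where "((False, False), 0, 0) = e i0" "i0 : {..<?n}" by (rule imageE)
 then have i0: "i0 < ?n" "e i0 = ((False, False), 0, 0)" by (simp_all only: lessThan_iff)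
 show ?thesis
 proof (rule that[of "%i. bas (e i)" N u v i0])
  show "r = (\<Sum>i<?n. (\<Sum>k<N i. u i k * r * v i k) * bas (e i))" if "r : W" for r
   unfolding z using zop_expand(1)[OF that] sum.reindex_bij_betw[OF e, of "%q. zop q r * bas q"] by simp
  show "(\<Sum>k<N i. u i k * bas (e j) * v i k) = (if i = j then 1 else 0)" if "i < ?n" "j < ?n" for i j
   unfolding z using zop_bas[OF eI eI] that e by (auto simp: bij_betw_def inj_on_def)
  show "(\<Sum>k<N i. u i k * r * v i k) : Z0" if "i < ?n" "r : W" for i r
   unfolding z using zop_expand(2)[OF that(2) eI[OF that(1)]] .
  show "(\<Sum>k<N i0. u i0 k * 1 * v i0 k) = 1" unfolding z i0(2) by (rule zop_one(1))
 qed (use bas_W uv i0(1) in blast)+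
qed

lemma PI_ring_W: "PI_ring (ring_on W)"
proof -
 obtain b :: "nat => 'a" and N :: "nat => nat" and u v :: "nat => nat => 'a" and i0 :: nat where d:
  "!!i. i < (2 * p)\<^sup>2 ==> b i : W"
  "!!i k. i < (2 * p)\<^sup>2 ==> k < N i ==> u i k : W & v i k : W"
  "!!i r. i < (2 * p)\<^sup>2 ==> r : W ==> (\<Sum>k<N i. u i k * r * v i k) : Z0"
  "!!r. r : W ==> r = (\<Sum>i<(2 * p)\<^sup>2. (\<Sum>k<N i. u i k * r * v i k) * b i)"
  "!!i j. i < (2 * p)\<^sup>2 ==> j < (2 * p)\<^sup>2 ==> (\<Sum>k<N i. u i k * b j * v i k) = (if i = j then 1 else 0)"
  "i0 < (2 * p)\<^sup>2" "(\<Sum>k<N i0. u i0 k * 1 * v i0 k) = 1"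
  by (rule dual_data) (rule that)
 show ?thesis
 proof (rule PI_ring_on[OF subring_W d(1) _ two_cancel])
  fix r assume r: "r : W"
  show "\<exists>c. (\<forall>j<(2 * p)\<^sup>2. \<forall>w'\<in>W. c j * w' = w' * c j) & r = (\<Sum>j<(2 * p)\<^sup>2. c j * b j)"
  proof (intro exI[of _ "%i. \<Sum>k<N i. u i k * r * v i k"] conjI allI impI ballI)
   show "(\<Sum>k<N j. u j k * r * v j k) * w' = w' * (\<Sum>k<N j. u j k * r * v j k)" if "j < (2 * p)\<^sup>2" "w' : W" for j w'
    using Z0_central[OF d(3)[OF that(1) r] that(2)] .
   show "r = (\<Sum>j<(2 * p)\<^sup>2. (\<Sum>k<N j. u j k * r * v j k) * b j)" by (rule d(4)[OF r])
  qed
 qed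
qed

subsection \<open>The subalgebra generated by \<open>x\<close> and \<open>y\<close>\<close>

definition WJ where "WJ = vs.span (mon ` {(i, j, k). j \<ge> 0})"

lemma WJ_W: "u : WJ ==> u : W"
 unfolding WJ_def W_def using vs.span_mono[of "mon ` {(i, j, k). j \<ge> 0}" "range mon"] by auto

lemma WJ_mon: "j \<ge> 0 ==> mon (i, j, k) : WJ"
 unfolding WJ_def by (intro vs.span_base) auto

lemma WJ_left:
 assumes "u : WJ" shows "x * u : WJ" "y * u : WJ" "s * u : WJ"
proof -
 have 0: "0 : WJ" by (simp add: WJ_def vs.span_zero)
 have m: "x * mon q : WJ & y * mon q : WJ & s * mon q : WJ" if "q : {(i, j, k). j \<ge> 0}" for q
 proof -
  obtain i j k where q: "q = (i, j, k)" by (cases q)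
  then have j: "j \<ge> 0" using that by simp
  have "of_int j * mon (True, j, k) : WJ" using WJ_mon[OF j] span_of_int unfolding WJ_def by blast
  then have "y * mon q : WJ" unfolding q
   using mon_left(4,5)[of j k] WJ_mon[of j] WJ_mon[of "j + 1"] j vs.span_add vs.span_diff unfolding WJ_def by (cases i) auto
  then show ?thesis unfolding q using mon_left(1-3)[of i j k] WJ_mon[of j] WJ_mon[of "j + 1"] j 0 by simp
 qed
 show "x * u : WJ" "y * u : WJ" "s * u : WJ"
  using assms m span_left_mult[of "mon ` {(i, j, k). j \<ge> 0}" _ "mon ` {(i, j, k). j \<ge> 0}" u] unfolding WJ_def by blast+
qed

lemma WJ_closed: "0 : WJ" "1 : WJ" "u : WJ ==> u' : WJ ==> u + u' : WJ" "u : WJ ==> u' : WJ ==> u - u' : WJ"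
 "u : WJ ==> eta c * u : WJ"
 using WJ_mon[of 0 False 0] unfolding WJ_def
 by (simp_all add: vs.span_zero vs.span_add vs.span_diff vs.span_scale mon_def)

lemma WJ_left':
 assumes "u : WJ" shows "s ^ n * u : WJ" "y ^ n * u : WJ"
 by (induction n) (simp_all add: mult.assoc WJ_left assms)

lemma subring_WJ: "subring_set WJ"
proof -
 have "u * u' : WJ" if u: "u : WJ" and u': "u' : WJ" for u u'
 proof -
  have "mon q * u' : WJ" if q: "q : {(i, j, k). j \<ge> 0}" for q
  proof -
   obtain i j k where q': "q = (i, j, k)" by (cases q)
   then have j: "j \<ge> 0" using q by simp
   have "spow j * (y ^ k * u') : WJ" using j WJ_left'[OF WJ_left'(2)[OF u']] by (simp add: spow_def)
   then show ?thesis using WJ_left(1) by (simp add: q' mon_def mult.assoc)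
  qed
  then show ?thesis using span_right_mult[of "mon ` {(i, j, k). j \<ge> 0}" u' "mon ` {(i, j, k). j \<ge> 0}" u] u unfolding WJ_def by blast
 qed
 then show ?thesis using WJ_closed by (simp add: subring_set_def)
qed

lemma WJ_gens: "x : WJ" "y : WJ" "s : WJ" "eta c : WJ"
 using WJ_left[OF WJ_closed(2)] WJ_closed(5)[OF WJ_closed(2)] by simp_all

text \<open>By independence an element determines which monomials occur in it, so those monomials
  belong to both index sets.\<close>

lemma span_Int:
 assumes "u : vs.span (mon ` A)" "u : vs.span (mon ` B)"
 shows "u : vs.span (mon ` (A \<inter> B))"
proof -
 obtain F c where F: "finite F" "F <= A" "u = (\<Sum>q\<in>F. eta (c q) * mon q)" "!!q. q : F ==> c q ~= 0"
  by (rule span_exhibit[OF assms(1)]) (rule that)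
 obtain G d where G: "finite G" "G <= B" "u = (\<Sum>q\<in>G. eta (d q) * mon q)" "!!q. q : G ==> d q ~= 0"
  by (rule span_exhibit[OF assms(2)]) (rule that)
 have "F <= G"
 proof
  fix q assume q: "q : F"
  show "q : G"
  proof (rule ccontr)
   assume nq: "q \<notin> G"
   let ?e = "%q. (if q : F then c q else 0) - (if q : G then d q else 0)"
   have "(\<Sum>q\<in>F \<union> G. eta (?e q) * mon q) = (\<Sum>q\<in>F \<union> G. if q : F then eta (c q) * mon q else 0) - (\<Sum>q\<in>F \<union> G. if q : G then eta (d q) * mon q else 0)"
   proof -
    have eta_diff: "eta (a - b) = eta a - eta b" for a b using eta_add[of "a - b" b] by simp
    show ?thesis unfolding sum_subtractf[symmetric] by (intro sum.cong refl) (auto simp: eta_diff left_diff_distrib)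
   qed
   also have "(\<Sum>q\<in>F \<union> G. if q : F then eta (c q) * mon q else 0) = u"
    unfolding F(3) using F G by (intro sum.mono_neutral_cong_right) auto
   also have "(\<Sum>q\<in>F \<union> G. if q : G then eta (d q) * mon q else 0) = u"
    unfolding G(3) using F G by (intro sum.mono_neutral_cong_right) auto
   finally have "?e q = 0" using F G q by (intro indep[of "F \<union> G" ?e q]) auto
   then show False using q nq F(4) by simp
  qed
 qed
 then have "mon q : vs.span (mon ` (A \<inter> B))" if "q : F" for q
  using that F(2) G(2) by (intro vs.span_base imageI) blast
 then show ?thesis unfolding F(3) by (intro vs.span_sum vs.span_scale)
qed

text \<open>An element of \<open>WJ\<close> that commutes with the generators lies in
  \<open>Z0\<close>. The elements \<open>zmon\<close> are themselves monomials, so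
  \<open>span_Int\<close> leaves exactly those with a nonnegative power of \<open>s\<close>.\<close>

lemma center_WJ:
 assumes z: "z : WJ" "z * x = x * z" "z * y = y * z" "z * s = s * z"
 shows "z : vs.span (zmon ` {(i, j). i \<ge> 0})"
proof -
 have "z : Z0" using z WJ_W commute_W by (intro center_W) auto
 moreover have "range zmon = mon ` {(m, i, j). \<exists>i' j'. (m, i, j) = (False, int p * i', 2 * p * j')}"
  by (auto simp: zmon_mon image_iff) (metis surj_pair zmon_mon)
 ultimately have "z : vs.span (mon ` ({(i, j, k). j \<ge> 0} \<inter> {(m, i, j). \<exists>i' j'. (m, i, j) = (False, int p * i', 2 * p * j')}))"
  using z(1) unfolding Z0_def WJ_def by (intro span_Int) simp_all
 moreover have "mon ` ({(i, j, k). j \<ge> 0} \<inter> {(m, i, j). \<exists>i' j'. (m, i, j) = (False, int p * i', 2 * p * j')}) <= zmon ` {(i, j). i \<ge> 0}"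
  using p2 by (force simp: zmon_mon zero_le_mult_iff)
 ultimately show ?thesis using vs.span_mono by blast
qed

text \<open>The exponent is taken to be a multiple of \<open>p\<close>, which makes the denominator
  central.\<close>

lemma clear_denominator:
 assumes "u : W" shows "\<exists>m. s ^ (p * m) * u : WJ"
proof -
 have up: "s ^ (p * m') * u : WJ" if "s ^ (p * m) * u : WJ" "m \<le> m'" for u m m'
 proof -
  have "p * m' = p * (m' - m) + p * m" using that by (simp add: distrib_left[symmetric])
  then have "s ^ (p * m') * u = s ^ (p * (m' - m)) * (s ^ (p * m) * u)" by (simp add: power_add mult.assoc)
  then show ?thesis using that WJ_left'(1) by simp
 qed
 show ?thesis using assms unfolding W_def
 proof (induction u rule: vs.span_induct_alt)
  case base
  show ?case using WJ_closed by simp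
 next
  case (step c m u)
  then obtain i j k where m: "m = mon (i, j, k)" by (metis imageE surj_pair)
  obtain e where e: "s ^ (p * e) * u : WJ" using step by blast
  define f where "f = nat (- j)"
  have sm: "s ^ n * mon (i, j, k) = mon (i, j + int n, k)" for n
   by (induction n arbitrary: j) (simp_all add: mult.assoc mon_left algebra_simps)
  have "j + int (p * f) \<ge> 0"
  proof -
   have "f \<le> p * f" using p2 by simp
   then have "int f \<le> int (p * f)" by (simp only: of_nat_le_iff)
   moreover have "- j \<le> int f" by (simp add: f_def)
   ultimately show ?thesis by linarith
  qed
  then have "s ^ (p * f) * m : WJ" unfolding m sm by (rule WJ_mon)
  then have 1: "s ^ (p * max e f) * m : WJ" by (rule up) simp
  have 2: "s ^ (p * max e f) * u : WJ" using e by (rule up) simp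
  have "s ^ (p * max e f) * (eta c * m + u) = eta c * (s ^ (p * max e f) * m) + s ^ (p * max e f) * u"
   by (simp add: distrib_left eta_scale_right)
  then show ?case using WJ_closed(3)[OF WJ_closed(5)[OF 1] 2] by (intro exI[of _ "max e f"]) simp
 qed
qed

end

section \<open>Rings embedded between the generators and \<open>W\<close>\<close>

context sj_alg_p
begin

abbreviation EE where "EE \<equiv> ring_on (UNIV :: 'a set)"

lemma ring_EE: "ring EE" by (rule ring_ring_on) simp

lemma finsum_EE: "finite A ==> (\<Oplus>$EE i\<in>A. f i) = (\<Sum>i\<in>A. f i)"
 by (rule finsum_ring_on) simp_all

end

text \<open>The common situation of the plane, with image \<open>WJ\<close>, and of its
  localization, with image \<open>W\<close>: a ring embedded in \<open>W\<close> whose image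
  contains the generators. Center, cancellation and dual bases are carried over once for
  both.\<close>

locale sj_copy = sj_alg_p + R?: ring R for R (structure) +
 fixes f
 assumes f_hom: "f : ring_hom R (ring_on UNIV)" and f_inj: "inj_on f (carrier R)"
  and f_W: "f ` carrier R <= W" and f_gens: "x : f ` carrier R" "y : f ` carrier R" "s : f ` carrier R"
begin

lemma f_simps [simp]: "a : carrier R ==> b : carrier R ==> f (a ** b) = f a * f b"
  "a : carrier R ==> b : carrier R ==> f (a \<oplus> b) = f a + f b" "f \<one> = 1" "f \<zero> = 0"
 using ring_hom_mult[OF f_hom] ring_hom_add[OF f_hom] ring_hom_one[OF f_hom]
  ring_hom_zero[OF f_hom ring_axioms ring_EE] by auto

lemma f_eq_iff: "a : carrier R ==> b : carrier R ==> f a = f b \<longleftrightarrow> a = b"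
 using f_inj by (auto dest: inj_onD)

lemma f_in_W: "a : carrier R ==> f a : W" using f_W by blast

lemma f_minus: "a : carrier R ==> f (\<ominus> a) = - f a"
proof -
 assume a: "a : carrier R"
 have "f (\<ominus> a \<oplus> a) = 0" unfolding l_neg[OF a] by simp
 then have "f (\<ominus> a) + f a = 0" using a by simp
 then show ?thesis by (simp add: add_eq_0_iff2)
qed

lemma f_pow: "a : carrier R ==> f (a [^] (n::nat)) = f a ^ n"
 by (induction n) (simp_all add: power_commutes)

lemma f_finsum:
 assumes "finite A" "g : A \<rightarrow> carrier R"
 shows "f (\<Oplus>i\<in>A. g i) = (\<Sum>i\<in>A. f (g i))"
 using finsum_ring_hom[OF ring_axioms ring_EE f_hom assms] finsum_EE[OF assms(1)] by simp

text \<open>An element of \<open>W\<close> that commutes with the images of the generators commutes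
  with all of \<open>W\<close>, so the center of the copy is the part of \<open>Z0\<close> that lies
  in the image.\<close>

lemma center_iff:
 assumes r: "r : carrier R"
 shows "r : ring_center R \<longleftrightarrow> f r : Z0"
proof
 assume c: "r : ring_center R"
 have "f r * u = u * f r" if u: "u : f ` carrier R" for u
 proof -
  obtain a where a: "a : carrier R" "u = f a" using u by blast
  have "f (r ** a) = f (a ** r)" using ring_centerD(2)[OF c a(1)] by simp
  then show ?thesis using a r by simp
 qed
 then show "f r : Z0" using f_gens f_in_W[OF r] commute_W by (intro center_W) blast+
next
 assume c: "f r : Z0"
 show "r : ring_center R"
 proof (rule ring_centerI[OF r])
  fix a assume a: "a : carrier R"
  have "f (r ** a) = f (a ** r)" using Z0_central[OF c f_in_W[OF a]] r a by simp
  then show "r ** a = a ** r" using r a by (simp add: f_eq_iff del: f_simps)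
 qed
qed

lemma central_cancel:
 assumes "c : ring_center R" "r : carrier R" "c ** r = \<zero>" "c ~= \<zero>"
 shows "r = \<zero>"
proof -
 have c: "c : carrier R" by (rule ring_centerD(1)[OF assms(1)])
 have "f c * f r = 0" using f_simps(1)[OF c assms(2)] assms(3) by simp
 moreover have "f c ~= 0" using f_eq_iff[OF c zero_closed] assms(4) by simp
 ultimately have "f r = 0"
  using Z0_torsion_free[of "f c" "f r"] center_iff[OF c] assms(1) f_in_W[OF assms(2)] by blast
 then show ?thesis using f_eq_iff[OF assms(2) zero_closed] by simp
qed

text \<open>\<open>M\<close> clears the denominators of the dual bases of \<open>W\<close>; for the localized ring itself \<open>M = 0\<close>.\<close>

lemma dual_basis_copy:
 fixes b :: "nat => 'b" and N :: "nat => nat" and u v :: "nat => nat => 'b" and i0 M :: nat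
 assumes M: "!!w'. w' : B ==> s ^ (p * M) * w' : f ` carrier R"
  and b: "!!i. i < n ==> b i : W" "!!i. i < n ==> b i : B"
  and uv: "!!i k. i < n ==> k < N i ==> u i k : W & v i k : W" "!!i k. i < n ==> k < N i ==> u i k : B & v i k : B"
  and z: "!!i r. i < n ==> r : W ==> (\<Sum>k<N i. u i k * r * v i k) : Z0"
  and ex: "!!r. r : W ==> r = (\<Sum>i<n. (\<Sum>k<N i. u i k * r * v i k) * b i)"
  and du: "!!i j. i < n ==> j < n ==> (\<Sum>k<N i. u i k * b j * v i k) = (if i = j then 1 else 0)"
 defines "g \<equiv> %w'. inv_into (carrier R) f (s ^ (p * M) * w')"
 shows "dual_basis_domain R n N (%i. g (b i)) (%i k. g (u i k)) (%i k. g (v i k)) (inv_into (carrier R) f (s ^ (p * (3 * M))))"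
  "M = 0 ==> i0 < n ==> (\<Sum>k<N i0. u i0 k * 1 * v i0 k) = 1 ==>
   azumaya_basis R n N (%i. g (b i)) (%i k. g (u i k)) (%i k. g (v i k)) i0"
proof -
 let ?\<sigma> = "s ^ (p * M)" and ?d = "inv_into (carrier R) f (s ^ (p * (3 * M)))"
 have fg: "f (g w') = ?\<sigma> * w'" and gc: "g w' : carrier R" if "w' : B" for w'
  using M[OF that] f_inv_into_f inv_into_into unfolding g_def by metis+
 have \<sigma>Z: "s ^ (p * m) : Z0" for m
 proof -
  have "zmon (int m, 0) = s ^ (p * m)" using spow_of_nat[of "p * m"] by (simp add: zmon_def)
  then show ?thesis using Z0_closed(6)[of "(int m, 0)"] by simp
 qed
 have \<sigma>c: "a * (?\<sigma> * a') = ?\<sigma> * (a * a')" if "a : W" for a a'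
  using Z0_central[OF \<sigma>Z that, of M] by (metis mult.assoc)
 obtain s' where s': "s' : carrier R" "f s' = s" using f_gens by blast
 have "s ^ (p * (3 * M)) : f ` carrier R"
  using f_pow[OF s'(1), of "p * (3 * M)"] s' by (metis imageI nat_pow_closed)
 then have d: "?d : carrier R" "f ?d = s ^ (p * (3 * M))" by (simp_all add: f_inv_into_f inv_into_into)
 \<comment> \<open>Each of \<open>u\<close>, \<open>v\<close> and \<open>b\<close> carries one
   factor \<open>s^(p M)\<close>; together they make up the denominator \<open>d\<close>, which
   explains the exponent \<open>3 * M\<close>.\<close>
 have \<sigma>3: "?\<sigma> * (?\<sigma> * ?\<sigma>) = s ^ (p * (3 * M))"
 proof -
  have "p * M + (p * M + p * M) = p * (3 * M)" by simp
  then show ?thesis by (simp only: power_add[symmetric])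
 qed
 have elem: "elem_op R (N i) (%k. g (u i k)) (%k. g (v i k)) r : carrier R"
  "f (elem_op R (N i) (%k. g (u i k)) (%k. g (v i k)) r) = ?\<sigma> * (?\<sigma> * (\<Sum>k<N i. u i k * f r * v i k))"
  if i: "i < n" and r: "r : carrier R" for i r
 proof -
  have uvc: "g (u i k) : carrier R" "g (v i k) : carrier R" if "k < N i" for k using uv(2)[OF i that] gc by auto
  then have t: "(%k. g (u i k) ** r ** g (v i k)) : {..<N i} \<rightarrow> carrier R" using r by auto
  show "elem_op R (N i) (%k. g (u i k)) (%k. g (v i k)) r : carrier R" unfolding elem_op_def using t by (rule finsum_closed)
  have "f (elem_op R (N i) (%k. g (u i k)) (%k. g (v i k)) r) = (\<Sum>k<N i. f (g (u i k) ** r ** g (v i k)))"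
   unfolding elem_op_def using t by (intro f_finsum) simp
  also have "\<dots> = (\<Sum>k<N i. ?\<sigma> * (?\<sigma> * (u i k * f r * v i k)))"
  proof (intro sum.cong refl)
   fix k assume "k : {..<N i}"
   then have k: "k < N i" by simp
   have uW: "u i k * f r : W" using uv(1)[OF i k] f_in_W[OF r] subring_setD(4)[OF subring_W] by blast
   have "f (g (u i k) ** r ** g (v i k)) = ?\<sigma> * u i k * f r * (?\<sigma> * v i k)"
    using uvc[OF k] r fg uv(2)[OF i k] by simp
   also have "\<dots> = ?\<sigma> * ((u i k * f r) * (?\<sigma> * v i k))" by (simp only: mult.assoc)
   finally show "f (g (u i k) ** r ** g (v i k)) = ?\<sigma> * (?\<sigma> * (u i k * f r * v i k))"
    unfolding \<sigma>c[OF uW] .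
  qed
  finally show "f (elem_op R (N i) (%k. g (u i k)) (%k. g (v i k)) r) = ?\<sigma> * (?\<sigma> * (\<Sum>k<N i. u i k * f r * v i k))"
   by (simp add: sum_distrib_left)
 qed
 have DB: "dual_basis R n N (%i. g (b i)) (%i k. g (u i k)) (%i k. g (v i k)) ?d"
 proof unfold_locales
  show "g (b i) : carrier R" if "i < n" for i using gc b(2) that by blast
  show "g (u i k) : carrier R" "g (v i k) : carrier R" if "i < n" "k < N i" for i k using gc uv(2) that by blast+
  show "?d : ring_center R" unfolding center_iff[OF d(1)] d(2) by (rule \<sigma>Z)
  show "elem_op R (N i) (%k. g (u i k)) (%k. g (v i k)) r : ring_center R" if "i < n" "r : carrier R" for i r
   unfolding center_iff[OF elem(1)[OF that]] elem(2)[OF that]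
   by (intro Z0_closed(4) \<sigma>Z z that(1) f_in_W that(2))
  show "?d ** r = (\<Oplus>i\<in>{..<n}. elem_op R (N i) (%k. g (u i k)) (%k. g (v i k)) r ** g (b i))" if r: "r : carrier R" for r
  proof -
   have t: "(%i. elem_op R (N i) (%k. g (u i k)) (%k. g (v i k)) r ** g (b i)) : {..<n} \<rightarrow> carrier R"
    using elem(1)[OF _ r] gc b(2) by auto
   have "f (\<Oplus>i\<in>{..<n}. elem_op R (N i) (%k. g (u i k)) (%k. g (v i k)) r ** g (b i))
     = (\<Sum>i<n. f (elem_op R (N i) (%k. g (u i k)) (%k. g (v i k)) r ** g (b i)))"
    using t by (intro f_finsum) simp
   also have "\<dots> = (\<Sum>i<n. ?\<sigma> * (?\<sigma> * (?\<sigma> * ((\<Sum>k<N i. u i k * f r * v i k) * b i))))"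
   proof (intro sum.cong refl)
    fix i assume "i : {..<n}"
    then have i: "i < n" by simp
    have zW: "(\<Sum>k<N i. u i k * f r * v i k) : W" using z[OF i f_in_W[OF r]] Z0_W by blast
    have "f (elem_op R (N i) (%k. g (u i k)) (%k. g (v i k)) r ** g (b i))
      = ?\<sigma> * (?\<sigma> * (\<Sum>k<N i. u i k * f r * v i k)) * (?\<sigma> * b i)"
     using elem[OF i r] gc[OF b(2)[OF i]] fg[OF b(2)[OF i]] by simp
    also have "\<dots> = ?\<sigma> * (?\<sigma> * ((\<Sum>k<N i. u i k * f r * v i k) * (?\<sigma> * b i)))" by (simp only: mult.assoc)
    finally show "f (elem_op R (N i) (%k. g (u i k)) (%k. g (v i k)) r ** g (b i))
      = ?\<sigma> * (?\<sigma> * (?\<sigma> * ((\<Sum>k<N i. u i k * f r * v i k) * b i)))"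
     unfolding \<sigma>c[OF zW] .
   qed
   also have "\<dots> = ?\<sigma> * (?\<sigma> * (?\<sigma> * f r))"
    using ex[OF f_in_W[OF r]] by (simp add: sum_distrib_left[symmetric])
   also have "\<dots> = f (?d ** r)" using d r \<sigma>3 by (simp add: mult.assoc[symmetric])
   finally show ?thesis unfolding f_eq_iff[OF finsum_closed[OF t] m_closed[OF d(1) r]] by (rule sym)
  qed
  show "elem_op R (N i) (%k. g (u i k)) (%k. g (v i k)) (g (b j)) = (if i = j then ?d else \<zero>)" if ij: "i < n" "j < n" for i j
  proof -
   have gb: "g (b j) : carrier R" using gc b(2) ij by blast
   have "(\<Sum>k<N i. u i k * f (g (b j)) * v i k) = ?\<sigma> * (\<Sum>k<N i. u i k * b j * v i k)"
    unfolding sum_distrib_left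
   proof (intro sum.cong refl)
    fix k assume "k : {..<N i}"
    then have k: "u i k : W" using uv(1) ij by simp
    show "u i k * f (g (b j)) * v i k = ?\<sigma> * (u i k * b j * v i k)"
     using \<sigma>c[OF k, of "b j * v i k"] fg[OF b(2)[OF ij(2)]] by (simp add: mult.assoc)
   qed
   then have "f (elem_op R (N i) (%k. g (u i k)) (%k. g (v i k)) (g (b j))) = (if i = j then s ^ (p * (3 * M)) else 0)"
    unfolding elem(2)[OF ij(1) gb] using du[OF ij] \<sigma>3 by simp
   then have "f (elem_op R (N i) (%k. g (u i k)) (%k. g (v i k)) (g (b j))) = f (if i = j then ?d else \<zero>)"
    using d by simp
   then show ?thesis using f_eq_iff[OF elem(1)[OF ij(1) gb], of "if i = j then ?d else \<zero>"] d by simp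
  qed
 qed
 show "dual_basis_domain R n N (%i. g (b i)) (%i k. g (u i k)) (%i k. g (v i k)) ?d"
 proof (intro dual_basis_domain.intro DB dual_basis_domain_axioms.intro)
  show "r = \<zero>" if "c : ring_center R" "r : carrier R" "c ** r = \<zero>" "c ~= \<zero>" for c r
   using that by (rule central_cancel)
  have "si ^ n * s ^ n = 1" for n
  proof (induction n)
   case (Suc n)
   have "si ^ Suc n * s ^ Suc n = si ^ n * (si * s) * s ^ n"
    by (simp only: power_Suc2[of si] power_Suc[of s] mult.assoc)
   then show ?case using Suc by simp
  qed simp
  \<comment> \<open>In the zero ring even a single monomial would be linearly dependent.\<close>
  moreover have "(1::'b) ~= 0"
  proof
   assume "(1::'b) = 0"
   then have "(\<Sum>q\<in>{(False, 0, 0)}. eta 1 * mon q) = 0" by (metis mult_1_left mult_zero_left sum.neutral)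
   from indep[OF _ this] have "(1::'a) = 0" by simp
   then show False by simp
  qed
  ultimately have "s ^ (p * (3 * M)) ~= 0" by (metis mult_zero_right)
  then show "?d ~= \<zero>" using d(2) by (metis f_simps(4))
 qed
 show "azumaya_basis R n N (%i. g (b i)) (%i k. g (u i k)) (%i k. g (v i k)) i0"
  if M0: "M = 0" and i0: "i0 < n" "(\<Sum>k<N i0. u i0 k * 1 * v i0 k) = 1"
 proof -
  have d1: "?d = \<one>" using f_eq_iff[OF d(1) one_closed] d(2) M0 by simp
  have "f (elem_op R (N i0) (%k. g (u i0 k)) (%k. g (v i0 k)) \<one>) = f \<one>"
   unfolding elem(2)[OF i0(1) one_closed] using i0(2) M0 by simp
  then have "elem_op R (N i0) (%k. g (u i0 k)) (%k. g (v i0 k)) \<one> = \<one>"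
   using f_eq_iff[OF elem(1)[OF i0(1) one_closed] one_closed] by simp
  then show ?thesis
   using DB i0(1) unfolding d1 by (intro azumaya_basis.intro azumaya_basis_axioms.intro)
 qed
qed

end

subsection \<open>The left regular representation on the monomials\<close>

text \<open>Linear maps on all functions of the monomial indices, of whatever support: the operators
  for the generators shift indices, so no finiteness has to be carried along.\<close>

typedef (overloaded) 'k sj_end = "{f :: (bool \<times> int \<times> nat => 'k::field) => (bool \<times> int \<times> nat => 'k).
  \<forall>a g h. f (%q. a * g q + h q) = (%q. a * f g q + f h q)}"
 by (rule exI[of _ "%g. g"]) simp

setup_lifting type_definition_sj_end

lemma sj_end_linear:
 fixes F :: "'k::field sj_end"
 shows "Rep_sj_end F (%q. a * g q + h q) = (%q. a * Rep_sj_end F g q + Rep_sj_end F h q)"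
 using Rep_sj_end[of F] by simp

instantiation sj_end :: (field) ring_1
begin

lift_definition zero_sj_end :: "'a sj_end" is "%g q. 0" by simp
lift_definition one_sj_end :: "'a sj_end" is "%g. g" by simp
lift_definition plus_sj_end :: "'a sj_end => 'a sj_end => 'a sj_end" is "%f f' g q. f g q + f' g q"
 by (simp add: algebra_simps)
lift_definition minus_sj_end :: "'a sj_end => 'a sj_end => 'a sj_end" is "%f f' g q. f g q - f' g q"
 by (simp add: algebra_simps)
lift_definition uminus_sj_end :: "'a sj_end => 'a sj_end" is "%f g q. - f g q"
 by (simp add: algebra_simps)
lift_definition times_sj_end :: "'a sj_end => 'a sj_end => 'a sj_end" is "%f f' g. f (f' g)"
 by simp

instance
proof
 fix a b c :: "'a sj_end"
 have lin: "f (%q. g q + h q) = (%q. f g q + f h q)"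
  if "\<forall>a g h. f (%q. a * g q + h q) = (%q. a * f g q + f h q)"
  for f :: "(bool \<times> int \<times> nat => 'a) => (bool \<times> int \<times> nat => 'a)" and g h
  using that[rule_format, of 1 g h] by simp
 show "a * b * c = a * (b * c)" by transfer simp
 show "a + b + c = a + (b + c)" by transfer (simp add: add.assoc)
 show "a + b = b + a" by transfer (simp add: add.commute)
 show "0 + a = a" by transfer simp
 show "- a + a = 0" by transfer simp
 show "a - b = a + - b" by transfer simp
 show "1 * a = a" "a * 1 = a" by (transfer, simp)+
 show "(a + b) * c = a * c + b * c" by transfer simp
 show "a * (b + c) = a * b + a * c" by transfer (simp add: lin)
 show "(0 :: 'a sj_end) ~= 1"
  by transfer (auto simp: fun_eq_iff intro!: exI[of _ "%_. 1"])
qed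

end

lift_definition end_const :: "'k::field => 'k sj_end" is "%c g q. c * g q"
 by (simp add: algebra_simps)

lift_definition end_x :: "'k::field sj_end" is "%g (i, j, k). if i then g (False, j, k) else 0"
 by (auto simp: fun_eq_iff)

text \<open>The formulas of \<open>mon_left\<close> in terms of coefficients: each value collects
  the contributions of the monomials that \<open>y\<close> sends there. For \<open>k = 0\<close>
  there is no monomial with one factor \<open>y\<close> less.\<close>

lift_definition end_y :: "'k::field sj_end" is
 "%g (i, j, k). if i then of_int j * g (False, j, k) - (if k = 0 then 0 else g (True, j, k - 1))
   else (if k = 0 then 0 else g (False, j, k - 1)) + g (True, j - 1, k)"
 by (auto simp: fun_eq_iff algebra_simps)

lift_definition end_s :: "'k::field sj_end" is "%g (i, j, k). g (i, j - 1, k)"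
 by (auto simp: fun_eq_iff)

lift_definition end_si :: "'k::field sj_end" is "%g (i, j, k). g (i, j + 1, k)"
 by (auto simp: fun_eq_iff)

lemma Rep_sj_end_simps:
 "Rep_sj_end (F * F') g = Rep_sj_end F (Rep_sj_end F' g)" "Rep_sj_end 1 g = g"
 "Rep_sj_end (F + F') g q = Rep_sj_end F g q + Rep_sj_end F' g q" "Rep_sj_end 0 g q = 0"
 "Rep_sj_end (end_const c) g q = c * g q"
 by (transfer, simp)+

lemma end_const_commute: "end_const a * r = r * end_const a"
proof -
 have z: "Rep_sj_end r (%q. 0) = (%q. 0)"
  using sj_end_linear[of r "-1" "%q. 0" "%q. 0"] by (simp add: fun_eq_iff)
 have "Rep_sj_end (end_const a * r) g = Rep_sj_end (r * end_const a) g" for g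
 proof -
  have c: "Rep_sj_end (end_const a) h = (%q. a * h q)" for h by (simp add: fun_eq_iff Rep_sj_end_simps)
  show ?thesis
   using sj_end_linear[of r a g "%q. 0"] z by (simp add: c Rep_sj_end_simps(1))
 qed
 then show ?thesis by (simp add: Rep_sj_end_inject[symmetric] fun_eq_iff)
qed

interpretation sj_model: sj_alg "end_const :: 'k::field => _" end_x end_y end_s end_si
proof
 fix a b :: 'k and r :: "'k sj_end"
 show "end_const (a + b) = end_const a + end_const b" by transfer (simp add: algebra_simps)
 show "end_const (a * b) = end_const a * end_const b" by transfer (simp add: algebra_simps)
 show "(end_const 1 :: 'k sj_end) = 1" by transfer simp
 show "end_const a * r = r * end_const a" by (rule end_const_commute)
 show "(end_x * end_x :: 'k sj_end) = 0" by transfer (auto simp: fun_eq_iff)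
 show "(end_s :: 'k sj_end) = end_x * end_y + end_y * end_x" by transfer (auto simp: fun_eq_iff)
 show "(end_y * end_y * end_x :: 'k sj_end) = end_x * end_y * end_y + end_x * end_y * end_x"
  by transfer (auto simp: fun_eq_iff algebra_simps)
 show "(end_s * end_si :: 'k sj_end) = 1" "(end_si * end_s :: 'k sj_end) = 1"
  by (transfer, auto simp: fun_eq_iff)+
qed

definition unit_fun :: "bool \<times> int \<times> nat => bool \<times> int \<times> nat => 'k::field" where
 "unit_fun q = (%q'. if q' = q then 1 else 0)"

lemma end_unit_fun:
 "Rep_sj_end end_x (unit_fun (False, j, k)) = (unit_fun (True, j, k) :: _ => 'k::field)"
 "Rep_sj_end end_y (unit_fun (False, 0, k)) = (unit_fun (False, 0, Suc k) :: _ => 'k)"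
 "Rep_sj_end end_s (unit_fun (i, j, k)) = (unit_fun (i, j + 1, k) :: _ => 'k)"
 "Rep_sj_end end_si (unit_fun (i, j, k)) = (unit_fun (i, j - 1, k) :: _ => 'k)"
 by (transfer; force simp: fun_eq_iff unit_fun_def)+

text \<open>Applied to the unit function of the monomial \<open>1\<close>, the monomials run through
  all unit functions. This is the source of their independence.\<close>

lemma mon_unit_fun:
 "Rep_sj_end (sj_model.mon q) (unit_fun (False, 0, 0)) = (unit_fun q :: _ => 'k::field)"
proof -
 obtain i j k where q: "q = (i, j, k)" by (cases q)
 have y: "Rep_sj_end (end_y ^ k) (unit_fun (False, 0, 0)) = (unit_fun (False, 0, k) :: _ => 'k)"
  by (induction k) (simp_all add: Rep_sj_end_simps end_unit_fun)
 have "Rep_sj_end (end_s ^ n) (unit_fun (i, j, k)) = (unit_fun (i, j + int n, k) :: _ => 'k)" for n i j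
  by (induction n) (simp_all add: Rep_sj_end_simps end_unit_fun algebra_simps)
 moreover have "Rep_sj_end (end_si ^ n) (unit_fun (i, j, k)) = (unit_fun (i, j - int n, k) :: _ => 'k)" for n i j
  by (induction n) (simp_all add: Rep_sj_end_simps end_unit_fun algebra_simps)
 ultimately have s: "Rep_sj_end (sj_model.spow j) (unit_fun (False, 0, k)) = (unit_fun (False, j, k) :: _ => 'k)"
  by (simp add: sj_model.spow_def)
 show ?thesis by (simp add: q sj_model.mon_def Rep_sj_end_simps y s end_unit_fun)
qed

lemma sj_model_p:
 assumes "CHAR('k::field) = p" "p > 2"
 shows "sj_alg_p (end_const :: 'k => _) end_x end_y end_s end_si p"
proof
 fix F :: "(bool \<times> int \<times> nat) set" and c :: "_ => 'k" and q
 assume F: "finite F" "(\<Sum>q\<in>F. end_const (c q) * sj_model.mon q) = 0" "q : F"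
 have "Rep_sj_end (\<Sum>q\<in>G. end_const (c q) * sj_model.mon q) (unit_fun (False, 0, 0)) q = (if q : G then c q else 0)"
  if "finite G" for G
 proof -
  have u: "unit_fun q' q = (if q = q' then 1 else (0::'k))" for q' by (simp add: unit_fun_def)
  show ?thesis using that by (induction G) (auto simp: Rep_sj_end_simps mon_unit_fun u)
 qed
 from this[OF F(1)] show "c q = 0" unfolding F(2) using F(3) by (simp only: Rep_sj_end_simps if_True)
qed (use assms in auto)

subsection \<open>The super Jordan plane\<close>

text \<open>The relations once more, now in a ring record and with no inverse of \<open>s\<close>.
  Here they serve to show that the monomials span the plane; independence comes from the
  model.\<close>

locale sj_relations = ring R for R (structure) +
 fixes c :: "'k::field => 'a" and x y :: 'a
 assumes c_closed [simp]: "c a : carrier R" and x_closed [simp]: "x : carrier R" and y_closed [simp]: "y : carrier R"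
  and c_add: "c (a + b) = c a \<oplus> c b" and c_mult: "c (a * b) = c a ** c b" and c_one: "c 1 = \<one>"
  and c_comm: "r : carrier R ==> r ** c a = c a ** r"
  and xx: "x ** x = \<zero>" and yyx: "y ** y ** x = x ** y ** y \<oplus> x ** y ** x"
begin

definition s where "s = x ** y \<oplus> y ** x"

lemma s_closed [simp]: "s : carrier R" by (simp add: s_def)

lemma sx: "s ** x = x ** s"
 by (simp add: s_def l_distr r_distr m_assoc xx, simp add: m_assoc[symmetric] xx)

lemma ys: "y ** s = s ** y \<oplus> x ** s"
proof -
 have "x ** (x ** y) = \<zero>" by (simp add: m_assoc[symmetric] xx)
 moreover have "y ** (y ** x) = x ** (y ** y) \<oplus> x ** (y ** x)" using yyx by (simp add: m_assoc)
 ultimately show ?thesis by (simp add: s_def l_distr r_distr m_assoc a_ac)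
qed

lemma s_pow_x: "s [^] (j::nat) ** x = x ** s [^] j"
 by (induction j) (simp_all add: m_assoc sx, simp add: m_assoc[symmetric])

lemma c_minus: "c (- a) = \<ominus> c a" and c_zero: "c 0 = \<zero>"
proof -
 show 0: "c 0 = \<zero>" using c_add[of 0 0] add.l_cancel_one[of "c 0" "c 0"] by simp
 show "c (- a) = \<ominus> c a" using c_add[of "- a" a] 0 minus_equality[of "c (- a)" "c a"] by simp
qed

lemma y_s_pow: "y ** s [^] (j::nat) = s [^] j ** y \<oplus> c (of_nat j) ** (x ** s [^] j)"
proof (induction j)
 case 0
 show ?case by (simp add: c_zero)
next
 case (Suc j)
 have "y ** s [^] Suc j = (s [^] j ** y \<oplus> c (of_nat j) ** (x ** s [^] j)) ** s"
  using Suc by (simp add: m_assoc[symmetric])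
 also have "\<dots> = s [^] j ** (s ** y \<oplus> x ** s) \<oplus> c (of_nat j) ** (x ** (s [^] j ** s))"
  by (simp add: l_distr m_assoc ys)
 also have "s [^] j ** (s ** y \<oplus> x ** s) = s [^] j ** s ** y \<oplus> x ** (s [^] j ** s)"
  by (simp add: r_distr m_assoc[symmetric] s_pow_x)
 finally show ?case by (simp add: c_add c_one l_distr a_ac)
qed

definition mon :: "bool \<times> nat \<times> nat => 'a" where
 "mon = (%(i, j, k). (if i then x else \<one>) ** s [^] j ** y [^] k)"

lemma mon_closed [simp]: "mon q : carrier R"
 by (cases q) (simp add: mon_def)

text \<open>The span of the monomials, built one term at a time, so that closure under left
  multiplication is a short induction.\<close>

inductive_set SJ :: "'a set" where
 zero: "\<zero> : SJ"
| add: "u : SJ ==> c a ** mon q \<oplus> u : SJ"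

lemma SJ_closed: "u : SJ ==> u : carrier R"
 by (induction rule: SJ.induct) auto

lemma SJ_add: "u : SJ ==> u' : SJ ==> u \<oplus> u' : SJ"
 by (induction rule: SJ.induct) (auto simp: SJ_closed a_assoc intro: SJ.add)

lemma SJ_mon: "c a ** mon q : SJ"
 using SJ.add[OF SJ.zero, of a q] by simp

lemma SJ_c: "u : SJ ==> c a ** u : SJ"
proof (induction rule: SJ.induct)
 case zero
 show ?case using SJ.zero by simp
next
 case (add u b q)
 have "c a ** (c b ** mon q \<oplus> u) = c (a * b) ** mon q \<oplus> c a ** u"
  using SJ_closed[OF add(1)] by (simp add: r_distr c_mult m_assoc)
 then show ?case using SJ.add[OF add(2)] by simp
qed

lemma SJ_left:
 assumes r: "r : carrier R" and m: "!!q. r ** mon q : SJ"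
 shows "u : SJ ==> r ** u : SJ"
proof (induction rule: SJ.induct)
 case zero
 show ?case using r SJ.zero by simp
next
 case (add u b q)
 have "r ** (c b ** mon q \<oplus> u) = c b ** (r ** mon q) \<oplus> r ** u"
  using SJ_closed[OF add(1)] r c_comm[OF r] by (simp add: r_distr m_assoc[symmetric])
 then show ?case using SJ_add[OF SJ_c[OF m] add(2)] by simp
qed

lemma mon_one: "mon q : SJ" using SJ_mon[of 1 q] by (simp add: c_one)

lemma x_mon: "x ** mon (i, j, k) = (if i then \<zero> else mon (True, j, k))"
 by (simp add: mon_def m_assoc[symmetric] xx)

lemma y_mon_False: "y ** mon (False, j, k) = mon (False, j, Suc k) \<oplus> c (of_nat j) ** mon (True, j, k)"
proof -
 have "y ** mon (False, j, k) = y ** s [^] j ** y [^] k" by (simp add: mon_def m_assoc)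
 moreover have "y [^] k ** y = y ** y [^] k" using nat_pow_Suc2[of y k] by simp
 ultimately show ?thesis unfolding y_s_pow by (simp add: mon_def l_distr m_assoc)
qed

lemma SJ_x: "u : SJ ==> x ** u : SJ"
proof (rule SJ_left[OF x_closed])
 show "x ** mon q : SJ" for q using x_mon mon_one SJ.zero by (cases q) simp
qed

text \<open>For a monomial that begins with \<open>x\<close>, the definition of \<open>s\<close>
  replaces \<open>y x\<close> by \<open>s - x y\<close>; what is left is \<open>y\<close> times a
  monomial without \<open>x\<close>, a case already settled, followed by \<open>x\<close>.\<close>

lemma SJ_y: "u : SJ ==> y ** u : SJ"
proof (rule SJ_left[OF y_closed])
 fix q :: "bool \<times> nat \<times> nat"
 obtain i j k where q: "q = (i, j, k)" by (cases q)
 have F: "y ** mon (False, j, k) : SJ"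
  unfolding y_mon_False by (intro SJ_add SJ_c mon_one)
 show "y ** mon q : SJ"
 proof (cases i)
  case True
  have "x ** (y ** mon (False, j, k)) \<oplus> y ** mon q = s ** mon (False, j, k)"
   by (simp add: q True s_def mon_def l_distr m_assoc)
  moreover have "s ** mon (False, j, k) = mon (False, Suc j, k)"
   using nat_pow_Suc2[OF s_closed, of j] by (simp add: mon_def m_assoc[symmetric])
  moreover have "b = d \<oplus> \<ominus> a" if "a : carrier R" "b : carrier R" "a \<oplus> b = d" for a b d
   unfolding that(3)[symmetric] a_comm[OF that(1,2)] using that by (simp add: a_assoc r_neg)
  ultimately have "y ** mon q = mon (False, Suc j, k) \<oplus> \<ominus> (x ** (y ** mon (False, j, k)))"
   by simp
  also have "\<ominus> (x ** (y ** mon (False, j, k))) = c (- 1) ** (x ** (y ** mon (False, j, k)))"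
   by (simp add: c_minus c_one l_minus)
  finally show ?thesis using SJ_add[OF mon_one SJ_c[OF SJ_x[OF F]]] by simp
 qed (simp add: q F)
qed

lemma SJ_combination:
 "u : SJ ==> \<exists>F a. finite F & u = (\<Oplus>q\<in>F. c (a q) ** mon q)"
proof (induction rule: SJ.induct)
 case zero
 show ?case by (intro exI[of _ "{}"]) simp
next
 case (add u b q)
 then obtain F a where F: "finite F" "u = (\<Oplus>q\<in>F. c (a q) ** mon q)" by blast
 define G where "G = F - {q}"
 define a' where "a' = a(q := if q : F then b + a q else b)"
 have G: "finite G" "q \<notin> G" using F by (auto simp: G_def)
 have eq: "(\<Oplus>q\<in>G. c (a' q) ** mon q) = (\<Oplus>q\<in>G. c (a q) ** mon q)"
  using G by (intro finsum_cong') (auto simp: a'_def)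
 have "c b ** mon q \<oplus> u = c (a' q) ** mon q \<oplus> (\<Oplus>q\<in>G. c (a q) ** mon q)"
 proof (cases "q : F")
  case True
  then have "F = insert q G" by (auto simp: G_def)
  then have "u = c (a q) ** mon q \<oplus> (\<Oplus>q\<in>G. c (a q) ** mon q)" using F(2) G by simp
  then show ?thesis using True by (simp add: a'_def c_add l_distr a_assoc)
 next
  case False
  then have "F = G" by (auto simp: G_def)
  then show ?thesis using False F(2) by (simp add: a'_def)
 qed
 also have "\<dots> = (\<Oplus>q\<in>insert q G. c (a' q) ** mon q)" using G eq by simp
 finally show ?case using G(1) by blast
qed

end

abbreviation (input) words :: "'x list monoid" where
 "words \<equiv> \<lparr>carrier = UNIV, mult = (@), one = []\<rparr>"

lemma monoid_words: "Group.monoid words"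
 by unfold_locales auto

lemma ring_free_algebra: "ring (free_algebra :: ('x list => 'k::comm_ring_1) ring)"
 unfolding free_algebra_def by (rule monoid.ring_monoid_ring[OF monoid_words])

lemmas free_algebra_induct = monoid.monoid_ring_induct[OF monoid_words, folded free_algebra_def, consumes 1, case_names zero add]

lemma delta_free_algebra:
 "delta v a : carrier free_algebra"
 "delta v a **$free_algebra delta v' b = delta (v @ v') (a * b)"
 "delta v a \<oplus>$free_algebra delta v b = delta v (a + b)"
 "\<one>$free_algebra = delta [] 1"
 unfolding free_algebra_def using monoid.delta_closed[OF monoid_words, of v a]
 by (simp_all only: delta_mult delta_add monoid_ring_simps(2)) simp_all

lemma free_algebra_minus:
 assumes "f : carrier free_algebra" shows "\<ominus>$free_algebra f = (%v. - f v)"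
proof -
 interpret ring free_algebra by (rule ring_free_algebra)
 have "(%v. - f v) : carrier free_algebra" using assms unfolding free_algebra_def monoid_ring_simps by simp
 moreover have "(%v. - f v) \<oplus>$free_algebra f = \<zero>$free_algebra"
  unfolding free_algebra_def monoid_ring_simps by simp
 ultimately show ?thesis using minus_equality assms by blast
qed

lemma ideal_sj_ideal: "ideal sj_ideal (free_algebra :: (sj_gen list => 'k::field) ring)"
proof -
 interpret ring "free_algebra :: (sj_gen list => 'k) ring" by (rule ring_free_algebra)
 show ?thesis unfolding sj_ideal_def Let_def by (rule genideal_ideal) (simp add: delta_free_algebra)
qed

lemma sj_relation:
 defines "D \<equiv> %v. delta v (1 :: 'k::field)"
 shows "D [GX, GX] : sj_ideal"
  "D [GY, GY, GX] \<ominus>$free_algebra D [GX, GY, GY] \<ominus>$free_algebra D [GX, GY, GX] : sj_ideal"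
proof -
 interpret ring "free_algebra :: (sj_gen list => 'k) ring" by (rule ring_free_algebra)
 have "{D [GX, GX], D [GY, GY, GX] \<ominus>$free_algebra D [GX, GY, GY] \<ominus>$free_algebra D [GX, GY, GX]} <= sj_ideal"
  unfolding sj_ideal_def Let_def D_def by (rule genideal_self) (simp add: delta_free_algebra)
 then show "D [GX, GX] : sj_ideal"
  "D [GY, GY, GX] \<ominus>$free_algebra D [GX, GY, GY] \<ominus>$free_algebra D [GX, GY, GX] : sj_ideal" by auto
qed

abbreviation (input) sj_coset :: "(sj_gen list => 'k::field) => (sj_gen list => 'k) set" where
 "sj_coset f \<equiv> sj_ideal +>$free_algebra f"

lemma sj_coset_hom: "sj_coset : ring_hom (free_algebra :: (sj_gen list => 'k::field) ring) super_jordan"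
 unfolding super_jordan_def by (rule ideal.rcos_ring_hom[OF ideal_sj_ideal])

lemma ring_super_jordan: "ring super_jordan"
 unfolding super_jordan_def by (rule ideal.quotient_is_ring[OF ideal_sj_ideal])

lemma sj_coset_delta:
 "sj_coset (delta v a) : carrier super_jordan"
 "sj_coset (delta v a) **$super_jordan sj_coset (delta v' b) = sj_coset (delta (v @ v') (a * b))"
 "sj_coset (delta v a) \<oplus>$super_jordan sj_coset (delta v b) = sj_coset (delta v (a + b))"
 using ring_hom_closed[OF sj_coset_hom, of "delta v a"] ring_hom_mult[OF sj_coset_hom, of "delta v a" "delta v' b"]
  ring_hom_add[OF sj_coset_hom, of "delta v a" "delta v b"]
 by (simp_all add: delta_free_algebra)

lemma sj_coset_one: "\<one>$super_jordan = sj_coset (delta [] 1)"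
 by (rule ring_hom_one[OF sj_coset_hom, symmetric, unfolded delta_free_algebra])

lemma sj_coset_eqI:
 assumes "a : carrier free_algebra" "b : carrier free_algebra" "a \<ominus>$free_algebra b : sj_ideal"
 shows "sj_coset a = sj_coset b"
 using ring.quotient_eq_iff_same_a_r_cos[OF ring_free_algebra ideal_sj_ideal assms(1,2)] assms(3) by simp

interpretation SJ: sj_relations super_jordan "sj_const :: 'k::field => _" sj_x sj_y
 rewrites "sj_relations.s super_jordan sj_x sj_y = sj_s"
proof -
 interpret FA: ring "free_algebra :: (sj_gen list => 'k) ring" by (rule ring_free_algebra)
 interpret J: ring "super_jordan :: (sj_gen list => 'k) set ring" by (rule ring_super_jordan)
 note simps = sj_const_def sj_x_def sj_y_def sj_coset_delta sj_coset_one
 show 1: "sj_relations super_jordan (sj_const :: 'k => _) sj_x sj_y"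
 proof unfold_locales
  show "r **$super_jordan sj_const a = sj_const a **$super_jordan r"
   if r: "r : carrier super_jordan" for a :: 'k and r
  proof -
   obtain f where f: "f : carrier free_algebra" "r = sj_coset f"
    using r unfolding super_jordan_def by (rule ideal.quotient_cases[OF ideal_sj_ideal])
   have "f **$free_algebra delta [] a = delta [] a **$free_algebra f"
    using f(1)
   proof (induction f rule: free_algebra_induct)
    case zero
    show ?case by (simp add: delta_free_algebra(1))
   next
    case (add f g b)
    then show ?case by (simp add: FA.l_distr FA.r_distr delta_free_algebra(1,2) mult.commute)
   qed
   then show ?thesis
    unfolding f(2) sj_const_def ring_hom_mult[OF sj_coset_hom f(1) delta_free_algebra(1), symmetric]
     ring_hom_mult[OF sj_coset_hom delta_free_algebra(1) f(1), symmetric] by (rule arg_cong)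
  qed
  show "sj_x **$super_jordan sj_x = (\<zero>$super_jordan :: (sj_gen list => 'k) set)"
   unfolding simps using FA.a_rcos_zero[OF ideal_sj_ideal sj_relation(1)] by (simp add: super_jordan_def FactRing_def)
  show "sj_y **$super_jordan sj_y **$super_jordan sj_x = sj_x **$super_jordan sj_y **$super_jordan sj_y
    \<oplus>$super_jordan sj_x **$super_jordan (sj_y :: (sj_gen list => 'k) set) **$super_jordan sj_x"
  proof -
   let ?D = "%v. delta v (1 :: 'k)"
   have "?D [GY, GY, GX] \<ominus>$free_algebra (?D [GX, GY, GY] \<oplus>$free_algebra ?D [GX, GY, GX])
     = ?D [GY, GY, GX] \<ominus>$free_algebra ?D [GX, GY, GY] \<ominus>$free_algebra ?D [GX, GY, GX]"
    by (simp add: FA.minus_eq FA.minus_add delta_free_algebra FA.a_assoc)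
   then have "sj_coset (?D [GY, GY, GX]) = sj_coset (?D [GX, GY, GY] \<oplus>$free_algebra ?D [GX, GY, GX])"
    using sj_relation(2)[where 'k = 'k] by (intro sj_coset_eqI) (simp_all add: delta_free_algebra)
   then show ?thesis
    using ring_hom_add[OF sj_coset_hom, of "?D [GX, GY, GY]" "?D [GX, GY, GX]"] by (simp add: simps delta_free_algebra)
  qed
 qed (simp_all add: simps)
 show "sj_relations.s super_jordan (sj_x :: (sj_gen list => 'k) set) sj_y = sj_s"
  by (simp add: sj_relations.s_def[OF 1] sj_s_def)
qed

lemma sj_delta_in_SJ:
 fixes a :: "'k::field"
 shows "sj_coset (delta v a) : SJ.SJ"
proof (induction v)
 case Nil
 have "SJ.mon (False, 0, 0) = (\<one>$super_jordan :: (sj_gen list => 'k) set)" by (simp add: SJ.mon_def)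
 moreover have "sj_const a = sj_coset (delta [] a)" by (simp add: sj_const_def)
 ultimately show ?case using SJ.SJ_mon[of a "(False, 0, 0)"] sj_coset_delta(1)[of "[]" a] by simp
next
 case (Cons g v)
 have "sj_coset (delta (g # v) a) = sj_coset (delta [g] 1) **$super_jordan sj_coset (delta v a)"
  by (simp add: sj_coset_delta)
 then show ?case using SJ.SJ_x[OF Cons] SJ.SJ_y[OF Cons] by (cases g) (simp_all add: sj_x_def sj_y_def)
qed

lemma super_jordan_SJ:
 assumes "u : carrier super_jordan" shows "u : SJ.SJ"
proof -
 obtain f where f: "f : carrier free_algebra" "u = sj_coset f"
  using assms unfolding super_jordan_def by (rule ideal.quotient_cases[OF ideal_sj_ideal])
 have "sj_coset f : SJ.SJ" using f(1)
 proof (induction f rule: free_algebra_induct)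
  case zero
  show ?case unfolding ring_hom_zero[OF sj_coset_hom ring_free_algebra ring_super_jordan] by (rule SJ.SJ.zero)
 next
  case (add f g b)
  then show ?case
   using ring_hom_add[OF sj_coset_hom, of f "delta g b"] delta_free_algebra(1)[of g b] SJ.SJ_add[OF add.IH sj_delta_in_SJ]
   by simp
 qed
 then show ?thesis by (simp add: f(2))
qed

abbreviation (input) end_ring :: "'k::field sj_end ring" where "end_ring \<equiv> ring_on UNIV"

primrec sj_word :: "sj_gen list => 'k::field sj_end" where
 "sj_word [] = 1"
| "sj_word (g # v) = (case g of GX => end_x | GY => end_y) * sj_word v"

lemma sj_word_append: "sj_word (v @ v') = sj_word v * sj_word v'"
 by (induction v) (simp_all add: mult.assoc)

text \<open>Evaluation of words in the model annihilates both defining relations, hence the ideal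
  they generate, and descends to the plane.\<close>

lemma ex_super_jordan_rep:
 "\<exists>phi\<in>ring_hom super_jordan (end_ring :: 'k::field sj_end ring).
   (\<forall>a. phi (sj_const a) = end_const a) & phi sj_x = end_x & phi sj_y = end_y"
proof -
 interpret E: ring "end_ring :: 'k sj_end ring" by (rule ring_ring_on) simp
 interpret FA: ring "free_algebra :: (sj_gen list => 'k) ring" by (rule ring_free_algebra)
 interpret M: monoid_ring_target words "end_ring :: 'k sj_end ring" end_const sj_word
 proof (intro monoid_ring_target.intro monoid_words E.ring_axioms monoid_ring_target_axioms.intro)
  fix a b :: 'k and v v' :: "sj_gen list"
  show "end_const (a + b) = end_const a \<oplus>$end_ring end_const b" by (simp add: sj_model.eta_add)
  show "end_const (a * b) = end_const a **$end_ring end_const b" by (simp add: sj_model.eta_mult)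
  show "sj_word (v **$words v') = sj_word v **$end_ring (sj_word v' :: 'k sj_end)" by (simp add: sj_word_append)
  show "end_const a **$end_ring sj_word v = sj_word v **$end_ring end_const a"
   unfolding ring_on_simps by (rule sj_model.eta_comm)
 qed simp_all
 have hom: "M.mlift : ring_hom free_algebra end_ring" unfolding free_algebra_def by (rule M.mlift_hom)
 have M_delta: "M.mlift (delta v a) = end_const a * sj_word v" for v a using M.mlift_delta[of v a] by simp
 have id: "ideal (a_kernel free_algebra end_ring M.mlift) free_algebra"
  by (rule ring_hom_ring.kernel_is_ideal[OF ring_hom_ringI2[OF FA.ring_axioms E.ring_axioms hom]])
 have M_diff: "M.mlift (f \<ominus>$free_algebra g) = M.mlift f - M.mlift g"
  if f: "f : carrier free_algebra" "g : carrier free_algebra" for f g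
 proof -
  have "f = (f \<ominus>$free_algebra g) \<oplus>$free_algebra g"
   using f by (simp add: FA.minus_eq FA.a_assoc FA.l_neg)
  then have "M.mlift f = M.mlift (f \<ominus>$free_algebra g) + M.mlift g"
   using ring_hom_add[OF hom FA.minus_closed[OF f] f(2)] by simp
  then show ?thesis by simp
 qed
 have "sj_ideal <= a_kernel free_algebra end_ring M.mlift"
  unfolding sj_ideal_def Let_def
  by (rule FA.genideal_minimal[OF id])
   (auto simp: a_kernel_def' M_delta M_diff delta_free_algebra sj_model.yyx[unfolded mult.assoc])
 then have ker: "M.mlift f = \<zero>$end_ring" if "f : sj_ideal" for f
  using that unfolding a_kernel_def' by blast
 obtain phi where "phi : ring_hom (free_algebra Quot sj_ideal) end_ring"
  "!!f. f : carrier free_algebra ==> phi (sj_coset f) = M.mlift f"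
  using ideal.quotient_lift[OF ideal_sj_ideal E.ring_axioms hom ker] by metis
 then show ?thesis
  unfolding super_jordan_def[symmetric]
  by (intro bexI[of _ phi]) (simp_all add: sj_const_def sj_x_def sj_y_def delta_free_algebra M_delta)
qed

definition sj_rep :: "(sj_gen list => 'k::field) set => 'k sj_end" where
 "sj_rep = (SOME phi. phi : ring_hom super_jordan end_ring &
   (\<forall>a. phi (sj_const a) = end_const a) & phi sj_x = end_x & phi sj_y = end_y)"

lemma sj_rep: "sj_rep : ring_hom super_jordan end_ring" "sj_rep (sj_const a) = end_const a"
  "sj_rep sj_x = end_x" "sj_rep sj_y = end_y"
 using someI_ex[OF ex_super_jordan_rep[unfolded Bex_def], folded sj_rep_def] by auto

lemma sj_rep_simps [simp]:
 assumes "u : carrier super_jordan" "u' : carrier super_jordan"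
 shows "sj_rep (u **$super_jordan u') = sj_rep u * sj_rep u'" "sj_rep (u \<oplus>$super_jordan u') = sj_rep u + sj_rep u'"
 using ring_hom_mult[OF sj_rep(1) assms] ring_hom_add[OF sj_rep(1) assms] by simp_all

lemma sj_rep_one [simp]: "sj_rep \<one>$super_jordan = 1"
 using ring_hom_one[OF sj_rep(1)] by simp

lemma sj_rep_pow: "u : carrier super_jordan ==> sj_rep (u [^]$super_jordan (n::nat)) = sj_rep u ^ n"
 by (induction n) (simp_all add: power_commutes)

lemma sj_rep_s: "sj_rep sj_s = end_s"
 by (simp add: sj_s_def sj_rep sj_model.s_def)

lemma sj_rep_mon: "sj_rep (SJ.mon (i, j, k)) = sj_model.mon (i, int j, k)"
 by (simp add: SJ.mon_def sj_model.mon_def sj_rep_pow sj_rep sj_rep_s sj_model.spow_of_nat)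

locale sj_setting =
 fixes p :: nat and k_type :: "'k::field itself"
 assumes char: "CHAR('k::field) = p" and p: "p > 2"
begin

sublocale sj_alg_p "end_const :: 'k => _" end_x end_y end_s end_si p
 by (rule sj_model_p[OF char p])

lemma sj_rep_combination:
 assumes "finite F"
 shows "sj_rep (\<Oplus>$super_jordan q\<in>F. sj_const (a q) **$super_jordan SJ.mon q)
  = (\<Sum>(i, j, k)\<in>F. end_const (a (i, j, k) :: 'k) * sj_model.mon (i, int j, k))"
proof -
 have "sj_rep (\<Oplus>$super_jordan q\<in>F. sj_const (a q) **$super_jordan SJ.mon q)
   = (\<Oplus>$end_ring q\<in>F. sj_rep (sj_const (a q) **$super_jordan SJ.mon q))"
  by (rule finsum_ring_hom[OF ring_super_jordan ring_EE sj_rep(1) assms]) simp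
 also have "\<dots> = (\<Sum>q\<in>F. sj_rep (sj_const (a q) **$super_jordan SJ.mon q))" by (rule finsum_EE[OF assms])
 also have "\<dots> = (\<Sum>(i, j, k)\<in>F. end_const (a (i, j, k)) * sj_model.mon (i, int j, k))"
  by (rule sum.cong) (auto simp: sj_rep sj_rep_mon)
 finally show ?thesis .
qed

text \<open>The monomials span the plane and their images are independent, so an element of the
  kernel has only zero coefficients.\<close>

lemma sj_rep_inj: "inj_on sj_rep (carrier (super_jordan :: (sj_gen list => 'k) set ring))"
proof -
 let ?J = "super_jordan :: (sj_gen list => 'k) set ring"
 have zero: "u = \<zero>\<^bsub>?J\<^esub>" if u: "u : carrier ?J" "sj_rep u = 0" for u
 proof -
  obtain F a where F: "finite F" "u = (\<Oplus>\<^bsub>?J\<^esub>q\<in>F. sj_const (a q) **\<^bsub>?J\<^esub> SJ.mon q)"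
   using SJ.SJ_combination[OF super_jordan_SJ[OF u(1)]] by blast
  define e :: "bool \<times> nat \<times> nat => bool \<times> int \<times> nat" where "e = (%(i, j, k). (i, int j, k))"
  define e' :: "bool \<times> int \<times> nat => bool \<times> nat \<times> nat" where "e' = (%(i, j, k). (i, nat j, k))"
  have e: "e' (e q) = q" for q by (auto simp: e_def e'_def split: prod.splits)
  then have inj: "inj_on e F" by (metis inj_onI)
  have "(\<Sum>q\<in>e ` F. end_const (a (e' q)) * sj_model.mon q) = (\<Sum>q\<in>F. end_const (a q) * sj_model.mon (e q))"
   using inj by (simp add: sum.reindex e)
  also have "\<dots> = 0" using u(2) unfolding F(2) sj_rep_combination[OF F(1)] by (simp add: e_def case_prod_beta)
  finally have "a (e' q) = 0" if "q : e ` F" for q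
   by (rule indep[rotated]) (use F(1) that in auto)
  then have "a q = 0" if "q : F" for q using that e by (metis imageI)
  then have "u = (\<Oplus>\<^bsub>?J\<^esub>q\<in>F. \<zero>\<^bsub>?J\<^esub>)" unfolding F(2)
   by (intro SJ.finsum_cong') (auto simp: SJ.c_zero)
  then show ?thesis by simp
 qed
 interpret E: ring "end_ring :: 'k sj_end ring" by (rule ring_EE)
 interpret ring_hom_ring ?J end_ring sj_rep by (rule ring_hom_ringI2[OF ring_super_jordan ring_EE sj_rep(1)])
 have "a_kernel ?J end_ring sj_rep <= {\<zero>\<^bsub>?J\<^esub>}" unfolding a_kernel_def' using zero by auto
 then have "a_kernel ?J end_ring sj_rep = {\<zero>\<^bsub>?J\<^esub>}" using ring_hom_zero[OF sj_rep(1) ring_super_jordan ring_EE]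
  unfolding a_kernel_def' by auto
 then show ?thesis by (rule trivial_ker_imp_inj)
qed

lemma sj_rep_image: "sj_rep ` carrier (super_jordan :: (sj_gen list => 'k) set ring) = WJ"
proof
 let ?J = "super_jordan :: (sj_gen list => 'k) set ring"
 show "sj_rep ` carrier ?J <= WJ"
 proof (intro image_subsetI)
  fix u assume "u : carrier ?J"
  then obtain F a where F: "finite F" "u = (\<Oplus>\<^bsub>?J\<^esub>q\<in>F. sj_const (a q) **\<^bsub>?J\<^esub> SJ.mon q)"
   using SJ.SJ_combination[OF super_jordan_SJ] by blast
  show "sj_rep u : WJ" unfolding F(2) sj_rep_combination[OF F(1)] WJ_def
   by (intro sj_model.vs.span_sum) (auto intro!: sj_model.vs.span_scale[OF sj_model.vs.span_base])
 qed
 show "WJ <= sj_rep ` carrier ?J"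
 proof
  fix u assume "u : WJ"
  then show "u : sj_rep ` carrier ?J" unfolding WJ_def
  proof (induction u rule: sj_model.vs.span_induct_alt)
   case base
   show ?case using ring_hom_zero[OF sj_rep(1) ring_super_jordan ring_EE] by (metis SJ.zero_closed imageI ring_on_simps(4))
  next
   case (step a m u)
   then obtain i j k r where m: "m = sj_model.mon (i, j, k)" "j \<ge> 0" and r: "r : carrier ?J" "u = sj_rep r" by auto
   have "sj_rep (sj_const a **\<^bsub>?J\<^esub> SJ.mon (i, nat j, k) \<oplus>\<^bsub>?J\<^esub> r) = end_const a * m + u"
    using r m by (simp add: sj_rep sj_rep_mon)
   then show ?case using r(1) by (metis SJ.a_closed SJ.c_closed SJ.m_closed SJ.mon_closed imageI)
  qed
 qed
qed

end

section \<open>Polynomial identities and the center of a copy\<close>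

lemma power_mult_inverse:
 fixes a b :: "'a::monoid_mult"
 assumes "a * b = 1" shows "a ^ n * b ^ n = 1"
proof (induction n)
 case (Suc n)
 have "a ^ Suc n * b ^ Suc n = a ^ n * (a * b) * b ^ n"
  by (simp only: power_Suc2[of a] power_Suc[of b] mult.assoc)
 then show ?case using Suc assms by simp
qed simp

context sj_copy
begin

lemma PI_ring_copy: "PI_ring R"
proof (rule PI_ring_inj[OF R.ring_axioms _ f_inj PI_ring_W])
 show "f : ring_hom R (ring_on W)"
  using f_W by (intro ring_hom_memI) (auto simp: image_subset_iff)
qed

text \<open>The set \<open>I\<close> holds the exponents that occur in the center: all pairs for the
  localization, those with a nonnegative power of \<open>s\<close> for the plane. It then suffices
  to find each such \<open>zmon\<close> in the subring generated by \<open>S\<close>.\<close>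

lemma center_generated:
 assumes theta: "!!a. theta a : carrier R & f (theta a) = eta a" and S: "S <= ring_center R"
  and I: "!!r. r : ring_center R ==> f r : vs.span (zmon ` I)"
  and gen: "!!q. q : I ==> \<exists>g\<in>generate_ring R S. f g = zmon q"
 shows "ring_center R = generated_algebra theta R S"
proof
 let ?G = "generate_ring R (range theta \<union> S)"
 have G: "range theta \<union> S <= ring_center R"
 proof -
  have "eta a : Z0" for a using Z0_closed(5)[OF Z0_closed(2), of a] by simp
  then show ?thesis using theta S center_iff by auto
 qed
 have Gc: "range theta \<union> S <= carrier R"
  by (rule subset_trans[OF G]) (rule subsetI, rule ring_centerD(1))
 show "generated_algebra theta R S <= ring_center R"
  unfolding generated_algebra_def by (intro generate_ring_min_subring1 ring_center_subring G Gc)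
 have SG: "generate_ring R S <= ?G" using Gc by (intro mono_generate_ring) auto
 have span: "\<exists>g\<in>?G. f g = z" if "z : vs.span (zmon ` I)" for z
  using that
 proof (induction z rule: vs.span_induct_alt)
  case base
  show ?case using zero_in_generate f_simps(4) by blast
 next
  case (step a m z)
  then obtain q g h where q: "q : I" "m = zmon q" and g: "g : ?G" "f g = z" and h: "h : ?G" "f h = m"
   using gen SG by blast
  have th: "theta a : ?G" by (rule generate_ring.incl) simp
  have "f (theta a ** h \<oplus> g) = eta a * m + z"
   using generate_ring_in_carrier[OF Gc] g h theta by simp
  moreover have "theta a ** h \<oplus> g : ?G"
   by (rule generate_ring.eng_add[OF generate_ring.eng_mult[OF th h(1)] g(1)])
  ultimately show ?case by blast
 qed
 show "ring_center R <= generated_algebra theta R S"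
 proof
  fix r assume r: "r : ring_center R"
  obtain g where g: "g : ?G" "f g = f r" using span[OF I[OF r]] by blast
  then have "g = r" using f_eq_iff generate_ring_in_carrier[OF Gc g(1)] ring_centerD(1)[OF r] by simp
  then show "r : generated_algebra theta R S" using g(1) by (simp add: generated_algebra_def)
 qed
qed

lemma independent_copy:
 assumes theta: "!!a. theta a : carrier R & f (theta a) = eta a" and m: "!!i. m i : carrier R & f (m i) = zmon (e i)" and e: "inj e"
 shows "linearly_independent_over theta R UNIV m"
 unfolding linearly_independent_over_def
proof (intro allI impI ballI)
 fix F c i
 assume F: "finite F & F <= UNIV & (\<Oplus>i\<in>F. theta (c i) ** m i) = \<zero>" and i: "i : F"
 have inj: "inj_on e F" using e by (rule inj_on_subset) simp
 have "(\<Sum>q\<in>e ` F. eta (c (inv_into UNIV e q)) * zmon q) = (\<Sum>i\<in>F. eta (c i) * zmon (e i))"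
  using e by (simp add: sum.reindex[OF inj])
 also have "\<dots> = f (\<Oplus>i\<in>F. theta (c i) ** m i)"
  using F theta m by (subst f_finsum) auto
 also have "\<dots> = 0" using F by simp
 finally have "c (inv_into UNIV e (e i)) = 0" using F i by (intro zmon_indep) auto
 then show "c i = 0" using e by simp
qed

end

section \<open>The plane and its localization as copies\<close>

context sj_setting
begin

abbreviation J where "J \<equiv> super_jordan :: (sj_gen list => 'k) set ring"
abbreviation L where "L \<equiv> super_jordan_loc :: 'k sj_loc ring"

sublocale JC: sj_copy "end_const :: 'k => _" end_x end_y end_s end_si p J sj_rep
proof (intro sj_copy.intro sj_alg_p_axioms sj_copy_axioms.intro ring_super_jordan sj_rep(1) sj_rep_inj)
 show "sj_rep ` carrier J <= sj_model.W" unfolding sj_rep_image using WJ_W by blast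
 show "end_x : sj_rep ` carrier J" "end_y : sj_rep ` carrier J" "end_s : sj_rep ` carrier J"
  unfolding sj_rep_image by (rule WJ_gens)+
qed

lemma s_si_power: "(end_s :: 'k sj_end) ^ n * end_si ^ n = 1" "(end_si :: 'k sj_end) ^ n * end_s ^ n = 1"
 by (rule power_mult_inverse, simp)+

lemma s_power_Z0: "(end_s :: 'k sj_end) ^ (p * n) = zmon (int n, 0)" "(end_s :: 'k sj_end) ^ (p * n) : Z0"
proof -
 show 1: "(end_s :: 'k sj_end) ^ (p * n) = zmon (int n, 0)"
 proof -
  have "sj_model.spow (int (p * n)) = (end_s :: 'k sj_end) ^ (p * n)" by (rule sj_model.spow_of_nat)
  then show ?thesis by (simp add: zmon_def)
 qed
 show "(end_s :: 'k sj_end) ^ (p * n) : Z0" unfolding 1 by (rule Z0_closed(6))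
qed

lemma sj_s_power: "sj_rep (sj_s [^]$J (n::nat)) = end_s ^ n" "sj_s [^]$J (n::nat) : carrier J"
 by (simp_all add: sj_rep_pow sj_rep_s)

text \<open>In the model the powers of \<open>s\<close> are invertible, so they are regular in the
  plane; and \<open>s^n\<close> divides \<open>s^(p n)\<close>, which is central.\<close>

lemma central_frac_J: "central_frac J sj_s_powers"
proof (intro central_frac.intro ring_super_jordan central_frac_axioms.intro)
 show "sj_s_powers <= regular_elements J"
 proof
  fix r assume "r : (sj_s_powers :: (sj_gen list => 'k) set set)"
  then obtain n :: nat where r: "r = sj_s [^]$J n" by (auto simp: sj_s_powers_def)
  show "r : regular_elements J"
  proof (rule regular_elementsI)
   fix a assume a: "a : carrier J"
   show "a = \<zero>$J" if "r **$J a = \<zero>$J"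
   proof -
    have "end_s ^ n * sj_rep a = 0"
     using sj_rep_simps(1)[OF sj_s_power(2) a, of n] that by (simp add: r sj_s_power JC.f_simps)
    then have "end_si ^ n * end_s ^ n * sj_rep a = 0" by (simp add: mult.assoc)
    then show ?thesis using JC.f_eq_iff[OF a SJ.zero_closed] by (simp add: s_si_power)
   qed
   show "a = \<zero>$J" if "a **$J r = \<zero>$J"
   proof -
    have "sj_rep a * end_s ^ n = 0"
     using sj_rep_simps(1)[OF a sj_s_power(2), of n] that by (simp add: r sj_s_power JC.f_simps)
    then have "sj_rep a * (end_s ^ n * end_si ^ n) = 0" by (simp add: mult.assoc[symmetric])
    then show ?thesis using JC.f_eq_iff[OF a SJ.zero_closed] by (simp add: s_si_power)
   qed
  qed (simp add: r)
 qed
 show "\<one>$J : sj_s_powers" unfolding sj_s_powers_def by (auto intro!: exI[of _ "0::nat"])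
 show "s **$J t : sj_s_powers" if "s : sj_s_powers" "t : sj_s_powers" for s t
  using that SJ.nat_pow_mult[OF SJ.s_closed] unfolding sj_s_powers_def by blast
 show "\<exists>s'\<in>carrier J. s **$J s' : sj_s_powers \<inter> ring_center J" if s: "s : sj_s_powers" for s
 proof -
  obtain n :: nat where n: "s = sj_s [^]$J n" using s by (auto simp: sj_s_powers_def)
  have "n + (p * n - n) = p * n" using p by simp
  then have eq: "s **$J sj_s [^]$J (p * n - n) = sj_s [^]$J (p * n)"
   using SJ.nat_pow_mult[OF SJ.s_closed, of n "p * n - n"] by (simp add: n)
  have "sj_s [^]$J (p * n) : ring_center J"
   unfolding JC.center_iff[OF sj_s_power(2)] sj_s_power(1) by (rule s_power_Z0)
  then have "s **$J sj_s [^]$J (p * n - n) : sj_s_powers \<inter> ring_center J"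
   unfolding eq by (auto simp: sj_s_powers_def)
  then show ?thesis using sj_s_power(2) by blast
 qed
qed

sublocale LF: central_frac_hom J sj_s_powers "end_ring :: 'k sj_end ring" sj_rep
proof (intro central_frac_hom.intro central_frac_J ring_EE central_frac_hom_axioms.intro sj_rep(1) sj_rep_inj)
 fix s assume "s : (sj_s_powers :: (sj_gen list => 'k) set set)"
 then obtain n :: nat where n: "s = sj_s [^]$J n" by (auto simp: sj_s_powers_def)
 show "sj_rep s : Units (end_ring :: 'k sj_end ring)"
  unfolding n sj_s_power Units_def using s_si_power[of n] by auto
qed

abbreviation lrep where "lrep \<equiv> LF.lift"

lemmas ring_L = LF.ring_F[folded super_jordan_loc_def]
lemmas lrep_hom = LF.lift_hom[folded super_jordan_loc_def] and lrep_inj = LF.lift_inj[folded super_jordan_loc_def]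

lemma sj_embed_emb: "sj_embed = LF.emb"
 by (rule ext) (simp add: sj_embed_def LF.emb_def)

lemma sj_embed_closed [simp]: "u : carrier J ==> sj_embed u : carrier L"
 unfolding sj_embed_emb super_jordan_loc_def by (rule LF.emb_closed)

lemma lrep_embed: "u : carrier J ==> lrep (sj_embed u) = sj_rep u"
 unfolding sj_embed_emb by (rule LF.lift_emb)

lemma inv_end_s: "inv$end_ring ((end_s :: 'k sj_end) ^ n) = end_si ^ n"
proof -
 have m: "Group.monoid (end_ring :: 'k sj_end ring)" using ring_EE by (rule ring.is_monoid)
 show ?thesis by (rule monoid.inv_char[OF m]) (simp_all add: s_si_power)
qed

lemma lrep_fr:
 assumes "u : carrier J"
 shows "lrep (LF.fr u (sj_s [^]$J (n::nat))) = sj_rep u * end_si ^ n"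
 using LF.lift_fr[OF assms, of "sj_s [^]$J n"] inv_end_s[of n]
 by (auto simp: sj_s_powers_def sj_s_power)

text \<open>An element of \<open>W\<close> multiplied by a central power of \<open>s\<close> falls
  into \<open>WJ\<close>, the image of the plane, so the element itself is the image of a
  fraction.\<close>

lemma lrep_image: "lrep ` carrier L = sj_model.W"
proof
 show "lrep ` carrier L <= sj_model.W"
 proof (intro image_subsetI)
  fix X assume "X : carrier L"
  then obtain a s where a: "a : carrier J" "s : sj_s_powers" "X = LF.fr a s"
   unfolding super_jordan_loc_def by (rule LF.frac_cases)
  obtain n :: nat where n: "s = sj_s [^]$J n" using a(2) by (auto simp: sj_s_powers_def)
  have "sj_rep a * end_si ^ n : sj_model.W"
   using JC.f_in_W[OF a(1)] sj_model.W_gens(4) subring_setD(4,7)[OF sj_model.subring_W] by blast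
  then show "lrep X : sj_model.W" unfolding a(3) n lrep_fr[OF a(1)] .
 qed
 show "sj_model.W <= lrep ` carrier L"
 proof
  fix u :: "'k sj_end" assume u: "u : sj_model.W"
  obtain m where m: "end_s ^ (p * m) * u : WJ" using clear_denominator[OF u] by blast
  then obtain a where a: "a : carrier J" "sj_rep a = end_s ^ (p * m) * u" unfolding sj_rep_image[symmetric] by auto
  have S: "sj_s [^]$J (p * m) : sj_s_powers" by (auto simp: sj_s_powers_def)
  have "lrep (LF.fr a (sj_s [^]$J (p * m))) = u * (end_s ^ (p * m) * end_si ^ (p * m))"
   unfolding lrep_fr[OF a(1)] a(2) Z0_central[OF s_power_Z0(2) u] by (simp only: mult.assoc)
  then have "lrep (LF.fr a (sj_s [^]$J (p * m))) = u" by (simp add: s_si_power)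
  then show "u : lrep ` carrier L" using LF.fr_closed[OF a(1) S] unfolding super_jordan_loc_def by (metis imageI)
 qed
qed

sublocale LC: sj_copy "end_const :: 'k => _" end_x end_y end_s end_si p L lrep
 by (intro sj_copy.intro sj_alg_p_axioms sj_copy_axioms.intro ring_L lrep_hom lrep_inj)
  (simp_all only: lrep_image order_refl sj_model.W_gens)

abbreviation (input) "nn \<equiv> (2 * p)\<^sup>2"

text \<open>The image of the localization is all of \<open>W\<close>, so the dual basis is available
  without clearing denominators: \<open>M = 0\<close> and \<open>d = 1\<close>.\<close>

lemma L_basis:
 obtains N b u v i0 where "azumaya_basis L nn N b u v i0" "dual_basis_domain L nn N b u v \<one>$L"
proof -
 obtain b :: "nat => 'k sj_end" and N :: "nat => nat" and u v :: "nat => nat => 'k sj_end" and i0 :: nat where d: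
  "!!i. i < nn ==> b i : sj_model.W"
  "!!i k. i < nn ==> k < N i ==> u i k : sj_model.W & v i k : sj_model.W"
  "!!i r. i < nn ==> r : sj_model.W ==> (\<Sum>k<N i. u i k * r * v i k) : Z0"
  "!!r. r : sj_model.W ==> r = (\<Sum>i<nn. (\<Sum>k<N i. u i k * r * v i k) * b i)"
  "!!i j. i < nn ==> j < nn ==> (\<Sum>k<N i. u i k * b j * v i k) = (if i = j then 1 else 0)"
  "i0 < nn" "(\<Sum>k<N i0. u i0 k * 1 * v i0 k) = 1"
  by (rule dual_data) (rule that)
 have M: "end_s ^ (p * 0) * w' : lrep ` carrier L" if "w' : sj_model.W" for w'
  using that by (simp add: lrep_image)
 note copy1 = LC.dual_basis_copy(1)[where M = 0 and B = sj_model.W, OF M d(1) d(1) d(2) d(2) d(3,4,5)]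
  and copy2 = LC.dual_basis_copy(2)[where M = 0 and B = sj_model.W, OF M d(1) d(1) d(2) d(2) d(3,4,5) refl d(6,7)]
 have "inv_into (carrier L) lrep (end_s ^ (p * (3 * 0))) = \<one>$L"
  using inv_into_f_eq[OF lrep_inj LC.R.one_closed LC.f_simps(3)] by simp
 then show ?thesis using that[OF copy2] copy1 by simp
qed

lemma common_denominator:
 assumes "finite B" "B <= sj_model.W"
 shows "\<exists>M. \<forall>w'\<in>B. (end_s :: 'k sj_end) ^ (p * M) * w' : WJ"
 using assms
proof (induction B)
 case (insert w' B)
 then obtain M where M: "!!r. r : B ==> end_s ^ (p * M) * r : WJ" by auto
 obtain m where m: "end_s ^ (p * m) * w' : WJ" using clear_denominator insert by blast
 have "end_s ^ (p * (M + m)) * r = end_s ^ (p * m) * (end_s ^ (p * M) * r)"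
  "end_s ^ (p * (M + m)) * r = end_s ^ (p * M) * (end_s ^ (p * m) * r)" for r :: "'k sj_end"
  by (simp_all add: distrib_left power_add mult.assoc[symmetric]) (simp add: power_add[symmetric] add.commute)
 then have "end_s ^ (p * (M + m)) * r : WJ" if "r : insert w' B" for r
  using that M m WJ_left'(1) by (metis insert_iff)
 then show ?case by blast
qed simp

text \<open>Only finitely many elements of \<open>W\<close> enter a dual basis, so one power
  \<open>s^(p M)\<close> takes all of them into the plane.\<close>

lemma J_basis:
 obtains N b u v d where "dual_basis_domain J nn N b u v d"
proof -
 obtain b :: "nat => 'k sj_end" and N :: "nat => nat" and u v :: "nat => nat => 'k sj_end" and i0 :: nat where d:
  "!!i. i < nn ==> b i : sj_model.W"
  "!!i k. i < nn ==> k < N i ==> u i k : sj_model.W & v i k : sj_model.W"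
  "!!i r. i < nn ==> r : sj_model.W ==> (\<Sum>k<N i. u i k * r * v i k) : Z0"
  "!!r. r : sj_model.W ==> r = (\<Sum>i<nn. (\<Sum>k<N i. u i k * r * v i k) * b i)"
  "!!i j. i < nn ==> j < nn ==> (\<Sum>k<N i. u i k * b j * v i k) = (if i = j then 1 else 0)"
  "i0 < nn" "(\<Sum>k<N i0. u i0 k * 1 * v i0 k) = 1"
  by (rule dual_data) (rule that)
 define B where "B = b ` {..<nn} \<union> (\<Union>i<nn. u i ` {..<N i} \<union> v i ` {..<N i})"
 have "finite B" "B <= sj_model.W" using d(1,2) by (auto simp: B_def)
 then obtain M where "\<forall>w'\<in>B. end_s ^ (p * M) * w' : WJ" using common_denominator by blast
 then have M: "end_s ^ (p * M) * w' : sj_rep ` carrier J" if "w' : B" for w' using that by (simp add: sj_rep_image)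
 have B: "b i : B" "k < N i ==> u i k : B & v i k : B" if "i < nn" for i k using that by (auto simp: B_def)
 show ?thesis
  by (rule that) (rule JC.dual_basis_copy(1)[where M = M and B = B and b = b and N = N and u = u and v = v and n = nn,
   OF M d(1) B(1) d(2) B(2) d(3,4,5)])
qed

end

section \<open>Algebra isomorphisms and tensor products with the field of fractions\<close>

lemma algebra_isomorphic_sym:
 assumes "algebra_isomorphic K \<kappa> R \<kappa>' R'" "ring R" "!!c. c : carrier K ==> \<kappa> c : carrier R"
 shows "algebra_isomorphic K \<kappa>' R' \<kappa> R"
proof -
 obtain phi where phi: "phi : ring_iso R R'" "!!c. c : carrier K ==> phi (\<kappa> c) = \<kappa>' c"
  using assms(1) unfolding algebra_isomorphic_def by blast
 have "inv_into (carrier R) phi (\<kappa>' c) = \<kappa> c" if "c : carrier K" for c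
 proof -
  have "inj_on phi (carrier R)" using phi(1) unfolding ring_iso_def bij_betw_def by blast
  then show ?thesis unfolding phi(2)[OF that, symmetric] using assms(3)[OF that] by (rule inv_into_f_f)
 qed
 then show ?thesis
  unfolding algebra_isomorphic_def using ring_iso_set_sym[OF assms(2) phi(1)] by blast
qed

lemma algebra_isomorphic_trans:
 assumes "algebra_isomorphic K \<kappa> R \<kappa>' R'" "algebra_isomorphic K \<kappa>' R' \<kappa>'' R''"
 shows "algebra_isomorphic K \<kappa> R \<kappa>'' R''"
proof -
 obtain phi psi where phi: "phi : ring_iso R R'" "!!c. c : carrier K ==> phi (\<kappa> c) = \<kappa>' c"
  and psi: "psi : ring_iso R' R''" "!!c. c : carrier K ==> psi (\<kappa>' c) = \<kappa>'' c"
  using assms unfolding algebra_isomorphic_def by blast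
 then show ?thesis
  unfolding algebra_isomorphic_def using ring_iso_set_trans[OF phi(1) psi(1)] by (intro bexI[of _ "psi \<circ> phi"]) simp_all
qed

context sj_alg
begin

lemma E_product:
 assumes "!!i j k l. B i j * E k l = E k l * B i j"
 shows "(\<Sum>i\<in>UNIV. \<Sum>j\<in>UNIV. A i j * E i j) * (\<Sum>k\<in>UNIV. \<Sum>l\<in>UNIV. B k l * E k l)
  = (\<Sum>i\<in>UNIV. \<Sum>j\<in>UNIV. (\<Sum>l\<in>UNIV. A i l * B l j) * E i j)"
proof -
 have "A i j * E i j * (B k l * E k l) = A i j * B k l * (E i j * E k l)" for i j k l
  using assms[of k l i j] by (metis mult.assoc)
 then show ?thesis by (simp add: UNIV_bool distrib_left distrib_right E_mult add_ac)
qed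

lemma E_independent:
 assumes A: "!!i j k l. A i j * E k l = E k l * A i j" and zero: "(\<Sum>i\<in>UNIV. \<Sum>j\<in>UNIV. A i j * E i j) = 0"
 shows "A i j = 0"
proof -
 have "E k i * (A i' j' * E i' j') * E j k = A i' j' * (E k i * E i' j' * E j k)" for i' j' k
  using A[of i' j' k i] by (metis mult.assoc)
 then have "E k i * (\<Sum>i\<in>UNIV. \<Sum>j\<in>UNIV. A i j * E i j) * E j k = A i j * E k k" for k
  by (cases i; cases j) (simp_all add: UNIV_bool distrib_left distrib_right E_mult)
 then have "A i j * E k k = 0" for k using zero by simp
 then have "A i j * (E False False + E True True) = 0" by (simp add: distrib_left)
 then show ?thesis by (simp add: E_one)
qed

end

text \<open>The ring laws are pulled back along an injective map into a type class ring; for the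
  matrices over \<open>sj_A\<close> this replaces computations with matrix products.\<close>

lemma ring_if_embedded:
 fixes f :: "'b => 'a::ring_1" and R (structure)
 assumes inj: "inj_on f (carrier R)"
  and closed: "!!a b. a : carrier R ==> b : carrier R ==> a \<oplus> b : carrier R & a ** b : carrier R" "\<one> : carrier R" "\<zero> : carrier R"
  and f: "!!a b. a : carrier R ==> b : carrier R ==> f (a \<oplus> b) = f a + f b & f (a ** b) = f a * f b" "f \<one> = 1" "f \<zero> = 0"
  and neg: "!!a. a : carrier R ==> \<exists>b\<in>carrier R. f b = - f a"
 shows "ring R"
proof -
 note eq = inj_onD[OF inj]
 have cl [simp]: "a \<oplus> b : carrier R" "a ** b : carrier R" "f (a \<oplus> b) = f a + f b" "f (a ** b) = f a * f b"
  if "a : carrier R" "b : carrier R" for a b using closed(1)[OF that] f(1)[OF that] by auto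
 note [simp] = closed(2,3) f(2,3)
 show ?thesis
 proof (rule ringI)
  show "abelian_group R"
  proof (rule abelian_groupI)
   fix a assume a: "a : carrier R"
   obtain b where b: "b : carrier R" "f b = - f a" using neg[OF a] by blast
   have "b \<oplus> a = \<zero>" by (rule eq) (use a b in simp_all)
   then show "\<exists>b\<in>carrier R. b \<oplus> a = \<zero>" using b(1) by blast
   show "\<zero> \<oplus> a = a" by (rule eq) (use a in simp_all)
  next
   fix a b c assume a: "a : carrier R" "b : carrier R" "c : carrier R"
   show "a \<oplus> b \<oplus> c = a \<oplus> (b \<oplus> c)" by (rule eq) (use a in \<open>simp_all add: add.assoc\<close>)
  next
   fix a b assume a: "a : carrier R" "b : carrier R"
   show "a \<oplus> b = b \<oplus> a" by (rule eq) (use a in \<open>simp_all add: add.commute\<close>)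
  qed simp_all
  show "Group.monoid R"
  proof (rule Group.monoidI)
   fix a b c assume a: "a : carrier R" "b : carrier R" "c : carrier R"
   show "a ** b ** c = a ** (b ** c)" by (rule eq) (use a in \<open>simp_all add: mult.assoc\<close>)
  next
   fix a assume a: "a : carrier R"
   show "\<one> ** a = a" "a ** \<one> = a" by (rule eq; use a in simp)+
  qed simp_all
  fix a b c assume a: "a : carrier R" "b : carrier R" "c : carrier R"
  show "(a \<oplus> b) ** c = a ** c \<oplus> b ** c" by (rule eq) (use a in \<open>simp_all add: distrib_right\<close>)
  show "c ** (a \<oplus> b) = c ** a \<oplus> c ** b" by (rule eq) (use a in \<open>simp_all add: distrib_left\<close>)
 qed
qed

text \<open>Any ring \<open>A\<close> between the image of \<open>R\<close> and its quotient ring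
  \<open>Q\<close>, compatibly with the center, becomes \<open>Q\<close> after tensoring with
  \<open>K\<close>. This is applied to the plane and to the matrices over \<open>sj_A\<close>, which
  settles both isomorphisms at once.\<close>

lemma (in dual_basis_domain) tensor_fractions:
 assumes A: "ring A" and f: "f : ring_hom A Q" "inj_on f (carrier A)"
  and \<alpha>: "!!c. c : C ==> \<alpha> c : carrier A & f (\<alpha> c) = QF.emb c" and surj: "QF.emb ` carrier R <= f ` carrier A"
 shows "algebra_isomorphic K (tensor ZR \<alpha> A KF.emb K \<one>$A) (tensor_ring ZR \<alpha> A KF.emb K) KQ Q"
  "ring (tensor_ring ZR \<alpha> A KF.emb K)"
  "X : carrier K ==> tensor ZR \<alpha> A KF.emb K \<one>$A X : carrier (tensor_ring ZR \<alpha> A KF.emb K)"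
proof -
 interpret A: ring A by (rule A)
 have TD: "tensor_data ZR \<alpha> A KF.emb K"
  using \<alpha> by (intro tensor_data.intro tensor_data_axioms.intro A KF.ring_F) simp_all
 interpret TD: tensor_data ZR \<alpha> A KF.emb K by (rule TD)
 have KQ_emb: "KQ (KF.emb c) = QF.emb c" if "c : C" for c
  using KQ_fr[OF that, of \<one>] one_nonzero by (simp add: KF.emb_def QF.emb_def)
 have KQ_center: "KQ X : ring_center Q" if "X : carrier K" for X
  using KQ_image that by blast
 interpret TT: tensor_target ZR \<alpha> A KF.emb K Q f KQ
 proof (intro tensor_target.intro TD QF.ring_F tensor_target_axioms.intro f(1) KQ_hom)
  show "f (\<alpha> c) = KQ (KF.emb c)" if "c : carrier ZR" for c using \<alpha> KQ_emb that by simp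
  show "f a **$Q KQ X = KQ X **$Q f a" if "a : carrier A" "X : carrier K" for a X
   using ring_centerD(2)[OF KQ_center[OF that(2)] ring_hom_closed[OF f(1) that(1)]] by (rule sym)
 qed
 have unit: "KF.emb c : Units K" and inv_emb: "inv$K (KF.emb c) = KF.fr \<one> c" if c: "c : C0" for c
 proof -
  show u: "KF.emb c : Units K" by (rule KF.emb_Units[OF c])
  have "KF.fr \<one> c = KF.emb \<one> **$K inv$K (KF.emb c)" using KF.fr_eq_emb_inv[OF _ c, of \<one>] by simp
  moreover have "KF.emb \<one> = \<one>$K" by (simp add: KF.emb_def KF.F_one)
  ultimately show "inv$K (KF.emb c) = KF.fr \<one> c" using u TD.B.l_one[OF TD.B.Units_inv_closed[OF u]] by simp
 qed
 interpret FK: field K by (rule field_K)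
 obtain phi where phi: "phi : ring_iso TD.TR Q" "!!a X. a : carrier A ==> X : carrier K ==> phi (TD.ten a X) = f a **$Q KQ X"
 proof (rule TT.tensor_localization)
  show "c **$ZR c' : carrier ZR" if "c : carrier ZR" "c' : carrier ZR" for c c' using that by simp
  show "KF.emb (c **$ZR c') = KF.emb c **$K KF.emb c'" if "c : carrier ZR" "c' : carrier ZR" for c c'
   by (rule ring_hom_mult[OF KF.emb_hom that])
  show "X **$K Y = Y **$K X" if "X : carrier K" "Y : carrier K" for X Y by (rule FK.m_comm[OF that])
  show "\<exists>z\<in>carrier ZR. \<exists>w\<in>carrier ZR. KF.emb w : Units K & X = KF.emb z **$K inv$K KF.emb w" if X: "X : carrier K" for X
  proof -
   obtain a w where a: "a : C" "w : C0" "X = KF.fr a w" using X by (rule K_cases)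
   then have X: "X = KF.emb a **$K inv$K KF.emb w" using KF.fr_eq_emb_inv[of a w] by simp
   show ?thesis by (rule bexI[of _ a], rule bexI[of _ w], intro conjI unit[OF a(2)] X) (use a in simp_all)
  qed
  show "inj_on f (carrier A)" by (rule f(2))
  show "\<exists>a\<in>carrier A. \<exists>w\<in>carrier ZR. KF.emb w : Units K & q = f a **$Q KQ (inv$K KF.emb w)" if q: "q : carrier Q" for q
  proof -
   obtain r c where r: "r : carrier R" "c : regular_elements R" "c : C" "q = QF.fr r c"
    using q by (rule QF.frac_cases)
   have "c ~= \<zero>"
   proof
    assume "c = \<zero>"
    then have "c ** \<one> = \<zero>" by simp
    then have "\<one> = \<zero>" by (rule regular_elementsD(2)[OF r(2) one_closed])
    then show False using one_nonzero by simp
   qed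
   then have c: "c : C0" using r(3) by simp
   obtain a where a: "a : carrier A" "f a = QF.emb r" using subsetD[OF surj imageI[OF r(1)]] by (auto elim: imageE)
   have "KQ (inv$K KF.emb c) = QF.fr \<one> c" unfolding inv_emb[OF c] by (rule KQ_fr[OF _ c]) simp
   then have "f a **$Q KQ (inv$K KF.emb c) = QF.fr r \<one> **$Q QF.fr \<one> c"
    unfolding a(2) QF.emb_def by simp
   also have "\<dots> = q" using QF.fr_mult[OF r(1) one_closed QF.S_one _ r(2,3)] r by simp
   finally have q: "q = f a **$Q KQ (inv$K KF.emb c)" by (rule sym)
   show ?thesis by (rule bexI[of _ a], rule bexI[of _ c], intro conjI unit[OF c] q) (use a(1) c in simp_all)
  qed
 qed blast
 have "phi (TD.ten \<one>$A X) = KQ X" if "X : carrier K" for X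
  using phi(2)[OF A.one_closed that] ring_hom_one[OF f(1)] ring_hom_closed[OF KQ_hom that]
   monoid.l_one[OF ring.is_monoid[OF QF.ring_F]] by simp
 then show "algebra_isomorphic K (TD.ten \<one>$A) TD.TR KQ Q"
  unfolding algebra_isomorphic_def using phi(1) by blast
 show "ring TD.TR" by (rule TD.TR.ring_axioms)
 show "X : carrier K ==> TD.ten \<one>$A X : carrier TD.TR" by simp
qed

section \<open>Center, Azumaya property, PI degree and ideals\<close>

lemma generate_ring_pow: "h : generate_ring R S ==> h [^]$R (n::nat) : generate_ring R S"
 by (induction n) (auto intro: generate_ring.intros)

context sj_setting
begin

lemma inv_sL_power:
 "sj_embed sj_s [^]$L (n::nat) : Units L" "inv$L (sj_embed sj_s [^]$L n) : carrier L"
 "lrep (inv$L (sj_embed sj_s [^]$L n)) = end_si ^ n"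
proof -
 let ?a = "sj_embed sj_s [^]$L n"
 have a: "?a : carrier L" "lrep ?a = end_s ^ n"
  using LC.f_pow[of "sj_embed sj_s" n] by (simp_all add: lrep_embed sj_rep_s)
 have "(end_si :: 'k sj_end) ^ n : sj_model.W" using subring_setD(7)[OF sj_model.subring_W sj_model.W_gens(4)] .
 then obtain i where i: "i : carrier L" "lrep i = end_si ^ n" unfolding lrep_image[symmetric] by auto
 have "lrep (?a **$L i) = lrep \<one>$L" "lrep (i **$L ?a) = lrep \<one>$L"
  using a i by (simp_all add: s_si_power)
 then have e: "?a **$L i = \<one>$L" "i **$L ?a = \<one>$L"
  using a(1) i(1) inj_onD[OF lrep_inj] LC.R.m_closed LC.R.one_closed by metis+
 have "inv$L ?a = i" by (rule monoid.inv_char[OF ring.is_monoid[OF ring_L] a(1) i(1) e])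
 then show "inv$L ?a : carrier L" "lrep (inv$L ?a) = end_si ^ n" using i by simp_all
 show "?a : Units L" using a(1) i(1) e unfolding Units_def by blast
qed

lemma lrep_power: "lrep (sj_embed sj_s [^]$L (n::nat)) = end_s ^ n" "lrep (sj_embed sj_y [^]$L (n::nat)) = end_y ^ n"
 using LC.f_pow[of "sj_embed sj_s" n] LC.f_pow[of "sj_embed sj_y" n] by (simp_all add: lrep_embed sj_rep_s sj_rep)

lemma zmon_nat: "zmon (int i, j) = ((end_s :: 'k sj_end) ^ p) ^ i * (end_y ^ (2 * p)) ^ j"
 and zmon_neg: "zmon (- int i, j) = ((end_si :: 'k sj_end) ^ p) ^ i * (end_y ^ (2 * p)) ^ j"
proof -
 have 1: "sj_model.spow (int (p * i)) = (end_s :: 'k sj_end) ^ (p * i)" by (rule sj_model.spow_of_nat)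
 show "zmon (int i, j) = ((end_s :: 'k sj_end) ^ p) ^ i * (end_y ^ (2 * p)) ^ j"
  using 1 by (simp add: zmon_def power_mult[symmetric] mult.commute)
 have 2: "sj_model.spow (- int (p * i)) = (end_si :: 'k sj_end) ^ (p * i)"
 proof (cases "p * i = 0")
  case False
  then show ?thesis unfolding sj_model.spow_def by (simp del: mult_eq_0_iff of_nat_mult)
 next
  case True
  show ?thesis unfolding True by simp
 qed
 show "zmon (- int i, j) = ((end_si :: 'k sj_end) ^ p) ^ i * (end_y ^ (2 * p)) ^ j"
  using 2 by (simp add: zmon_def power_mult[symmetric] mult.commute)
qed

lemma etaL: "(sj_embed \<circ> sj_const) a : carrier L & lrep ((sj_embed \<circ> sj_const) a) = end_const (a :: 'k)"
 by (simp add: lrep_embed sj_rep)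

lemma center_L:
 defines "S \<equiv> {sj_embed sj_s [^]$L p, inv$L (sj_embed sj_s [^]$L p), sj_embed sj_y [^]$L (2 * p)}"
 shows "ring_center L = generated_algebra (sj_embed \<circ> sj_const) L S"
  "linearly_independent_over (sj_embed \<circ> sj_const) L UNIV
    (%(i :: int, j :: nat). (sj_embed sj_s [^]$L p) [^]$L i **$L (sj_embed sj_y [^]$L (2 * p)) [^]$L j)"
proof -
 let ?s = "sj_embed sj_s [^]$L p" and ?y = "sj_embed sj_y [^]$L (2 * p)"
 have c: "?s : carrier L" "inv$L ?s : carrier L" "?y : carrier L" using inv_sL_power(2) by simp_all
 have z: "lrep ?s = zmon (1, 0)" "lrep (inv$L ?s) = zmon (- 1, 0)" "lrep ?y = zmon (0, 1)"
  using zmon_nat[of 1 0] zmon_neg[of 1 0] zmon_nat[of 0 1] by (simp_all add: lrep_power inv_sL_power)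
 have S: "S <= ring_center L"
  using c z Z0_closed(6) by (simp add: S_def LC.center_iff)
 show "ring_center L = generated_algebra (sj_embed \<circ> sj_const) L S"
 proof (rule LC.center_generated[OF etaL S, where I = UNIV])
  show "lrep r : sj_model.vs.span (range zmon)" if "r : ring_center L" for r
   using that LC.center_iff[OF ring_centerD(1)[OF that]] by (simp add: Z0_def)
  fix q :: "int \<times> nat"
  obtain i j where q: "q = (i, j)" by (cases q)
  let ?g = "(if i \<ge> 0 then ?s else inv$L ?s) [^]$L nat \<bar>i\<bar> **$L ?y [^]$L j"
  have "?g : generate_ring L S"
   by (rule generate_ring.eng_mult[OF generate_ring_pow generate_ring_pow]) (auto simp: S_def intro: generate_ring.incl)
  moreover have "lrep ?g = zmon q"
  proof (cases "i \<ge> 0")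
   case True
   have "lrep (?s [^]$L nat i **$L ?y [^]$L j) = zmon (int (nat i), j)"
    unfolding zmon_nat LC.f_simps(1)[OF LC.R.nat_pow_closed[OF c(1)] LC.R.nat_pow_closed[OF c(3)]]
     LC.f_pow[OF c(1)] LC.f_pow[OF c(3)] lrep_power by (rule refl)
   then show ?thesis using True by (simp add: q)
  next
   case False
   have "lrep (inv$L ?s [^]$L nat (- i) **$L ?y [^]$L j) = zmon (- int (nat (- i)), j)"
    unfolding zmon_neg LC.f_simps(1)[OF LC.R.nat_pow_closed[OF c(2)] LC.R.nat_pow_closed[OF c(3)]]
     LC.f_pow[OF c(2)] LC.f_pow[OF c(3)] lrep_power(2) inv_sL_power(3) by (rule refl)
   then show ?thesis using False by (simp add: q)
  qed
  ultimately show "\<exists>g\<in>generate_ring L S. lrep g = zmon q" by blast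
 qed
 show "linearly_independent_over (sj_embed \<circ> sj_const) L UNIV (%(i :: int, j :: nat). ?s [^]$L i **$L ?y [^]$L j)"
 proof (rule LC.independent_copy[OF etaL, where e = "%q. q"])
  fix q :: "int \<times> nat"
  obtain i j where q: "q = (i, j)" by (cases q)
  have pp: "?s [^]$L n = sj_embed sj_s [^]$L (p * n)" for n :: nat by (simp add: LC.R.nat_pow_pow)
  have i: "?s [^]$L i : carrier L & lrep (?s [^]$L i) = zmon (i, 0)"
  proof (cases "i \<ge> 0")
   case True
   then obtain n where n: "i = int n" by (rule nonneg_int_cases)
   have "lrep (?s [^]$L n) = zmon (int n, 0)"
    unfolding zmon_nat LC.f_pow[OF c(1)] lrep_power by simp
   then show ?thesis unfolding n int_pow_int using LC.R.nat_pow_closed[OF c(1)] by blast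
  next
   case False
   then obtain n where n: "i = - int n" by (intro that[of "nat (- i)"]) simp
   have "?s [^]$L i = inv$L (sj_embed sj_s [^]$L (p * n))"
    unfolding int_pow_def2 n pp[symmetric] using False by (auto simp only: n nat_int minus_minus of_nat_0_le_iff split: if_split)
   moreover have "lrep (inv$L (sj_embed sj_s [^]$L (p * n))) = zmon (- int n, 0)"
    unfolding zmon_neg inv_sL_power(3) power_mult by simp
   ultimately show ?thesis unfolding n using inv_sL_power(2) by simp
  qed
  have y: "lrep (?y [^]$L j) = zmon (0, j)"
   using zmon_nat[of 0 j] unfolding LC.f_pow[OF c(3)] lrep_power by simp
  have "lrep (?s [^]$L i **$L ?y [^]$L j) = zmon (i, 0) * zmon (0, j)"
   unfolding LC.f_simps(1)[OF conjunct1[OF i] LC.R.nat_pow_closed[OF c(3)]] y conjunct2[OF i] by (rule refl)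
  also have "\<dots> = zmon (i, j)" by (simp add: zmon_mult)
  finally have e: "lrep (?s [^]$L i **$L ?y [^]$L j) = zmon (i, j)" .
  show "(case q of (i, j) => ?s [^]$L i **$L ?y [^]$L j) : carrier L &
    lrep (case q of (i, j) => ?s [^]$L i **$L ?y [^]$L j) = zmon q"
   unfolding q prod.case by (intro conjI e LC.R.m_closed[OF conjunct1[OF i] LC.R.nat_pow_closed[OF c(3)]])
 qed simp
qed

lemma center_J:
 defines "S \<equiv> {sj_s [^]$J p, sj_y [^]$J (2 * p)}"
 shows "ring_center J = generated_algebra sj_const J S"
  "linearly_independent_over sj_const J UNIV
    (%(i :: nat, j :: nat). (sj_s [^]$J p) [^]$J i **$J (sj_y [^]$J (2 * p)) [^]$J j)"
proof -
 let ?s = "sj_s [^]$J p" and ?y = "sj_y [^]$J (2 * p)"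
 have c: "?s : carrier J" "?y : carrier J" by simp_all
 have r: "sj_rep ?s = end_s ^ p" "sj_rep ?y = end_y ^ (2 * p)" by (simp_all add: sj_rep_pow sj_rep_s sj_rep)
 have z: "sj_rep ?s = zmon (1, 0)" "sj_rep ?y = zmon (0, 1)"
  using zmon_nat[of 1 0] zmon_nat[of 0 1] by (simp_all add: r)
 have S: "S <= ring_center J"
  using c z Z0_closed(6) by (simp add: S_def JC.center_iff)
 have eta: "sj_const a : carrier J & sj_rep (sj_const a) = end_const (a :: 'k)" for a by (simp add: sj_rep)
 have m: "sj_rep (?s [^]$J i **$J ?y [^]$J j) = zmon (int i, j)" for i j :: nat
  using c by (simp add: sj_rep_pow r zmon_nat)
 show "ring_center J = generated_algebra sj_const J S"
 proof (rule JC.center_generated[OF eta S, where I = "{(i, j). i \<ge> 0}"])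
  show "sj_rep r : sj_model.vs.span (zmon ` {(i, j). i \<ge> 0})" if rc: "r : ring_center J" for r
  proof (rule center_WJ)
   have "sj_rep r : Z0" using rc JC.center_iff[OF ring_centerD(1)[OF rc]] by simp
   then show "sj_rep r * end_x = end_x * sj_rep r" "sj_rep r * end_y = end_y * sj_rep r" "sj_rep r * end_s = end_s * sj_rep r"
    using Z0_central sj_model.W_gens(1-3) by blast+
   show "sj_rep r : WJ" using ring_centerD(1)[OF rc] sj_rep_image by blast
  qed
  fix q :: "int \<times> nat" assume "q : {(i, j). i \<ge> 0}"
  then obtain i j where q: "q = (int i, j)" by (auto elim: nonneg_int_cases)
  have "?s [^]$J i **$J ?y [^]$J j : generate_ring J S"
   by (rule generate_ring.eng_mult[OF generate_ring_pow generate_ring_pow]) (auto simp: S_def intro: generate_ring.incl)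
  then show "\<exists>g\<in>generate_ring J S. sj_rep g = zmon q" unfolding q using m by blast
 qed
 show "linearly_independent_over sj_const J UNIV (%(i :: nat, j :: nat). ?s [^]$J i **$J ?y [^]$J j)"
 proof (rule JC.independent_copy[OF eta, where e = "%(i, j). (int i, j)"])
  show "inj (%(i, j :: nat). (int i, j))" by (auto intro: injI)
  fix q :: "nat \<times> nat"
  obtain i j where q: "q = (i, j)" by (cases q)
  show "(case q of (i, j) => ?s [^]$J i **$J ?y [^]$J j) : carrier J &
    sj_rep (case q of (i, j) => ?s [^]$J i **$J ?y [^]$J j) = zmon (case q of (i, j) => (int i, j))"
   unfolding q prod.case by (intro conjI m SJ.m_closed SJ.nat_pow_closed c)
 qed
qed

lemma azumaya_L: "azumaya L (ring_center L)" "constant_rank L (ring_center L) nn"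
proof -
 obtain N b u v i0 where A: "azumaya_basis L nn N b u v i0" and D: "dual_basis_domain L nn N b u v \<one>$L"
  by (rule L_basis)
 show "azumaya L (ring_center L)" by (rule azumaya_basis.azumaya[OF A])
 show "constant_rank L (ring_center L) nn" by (rule azumaya_basis.constant_rank[OF A D])
qed

text \<open>All primes are regular because the dual basis survives in the quotient with the same
  number of elements, and that number is the square of the PI degree.\<close>

lemma PI_degree_L:
 "prime_ring L" "PI_ring L" "has_PI_degree L (2 * p)" "prime_ideal P L ==> regular_prime P L"
proof -
 obtain N b u v i0 where A: "azumaya_basis L nn N b u v i0" and D: "dual_basis_domain L nn N b u v \<one>$L"
  by (rule L_basis)
 show "prime_ring L" by (rule dual_basis_domain.prime_ring[OF D])
 show PI: "PI_ring L" by (rule LC.PI_ring_copy)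
 show deg: "has_PI_degree L (2 * p)" by (rule dual_basis_domain.has_PI_degree[OF D PI refl])
 show "regular_prime P L" if P: "prime_ideal P L"
 proof -
  have I: "ideal P L" using P unfolding prime_ideal_def by blast
  have hom: "(+>$L) P : ring_hom L (L Quot P)" by (rule ideal.rcos_ring_hom[OF I])
  have "(+>$L) P ` carrier L = carrier (L Quot P)"
  proof
   show "(+>$L) P ` carrier L <= carrier (L Quot P)" using ring_hom_closed[OF hom] by blast
   show "carrier (L Quot P) <= (+>$L) P ` carrier L"
   proof
    fix X assume "X : carrier (L Quot P)"
    then obtain r where "r : carrier L" "X = P +>$L r" by (rule ideal.quotient_cases[OF I])
    then show "X : (+>$L) P ` carrier L" by blast
   qed
  qed
  then have "PI_ring (L Quot P)" by (rule PI_ring_surj[OF ideal.quotient_is_ring[OF I] hom _ PI])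
  then have "has_PI_degree (L Quot P) (2 * p)"
   by (rule dual_basis_domain.has_PI_degree[OF azumaya_basis.dual_basis_quotient[OF A P] _ refl])
  then show ?thesis unfolding regular_prime_def using P deg by blast
 qed
qed

lemma ideals_L:
 defines "ZR \<equiv> L\<lparr>carrier := ring_center L\<rparr>"
 shows "bij_betw (%I. I \<inter> ring_center L) {I. ideal I L} {a. ideal a ZR}"
  "ideal I L ==> (I \<inter> ring_center L) \<cdot>$L carrier L = I"
  "ideal a ZR ==> ideal (a \<cdot>$L carrier L) L & (a \<cdot>$L carrier L) \<inter> ring_center L = a"
  "ideal I L ==> prime_ideal I L \<longleftrightarrow> primeideal (I \<inter> ring_center L) ZR"
proof -
 obtain N b u v i0 where A: "azumaya_basis L nn N b u v i0" by (rule L_basis)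
 show "bij_betw (%I. I \<inter> ring_center L) {I. ideal I L} {a. ideal a ZR}"
  unfolding ZR_def by (rule azumaya_basis.ideals_bij[OF A])
 show "(I \<inter> ring_center L) \<cdot>$L carrier L = I" if "ideal I L"
  by (rule azumaya_basis.ideal_eq_extension[OF A that])
 show "ideal (a \<cdot>$L carrier L) L & (a \<cdot>$L carrier L) \<inter> ring_center L = a" if "ideal a ZR"
  using azumaya_basis.extension_ideal[OF A that[unfolded ZR_def]] azumaya_basis.contraction_extension[OF A that[unfolded ZR_def]] by (rule conjI)
 show "prime_ideal I L \<longleftrightarrow> primeideal (I \<inter> ring_center L) ZR" if "ideal I L"
  unfolding ZR_def by (rule azumaya_basis.prime_ideal_iff[OF A that])
qed

lemma PI_degree_J: "prime_ring J" "PI_ring J" "has_PI_degree J (2 * p)"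
proof -
 obtain N b u v d where D: "dual_basis_domain J nn N b u v d" by (rule J_basis)
 show "prime_ring J" by (rule dual_basis_domain.prime_ring[OF D])
 show PI: "PI_ring J" by (rule JC.PI_ring_copy)
 show "has_PI_degree J (2 * p)" by (rule dual_basis_domain.has_PI_degree[OF D PI refl])
qed

subsection \<open>Two by two matrices\<close>

abbreviation LA where "LA \<equiv> L\<lparr>carrier := sj_A\<rparr>"
abbreviation M2 where "M2 \<equiv> matrix_ring 2 LA"

lemma lrep_gens: "lrep (sj_embed sj_s) = end_s" "inv$L (sj_embed sj_s) : carrier L" "lrep (inv$L (sj_embed sj_s)) = end_si"
 "lrep ((sj_embed sj_y **$L inv$L (sj_embed sj_s)) [^]$L (2::nat)) = sj_model.t"
proof -
 show s: "lrep (sj_embed sj_s) = end_s" by (simp add: lrep_embed sj_rep_s)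
 show i: "inv$L (sj_embed sj_s) : carrier L" "lrep (inv$L (sj_embed sj_s)) = end_si"
  using inv_sL_power(2,3)[of 1] by simp_all
 show "lrep ((sj_embed sj_y **$L inv$L (sj_embed sj_s)) [^]$L (2::nat)) = sj_model.t"
  using i by (subst LC.f_pow) (simp_all add: lrep_embed sj_rep sj_model.t_def sj_model.w_def power2_eq_square)
qed

lemma sj_A_gens:
 fixes y s defines "y \<equiv> sj_embed sj_y" and "s \<equiv> sj_embed sj_s"
 defines "H \<equiv> range (sj_embed \<circ> sj_const) \<union> {(y **$L inv$L s) [^]$L (2::nat), s, inv$L s}"
 shows "sj_A = generate_ring L H" "H <= carrier L"
 using lrep_gens(2) by (auto simp: H_def sj_A_def generated_algebra_def y_def s_def Let_def)

lemma subring_sj_A: "subring sj_A L" "sj_A <= carrier L"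
 unfolding sj_A_gens(1) by (rule LC.R.generate_ring_is_subring[OF sj_A_gens(2)] LC.R.generate_ring_incl[OF sj_A_gens(2)])+

text \<open>The generators of \<open>sj_A\<close> correspond to scalars, \<open>s\<close>, its
  inverse and \<open>t\<close>, all of which commute with \<open>x\<close> and \<open>v\<close>. So
  the elements of \<open>sj_A\<close> can serve as matrix entries.\<close>

lemma sj_A_comm:
 assumes "a : sj_A" shows "lrep a * sj_model.E k l = sj_model.E k l * (lrep a :: 'k sj_end)"
 using assms unfolding sj_A_gens(1)
proof (induction a rule: generate_ring.induct)
 case (incl h)
 then consider c where "h = sj_embed (sj_const c)" | "h = sj_embed sj_s" | "h = inv$L (sj_embed sj_s)"
  | "h = (sj_embed sj_y **$L inv$L (sj_embed sj_s)) [^]$L (2::nat)" by auto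
 then show ?case
 proof cases
  case (1 c)
  then show ?thesis using sj_model.eta_comm by (simp add: lrep_embed sj_rep)
 next
  case 2
  then show ?thesis using sj_model.E_comm[OF sj_model.sx sj_model.sv] by (simp add: lrep_gens)
 next
  case 3
  then show ?thesis using sj_model.E_comm[OF sj_model.six sj_model.siv] by (simp add: lrep_gens)
 next
  case 4
  show ?thesis unfolding 4 lrep_gens by (rule sj_model.E_comm[OF sj_model.tx sj_model.tv])
 qed
next
 case (eng_mult h1 h2)
 have "lrep (h1 **$L h2) = lrep h1 * lrep h2"
  using LC.R.generate_ring_in_carrier[OF sj_A_gens(2)] eng_mult.hyps by (intro LC.f_simps(1))
 note eq = this
 have "lrep h1 * lrep h2 * sj_model.E k l = lrep h1 * (sj_model.E k l * lrep h2)" by (simp only: mult.assoc eng_mult.IH(2))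
 also have "\<dots> = sj_model.E k l * lrep h1 * lrep h2" by (simp only: mult.assoc[symmetric] eng_mult.IH(1))
 finally show ?case unfolding eq by (simp only: mult.assoc)
next
 case one
 show ?case by simp
next
 case (a_inv h)
 have "lrep (\<ominus>$L h) = - lrep h"
  by (rule LC.f_minus[OF LC.R.generate_ring_in_carrier[OF sj_A_gens(2) a_inv.hyps]])
 then show ?case using a_inv.IH by simp
next
 case (eng_add h1 h2)
 have "lrep (h1 \<oplus>$L h2) = lrep h1 + lrep h2"
  using LC.R.generate_ring_in_carrier[OF sj_A_gens(2)] eng_add.hyps by (intro LC.f_simps(2))
 then show ?case using eng_add.IH by (simp only: distrib_left distrib_right)
qed

lemma lrep_sj_A: "subring_set (lrep ` sj_A)" "end_const (c::'k) * (sj_model.spow j * sj_model.t ^ n) : lrep ` sj_A"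
proof -
 interpret A: ring LA by (rule LC.R.subring_is_ring[OF subring_sj_A(1)])
 have cl: "a \<oplus>$L b : sj_A" "a **$L b : sj_A" "\<ominus>$L a : sj_A" "\<one>$L : sj_A" if "a : sj_A" "b : sj_A" for a b
  using that unfolding sj_A_gens(1) by (auto intro: generate_ring.intros)
 have in_L: "a : carrier L" if "a : sj_A" for a using subring_sj_A(2) that by blast
 show W: "subring_set (lrep ` sj_A)"
  unfolding subring_set_def
 proof (intro conjI ballI)
  have "\<one>$L : sj_A" unfolding sj_A_gens(1) by (rule generate_ring.one)
  then show "1 : lrep ` sj_A" using LC.f_simps(3) by (metis imageI)
  fix u u' assume "u : lrep ` sj_A" "u' : lrep ` sj_A"
  then obtain a b where ab: "a : sj_A" "b : sj_A" "u = lrep a" "u' = lrep b" by blast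
  have "u - u' = lrep (a \<oplus>$L \<ominus>$L b)" "u * u' = lrep (a **$L b)"
   using ab in_L by (simp_all add: LC.f_minus)
  then show "u - u' : lrep ` sj_A" "u * u' : lrep ` sj_A" using cl ab(1,2) by auto
 qed
 have g: "h : sj_A" if "h : {(sj_embed sj_y **$L inv$L (sj_embed sj_s)) [^]$L (2::nat), sj_embed sj_s, inv$L (sj_embed sj_s), sj_embed (sj_const c)}" for h
  unfolding sj_A_gens(1) using that by (intro generate_ring.incl) auto
 have "lrep (sj_embed (sj_const c)) = end_const c" by (simp add: lrep_embed sj_rep)
 note const = this
 have c: "sj_model.t : lrep ` sj_A" "end_s : lrep ` sj_A" "end_si : lrep ` sj_A" "end_const c : lrep ` sj_A"
  using imageI[OF g, of "(sj_embed sj_y **$L inv$L (sj_embed sj_s)) [^]$L (2::nat)" lrep]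
   imageI[OF g, of "sj_embed sj_s" lrep] imageI[OF g, of "inv$L (sj_embed sj_s)" lrep] imageI[OF g, of "sj_embed (sj_const c)" lrep]
  unfolding lrep_gens(1,3,4) const by simp_all
 then have "sj_model.spow j : lrep ` sj_A" using subring_setD(7)[OF W] by (simp add: sj_model.spow_def)
 then show "end_const (c::'k) * (sj_model.spow j * sj_model.t ^ n) : lrep ` sj_A"
  using c subring_setD(4,7)[OF W] by simp
qed

text \<open>The isomorphism of the matrix ring with \<open>W\<close>: each entry is multiplied by
  its matrix unit. The function \<open>of_bool\<close> converts the truth values that index
  \<open>E\<close> to the row and column numbers 0 and 1.\<close>

definition mrep :: "(nat \<times> nat => 'k sj_loc) => 'k sj_end" where
 "mrep M = (\<Sum>i\<in>UNIV. \<Sum>j\<in>UNIV. lrep (M (of_bool i, of_bool j)) * sj_model.E i j)"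

lemma M2_carrier: "M : carrier M2 \<longleftrightarrow> M : {..<2} \<times> {..<2} \<rightarrow>\<^sub>E sj_A"
 by (simp add: matrix_ring_def Let_def)

lemma M2_entry:
 assumes "M : carrier M2" shows "M (of_bool i, of_bool j) : sj_A"
proof -
 have "(of_bool i, of_bool j) : {..<2::nat} \<times> {..<2::nat}" by (cases i; cases j) simp_all
 then show ?thesis by (rule PiE_mem[OF assms[unfolded M2_carrier]])
qed

lemma M2_entry_L: "M : carrier M2 ==> M (of_bool i, of_bool j) : carrier L"
 using M2_entry subring_sj_A(2) by blast

lemma M2_eqI:
 assumes M: "M : carrier M2" "N : carrier M2" and eq: "!!i j. M (of_bool i, of_bool j) = N (of_bool i, of_bool j)"
 shows "M = N"
proof (rule PiE_ext[OF M[unfolded M2_carrier]])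
 fix q :: "nat \<times> nat" assume "q : {..<2} \<times> {..<2}"
 then have "q = (of_bool (fst q = 1), of_bool (snd q = 1))" by (cases q) auto
 then show "M q = N q" using eq by metis
qed

lemma M2_ops:
 assumes M: "M : carrier M2" "N : carrier M2"
 shows "M \<oplus>$M2 N : carrier M2" "(M \<oplus>$M2 N) (of_bool i, of_bool j) = M (of_bool i, of_bool j) \<oplus>$L N (of_bool i, of_bool j)"
  "M **$M2 N : carrier M2"
  "lrep ((M **$M2 N) (of_bool i, of_bool j))
   = (\<Sum>l\<in>UNIV. lrep (M (of_bool i, of_bool l)) * lrep (N (of_bool l, of_bool j)))"
proof -
 interpret A: ring LA by (rule LC.R.subring_is_ring[OF subring_sj_A(1)])
 have Me: "M (k, l) : sj_A" "N (k, l) : sj_A" if "k < 2" "l < 2" for k l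
  using PiE_mem[OF M(1)[unfolded M2_carrier], of "(k, l)"] PiE_mem[OF M(2)[unfolded M2_carrier], of "(k, l)"] that by simp_all
 show "M \<oplus>$M2 N : carrier M2"
  unfolding M2_carrier using A.a_closed Me by (auto simp: matrix_ring_def Let_def)
 show "(M \<oplus>$M2 N) (of_bool i, of_bool j) = M (of_bool i, of_bool j) \<oplus>$L N (of_bool i, of_bool j)"
  by (simp add: matrix_ring_def Let_def of_bool_def)
 have "(\<Oplus>$LA l\<in>{..<2}. M (k, l) **$LA N (l, k')) : sj_A" if "k < 2" "k' < 2" for k k'
  using A.finsum_closed[of "%l. M (k, l) **$LA N (l, k')" "{..<2}"] A.m_closed Me that by auto
 then show "M **$M2 N : carrier M2"
  unfolding M2_carrier by (auto simp: matrix_ring_def Let_def)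
 have b: "of_bool i < (2::nat)" for i by (simp add: of_bool_def)
 have two: "{..<2::nat} = {0, 1}" by auto
 let ?h = "%l. M (of_bool i, l) **$LA N (l, of_bool j)"
 have h: "?h l : carrier LA" if "l < 2" for l by (rule A.m_closed) (use Me b that in simp_all)
 have "(\<Oplus>$LA l\<in>{0, 1}. ?h l) = ?h 0 \<oplus>$LA (\<Oplus>$LA l\<in>{1}. ?h l)"
  by (rule A.finsum_insert) (use h in \<open>simp_all del: ring_record_simps partial_object.simps\<close>)
 also have "(\<Oplus>$LA l\<in>{1}. ?h l) = ?h 1 \<oplus>$LA (\<Oplus>$LA l\<in>{}. ?h l)"
  by (rule A.finsum_insert) (use h in \<open>simp_all del: ring_record_simps partial_object.simps\<close>)
 also have "\<dots> = ?h 1" unfolding A.finsum_empty by (rule A.r_zero[OF h]) simp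
 finally have "(\<Oplus>$LA l\<in>{0, 1}. ?h l) = ?h 0 \<oplus>$LA ?h 1" .
 have e: "(M **$M2 N) (of_bool i, of_bool j)
   = M (of_bool i, of_bool False) **$L N (of_bool False, of_bool j) \<oplus>$L M (of_bool i, of_bool True) **$L N (of_bool True, of_bool j)"
 proof -
  have "(M **$M2 N) (k, l) = (\<Oplus>$LA q\<in>{..<2}. M (k, q) **$LA N (q, l))" if "k < 2" "l < 2" for k l
   using that by (simp add: matrix_ring_def Let_def)
  from this[OF b b] show ?thesis unfolding two using \<open>(\<Oplus>$LA l\<in>{0, 1}. ?h l) = ?h 0 \<oplus>$LA ?h 1\<close> by simp
 qed
 show "lrep ((M **$M2 N) (of_bool i, of_bool j))
   = (\<Sum>l\<in>UNIV. lrep (M (of_bool i, of_bool l)) * lrep (N (of_bool l, of_bool j)))"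
  unfolding e using M2_entry_L[OF M(1)] M2_entry_L[OF M(2)] by (simp add: UNIV_bool del: of_bool_eq)
qed

lemma scalar_matrix_M2:
 assumes "a : sj_A"
 shows "scalar_matrix 2 L a : carrier M2" "mrep (scalar_matrix 2 L a) = lrep a"
proof -
 interpret A: ring LA by (rule LC.R.subring_is_ring[OF subring_sj_A(1)])
 show "scalar_matrix 2 L a : carrier M2"
  using assms A.zero_closed by (auto simp: M2_carrier scalar_matrix_def)
 have "scalar_matrix 2 L a (of_bool i, of_bool j) = (if i = j then a else \<zero>$L)" for i j
  by (auto simp: scalar_matrix_def of_bool_def)
 then have "mrep (scalar_matrix 2 L a) = lrep a * (sj_model.E False False + sj_model.E True True)"
  by (simp add: mrep_def UNIV_bool distrib_left)
 then show "mrep (scalar_matrix 2 L a) = lrep a" by (simp add: sj_model.E_one)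
qed

lemma M2_one_zero: "\<one>$M2 = scalar_matrix 2 L \<one>$L" "\<zero>$M2 = scalar_matrix 2 L \<zero>$L"
 by (auto simp: matrix_ring_def Let_def scalar_matrix_def fun_eq_iff)

lemma mrep_ops:
 assumes M: "M : carrier M2" "N : carrier M2"
 shows "mrep (M \<oplus>$M2 N) = mrep M + mrep N" "mrep (M **$M2 N) = mrep M * mrep N"
proof -
 show "mrep (M \<oplus>$M2 N) = mrep M + mrep N"
  unfolding mrep_def M2_ops(2)[OF M] using M2_entry_L[OF M(1)] M2_entry_L[OF M(2)]
  by (simp add: distrib_right sum.distrib del: of_bool_eq)
 show "mrep (M **$M2 N) = mrep M * mrep N"
  unfolding mrep_def M2_ops(4)[OF M]
  by (rule sj_model.E_product[symmetric]) (rule sj_A_comm[OF M2_entry[OF M(2)]])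
qed

lemma mrep_inj: "inj_on mrep (carrier M2)"
proof (rule inj_onI, rule M2_eqI)
 fix M N i j assume M: "M : carrier M2" "N : carrier M2" "mrep M = mrep N"
 have "(\<Sum>i\<in>UNIV. \<Sum>j\<in>UNIV. (lrep (M (of_bool i, of_bool j)) - lrep (N (of_bool i, of_bool j))) * sj_model.E i j) = 0"
  using M(3) unfolding mrep_def by (simp add: left_diff_distrib sum_subtractf del: of_bool_eq)
 from sj_model.E_independent[OF _ this] have "lrep (M (of_bool i, of_bool j)) - lrep (N (of_bool i, of_bool j)) = 0"
  using sj_A_comm[OF M2_entry[OF M(1)]] sj_A_comm[OF M2_entry[OF M(2)]]
  by (simp add: left_diff_distrib right_diff_distrib del: of_bool_eq)
 then show "M (of_bool i, of_bool j) = N (of_bool i, of_bool j)"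
  using LC.f_eq_iff[OF M2_entry_L[OF M(1)] M2_entry_L[OF M(2)]] by simp
qed

lemma mrep_surj:
 assumes "!!i j. A i j : lrep ` sj_A"
 shows "\<exists>M\<in>carrier M2. mrep M = (\<Sum>i\<in>UNIV. \<Sum>j\<in>UNIV. A i j * sj_model.E i j)"
proof -
 define a where "a i j = inv_into sj_A lrep (A i j)" for i j
 have a: "a i j : sj_A" "lrep (a i j) = A i j" for i j
  unfolding a_def by (rule inv_into_into[OF assms], rule f_inv_into_f[OF assms])
 let ?M = "\<lambda>(k, l)\<in>{..<2::nat} \<times> {..<2::nat}. a (k = 1) (l = 1)"
 have "?M : carrier M2" unfolding M2_carrier using a(1) by auto
 moreover have "?M (of_bool i, of_bool j) = a i j" for i j by (auto simp: of_bool_def)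
 then have "mrep ?M = (\<Sum>i\<in>UNIV. \<Sum>j\<in>UNIV. A i j * sj_model.E i j)" unfolding mrep_def using a(2) by simp
 ultimately show ?thesis by blast
qed

text \<open>In the family \<open>mon'\<close> each element is a matrix unit times an element of the
  image of \<open>sj_A\<close>, so the span of this family is reached by matrices.\<close>

lemma mrep_image: "sj_model.W <= mrep ` carrier M2" "mrep ` carrier M2 <= sj_model.W"
proof -
 note A = lrep_sj_A(1)
 show "sj_model.W <= mrep ` carrier M2"
 proof
  fix u :: "'k sj_end" assume "u : sj_model.W"
  then have "\<exists>A. (\<forall>i j. A i j : lrep ` sj_A) & u = (\<Sum>i\<in>UNIV. \<Sum>j\<in>UNIV. A i j * sj_model.E i j)"
   unfolding sj_model.W_eq
  proof (induction u rule: sj_model.vs.span_induct_alt)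
   case base
   show ?case using subring_setD(2)[OF A] by (intro exI[of _ "%i j. 0"]) simp
  next
   case (step c m u)
   then obtain B where B: "!!i j. B i j : lrep ` sj_A" "u = (\<Sum>i\<in>UNIV. \<Sum>j\<in>UNIV. B i j * sj_model.E i j)" by blast
   obtain i j k n where m: "m = sj_model.mon' ((i, j), k, n)" using step(1) by (metis rangeE surj_pair)
   define e where "e = end_const c * (sj_model.spow k * sj_model.t ^ n)"
   have e: "e : lrep ` sj_A" unfolding e_def by (rule lrep_sj_A(2))
   then obtain a where a: "a : sj_A" "e = lrep a" by (rule imageE)
   have "end_const c * m = sj_model.E i j * e"
    unfolding m sj_model.mon'_def prod.case e_def by (simp only: sj_model.eta_scale_right mult.assoc)
   also have "\<dots> = e * sj_model.E i j" unfolding a(2) using sj_A_comm[OF a(1)] by (rule sym)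
   finally have cm: "end_const c * m = e * sj_model.E i j" .
   have "end_const c * m + u
     = (\<Sum>i'\<in>UNIV. \<Sum>j'\<in>UNIV. ((if i' = i & j' = j then e else 0) + B i' j') * sj_model.E i' j')"
    unfolding B(2) cm by (cases i; cases j) (simp_all add: UNIV_bool distrib_right add_ac)
   moreover have "(if i' = i & j' = j then e else 0) + B i' j' : lrep ` sj_A" for i' j'
    using subring_setD(2,6)[OF A] B(1) e by (cases "i' = i & j' = j") auto
   ultimately show ?case by (intro exI[of _ "%i' j'. (if i' = i & j' = j then e else 0) + B i' j'"]) simp
  qed
  then obtain A where A: "!!i j. A i j : lrep ` sj_A" "u = (\<Sum>i\<in>UNIV. \<Sum>j\<in>UNIV. A i j * sj_model.E i j)" by blast
  obtain M where "M : carrier M2" "mrep M = u" unfolding A(2) using mrep_surj[of A, OF A(1)] by blast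
  then show "u : mrep ` carrier M2" by blast
 qed
 show "mrep ` carrier M2 <= sj_model.W"
 proof (intro image_subsetI)
  fix M assume M: "M : carrier M2"
  have "lrep (M (of_bool i, of_bool j)) * sj_model.E i j : sj_model.W" for i j
   by (rule subring_setD(4)[OF sj_model.subring_W LC.f_in_W[OF M2_entry_L[OF M]] sj_model.W_gens(9)])
  then show "mrep M : sj_model.W"
   unfolding mrep_def by (simp add: UNIV_bool sj_model.W_closed(3) del: of_bool_eq)
 qed
qed

lemma ring_M2: "ring M2"
proof (rule ring_if_embedded[OF mrep_inj])
 have one: "\<one>$L : sj_A" "\<zero>$L : sj_A" using subringE(2,3)[OF subring_sj_A(1)] by auto
 show "\<one>$M2 : carrier M2" "\<zero>$M2 : carrier M2" "mrep \<one>$M2 = 1" "mrep \<zero>$M2 = 0"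
  unfolding M2_one_zero using scalar_matrix_M2[OF one(1)] scalar_matrix_M2[OF one(2)] by simp_all
 show "\<exists>N\<in>carrier M2. mrep N = - mrep M" if "M : carrier M2" for M
 proof -
  have "- mrep M : sj_model.W" using subring_setD(5)[OF sj_model.subring_W] mrep_image(2) that by blast
  from subsetD[OF mrep_image(1) this] obtain N where "- mrep M = mrep N" "N : carrier M2" by (rule imageE)
  then show ?thesis by (intro bexI[of _ N]) simp_all
 qed
qed (simp_all add: M2_ops mrep_ops)

text \<open>By \<open>zmon_t\<close>, the central elements are spanned by products of powers of
  \<open>s\<close> and \<open>t\<close>. Hence the center of the plane acts on the matrices through
  scalar matrices with entries in \<open>sj_A\<close>.\<close>

lemma Z0_sj_A:
 assumes "z : Z0" shows "z : lrep ` sj_A"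
 using assms unfolding Z0_def
proof (induction z rule: sj_model.vs.span_induct_alt)
 case base
 show ?case by (rule subring_setD(2)[OF lrep_sj_A(1)])
next
 case (step c m u)
 then obtain i j where m: "m = zmon (i, j)" by (metis rangeE surj_pair)
 have "m = sj_model.spow (int p * (i + 2 * int j)) * sj_model.t ^ (p * j)" using zmon_t[of "i + 2 * int j" j] by (simp add: m)
 then show ?case using lrep_sj_A(2)[of c "int p * (i + 2 * int j)" "p * j"] step(2) subring_setD(6)[OF lrep_sj_A(1)] by simp
qed

lemma sj_embed_center_sj_A:
 assumes z: "z : ring_center J" shows "sj_embed z : sj_A"
proof -
 have zJ: "z : carrier J" by (rule ring_centerD(1)[OF z])
 have "sj_rep z : Z0" using z JC.center_iff[OF zJ] by simp
 from Z0_sj_A[OF this] obtain a where a: "a : sj_A" "sj_rep z = lrep a" by (rule imageE)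
 then have "lrep (sj_embed z) = lrep a" by (simp add: lrep_embed zJ)
 then have "sj_embed z = a" using LC.f_eq_iff[OF sj_embed_closed[OF zJ]] subring_sj_A(2) a(1) by blast
 then show ?thesis using a(1) by simp
qed

definition M2_to_L where "M2_to_L M = inv_into (carrier L) lrep (mrep M)"

lemma M2_to_L:
 assumes "M : carrier M2"
 shows "M2_to_L M : carrier L" "lrep (M2_to_L M) = mrep M"
proof -
 have "mrep M : lrep ` carrier L" using mrep_image(2) assms unfolding lrep_image by blast
 then show "M2_to_L M : carrier L" "lrep (M2_to_L M) = mrep M"
  unfolding M2_to_L_def by (rule inv_into_into, rule f_inv_into_f)
qed

lemma M2_to_L_eqI: "M : carrier M2 ==> a : carrier L ==> mrep M = lrep a ==> M2_to_L M = a"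
 using LC.f_eq_iff[OF M2_to_L(1)] M2_to_L(2) by simp

lemma M2_to_L_hom: "M2_to_L : ring_hom M2 L"
proof (rule ring_hom_memI)
 fix M N assume M: "M : carrier M2" and N: "N : carrier M2"
 show "M2_to_L (M **$M2 N) = M2_to_L M **$L M2_to_L N"
  using M N M2_to_L by (intro M2_to_L_eqI) (simp_all add: M2_ops mrep_ops)
 show "M2_to_L (M \<oplus>$M2 N) = M2_to_L M \<oplus>$L M2_to_L N"
  using M N M2_to_L by (intro M2_to_L_eqI) (simp_all add: M2_ops mrep_ops)
next
 have one: "\<one>$L : sj_A" using subringE(3)[OF subring_sj_A(1)] .
 show "M2_to_L \<one>$M2 = \<one>$L"
  unfolding M2_one_zero using scalar_matrix_M2[OF one] by (intro M2_to_L_eqI) simp_all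
qed (rule M2_to_L(1))

lemma M2_to_L_inj: "inj_on M2_to_L (carrier M2)"
proof (rule inj_onI)
 fix M N assume M: "M : carrier M2" "N : carrier M2" "M2_to_L M = M2_to_L N"
 then have "mrep M = mrep N" using M2_to_L(2) by metis
 then show "M = N" by (rule inj_onD[OF mrep_inj _ M(1,2)])
qed

text \<open>Both tensor products are compared with the quotient ring. The plane embeds there
  directly; the matrices embed through their identification with the localization, whose
  denominators become units in the quotient ring.\<close>

lemma quotient_J:
 defines "ZR \<equiv> J\<lparr>carrier := ring_center J\<rparr>"
 defines "K \<equiv> fraction_ring ZR (ring_center J - {\<zero>$J})" and "QJ \<equiv> classical_quotient_ring J"
  and "toK \<equiv> %z. right_frac ZR (ring_center J - {\<zero>$J}) z \<one>$J"
  and "KQ \<equiv> %X. \<Union>(z, w)\<in>X. right_frac J (regular_elements J) z w"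
  and "toM2 \<equiv> %z. scalar_matrix 2 L (sj_embed z)"
 shows "algebra_isomorphic K KQ QJ (tensor ZR id J toK K \<one>$J) (tensor_ring ZR id J toK K)"
  "algebra_isomorphic K (tensor ZR id J toK K \<one>$J) (tensor_ring ZR id J toK K)
    (tensor ZR toM2 M2 toK K \<one>$M2) (tensor_ring ZR toM2 M2 toK K)"
  "central_simple_algebra K KQ QJ nn"
proof -
 obtain N b u v d where D: "dual_basis_domain J nn N b u v d" by (rule J_basis)
 interpret D: dual_basis_domain J nn N b u v d by (rule D)
 have K: "K = D.K" and QJ: "QJ = D.Q" and ZR: "ZR = D.ZR"
  by (simp_all add: K_def ZR_def QJ_def classical_quotient_ring_def)
 have toK: "toK = D.KF.emb" by (rule ext) (simp add: toK_def D.KF.emb_def ZR_def)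
 have KQ: "KQ = D.KQ" by (rule ext) (simp add: KQ_def D.KQ_def)
 note eqs = K QJ ZR toK KQ
 show "central_simple_algebra K KQ QJ nn" unfolding eqs by (rule D.central_simple_algebra)
 have id: "c : D.C ==> id c : carrier J & D.QF.emb (id c) = D.QF.emb c" for c by simp
 note J_iso = D.tensor_fractions[OF ring_super_jordan D.QF.emb_hom D.QF.emb_inj id order_refl]
 show J1: "algebra_isomorphic K KQ QJ (tensor ZR id J toK K \<one>$J) (tensor_ring ZR id J toK K)"
  unfolding eqs by (rule algebra_isomorphic_sym[OF J_iso])
 \<comment> \<open>The powers of \<open>s\<close> are regular, hence invertible in the quotient
   ring, so the embedding of the plane extends to its localization and stays injective.\<close>
 have X: "central_frac_hom J sj_s_powers D.Q D.QF.emb"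
 proof (rule central_frac_hom.intro[OF central_frac_J D.QF.ring_F], rule central_frac_hom_axioms.intro)
  show "D.QF.emb : ring_hom J D.Q" by (rule D.QF.emb_hom)
  show "inj_on D.QF.emb (carrier J)" by (rule D.QF.emb_inj)
  show "D.QF.emb s : Units D.Q" if "s : sj_s_powers" for s
   by (rule D.QF.emb_Units[OF subsetD[OF LF.S_regular that]])
 qed
 interpret X: central_frac_hom J sj_s_powers D.Q D.QF.emb by (rule X)
 define f where "f = X.lift \<circ> M2_to_L"
 have lift: "X.lift : ring_hom L D.Q" "inj_on X.lift (carrier L)"
  using X.lift_hom X.lift_inj by (simp_all only: super_jordan_loc_def)
 have f: "f : ring_hom M2 D.Q" unfolding f_def by (rule ring_hom_trans[OF M2_to_L_hom lift(1)])
 have f_inj: "inj_on f (carrier M2)" unfolding f_def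
  by (rule comp_inj_on[OF M2_to_L_inj inj_on_subset[OF lift(2)]]) (use M2_to_L(1) in blast)
 have f_embed: "f M = D.QF.emb r" if M: "M : carrier M2" "r : carrier J" "mrep M = sj_rep r" for M r
 proof -
  have "M2_to_L M = LF.emb r"
   using M2_to_L_eqI[OF M(1) sj_embed_closed[OF M(2)]] M(3) lrep_embed[OF M(2)] by (simp add: sj_embed_emb)
  then show ?thesis using X.lift_emb[OF M(2)] by (simp add: f_def)
 qed
 have toM2: "toM2 c : carrier M2 & f (toM2 c) = D.QF.emb c" if c: "c : D.C" for c
 proof -
  note A = scalar_matrix_M2[OF sj_embed_center_sj_A[OF c]] and cJ = ring_centerD(1)[OF c]
  show ?thesis using A(1) f_embed[OF A(1) cJ] A(2) lrep_embed[OF cJ] by (simp add: toM2_def)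
 qed
 have surj: "D.QF.emb ` carrier J <= f ` carrier M2"
 proof (intro image_subsetI)
  fix r assume r: "r : carrier J"
  obtain M where "M : carrier M2" "mrep M = sj_rep r" using subsetD[OF mrep_image(1) JC.f_in_W[OF r]] by (auto elim: imageE)
  then show "D.QF.emb r : f ` carrier M2" using f_embed[OF _ r] by (metis imageI)
 qed
 note M_iso = D.tensor_fractions[OF ring_M2 f f_inj toM2 surj]
 have "algebra_isomorphic K KQ QJ (tensor ZR toM2 M2 toK K \<one>$M2) (tensor_ring ZR toM2 M2 toK K)"
  unfolding eqs by (rule algebra_isomorphic_sym[OF M_iso])
 moreover have "algebra_isomorphic K (tensor ZR id J toK K \<one>$J) (tensor_ring ZR id J toK K) KQ QJ"
  unfolding eqs by (rule J_iso(1))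
 ultimately show "algebra_isomorphic K (tensor ZR id J toK K \<one>$J) (tensor_ring ZR id J toK K)
    (tensor ZR toM2 M2 toK K \<one>$M2) (tensor_ring ZR toM2 M2 toK K)"
  by (rule algebra_isomorphic_trans[rotated])
qed

end

subsection \<open>Maximal left ideals\<close>

context sj_alg
begin

definition ev :: "'a => 'k poly => 'a" where
 "ev r f = fold_coeffs (%a u. eta a + r * u) f 0"

lemma ev_0 [simp]: "ev r 0 = 0" by (simp add: ev_def)

lemma ev_pCons [simp]: "ev r (pCons a f) = eta a + r * ev r f"
 by (cases "f = 0 & a = 0") (auto simp: ev_def)

lemma ev_1 [simp]: "ev r 1 = 1" by (simp add: one_pCons)

lemma ev_add: "ev r (f + g) = ev r f + ev r g"
 by (induction f g rule: poly_induct2) (simp_all add: eta_add distrib_left add_ac)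

lemma ev_smult: "ev r (Polynomial.smult a f) = eta a * ev r f"
 by (induction f) (simp_all add: eta_mult distrib_left eta_scale_right)

lemma ev_mult: "ev r (f * g) = ev r f * ev r g"
 by (induction f) (simp_all add: ev_add ev_smult distrib_right mult.assoc)

lemma ev_power: "ev r (f ^ n) = ev r f ^ n"
 by (induction n) (simp_all add: ev_mult)

lemma ev_monom: "ev r (monom 1 n) = r ^ n"
 by (induction n) (simp_all add: monom_0 monom_Suc)

lemma eta_diff: "eta (a - b) = eta a - eta b"
 using eta_add[of "a - b" b] by simp

lemma eta_minus: "eta (- a) = - eta a"
 using eta_diff[of 0 a] by simp

lemma ev_commute:
 assumes "r * u = u * r" shows "ev r f * u = u * ev r f"
proof (induction f)
 case (pCons a f)
 have "r * ev r f * u = u * (r * ev r f)" by (metis pCons.IH assms mult.assoc)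
 then show ?case by (simp add: distrib_left distrib_right eta_comm)
qed simp

end

text \<open>The intended \<open>I\<close> is the annihilator of a vector in a simple module.
  Maximality is expressed as left invertibility modulo \<open>I\<close> of every element outside,
  which is what cyclicity of the module provides.\<close>

locale max_left_ideal = sj_alg_p eta x y s si p for eta :: "'k::field => 'a::ring_1" and x y s si p +
 fixes I :: "'a set"
 assumes I_W: "I <= W" and I_zero: "0 : I" and I_add: "u : I ==> u' : I ==> u + u' : I"
  and I_mult: "u : W ==> a : I ==> u * a : I" and I_one: "1 \<notin> I"
  and I_max: "u : W ==> u \<notin> I ==> \<exists>u'\<in>W. u' * u - 1 : I"
  and closed_field: "algebraically_closed_field TYPE('k)"
begin

lemma I_scale: "a : I ==> eta c * a : I"
 by (rule I_mult) (rule W_gens)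

lemma I_scale_iff: "c ~= 0 ==> eta c * a : I \<longleftrightarrow> a : I"
 using I_scale[of "eta c * a" "inverse c"] I_scale[of a c] by (auto simp: mult.assoc[symmetric] eta_mult[symmetric])

lemma I_minus: "a : I ==> - a : I"
 using I_scale[of a "- 1"] by (simp add: eta_minus)

lemma I_diff: "a : I ==> b : I ==> a - b : I"
 using I_add[of a "- b"] I_minus by simp

lemma I_sum: "(!!i. i : A ==> f i : I) ==> (\<Sum>i\<in>A. f i) : I"
 by (induction A rule: infinite_finite_induct) (auto simp: I_zero I_add)

lemma I_cong: "a - b : I ==> a : I \<longleftrightarrow> b : I"
 using I_add[of "a - b" b] I_diff[of a "a - b"] by auto

lemmas W_mult = subring_setD(4)[OF subring_W] and W_add = subring_setD(6)[OF subring_W]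
 and W_diff = subring_setD(3)[OF subring_W] and W_power = subring_setD(7)[OF subring_W]

lemma Z0_comm: "z : Z0 ==> z' : Z0 ==> z * z' = z' * z"
 using Z0_central Z0_W by blast

lemma eta_Z0: "eta c : Z0" using Z0_closed(5)[OF Z0_closed(2), of c] by simp

lemma Z0_diff: "z : Z0 ==> z' : Z0 ==> z - z' : Z0"
 using Z0_closed(3)[of z "eta (- 1) * z'"] Z0_closed(5)[of z' "- 1"] by (simp add: eta_minus)

lemma ev_Z0: "z : Z0 ==> ev z f : Z0"
 by (induction f) (simp_all add: Z0_closed eta_Z0)

text \<open>Nakayama's lemma; with \<open>T = 1 + z R\<close> it gives inverses modulo \<open>I\<close>, and a larger \<open>T\<close>
 accounts for denominators.\<close>

lemma nakayama:
 fixes n :: nat and b :: "nat => 'a"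
 assumes R: "R <= Z0" "!!a b. a : R ==> b : R ==> a + b : R & a * b : R" and z: "z : R"
  and T: "T <= R" "1 : T" "!!e e'. e : T ==> e' : T ==> e * e' : T" "!!e r. e : T ==> r : R ==> e - z * r : T"
  and b: "!!i. i < n ==> b i : W"
  and hyp: "!!i. i < n ==> \<exists>e\<in>T. \<exists>c. (\<forall>j<n. c j : R) & e * b i - (\<Sum>j<n. z * (c j * b j)) : I"
 shows "\<exists>e\<in>T. \<forall>i<n. e * b i : I"
 using b hyp
proof (induction n)
 case 0
 then show ?case using T(2) by auto
next
 case (Suc n)
 have RW: "r : W" if "r : R" for r using R(1) that Z0_W by blast
 have RC: "r * u = u * r" if "r : R" "u : W" for r u using R(1) that Z0_central by blast
 note RC' = RC[OF _ RW]
 obtain e c where e: "e : T" "!!j. j < Suc n ==> c j : R" "e * b n - (\<Sum>j<Suc n. z * (c j * b j)) : I"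
  using Suc.prems(2)[of n] by auto
 \<comment> \<open>The term with \<open>b n\<close> on the right is absorbed into the factor on the
   left, so that modulo \<open>I\<close> the element \<open>e1 * b n\<close> is a combination of the
   remaining generators.\<close>
 define e1 where "e1 = e - z * c n"
 have e1: "e1 : T" "e1 : R" unfolding e1_def using T(1) T(4)[OF e(1) e(2)[of n]] by auto
 have n: "e1 * b n - (\<Sum>j<n. z * (c j * b j)) : I"
  using e(3) by (simp add: e1_def left_diff_distrib mult.assoc algebra_simps)
 \<comment> \<open>The relation for \<open>b i\<close> is multiplied by \<open>e1\<close> and the
   relation \<open>n\<close> is substituted, which eliminates \<open>b n\<close>.\<close>
 have hyp': "\<exists>e\<in>T. \<exists>c. (\<forall>j<n. c j : R) & e * b i - (\<Sum>j<n. z * (c j * b j)) : I" if i: "i < n" for i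
 proof -
  obtain ei d where d: "ei : T" "!!j. j < Suc n ==> d j : R" "ei * b i - (\<Sum>j<Suc n. z * (d j * b j)) : I"
   using Suc.prems(2)[of i] i by auto
  have zd: "z * d n : R" using R(2) z d(2) by simp
  have 1: "e1 * (ei * b i - (\<Sum>j<Suc n. z * (d j * b j))) : I" using I_mult[OF RW[OF e1(2)] d(3)] .
  have 2: "z * d n * (e1 * b n - (\<Sum>j<n. z * (c j * b j))) : I" using I_mult[OF RW[OF zd] n] .
  have s1: "e1 * (\<Sum>j<n. z * (d j * b j)) = (\<Sum>j<n. z * (e1 * d j * b j))"
   unfolding sum_distrib_left by (intro sum.cong refl) (metis RC'[OF e1(2) z] mult.assoc)
  have s2: "z * (d n * (\<Sum>j<n. z * (c j * b j))) = (\<Sum>j<n. z * (d n * (z * (c j * b j))))"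
   by (simp only: sum_distrib_left)
  have s3: "e1 * (z * (d n * b n)) = z * d n * (e1 * b n)"
   by (metis RC'[OF e1(2) zd] mult.assoc)
  have "e1 * ei * b i - (\<Sum>j<n. z * ((e1 * d j + d n * z * c j) * b j))
    = e1 * (ei * b i - (\<Sum>j<Suc n. z * (d j * b j))) + z * d n * (e1 * b n - (\<Sum>j<n. z * (c j * b j)))"
   by (simp add: right_diff_distrib distrib_left distrib_right s1 s2 s3 sum.distrib mult.assoc)
  then have "e1 * ei * b i - (\<Sum>j<n. z * ((e1 * d j + d n * z * c j) * b j)) : I"
   using I_add[OF 1 2] by simp
  moreover have "e1 * d j + d n * z * c j : R" if "j < n" for j
   using R(2) e1(2) d(2) e(2) z that by simp
  ultimately show ?thesis using T(3)[OF e1(1) d(1)] by (intro bexI[of _ "e1 * ei"] exI[of _ "%j. e1 * d j + d n * z * c j"]) auto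
 qed
 have "\<exists>e\<in>T. \<forall>i<n. e * b i : I" by (rule Suc.IH[OF Suc.prems(1) hyp']) simp_all
 then obtain e' where e': "e' : T" "!!i. i < n ==> e' * b i : I" by blast
 have e'R: "e' : R" using e' T(1) by blast
 have "e1 * e' * b i : I" if "i < Suc n" for i
 proof (cases "i = n")
  case True
  have "z * (c j * (e' * b j)) : I" if "j < n" for j
   by (rule I_mult[OF RW[OF z] I_mult[OF RW[OF e(2)] e'(2)[OF that]]]) (use that in simp)
  then have 1: "(\<Sum>j<n. z * (c j * (e' * b j))) : I" by (intro I_sum) simp
  have 2: "e' * (e1 * b n - (\<Sum>j<n. z * (c j * b j))) : I" using I_mult[OF RW[OF e'R] n] .
  have "e' * (\<Sum>j<n. z * (c j * b j)) = (\<Sum>j<n. z * (c j * (e' * b j)))"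
   unfolding sum_distrib_left
  proof (intro sum.cong refl)
   fix j assume "j : {..<n}"
   then have "c j : R" using e(2) by simp
   then have "e' * (z * c j) = z * c j * e'" using RC'[OF e'R] R(2) z by blast
   from arg_cong[OF this, of "%u. u * b j"]
   show "e' * (z * (c j * b j)) = z * (c j * (e' * b j))" by (simp only: mult.assoc)
  qed
  then have "e' * (e1 * b n) : I" using I_add[OF 2 1] by (simp add: right_diff_distrib)
  then show ?thesis unfolding True RC'[OF e1(2) e'R] by (simp only: mult.assoc)
 next
  case False
  then have "e1 * (e' * b i) : I" using that e'(2) I_mult[OF RW[OF e1(2)]] by simp
  then show ?thesis by (simp add: mult.assoc)
 qed
 then show ?case using T(3)[OF e1(1) e'(1)] by blast
qed

text \<open>Maximality gives only a left inverse \<open>u\<close> in \<open>W\<close>. Writing each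
  \<open>bas q * u\<close> over \<open>Z0\<close> shows that \<open>bas q\<close> is
  \<open>z\<close> times a combination of the basis modulo \<open>I\<close>; by Nakayama some
  \<open>1 - z c\<close> sends all \<open>bas q\<close>, and hence \<open>1\<close>, into
  \<open>I\<close>. So \<open>c\<close> is an inverse that lies in the center.\<close>

lemma Z0_inverse:
 assumes z: "z : Z0" "z \<notin> I"
 shows "\<exists>c\<in>Z0. 1 - z * c : I"
proof -
 obtain e where e: "bij_betw e {..<card Ix} Ix"
  using ex_bij_betw_nat_finite[OF card_Ix(2)] by (auto simp: atLeast0LessThan)
 have eq: "(\<Sum>i<card Ix. g (e i)) = (\<Sum>q\<in>Ix. g q)" for g :: "_ => 'a"
  using sum.reindex_bij_betw[OF e, of g] by simp
 obtain u where u: "u : W" "u * z - 1 : I" using I_max[OF Z0_W[OF z(1)] z(2)] by blast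
 have "\<exists>e'\<in>{1 - z * r | r. r : Z0}. \<forall>i<card Ix. e' * bas (e i) : I"
 proof (rule nakayama[where R = Z0, OF order_refl _ z(1)])
  show "{1 - z * r | r. r : Z0} <= Z0" using Z0_closed z(1) Z0_diff by auto
  show "1 : {1 - z * r | r. r : Z0}" using Z0_closed(1) by (auto intro!: exI[of _ 0])
  show "e1 * e2 : {1 - z * r | r. r : Z0}" if e12: "e1 : {1 - z * r | r. r : Z0}" "e2 : {1 - z * r | r. r : Z0}" for e1 e2
  proof -
   obtain r1 r2 where r: "r1 : Z0" "r2 : Z0" "e1 = 1 - z * r1" "e2 = 1 - z * r2" using e12 by blast
   have "e1 * e2 = 1 - z * (r1 + r2 - r1 * (z * r2))"
    unfolding r(3,4) by (simp add: right_diff_distrib left_diff_distrib distrib_left mult.assoc)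
   moreover have "r1 + r2 - r1 * (z * r2) : Z0" using r z(1) Z0_closed Z0_diff by simp
   ultimately show ?thesis by blast
  qed
  show "e1 - z * r : {1 - z * r | r. r : Z0}" if e1: "e1 : {1 - z * r | r. r : Z0}" and r: "r : Z0" for e1 r
  proof -
   obtain r1 where r1: "r1 : Z0" "e1 = 1 - z * r1" using e1 by blast
   then have "e1 - z * r = 1 - z * (r1 + r)" by (simp add: algebra_simps)
   then show ?thesis using r1(1) r Z0_closed(3) by blast
  qed
  show "bas (e i) : W" for i by (rule bas_W)
  show "\<exists>e'\<in>{1 - z * r | r. r : Z0}. \<exists>c. (\<forall>j<card Ix. c j : Z0) & e' * bas (e i) - (\<Sum>j<card Ix. z * (c j * bas (e j))) : I" for i
  proof -
   obtain c where c: "!!q. c q : Z0" "bas (e i) * u = (\<Sum>q\<in>Ix. c q * bas q)"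
    using W_Z0_combination[OF W_mult[OF bas_W u(1)]] by blast
   have "(\<Sum>j<card Ix. z * (c (e j) * bas (e j))) = z * (bas (e i) * u)"
    unfolding c(2) sum_distrib_left by (rule eq)
   also have "\<dots> = bas (e i) * (u * z)"
    using Z0_central[OF z(1) W_mult[OF bas_W u(1)]] by (simp add: mult.assoc)
   finally have "1 * bas (e i) - (\<Sum>j<card Ix. z * (c (e j) * bas (e j))) = - (bas (e i) * (u * z - 1))"
    by (simp add: right_diff_distrib)
   then have "1 * bas (e i) - (\<Sum>j<card Ix. z * (c (e j) * bas (e j))) : I"
    using I_minus[OF I_mult[OF bas_W u(2)]] by simp
   then show ?thesis using c(1) Z0_closed(1)
    by (intro bexI[of _ 1] exI[of _ "%j. c (e j)"]) (auto intro!: exI[of _ 0])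
  qed
 qed (use Z0_closed in auto)
 then obtain c where c: "c : Z0" "!!i. i < card Ix ==> (1 - z * c) * bas (e i) : I" by blast
 have bI: "(1 - z * c) * bas q : I" if "q : Ix" for q
  using c(2) e that by (metis bij_betw_iff_bijections lessThan_iff)
 have zc: "1 - z * c : Z0" using Z0_diff[OF Z0_closed(2) Z0_closed(4)[OF z(1) c(1)]] .
 have "(1 - z * c) * (\<Sum>q\<in>Ix. zop q 1 * bas q) : I"
  unfolding sum_distrib_left
 proof (intro I_sum)
  fix q assume q: "q : Ix"
  have Z: "zop q 1 : Z0" using zop_expand(2)[OF W_closed(2) q] .
  have "(1 - z * c) * (zop q 1 * bas q) = zop q 1 * ((1 - z * c) * bas q)"
   by (simp only: mult.assoc[symmetric] Z0_comm[OF zc Z])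
  then show "(1 - z * c) * (zop q 1 * bas q) : I" using I_mult[OF Z0_W[OF Z] bI[OF q]] by simp
 qed
 then have "1 - z * c : I" using zop_expand(1)[OF W_closed(2)] by simp
 then show ?thesis using c(1) by blast
qed

text \<open>Linear factors of \<open>f\<close> are split off one at a time; just before the product
  enters \<open>I\<close>, an eigenvector modulo \<open>I\<close> appears.\<close>

lemma eigenvector:
 assumes r: "r : W" and n: "n : W" "n \<notin> I" and f: "f ~= 0" "ev r f * n : I"
 shows "\<exists>c g. ev r g * n \<notin> I & (r - eta c) * (ev r g * n) : I"
 using f
proof (induction "degree f" arbitrary: f rule: less_induct)
 case less
 show ?case
 proof (cases "degree f = 0")
  case True
  then obtain a where "f = [:a:]" by (metis degree_eq_zeroE)
  then show ?thesis using less.prems n(2) I_scale_iff by simp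
 next
  case False
  then obtain c where "poly f c = 0" using closed_field unfolding algebraically_closed_field_def by blast
  then obtain g where g: "f = [:- c, 1:] * g" by (metis poly_eq_0_iff_dvd dvdE)
  have g0: "g ~= 0" using less.prems(1) g by auto
  have dg: "degree g < degree f" using g0 unfolding g by (subst degree_mult_eq) auto
  have ev: "ev r f * n = (r - eta c) * (ev r g * n)"
   unfolding g ev_mult by (simp add: eta_minus mult.assoc)
  show ?thesis
  proof (cases "ev r g * n : I")
   case True
   then show ?thesis using less.hyps[OF dg g0] by blast
  next
   case False
   then show ?thesis using less.prems(2) ev by (intro exI[of _ c] exI[of _ g]) simp
  qed
 qed
qed

text \<open>There is \<open>g\<close> outside \<open>I\<close> with \<open>(z - c) g\<close> in
  \<open>I\<close>. If \<open>z - c\<close> were outside \<open>I\<close> it would have a central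
  inverse modulo \<open>I\<close>, and \<open>g\<close> would lie in \<open>I\<close>.\<close>

lemma scalar_if_algebraic:
 assumes z: "z : Z0" and f: "f ~= 0" "ev z f : I"
 shows "\<exists>c. z - eta c : I"
proof -
 obtain c g where g: "ev z g \<notin> I" "(z - eta c) * ev z g : I"
  using eigenvector[OF Z0_W[OF z] W_closed(2) I_one f(1)] f(2) by auto
 have zc: "z - eta c : Z0" using z eta_Z0 Z0_diff by blast
 have gZ: "ev z g : Z0" by (rule ev_Z0[OF z])
 have "z - eta c : I"
 proof (rule ccontr)
  assume "z - eta c \<notin> I"
  then obtain d where d: "d : Z0" "1 - (z - eta c) * d : I" using Z0_inverse[OF zc] by blast
  have 1: "ev z g * (1 - (z - eta c) * d) : I" using I_mult[OF Z0_W[OF gZ] d(2)] .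
  have 2: "d * ((z - eta c) * ev z g) : I" using I_mult[OF Z0_W[OF d(1)] g(2)] .
  have "d * ((z - eta c) * ev z g) = ev z g * ((z - eta c) * d)"
   using Z0_comm[OF zc gZ] Z0_comm[OF d(1) Z0_closed(4)[OF gZ zc]] by (simp add: mult.assoc)
  then have "ev z g : I" using I_add[OF 1 2] by (simp add: right_diff_distrib)
  then show False using g(1) by simp
 qed
 then show ?thesis by blast
qed

lemma scalar_action:
 assumes "z : Z0" "z - eta c : I" "u : W"
 shows "z * u - eta c * u : I"
proof -
 have "z * u - eta c * u = u * (z - eta c)"
  using Z0_central[OF assms(1,3)] eta_comm[of c u] by (simp add: right_diff_distrib)
 then show ?thesis using I_mult[OF assms(3,2)] by simp
qed

definition \<sigma> where "\<sigma> = zmon (1, 0)"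
definition \<zeta> where "\<zeta> = zmon (0, 1)"

lemma \<sigma>_Z0: "\<sigma> : Z0" and \<zeta>_Z0: "\<zeta> : Z0"
 unfolding \<sigma>_def \<zeta>_def by (rule Z0_closed(6))+

lemma zmon_power: "\<sigma> ^ n = zmon (int n, 0)" "\<zeta> ^ j = zmon (0, j)"
proof -
 have "zmon (0, 0) = 1" by (simp add: zmon_def)
 then show "\<sigma> ^ n = zmon (int n, 0)" "\<zeta> ^ j = zmon (0, j)"
  by (induction n) (simp_all add: \<sigma>_def zmon_mult add.commute, induction j, simp_all add: \<zeta>_def zmon_mult)
qed

text \<open>The inner variable stands for \<open>\<sigma>\<close>, which is \<open>s^p\<close>, and
  the outer one for \<open>\<zeta>\<close>, which is \<open>y^(2p)\<close>. With this nesting,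
  pseudo-division eliminates \<open>\<zeta>\<close>.\<close>

definition ev2 :: "'k poly poly => 'a" where
 "ev2 g = fold_coeffs (%f u. ev \<sigma> f + \<zeta> * u) g 0"

lemma ev2_0 [simp]: "ev2 0 = 0" by (simp add: ev2_def)

lemma ev2_pCons [simp]: "ev2 (pCons f g) = ev \<sigma> f + \<zeta> * ev2 g"
 by (cases "g = 0 & f = 0") (auto simp: ev2_def)

lemma ev\<sigma>_Z0: "ev \<sigma> f : Z0" by (rule ev_Z0[OF \<sigma>_Z0])

lemma ev\<sigma>_\<zeta>: "\<zeta> * (ev \<sigma> f * u) = ev \<sigma> f * (\<zeta> * u)"
 using Z0_comm[OF \<zeta>_Z0 ev\<sigma>_Z0] by (simp add: mult.assoc[symmetric])

lemma ev2_add: "ev2 (f + g) = ev2 f + ev2 g"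
 by (induction f g rule: poly_induct2) (simp_all add: ev_add distrib_left add_ac)

lemma ev2_smult: "ev2 (Polynomial.smult f g) = ev \<sigma> f * ev2 g"
 by (induction g) (simp_all add: ev_mult distrib_left ev\<sigma>_\<zeta>)

lemma ev2_mult: "ev2 (f * g) = ev2 f * ev2 g"
 by (induction f) (simp_all add: ev2_add ev2_smult distrib_right mult.assoc)

lemma ev2_Z0: "ev2 g : Z0"
 by (induction g) (simp_all add: Z0_closed ev\<sigma>_Z0 \<zeta>_Z0)

lemma ev2_monom: "ev2 (monom f j) = \<zeta> ^ j * ev \<sigma> f"
 by (induction j) (simp_all add: monom_0 monom_Suc mult.assoc)

lemma ev2_sum:
 "(!!j. j \<ge> d ==> coeff g j = 0) ==> ev2 g = (\<Sum>j<d. ev \<sigma> (coeff g j) * \<zeta> ^ j)"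
proof (induction g arbitrary: d)
 case (pCons f g)
 show ?case
 proof (cases d)
  case 0
  then have "pCons f g = 0" using pCons.prems by (intro poly_eqI) simp
  then show ?thesis using 0 by (simp only: ev2_0) simp
 next
  case (Suc d')
  have "coeff g j = 0" if "j \<ge> d'" for j using pCons.prems[of "Suc j"] that Suc by simp
  then have "ev2 g = (\<Sum>j<d'. ev \<sigma> (coeff g j) * \<zeta> ^ j)" by (rule pCons.IH)
  then show ?thesis unfolding Suc sum.lessThan_Suc_shift by (simp add: sum_distrib_left ev\<sigma>_\<zeta>)
 qed
qed simp

lemma Z0_polynomial: "z : Z0 ==> \<exists>N g. \<sigma> ^ N * z = ev2 g"
 unfolding Z0_def
proof (induction z rule: vs.span_induct_alt)
 case base
 show ?case by (intro exI[of _ 0]) simp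
next
 case (step c m u)
 then obtain N g where g: "\<sigma> ^ N * u = ev2 g" by blast
 obtain i j where m: "m = zmon (i, j)" using step(1) by (metis rangeE surj_pair)
 let ?M = "nat (- i)" and ?k = "nat (i + int N + int (nat (- i)))"
 have "\<sigma> ^ (?M + N) * m = zmon (int ?k, j)" unfolding m zmon_power zmon_mult by (simp add: add.commute)
 also have "\<dots> = \<zeta> ^ j * \<sigma> ^ ?k" unfolding zmon_power zmon_mult by simp
 finally have 1: "\<sigma> ^ (?M + N) * m = ev2 (monom (monom 1 ?k) j)" by (simp add: ev2_monom ev_monom)
 have 2: "\<sigma> ^ (?M + N) * u = ev2 (Polynomial.smult (monom 1 ?M) g)"
  unfolding ev2_smult ev_monom g[symmetric] by (simp add: power_add mult.assoc)
 have "\<sigma> ^ (?M + N) * (eta c * m + u)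
   = ev2 (Polynomial.smult [:c:] (monom (monom 1 ?k) j) + Polynomial.smult (monom 1 ?M) g)"
  unfolding ev2_add 2[symmetric] ev2_smult[of "[:c:]"] 1[symmetric] by (simp add: distrib_left eta_scale_right)
 then show ?case by blast
qed

text \<open>An inverse of \<open>\<zeta>\<close> modulo \<open>I\<close>, cleared of negative powers
  of \<open>\<sigma>\<close>, becomes a polynomial relation whose constant term in
  \<open>\<zeta>\<close> is a power of \<open>\<sigma>\<close>. This term keeps the relation
  nonzero, also after a nonzero value is put for \<open>\<sigma>\<close>.\<close>

lemma \<zeta>_relation:
 assumes "\<zeta> \<notin> I"
 shows "\<exists>N g. ev2 (pCons (monom 1 N) g) : I"
proof -
 obtain c where c: "c : Z0" "1 - \<zeta> * c : I" using Z0_inverse[OF \<zeta>_Z0 assms] by blast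
 obtain N g where g: "\<sigma> ^ N * c = ev2 g" using Z0_polynomial[OF c(1)] by blast
 have "\<sigma> ^ N * (1 - \<zeta> * c) = \<sigma> ^ N - \<zeta> * (\<sigma> ^ N * c)"
  using ev\<sigma>_\<zeta>[of "monom 1 N" c] by (simp add: right_diff_distrib ev_monom)
 also have "\<dots> = ev2 (pCons (monom 1 N) (Polynomial.smult [:- 1:] g))"
  unfolding g ev2_pCons ev2_smult by (simp add: ev_monom eta_minus)
 finally show ?thesis using I_mult[OF W_power[OF Z0_W[OF \<sigma>_Z0]] c(2)] by metis
qed

text \<open>Otherwise no nonzero polynomial in \<open>\<sigma>\<close> lies in \<open>I\<close>,
  while \<open>\<zeta>\<close> satisfies a relation \<open>G\<close> of degree \<open>d > 0\<close>
  over them. Up to powers of a fixed polynomial \<open>h\<close>, the powers of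
  \<open>\<zeta>\<close> below \<open>d\<close> then span \<open>Z0\<close> modulo \<open>I\<close>.
  A nonconstant \<open>q\<close> prime to \<open>h\<close> is invertible modulo \<open>I\<close>,
  and Nakayama's lemma puts a value of some \<open>h^N + q r\<close> into \<open>I\<close>, although
  this polynomial is not zero.\<close>

lemma \<sigma>_scalar: "\<exists>a. \<sigma> - eta a : I"
proof (rule ccontr)
 assume "\<not> ?thesis"
 then have no: "f = 0" if "ev \<sigma> f : I" for f using scalar_if_algebraic[OF \<sigma>_Z0] that by blast
 have "\<exists>G. G ~= 0 & ev2 G : I"
 proof (cases "\<zeta> : I")
  case True
  then have "ev2 [:0, 1:] : I" by simp
  then show ?thesis by (intro exI[of _ "[:0, 1:]"]) simp
 next
  case False
  then obtain N g where "ev2 (pCons (monom 1 N) g) : I" using \<zeta>_relation by blast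
  then show ?thesis by (intro exI[of _ "pCons (monom 1 N) g"]) simp
 qed
 then obtain G where G: "G ~= 0" "ev2 G : I" by blast
 define d where "d = degree G"
 define l where "l = lead_coeff G"
 have l0: "l ~= 0" using G by (simp add: l_def)
 have d0: "d > 0"
 proof (rule ccontr)
  assume "\<not> d > 0"
  then obtain f where f: "G = [:f:]" unfolding d_def by (metis degree_eq_zeroE gr0I)
  then have "f = 0" using G(2) by (intro no) simp
  then show False using G(1) f by simp
 qed
 \<comment> \<open>The variable in \<open>h\<close> pays for the negative powers of
   \<open>\<sigma>\<close>, the factor \<open>l\<close> for the leading coefficients introduced by
   pseudo-division by \<open>G\<close>.\<close>
 define h where "h = monom 1 1 * l"
 \<comment> \<open>As in Euclid's construction of new primes: \<open>1 + h\<close> has no root in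
   common with \<open>h\<close>, and it is nonconstant because \<open>h\<close> has positive
   degree.\<close>
 define q where "q = 1 + h"
 have "degree h = Suc (degree l)" using l0 by (simp add: h_def monom_Suc monom_0 degree_pCons_eq)
 then have "degree q > 0" unfolding q_def by (subst degree_add_eq_right) simp_all
 then obtain \<beta> where "poly q \<beta> = 0" using closed_field unfolding algebraically_closed_field_def by blast
 then have \<beta>: "poly h \<beta> = - 1" by (simp add: q_def add_eq_0_iff)
 have unit: "h ^ N + q * r ~= 0" for N r
 proof
  assume "h ^ N + q * r = 0"
  then have "poly (h ^ N + q * r) \<beta> = 0" by simp
  then show False using \<open>poly q \<beta> = 0\<close> \<beta> by simp
 qed
 \<comment> \<open>After multiplication by a power of \<open>h\<close>, every central element is
   congruent to a polynomial of degree below \<open>d\<close> in \<open>\<zeta>\<close>.\<close>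
 have red: "\<exists>N r. (\<forall>j\<ge>d. coeff r j = 0) & ev \<sigma> (h ^ N) * z - ev2 r : I" if z: "z : Z0" for z
 proof -
  obtain N f where f: "\<sigma> ^ N * z = ev2 f" using Z0_polynomial[OF z] by blast
  obtain Q r where qr: "pseudo_divmod f G = (Q, r)" by (cases "pseudo_divmod f G")
  define m where "m = Suc (degree f) - degree G"
  have div: "Polynomial.smult (l ^ m) f = G * Q + r" "r = 0 \<or> degree r < d"
   using pseudo_divmod[OF G(1) qr] by (simp_all add: m_def l_def d_def)
  let ?e = "monom 1 m * l ^ N"
  have "h ^ (N + m) = ?e * (l ^ m * monom 1 N)"
   by (simp add: h_def power_mult_distrib monom_power power_add mult_ac mult_monom)
  then have "ev \<sigma> (h ^ (N + m)) * z = ev \<sigma> ?e * (ev \<sigma> (l ^ m) * (\<sigma> ^ N * z))"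
   by (simp only: ev_mult ev_monom mult.assoc)
  also have "\<dots> = ev \<sigma> ?e * ev2 (Polynomial.smult (l ^ m) f)" by (simp add: f ev2_smult)
  also have "\<dots> = ev \<sigma> ?e * (ev2 Q * ev2 G) + ev2 (Polynomial.smult ?e r)"
   unfolding div(1) ev2_add ev2_mult ev2_smult Z0_comm[OF ev2_Z0[of G] ev2_Z0[of Q]] by (simp only: distrib_left)
  finally have "ev \<sigma> (h ^ (N + m)) * z - ev2 (Polynomial.smult ?e r) : I"
   using I_mult[OF Z0_W[OF ev\<sigma>_Z0] I_mult[OF Z0_W[OF ev2_Z0] G(2)]] by simp
  moreover have "\<forall>j\<ge>d. coeff (Polynomial.smult ?e r) j = 0" using div(2) by (auto simp: coeff_eq_0)
  ultimately show ?thesis by blast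
 qed
 have "ev \<sigma> q \<notin> I" using no[of q] unit[of 0 0] \<open>degree q > 0\<close> by auto
 then obtain c where c: "c : Z0" "1 - ev \<sigma> q * c : I" using Z0_inverse[OF ev\<sigma>_Z0] by blast
 \<comment> \<open>The factors allowed in Nakayama's lemma: they are closed under products, contain
   the powers of \<open>h\<close> needed as denominators, and come from polynomials that do not
   vanish, by \<open>unit\<close>.\<close>
 let ?T = "{ev \<sigma> (h ^ N + q * r) | N r. True}"
 have "\<exists>e\<in>?T. \<forall>i<d. e * \<zeta> ^ i : I"
 proof (rule nakayama[where R = "range (ev \<sigma>)" and z = "ev \<sigma> q"])
  show "range (ev \<sigma>) <= Z0" using ev\<sigma>_Z0 by blast
  show "a + b : range (ev \<sigma>) & a * b : range (ev \<sigma>)" if "a : range (ev \<sigma>)" "b : range (ev \<sigma>)" for a b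
   using that by (auto simp: ev_add[symmetric] ev_mult[symmetric])
  show "1 : ?T" by (auto intro!: exI[of _ 0])
  show "e * e' : ?T" if ee: "e : ?T" "e' : ?T" for e e'
  proof -
   obtain N r N' r' where e: "e = ev \<sigma> (h ^ N + q * r)" "e' = ev \<sigma> (h ^ N' + q * r')" using ee by blast
   have "(h ^ N + q * r) * (h ^ N' + q * r') = h ^ (N + N') + q * (r * h ^ N' + h ^ N * r' + q * r * r')"
    by (simp add: algebra_simps power_add)
   then show ?thesis unfolding e ev_mult[symmetric] by auto
  qed
  show "e - ev \<sigma> q * r : ?T" if er: "e : ?T" "r : range (ev \<sigma>)" for e r
  proof -
   obtain N f f' where e: "e = ev \<sigma> (h ^ N + q * f)" "r = ev \<sigma> f'" using er by blast
   have "ev \<sigma> (h ^ N + q * f) = ev \<sigma> (h ^ N + q * (f - f')) + ev \<sigma> q * ev \<sigma> f'"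
    unfolding ev_mult[symmetric] ev_add[symmetric] by (simp add: algebra_simps)
   then have "e - ev \<sigma> q * r = ev \<sigma> (h ^ N + q * (f - f'))" unfolding e by simp
   then show ?thesis by blast
  qed
  show "\<zeta> ^ i : W" for i using W_power[OF Z0_W[OF \<zeta>_Z0]] .
  show "\<exists>e\<in>?T. \<exists>f. (\<forall>j<d. f j : range (ev \<sigma>)) & e * \<zeta> ^ i - (\<Sum>j<d. ev \<sigma> q * (f j * \<zeta> ^ j)) : I" for i
  proof -
   have \<zeta>Z: "\<zeta> ^ i : Z0" unfolding zmon_power by (rule Z0_closed(6))
   obtain N r where r: "!!j. j \<ge> d ==> coeff r j = 0" "ev \<sigma> (h ^ N) * (c * \<zeta> ^ i) - ev2 r : I"
    using red[OF Z0_closed(4)[OF c(1) \<zeta>Z]] by blast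
   let ?e = "ev \<sigma> (h ^ N)"
   have s: "(\<Sum>j<d. ev \<sigma> q * (ev \<sigma> (coeff r j) * \<zeta> ^ j)) = ev \<sigma> q * ev2 r"
    using ev2_sum[of d r] r(1) by (simp add: sum_distrib_left)
   have 1: "?e * \<zeta> ^ i * (1 - ev \<sigma> q * c) : I" by (rule I_mult[OF Z0_W[OF Z0_closed(4)[OF ev\<sigma>_Z0 \<zeta>Z]] c(2)])
   have 2: "ev \<sigma> q * (?e * (c * \<zeta> ^ i) - ev2 r) : I" by (rule I_mult[OF Z0_W[OF ev\<sigma>_Z0] r(2)])
   have k1: "?e * \<zeta> ^ i * ev \<sigma> q = ev \<sigma> q * (?e * \<zeta> ^ i)" by (rule Z0_comm[OF Z0_closed(4)[OF ev\<sigma>_Z0 \<zeta>Z] ev\<sigma>_Z0])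
   have "?e * \<zeta> ^ i * (ev \<sigma> q * c) = ?e * \<zeta> ^ i * ev \<sigma> q * c" by (simp only: mult.assoc)
   also have "\<dots> = ev \<sigma> q * (?e * (\<zeta> ^ i * c))" unfolding k1 by (simp only: mult.assoc)
   finally have "?e * \<zeta> ^ i * (ev \<sigma> q * c) = ev \<sigma> q * (?e * (c * \<zeta> ^ i))" unfolding Z0_comm[OF \<zeta>Z c(1)] .
   then have "?e * \<zeta> ^ i - ev \<sigma> q * ev2 r = ?e * \<zeta> ^ i * (1 - ev \<sigma> q * c) + ev \<sigma> q * (?e * (c * \<zeta> ^ i) - ev2 r)"
    by (simp add: right_diff_distrib)
   then have "?e * \<zeta> ^ i - (\<Sum>j<d. ev \<sigma> q * (ev \<sigma> (coeff r j) * \<zeta> ^ j)) : I" unfolding s using I_add[OF 1 2] by simp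
   moreover have "?e : ?T" by (rule CollectI, rule exI[of _ N], rule exI[of _ 0]) simp
   ultimately show ?thesis by (intro bexI[of _ ?e] exI[of _ "%j. ev \<sigma> (coeff r j)"]) auto
  qed
 qed auto
 then obtain N r where "ev \<sigma> (h ^ N + q * r) * \<zeta> ^ 0 : I" using d0 by blast
 then show False using no[of "h ^ N + q * r"] unit by simp
qed

text \<open>Since \<open>\<sigma>\<close> is invertible, its value \<open>a\<close> modulo
  \<open>I\<close> is not zero. Putting it into the relation for \<open>\<zeta>\<close> leaves a
  polynomial with constant term \<open>a^N\<close>, so \<open>\<zeta>\<close> is algebraic and hence
  a scalar modulo \<open>I\<close>. The rest of \<open>Z0\<close> consists of polynomials in the
  two, up to powers of \<open>\<sigma>\<close>.\<close>

lemma Z0_scalar: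
 assumes z: "z : Z0" shows "\<exists>c. z - eta c : I"
proof -
 note \<sigma>Z = \<sigma>_Z0 and \<zeta>Z = \<zeta>_Z0
 have ev_poly: "ev u f - eta (poly f a) : I" if u: "u : Z0" "u - eta a : I" for u a f
 proof (induction f)
  case (pCons b f)
  have "ev u (pCons b f) - eta (poly (pCons b f) a) = u * (ev u f - eta (poly f a)) + eta (poly f a) * (u - eta a)"
   using eta_comm[of "poly f a" u] eta_comm[of "poly f a" "eta a"] by (simp add: eta_add eta_mult right_diff_distrib)
  then show ?case using I_add[OF I_mult[OF Z0_W[OF u(1)] pCons.IH] I_scale[OF u(2), of "poly f a"]] by simp
 qed (simp add: I_zero)
 obtain a where a: "\<sigma> - eta a : I" using \<sigma>_scalar by blast
 have a0: "a ~= 0"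
 proof
  assume "a = 0"
  then have "zmon (- 1, 0) * \<sigma> : I" using I_mult[OF Z0_W[OF Z0_closed(6)]] a by simp
  then show False using I_one zmon_power(1)[of 0] by (simp add: zmon_mult \<sigma>_def)
 qed
 let ?\<pi> = "map_poly (%f. poly f a)"
 have ev2_ev: "ev2 g - ev \<zeta> (?\<pi> g) : I" for g
 proof (induction g)
  case (pCons f g)
  have eq: "ev2 (pCons f g) - ev \<zeta> (?\<pi> (pCons f g)) = (ev \<sigma> f - eta (poly f a)) + \<zeta> * (ev2 g - ev \<zeta> (?\<pi> g))"
   by (simp add: map_poly_pCons right_diff_distrib)
  show ?case unfolding eq by (rule I_add[OF ev_poly[OF \<sigma>Z a] I_mult[OF Z0_W[OF \<zeta>Z] pCons.IH]])
 qed (simp add: I_zero)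
 have "\<exists>b. \<zeta> - eta b : I"
 proof (cases "\<zeta> : I")
  case True
  then show ?thesis by (intro exI[of _ 0]) simp
 next
  case False
  then obtain N g where g: "ev2 (pCons (monom 1 N) g) : I" using \<zeta>_relation by blast
  have "ev \<zeta> (?\<pi> (pCons (monom 1 N) g)) : I" using I_cong[OF ev2_ev] g by blast
  moreover have "?\<pi> (pCons (monom 1 N) g) ~= 0" using a0 by (simp add: map_poly_pCons poly_monom)
  ultimately show ?thesis by (intro scalar_if_algebraic[OF \<zeta>Z])
 qed
 then obtain b where b: "\<zeta> - eta b : I" by blast
 obtain N g where g: "\<sigma> ^ N * z = ev2 g" using Z0_polynomial[OF z] by blast
 let ?c = "poly (?\<pi> g) b"
 have 1: "\<sigma> ^ N * z - eta ?c : I" unfolding g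
  using I_add[OF ev2_ev[of g] ev_poly[OF \<zeta>Z b, of "?\<pi> g"]] by simp
 have "\<sigma> ^ N - eta (a ^ N) : I" using ev_poly[OF \<sigma>Z a, of "monom 1 N"] by (simp add: ev_monom poly_monom)
 then have 2: "\<sigma> ^ N * z - eta (a ^ N) * z : I"
  by (rule scalar_action[rotated]) (use z Z0_W Z0_closed(6) zmon_power(1)[of N] in auto)
 have "eta (a ^ N) * z - eta ?c : I" using I_diff[OF 1 2] by simp
 moreover have "eta (a ^ N) * z - eta ?c = eta (a ^ N) * (z - eta (?c / a ^ N))"
  using a0 by (simp add: right_diff_distrib eta_mult[symmetric])
 ultimately have "z - eta (?c / a ^ N) : I" using I_scale_iff[of "a ^ N"] a0 by simp
 then show ?thesis by blast
qed

text \<open>Both \<open>x\<close> and \<open>x v\<close> are killed by \<open>x\<close>, and they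
  cannot both lie in \<open>I\<close> because \<open>v x + x v = 1\<close>. On the one outside,
  \<open>t^p\<close> acts as a scalar modulo \<open>I\<close>, which makes \<open>t\<close>
  algebraic there; the eigenvector is obtained by applying a polynomial in \<open>t\<close>, and
  \<open>t\<close> commutes with \<open>x\<close>.\<close>

lemma eigen_element:
 obtains n c where "n : W" "n \<notin> I" "x * n = 0" "(t - eta c) * n : I"
proof -
 have "\<exists>n\<in>{x, x * v}. n \<notin> I"
 proof (rule ccontr)
  assume "\<not> ?thesis"
  then have xI: "x : I" "x * v : I" by auto
  have "v * x + x * v : I" by (rule I_add[OF I_mult[OF W_gens(6) xI(1)] xI(2)])
  then show False using I_one by (simp add: vx)
 qed
 then obtain n where n: "n : {x, x * v}" "n \<notin> I" by blast
 have nW: "n : W" and xn: "x * n = 0" using n(1) W_gens(1,6) W_mult by (auto simp: mult.assoc[symmetric])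
 have tp: "t ^ p : Z0" using t_p_central[of _ 1] by (intro center_W W_power W_gens) simp_all
 then obtain c where c: "t ^ p - eta c : I" using Z0_scalar by blast
 have f: "monom 1 p - [:c:] ~= 0"
 proof
  assume "monom 1 p - [:c:] = 0"
  then have "coeff (monom 1 p - [:c:]) p = 0" by simp
  then show False using p2 by (simp add: coeff_pCons split: nat.splits)
 qed
 have "ev t (monom 1 p - [:c:]) = t ^ p - eta c"
 proof -
  have e: "monom 1 p - [:c:] = monom 1 p + [:- c:]" by (rule poly_eqI) (simp add: coeff_pCons split: nat.splits)
  show ?thesis unfolding e ev_add by (simp add: ev_monom eta_minus)
 qed
 then have "ev t (monom 1 p - [:c:]) * n : I"
  using scalar_action[OF tp c nW] by (simp add: left_diff_distrib)
 then obtain d g where d: "ev t g * n \<notin> I" "(t - eta d) * (ev t g * n) : I"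
  using eigenvector[OF W_gens(5) nW n(2) f] by blast
 have "ev t g : W" using W_gens(5) W_gens(8) by (induction g) (simp_all add: W_closed W_add W_mult)
 then have gW: "ev t g * n : W" using W_mult nW by blast
 have "x * (ev t g * n) = ev t g * (x * n)" using ev_commute[OF tx, of g] by (simp add: mult.assoc[symmetric])
 then have "x * (ev t g * n) = 0" using xn by simp
 then show ?thesis using that gW d by blast
qed

context
 fixes n0 \<gamma>
 assumes n0: "n0 : W" "n0 \<notin> I" "x * n0 = 0" and eig: "(t - eta \<gamma>) * n0 : I"
begin

text \<open>Modulo \<open>I\<close>, the element \<open>t - \<gamma>\<close> acts on the vectors
  \<open>s^i n0\<close> as the derivative with respect to \<open>s\<close>.\<close>

lemma t_s_n0: "t * (s ^ i * n0) = s ^ i * ((t - eta \<gamma>) * n0) + eta \<gamma> * (s ^ i * n0) + eta (of_nat i) * (s ^ (i - 1) * n0)"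
proof -
 have "t * (s ^ i * n0) = s ^ i * (t * n0) + of_nat i * (s ^ (i - 1) * n0)"
  using arg_cong[OF t_sn[of i], of "%u. u * n0"] by (simp add: distrib_right mult.assoc)
 then show ?thesis by (simp add: left_diff_distrib right_diff_distrib eta_of_nat eta_scale_right)
qed

lemma s_power_W: "s ^ i * n0 : W" by (rule W_mult[OF W_power[OF W_gens(3)] n0(1)])

text \<open>Applying \<open>t - \<gamma>\<close> differentiates a relation and shortens it. The
  factors that appear are positive integers below \<open>p\<close>, so they do not vanish in the
  field.\<close>

lemma s_powers_independent:
 "n \<le> p ==> (\<Sum>i<n. eta (c i) * (s ^ i * n0)) : I ==> \<forall>i<n. c i = 0"
proof (induction n arbitrary: c)
 case (Suc n)
 let ?S = "\<Sum>i<Suc n. eta (c i) * (s ^ i * n0)"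
 have D: "(t - eta \<gamma>) * (eta (c i) * (s ^ i * n0)) = eta (c i) * (s ^ i * ((t - eta \<gamma>) * n0)) + eta (c i * of_nat i) * (s ^ (i - 1) * n0)" for i
 proof -
  have "(t - eta \<gamma>) * (eta (c i) * (s ^ i * n0)) = eta (c i) * (t * (s ^ i * n0) - eta \<gamma> * (s ^ i * n0))"
   by (simp only: eta_scale_right left_diff_distrib)
  moreover have "P + Q + R - Q = P + R" for P Q R :: 'a by simp
  ultimately show ?thesis unfolding t_s_n0 by (simp only: distrib_left eta_mult mult.assoc)
 qed
 have 1: "(t - eta \<gamma>) * ?S : I" by (rule I_mult[OF W_diff[OF W_gens(5) W_gens(8)] Suc.prems(2)])
 have 2: "(\<Sum>i<Suc n. eta (c i) * (s ^ i * ((t - eta \<gamma>) * n0))) : I"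
  by (intro I_sum I_scale I_mult[OF W_power[OF W_gens(3)] eig])
 have 3: "(t - eta \<gamma>) * ?S = (\<Sum>i<Suc n. eta (c i) * (s ^ i * ((t - eta \<gamma>) * n0)))
   + (\<Sum>i<Suc n. eta (c i * of_nat i) * (s ^ (i - 1) * n0))"
  unfolding sum_distrib_left D sum.distrib by (rule refl)
 have "(\<Sum>i<Suc n. eta (c i * of_nat i) * (s ^ (i - 1) * n0)) : I" using I_diff[OF 1 2] unfolding 3 by simp
 then have "(\<Sum>i<n. eta (c (Suc i) * of_nat (Suc i)) * (s ^ i * n0)) : I"
  unfolding sum.lessThan_Suc_shift by (simp del: of_nat_Suc)
 then have "\<forall>i<n. c (Suc i) * of_nat (Suc i) = 0" using Suc.prems(1) by (intro Suc.IH) simp_all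
 moreover have "(of_nat (Suc i) :: 'k) ~= 0" if "i < n" for i
  using Suc.prems(1) that char unfolding of_nat_eq_0_iff_char_dvd by (auto dest: dvd_imp_le)
 ultimately have z: "c (Suc i) = 0" if "i < n" for i using that by auto
 then have "?S = eta (c 0) * n0" unfolding sum.lessThan_Suc_shift by simp
 then have "c 0 = 0" using Suc.prems(2) I_scale_iff n0(2) by metis
 then show ?case using z by (metis less_Suc_eq_0_disj)
qed simp

text \<open>The intended basis of \<open>W\<close> modulo \<open>I\<close>: first \<open>p\<close>
  vectors that \<open>x\<close> kills, then their images under \<open>v\<close>. These are the two
  halves cut out by the diagonal matrix units.\<close>

definition B where "B i = (if i < p then s ^ i * n0 else v * (s ^ (i - p) * n0))"

lemma B_W: "B i : W"
 using s_power_W W_mult[OF W_gens(6)] by (simp add: B_def)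

definition rep where "rep u \<longleftrightarrow> u : W & (\<exists>c. u - (\<Sum>i<2 * p. eta (c i) * B i) : I)"

lemma rep_I: "u : I ==> rep u"
 using I_W by (auto simp: rep_def intro!: exI[of _ "%_. 0"])

lemma rep_add: assumes "rep u" "rep u'" shows "rep (u + u')"
proof -
 obtain c c' where c: "u - (\<Sum>i<2 * p. eta (c i) * B i) : I" "u' - (\<Sum>i<2 * p. eta (c' i) * B i) : I"
  using assms by (auto simp: rep_def)
 have "u + u' - (\<Sum>i<2 * p. eta (c i + c' i) * B i) = (u - (\<Sum>i<2 * p. eta (c i) * B i)) + (u' - (\<Sum>i<2 * p. eta (c' i) * B i))"
  by (simp add: eta_add distrib_right sum.distrib)
 with I_add[OF c] have "u + u' - (\<Sum>i<2 * p. eta (c i + c' i) * B i) : I" by (simp only:)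
 moreover have "u + u' : W" using W_add assms by (simp add: rep_def)
 ultimately show ?thesis unfolding rep_def by (intro conjI exI[of _ "%i. c i + c' i"])
qed

lemma rep_scale: assumes "rep u" shows "rep (eta a * u)"
proof -
 obtain c where c: "u - (\<Sum>i<2 * p. eta (c i) * B i) : I" using assms by (auto simp: rep_def)
 have "eta a * u - (\<Sum>i<2 * p. eta (a * c i) * B i) = eta a * (u - (\<Sum>i<2 * p. eta (c i) * B i))"
  by (simp only: eta_mult right_diff_distrib sum_distrib_left mult.assoc)
 with I_scale[OF c, of a] have "eta a * u - (\<Sum>i<2 * p. eta (a * c i) * B i) : I" by (simp only:)
 moreover have "eta a * u : W" using W_closed(5) assms by (simp add: rep_def)
 ultimately show ?thesis unfolding rep_def by (intro conjI exI[of _ "%i. a * c i"])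
qed

lemma rep_sum: "(!!i. i : A ==> rep (f i)) ==> rep (\<Sum>i\<in>A. f i)"
 by (induction A rule: infinite_finite_induct) (auto intro: rep_I I_zero rep_add)

lemma rep_cong: "u - u' : I ==> rep u' ==> rep u"
 using rep_add[of "u - u'" u'] rep_I by simp

lemma rep_B: assumes "i < 2 * p" shows "rep (B i)"
proof -
 have "(\<Sum>j<2 * p. eta (if j = i then 1 else 0) * B j) = (\<Sum>j<2 * p. if j = i then B j else 0)"
  by (intro sum.cong refl) simp
 also have "\<dots> = B i" using assms by (simp add: sum.delta)
 finally show ?thesis unfolding rep_def using B_W I_zero by (intro conjI exI[of _ "%j. if j = i then 1 else 0"]) simp_all
qed

lemma rep_s_power: "i < p ==> rep (s ^ i * n0)" "i < p ==> rep (v * (s ^ i * n0))"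
 using rep_B[of i] rep_B[of "i + p"] by (simp_all add: B_def)

lemma rep_left:
 assumes r: "r : W" "!!i. i < p ==> rep (r * (s ^ i * n0))" "!!i. i < p ==> rep (r * (v * (s ^ i * n0)))" and u: "rep u"
 shows "rep (r * u)"
proof -
 obtain c where c: "u - (\<Sum>i<2 * p. eta (c i) * B i) : I" using u by (auto simp: rep_def)
 have B: "rep (r * B i)" if "i < 2 * p" for i
  using r(2)[of i] r(3)[of "i - p"] that by (auto simp: B_def)
 have "r * (\<Sum>i<2 * p. eta (c i) * B i) = (\<Sum>i<2 * p. eta (c i) * (r * B i))"
  unfolding sum_distrib_left by (simp only: eta_scale_right)
 then have "r * u = r * (u - (\<Sum>i<2 * p. eta (c i) * B i)) + (\<Sum>i<2 * p. eta (c i) * (r * B i))"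
  by (simp add: right_diff_distrib)
 moreover have "rep (\<Sum>i<2 * p. eta (c i) * (r * B i))" by (intro rep_sum rep_scale B) simp
 ultimately show ?thesis using rep_add[OF rep_I[OF I_mult[OF r(1) c]]] by simp
qed

lemma x_s_n0: "x * (s ^ i * n0) = 0"
 using power_commuting_commutes[OF sx, of i] n0(3) by (metis mult.assoc mult_zero_right)

lemma x_v_s_n0: "x * (v * (s ^ i * n0)) = s ^ i * n0"
proof -
 have "x * v = 1 - v * x" by (simp add: vx)
 then have "x * (v * (s ^ i * n0)) = (1 - v * x) * (s ^ i * n0)" by (simp add: mult.assoc[symmetric])
 also have "\<dots> = s ^ i * n0 - v * (x * (s ^ i * n0))" by (simp only: left_diff_distrib mult_1_left mult.assoc)
 finally show ?thesis by (simp add: x_s_n0)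
qed

lemma rep_v: "rep u ==> rep (v * u)"
proof (rule rep_left[OF W_gens(6)])
 show "rep (v * (v * (s ^ i * n0)))" for i using rep_I[OF I_zero] by (simp add: mult.assoc[symmetric])
qed (rule rep_s_power(2))

lemma rep_x: "rep u ==> rep (x * u)"
 by (rule rep_left[OF W_gens(1)]) (simp_all only: x_s_n0 x_v_s_n0 rep_I[OF I_zero] rep_s_power(1))

text \<open>The second half of \<open>B\<close> is \<open>v\<close> times the first, so for an
  element that commutes with \<open>v\<close> the first half decides.\<close>

lemma rep_via_v:
 assumes "r : W" "r * v = v * r" "!!i. i < p ==> rep (r * (s ^ i * n0))" "rep u"
 shows "rep (r * u)"
proof (rule rep_left[OF assms(1,3) _ assms(4)])
 fix i assume "i < p"
 have "r * (v * (s ^ i * n0)) = v * (r * (s ^ i * n0))" using assms(2) by (simp only: mult.assoc[symmetric])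
 then show "rep (r * (v * (s ^ i * n0)))" using rep_v[OF assms(3)[OF \<open>i < p\<close>]] by simp
qed

lemma rep_t: "rep u ==> rep (t * u)"
proof (rule rep_via_v[OF W_gens(5) tv])
 fix i assume i: "i < p"
 then show "rep (t * (s ^ i * n0))"
  unfolding t_s_n0 by (intro rep_add rep_scale rep_s_power rep_I I_mult[OF W_power[OF W_gens(3)] eig]) simp_all
qed

lemma rep_Z0: assumes z: "z : Z0" and u: "rep u" shows "rep (z * u)"
proof -
 obtain c where c: "z - eta c : I" using Z0_scalar[OF z] by blast
 have "u : W" using u by (simp add: rep_def)
 then show ?thesis using rep_cong[OF scalar_action[OF z c] rep_scale[OF u]] by blast
qed

lemma rep_s: "rep u ==> rep (s * u)"
proof (rule rep_via_v[OF W_gens(3) sv])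
 fix i assume i: "i < p"
 have eq: "s * (s ^ i * n0) = s ^ Suc i * n0" by (simp add: mult.assoc)
 show "rep (s * (s ^ i * n0))"
 proof (cases "Suc i = p")
  case True
  have "s ^ p = zmon (1, 0)" using spow_of_nat[of p] by (simp add: zmon_def)
  then show ?thesis unfolding eq True using rep_Z0[OF Z0_closed(6) rep_s_power(1)[of 0], of "(1, 0)"] p2 by simp
 next
  case False
  then show ?thesis unfolding eq using i by (intro rep_s_power) simp
 qed
qed

lemma rep_power: "(!!u. rep u ==> rep (r * u)) ==> rep u ==> rep (r ^ n * u)"
 by (induction n) (simp_all add: mult.assoc)

text \<open>The inverse of \<open>s\<close> is \<open>s^(p-1)\<close> times the central element
  \<open>s^(-p)\<close>, and central elements act as scalars.\<close>

lemma rep_si: assumes "rep u" shows "rep (si * u)"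
proof -
 have "zmon (- 1, 0) * s ^ (p - 1) = spow (- int p) * spow (int (p - 1))" unfolding spow_of_nat by (simp add: zmon_def)
 also have "\<dots> = spow (- int p + int (p - 1))" by (rule spow_add[symmetric])
 also have "- int p + int (p - 1) = - 1" using p2 by simp
 finally have "si = zmon (- 1, 0) * s ^ (p - 1)" by (simp add: spow_def)
 then have "si * u = zmon (- 1, 0) * (s ^ (p - 1) * u)" by (metis mult.assoc)
 then show ?thesis using rep_Z0[OF Z0_closed(6) rep_power[OF rep_s assms]] by simp
qed

lemma rep_left_W: assumes "r : W" "rep u" shows "rep (r * u)"
 using assms(1) unfolding W_eq
proof (induction r rule: vs.span_induct_alt)
 case base
 show ?case using rep_I[OF I_zero] by simp
next
 case (step c m r)
 obtain i j a b where m: "m = mon' ((i, j), a, b)" using step(1) by (metis rangeE surj_pair)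
 have "rep (spow a * (t ^ b * u))" unfolding spow_def by (simp add: rep_power rep_s rep_si rep_t assms(2))
 then have "rep (E i j * (spow a * (t ^ b * u)))" by (simp add: E_def rep_v rep_x mult.assoc)
 moreover have "(eta c * m + r) * u = eta c * (E i j * (spow a * (t ^ b * u))) + r * u"
  by (simp add: m mon'_def distrib_right mult.assoc)
 ultimately show ?case using rep_add[OF rep_scale step(2)] by simp
qed

text \<open>By maximality \<open>n0\<close> generates \<open>W\<close> modulo \<open>I\<close> as a
  left module, and \<open>n0\<close> is the first element of \<open>B\<close>.\<close>

lemma rep_all: assumes u: "u : W" shows "rep u"
proof -
 obtain u' where u': "u' : W" "u' * n0 - 1 : I" using I_max[OF n0(1,2)] by blast
 have "rep (u * u' * n0)" using rep_left_W[OF W_mult[OF u u'(1)] rep_s_power(1)[of 0]] p2 by simp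
 moreover have "u - u * u' * n0 = - (u * (u' * n0 - 1))" by (simp add: right_diff_distrib mult.assoc)
 then have "u - u * u' * n0 : I" using I_minus[OF I_mult[OF u u'(2)]] by simp
 ultimately show ?thesis using rep_cong by blast
qed

text \<open>Multiplication by \<open>x\<close> kills the first half of \<open>B\<close> and takes
  the second half to the first. So the coefficients of the second half vanish, and after that those
  of the first.\<close>

lemma B_independent:
 assumes "(\<Sum>i<2 * p. eta (c i) * B i) : I" "i < 2 * p"
 shows "c i = 0"
proof -
 have split: "(\<Sum>i<n + m. f i) = (\<Sum>i<n. f i) + (\<Sum>i<m. f (n + i))" for n m and f :: "nat => 'a"
  by (induction m) (simp_all add: add.assoc)
 have S: "(\<Sum>i<2 * p. eta (c i) * B i) = (\<Sum>i<p. eta (c i) * (s ^ i * n0)) + (\<Sum>i<p. eta (c (p + i)) * (v * (s ^ i * n0)))"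
  unfolding mult_2 split by (simp add: B_def)
 have "x * (\<Sum>i<2 * p. eta (c i) * B i) = (\<Sum>i<p. eta (c (p + i)) * (s ^ i * n0))"
  unfolding S distrib_left sum_distrib_left eta_scale_right x_s_n0 x_v_s_n0 by simp
 then have "(\<Sum>i<p. eta (c (p + i)) * (s ^ i * n0)) : I" using I_mult[OF W_gens(1) assms(1)] by simp
 then have hi: "c (p + i) = 0" if "i < p" for i
  using s_powers_independent[of p "%i. c (p + i)"] that by simp
 then have "(\<Sum>i<p. eta (c i) * (s ^ i * n0)) : I" using assms(1) unfolding S by simp
 then have "\<forall>i<p. c i = 0" using s_powers_independent[of p c] by simp
 then show ?thesis using hi[of "i - p"] assms(2) by (cases "i < p") auto
qed

end

lemma quotient_basis:
 obtains b where "!!i. b i : W" "!!u. u : W ==> \<exists>c. u - (\<Sum>i<2 * p. eta (c i) * b i) : I"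
  "!!c i. (\<Sum>i<2 * p. eta (c i) * b i) : I ==> i < 2 * p ==> c i = 0"
proof -
 obtain n0 \<gamma> where n: "n0 : W" "n0 \<notin> I" "x * n0 = 0" "(t - eta \<gamma>) * n0 : I" by (rule eigen_element)
 show ?thesis
 proof (rule that[of "B n0"])
  show "B n0 i : W" for i by (rule B_W[OF n])
  show "\<exists>c. u - (\<Sum>i<2 * p. eta (c i) * B n0 i) : I" if "u : W" for u
   using rep_all[OF n that] unfolding rep_def[OF n] by blast
  show "(\<Sum>i<2 * p. eta (c i) * B n0 i) : I ==> i < 2 * p ==> c i = 0" for c i by (rule B_independent[OF n])
 qed
qed

end

subsection \<open>Simple modules\<close>

context sj_setting
begin

text \<open>A simple module is generated by any nonzero \<open>m0\<close>, so it is the quotient of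
  the localization by the annihilator of \<open>m0\<close>. The image of this annihilator in
  \<open>W\<close> is a maximal left ideal, and a basis of \<open>W\<close> modulo it, applied to
  \<open>m0\<close>, is a basis of the module.\<close>

lemma simple_module_dimension:
 fixes M :: "('k sj_loc, 'v) module"
 assumes closed: "algebraically_closed_field TYPE('k)" and M: "simple_module L M"
 shows "free_of_rank (base_ring :: 'k ring) (restrict_scalars (sj_embed \<circ> sj_const) M) (2 * p)"
proof -
 interpret M: left_module L M using M unfolding simple_module_def by blast
 obtain m0 where m0: "m0 : carrier M" "m0 ~= \<zero>$M" using M M.M.zero_closed unfolding simple_module_def by blast
 have zero: "\<zero>$L \<odot>$M m = \<zero>$M" if m: "m : carrier M" for m
  using M.smult_l_distr[OF LC.R.zero_closed LC.R.zero_closed m] M.smult_closed[OF LC.R.zero_closed m]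
   M.M.add.l_cancel_one[of "\<zero>$L \<odot>$M m" "\<zero>$L \<odot>$M m"] by simp
 have minus: "(\<ominus>$L a) \<odot>$M m = \<ominus>$M (a \<odot>$M m)" if am: "a : carrier L" "m : carrier M" for a m
 proof (rule M.M.minus_equality[symmetric])
  have "(\<ominus>$L a) \<odot>$M m \<oplus>$M a \<odot>$M m = (\<ominus>$L a \<oplus>$L a) \<odot>$M m"
   using M.smult_l_distr[OF LC.R.a_inv_closed[OF am(1)] am] by simp
  then show "(\<ominus>$L a) \<odot>$M m \<oplus>$M a \<odot>$M m = \<zero>$M" using zero[OF am(2)] LC.R.l_neg[OF am(1)] by simp
 qed (use am M.smult_closed in auto)
 have cyclic: "\<exists>a\<in>carrier L. m' = a \<odot>$M m" if m: "m : carrier M" "m ~= \<zero>$M" and m': "m' : carrier M" for m m'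
 proof -
  let ?N = "{a \<odot>$M m | a. a : carrier L}"
  have "submodule ?N L M"
  proof (intro submodule.intro subgroup.intro submodule_axioms.intro)
   show "?N <= carrier (add_monoid M)" using M.smult_closed m(1) by auto
   show "u **\<^bsub>add_monoid M\<^esub> u' : ?N" if uu: "u : ?N" "u' : ?N" for u u'
   proof -
    obtain a a' where a: "a : carrier L" "a' : carrier L" "u = a \<odot>$M m" "u' = a' \<odot>$M m" using uu by blast
    then have "u **\<^bsub>add_monoid M\<^esub> u' = (a \<oplus>$L a') \<odot>$M m" using M.smult_l_distr[OF a(1,2) m(1)] by simp
    then show ?thesis using LC.R.a_closed[OF a(1,2)] by blast
   qed
   show "\<one>\<^bsub>add_monoid M\<^esub> : ?N" using zero[OF m(1)] LC.R.zero_closed by force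
   show "inv\<^bsub>add_monoid M\<^esub> u : ?N" if u: "u : ?N" for u
   proof -
    obtain a where a: "a : carrier L" "u = a \<odot>$M m" using u by blast
    show ?thesis unfolding a(2) a_inv_def[symmetric] minus[OF a(1) m(1), symmetric] using LC.R.a_inv_closed[OF a(1)] by blast
   qed
   show "a \<odot>$M u : ?N" if au: "a : carrier L" "u : ?N" for a u
   proof -
    obtain a' where a': "a' : carrier L" "u = a' \<odot>$M m" using au(2) by blast
    have "a \<odot>$M u = (a **$L a') \<odot>$M m" unfolding a'(2) using M.smult_assoc[OF au(1) a'(1) m(1)] by simp
    then show ?thesis using LC.R.m_closed[OF au(1) a'(1)] by blast
   qed
  qed
  moreover have "m : ?N" using M.smult_one[OF m(1)] LC.R.one_closed by force
  ultimately have "?N = carrier M" using M m(2) unfolding simple_module_def by blast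
  then show ?thesis using m' by blast
 qed
 define I where "I = {lrep a | a. a : carrier L & a \<odot>$M m0 = \<zero>$M}"
 have I_iff: "lrep a : I \<longleftrightarrow> a \<odot>$M m0 = \<zero>$M" if "a : carrier L" for a
 proof
  assume "lrep a : I"
  then obtain a' where a': "a' : carrier L" "lrep a = lrep a'" "a' \<odot>$M m0 = \<zero>$M" unfolding I_def by blast
  then have "a = a'" using LC.f_eq_iff[OF that a'(1)] by blast
  then show "a \<odot>$M m0 = \<zero>$M" using a'(3) by simp
 next
  assume "a \<odot>$M m0 = \<zero>$M"
  then show "lrep a : I" unfolding I_def using that by blast
 qed
 have W_E: "\<exists>a\<in>carrier L. u = lrep a" if "u : sj_model.W" for u
  using that unfolding lrep_image[symmetric] by blast
 have "max_left_ideal (end_const :: 'k => _) end_x end_y end_s end_si p I"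
 proof (intro max_left_ideal.intro sj_alg_p_axioms max_left_ideal_axioms.intro closed)
  show "I <= sj_model.W" unfolding lrep_image[symmetric] I_def by blast
  show "0 : I" using I_iff[OF LC.R.zero_closed] zero[OF m0(1)] by simp
  show "u + u' : I" if uu: "u : I" "u' : I" for u u'
  proof -
   obtain a a' where a: "a : carrier L" "a' : carrier L" "u = lrep a" "u' = lrep a'"
    "a \<odot>$M m0 = \<zero>$M" "a' \<odot>$M m0 = \<zero>$M" using uu unfolding I_def by blast
   have "(a \<oplus>$L a') \<odot>$M m0 = \<zero>$M" using M.smult_l_distr[OF a(1,2) m0(1)] a(5,6) by simp
   then show ?thesis using I_iff[OF LC.R.a_closed[OF a(1,2)]] a by simp
  qed
  show "u * u' : I" if uu: "u : sj_model.W" "u' : I" for u u'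
  proof -
   obtain a a' where a: "a : carrier L" "a' : carrier L" "u = lrep a" "u' = lrep a'" "a' \<odot>$M m0 = \<zero>$M"
    using uu(2) W_E[OF uu(1)] unfolding I_def by blast
   have "a \<odot>$M \<zero>$M = \<zero>$M"
    using M.smult_assoc[OF a(1) LC.R.zero_closed m0(1)] zero[OF m0(1)] LC.R.r_null[OF a(1)] by simp
   then have "(a **$L a') \<odot>$M m0 = \<zero>$M" using M.smult_assoc[OF a(1,2) m0(1)] a(5) by simp
   then show ?thesis using I_iff[OF LC.R.m_closed[OF a(1,2)]] a by simp
  qed
  show "1 \<notin> I" using I_iff[OF LC.R.one_closed] M.smult_one[OF m0(1)] m0(2) by simp
  show "\<exists>u'\<in>sj_model.W. u' * u - 1 : I" if u: "u : sj_model.W" "u \<notin> I" for u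
  proof -
   obtain a where a: "a : carrier L" "u = lrep a" using W_E[OF u(1)] by blast
   have "a \<odot>$M m0 ~= \<zero>$M" using I_iff[OF a(1)] u(2) a(2) by simp
   then obtain a' where a': "a' : carrier L" "m0 = a' \<odot>$M (a \<odot>$M m0)"
    using cyclic[OF M.smult_closed[OF a(1) m0(1)] _ m0(1)] by blast
   let ?e = "a' **$L a \<oplus>$L \<ominus>$L \<one>$L"
   have e: "?e : carrier L" using a a' by simp
   have "?e \<odot>$M m0 = (a' **$L a) \<odot>$M m0 \<oplus>$M (\<ominus>$L \<one>$L) \<odot>$M m0"
    by (rule M.smult_l_distr) (use a a' m0 in simp_all)
   also have "\<dots> = m0 \<oplus>$M \<ominus>$M m0"
    using M.smult_assoc[OF a'(1) a(1) m0(1)] a'(2) minus[OF LC.R.one_closed m0(1)] M.smult_one[OF m0(1)] by simp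
   also have "\<dots> = \<zero>$M" using M.M.r_neg[OF m0(1)] .
   finally have "lrep ?e : I" using I_iff[OF e] by simp
   moreover have "lrep ?e = lrep a' * u - 1" using a a' by (simp add: LC.f_minus)
   ultimately show ?thesis using LC.f_in_W[OF a'(1)] by (intro bexI[of _ "lrep a'"]) simp_all
  qed
 qed
 then obtain B :: "nat => 'k sj_end" where B: "!!i. B i : sj_model.W"
  "!!u. u : sj_model.W ==> \<exists>c. u - (\<Sum>i<2 * p. end_const (c i) * B i) : I"
  "!!c i. (\<Sum>i<2 * p. end_const (c i) * B i) : I ==> i < 2 * p ==> c i = 0"
  by (rule max_left_ideal.quotient_basis) (rule that)
 obtain b where b: "!!i. b i : carrier L" "!!i. lrep (b i) = B i" using W_E[OF B(1)] by metis
 let ?eta = "sj_embed \<circ> sj_const"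
 have etaL: "?eta a : carrier L & lrep (?eta a) = end_const a" for a :: 'k by (simp add: lrep_embed sj_rep)
 define S where "S c = (\<Oplus>$L i\<in>{..<2 * p}. ?eta (c i) **$L b i)" for c
 have t: "(%i. ?eta (c i) **$L b i) : {..<2 * p} \<rightarrow> carrier L" for c using b(1) etaL by auto
 have S_L: "S c : carrier L" for c unfolding S_def using t by (rule LC.R.finsum_closed)
 have S_rep: "lrep (S c) = (\<Sum>i<2 * p. end_const (c i) * B i)" for c
  unfolding S_def LC.f_finsum[OF finite_lessThan t] using b etaL by (intro sum.cong refl) simp
 have fin: "(\<Oplus>$L i\<in>A. g i) \<odot>$M m0 = (\<Oplus>$M i\<in>A. g i \<odot>$M m0)" if "finite A" "g : A \<rightarrow> carrier L" for A and g :: "nat => _"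
  using that
 proof (induction A)
  case (insert i A)
  have gi: "g i : carrier L" "g : A \<rightarrow> carrier L" using insert.prems by auto
  have "(\<Oplus>$L i\<in>insert i A. g i) \<odot>$M m0 = (g i \<oplus>$L (\<Oplus>$L i\<in>A. g i)) \<odot>$M m0"
   using LC.R.finsum_insert[OF insert.hyps gi(2,1)] by simp
  also have "\<dots> = g i \<odot>$M m0 \<oplus>$M (\<Oplus>$M i\<in>A. g i \<odot>$M m0)"
   using M.smult_l_distr[OF gi(1) LC.R.finsum_closed[OF gi(2)] m0(1)] insert.IH[OF gi(2)] by simp
  also have "\<dots> = (\<Oplus>$M i\<in>insert i A. g i \<odot>$M m0)"
   using M.M.finsum_insert[OF insert.hyps, of "%i. g i \<odot>$M m0"] gi M.smult_closed[OF _ m0(1)] by (simp add: Pi_iff)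
  finally show ?case .
 qed (simp add: zero[OF m0(1)])
 have S_M: "S c \<odot>$M m0 = (\<Oplus>$M i\<in>{..<2 * p}. ?eta (c i) \<odot>$M (b i \<odot>$M m0))" for c
  unfolding S_def fin[OF finite_lessThan t] using M.smult_assoc[OF _ b(1) m0(1)] etaL by simp
 have finsum: "finsum (restrict_scalars ?eta M) = finsum M"
  by (rule ext)+ (simp add: finsum_def finprod_def restrict_scalars_def)
 have S_cong: "S c = S c'" if "!!i. i < 2 * p ==> c i = c' i" for c c'
  using LC.f_eq_iff[OF S_L S_L, of c c'] that by (simp add: S_rep)
 have unique: "c = d" if c: "c : {..<2 * p} \<rightarrow>\<^sub>E UNIV" "d : {..<2 * p} \<rightarrow>\<^sub>E UNIV" and eq: "S c \<odot>$M m0 = S d \<odot>$M m0" for c d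
 proof (rule PiE_ext[OF c])
  fix i assume "i : {..<2 * p}"
  have "S c \<oplus>$L \<ominus>$L S d : carrier L" using S_L by simp
  moreover have "(S c \<oplus>$L \<ominus>$L S d) \<odot>$M m0 = \<zero>$M"
   using M.smult_l_distr[OF S_L LC.R.a_inv_closed[OF S_L] m0(1), of c d] minus[OF S_L m0(1), of d] eq
    M.M.r_neg[OF M.smult_closed[OF S_L m0(1)], of d] by simp
  ultimately have "lrep (S c \<oplus>$L \<ominus>$L S d) : I" using I_iff by blast
  moreover have "lrep (S c \<oplus>$L \<ominus>$L S d) = (\<Sum>i<2 * p. end_const (c i - d i) * B i)"
   using S_L by (simp add: LC.f_minus S_rep sj_model.eta_diff left_diff_distrib sum_subtractf)
  ultimately have "c i - d i = 0" using B(3)[of "%i. c i - d i" i] \<open>i : {..<2 * p}\<close> by simp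
  then show "c i = d i" by simp
 qed
 have exists: "\<exists>c\<in>{..<2 * p} \<rightarrow>\<^sub>E UNIV. m = S c \<odot>$M m0" if m: "m : carrier M" for m
 proof -
  obtain a where a: "a : carrier L" "m = a \<odot>$M m0" using cyclic[OF m0 m] by blast
  obtain c where c: "lrep a - (\<Sum>i<2 * p. end_const (c i) * B i) : I" using B(2)[OF LC.f_in_W[OF a(1)]] by blast
  have "lrep (a \<oplus>$L \<ominus>$L S c) : I" using c a(1) S_L by (simp add: LC.f_minus S_rep)
  moreover have "a \<oplus>$L \<ominus>$L S c : carrier L" using a(1) S_L by simp
  ultimately have "(a \<oplus>$L \<ominus>$L S c) \<odot>$M m0 = \<zero>$M" using I_iff by blast
  then have "m \<oplus>$M \<ominus>$M (S c \<odot>$M m0) = \<zero>$M"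
   using M.smult_l_distr[OF a(1) LC.R.a_inv_closed[OF S_L] m0(1), of c] minus[OF S_L m0(1), of c] a(2) by simp
  then have "m = S c \<odot>$M m0"
   using M.M.minus_equality[of m "\<ominus>$M (S c \<odot>$M m0)"] M.smult_closed[OF S_L m0(1), of c] m by simp
  \<comment> \<open>The coefficients are made extensional, since uniqueness in
    \<open>free_of_rank\<close> is uniqueness among functions that are undefined outside the index
    set.\<close>
  moreover have "S c = S (restrict c {..<2 * p})" by (rule S_cong) simp
  ultimately show ?thesis by (intro bexI[of _ "restrict c {..<2 * p}"]) auto
 qed
 have "\<exists>!c. c : {..<2 * p} \<rightarrow>\<^sub>E UNIV & m = (\<Oplus>$M i\<in>{..<2 * p}. ?eta (c i) \<odot>$M (b i \<odot>$M m0))" if "m : carrier M" for m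
  using exists[OF that] unique unfolding S_M by blast
 moreover have "(%i. b i \<odot>$M m0) : {..<2 * p} \<rightarrow> carrier M" using M.smult_closed[OF b(1) m0(1)] by simp
 ultimately show ?thesis
  unfolding free_of_rank_def finsum by (intro bexI[of _ "%i. b i \<odot>$M m0"]) (simp_all add: restrict_scalars_def base_ring_def)
qed

end

theorem proposition4p3:
  fixes p :: nat
    and J :: "(sj_gen list \<Rightarrow> 'k::field) set ring"
    and L :: "'k sj_loc ring"
    and \<eta> :: "'k \<Rightarrow> (sj_gen list \<Rightarrow> 'k) set"
    and \<eta>L :: "'k \<Rightarrow> 'k sj_loc"
    and s y :: "(sj_gen list \<Rightarrow> 'k) set"
    and sL yL :: "'k sj_loc"
    and Z :: "(sj_gen list \<Rightarrow> 'k) set set"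
    and ZL :: "'k sj_loc set"
    and ZR :: "(sj_gen list \<Rightarrow> 'k) set ring"
    and ZLR :: "'k sj_loc ring"
    and K :: "'k sj_loc ring"
    and QJ :: "'k sj_loc ring"
    and toK :: "(sj_gen list \<Rightarrow> 'k) set \<Rightarrow> 'k sj_loc"
    and KQ :: "'k sj_loc \<Rightarrow> 'k sj_loc"
    and M2A :: "(nat \<times> nat \<Rightarrow> 'k sj_loc) ring"
    and toM2A :: "(sj_gen list \<Rightarrow> 'k) set \<Rightarrow> (nat \<times> nat \<Rightarrow> 'k sj_loc)"
  defines "J \<equiv> super_jordan" and "L \<equiv> super_jordan_loc"
    and "\<eta> \<equiv> sj_const" and "\<eta>L \<equiv> sj_embed \<circ> sj_const"
    and "s \<equiv> sj_s" and "y \<equiv> sj_y" and "sL \<equiv> sj_embed sj_s" and "yL \<equiv> sj_embed sj_y"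
    and "Z \<equiv> ring_center J" and "ZL \<equiv> ring_center L"
    and "ZR \<equiv> J\<lparr>carrier := Z\<rparr>" and "ZLR \<equiv> L\<lparr>carrier := ZL\<rparr>"
    and "K \<equiv> fraction_ring ZR (Z - {\<zero>\<^bsub>J\<^esub>})"
    and "QJ \<equiv> classical_quotient_ring J"
    and "toK \<equiv> \<lambda>z. right_frac ZR (Z - {\<zero>\<^bsub>J\<^esub>}) z \<one>\<^bsub>J\<^esub>"
    and "KQ \<equiv> \<lambda>X. \<Union>(z, w)\<in>X. right_frac J (regular_elements J) z w"
    and "M2A \<equiv> matrix_ring 2 (L\<lparr>carrier := sj_A\<rparr>)"
    and "toM2A \<equiv> \<lambda>z. scalar_matrix 2 L (sj_embed z)"
  assumes char: "CHAR('k) = p" and p: "p > 2"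
  shows
    "\<comment> \<open>(1)\<close>
     (ZL = generated_algebra \<eta>L L
             {sL [^]\<^bsub>L\<^esub> p, inv\<^bsub>L\<^esub> (sL [^]\<^bsub>L\<^esub> p), yL [^]\<^bsub>L\<^esub> (2 * p)} \<and>
      linearly_independent_over \<eta>L L UNIV
        (\<lambda>(i :: int, j :: nat). (sL [^]\<^bsub>L\<^esub> p) [^]\<^bsub>L\<^esub> i \<otimes>\<^bsub>L\<^esub> (yL [^]\<^bsub>L\<^esub> (2 * p)) [^]\<^bsub>L\<^esub> j) \<and>
      Z = generated_algebra \<eta> J {s [^]\<^bsub>J\<^esub> p, y [^]\<^bsub>J\<^esub> (2 * p)} \<and>
      linearly_independent_over \<eta> J UNIV
        (\<lambda>(i :: nat, j :: nat). (s [^]\<^bsub>J\<^esub> p) [^]\<^bsub>J\<^esub> i \<otimes>\<^bsub>J\<^esub> (y [^]\<^bsub>J\<^esub> (2 * p)) [^]\<^bsub>J\<^esub> j)) \<and>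
    \<comment> \<open>(2)\<close>
     (azumaya L ZL \<and> constant_rank L ZL ((2 * p)\<^sup>2)) \<and>
    \<comment> \<open>(3)\<close>
     (prime_ring L \<and> PI_ring L \<and>
      (\<forall>P. prime_ideal P L \<longrightarrow> regular_prime P L) \<and> has_PI_degree L (2 * p)) \<and>
    \<comment> \<open>(4)\<close>
     (bij_betw (\<lambda>I. I \<inter> ZL) {I. ideal I L} {a. ideal a ZLR} \<and>
      (\<forall>I. ideal I L \<longrightarrow> (I \<inter> ZL) \<cdot>\<^bsub>L\<^esub> carrier L = I) \<and>
      (\<forall>a. ideal a ZLR \<longrightarrow> ideal (a \<cdot>\<^bsub>L\<^esub> carrier L) L \<and> (a \<cdot>\<^bsub>L\<^esub> carrier L) \<inter> ZL = a) \<and>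
      (\<forall>I. ideal I L \<longrightarrow> (prime_ideal I L \<longleftrightarrow> primeideal (I \<inter> ZL) ZLR))) \<and>
    \<comment> \<open>(5)\<close>
     (algebraically_closed_field TYPE('k) \<longrightarrow>
      (\<forall>M :: ('k sj_loc, 'v) module. simple_module L M \<longrightarrow>
         free_of_rank (base_ring :: 'k ring) (restrict_scalars \<eta>L M) (2 * p))) \<and>
    \<comment> \<open>(6)\<close>
     (prime_ring J \<and> PI_ring J \<and> has_PI_degree J (2 * p)) \<and>
    \<comment> \<open>(7)\<close>
     (algebra_isomorphic K
        KQ QJ
        (tensor ZR id J toK K \<one>\<^bsub>J\<^esub>) (tensor_ring ZR id J toK K) \<and>
      algebra_isomorphic K
        (tensor ZR id J toK K \<one>\<^bsub>J\<^esub>) (tensor_ring ZR id J toK K)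
        (tensor ZR toM2A M2A toK K \<one>\<^bsub>M2A\<^esub>) (tensor_ring ZR toM2A M2A toK K) \<and>
      central_simple_algebra K KQ QJ ((2 * p)\<^sup>2))"
proof -
  interpret S: sj_setting p "TYPE('k)" by (intro sj_setting.intro char p)
  show ?thesis
    unfolding J_def L_def \<eta>_def \<eta>L_def s_def y_def sL_def yL_def Z_def ZL_def ZR_def ZLR_def K_def QJ_def toK_def
      KQ_def M2A_def toM2A_def
    by (intro conjI allI impI S.center_L S.center_J S.azumaya_L S.PI_degree_L S.ideals_L(1,2,4)
        S.ideals_L(3)[THEN conjunct1] S.ideals_L(3)[THEN conjunct2] S.simple_module_dimension S.PI_degree_J S.quotient_J;
        assumption)
qed


end
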